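(* If $(M,\Omega)$ is a connected Bochner-Kähler manifold of complex dimension $n$ and of cohomogeneity $m$, then $n-m$ of the roots of the momentum polynomial $p_h(t)$ are constant and, outside a closed, proper, complex analytic subvariety $N\subset M$, the remaining $m$ roots are distinct, real-analytic, and functionally independent.
   Context: $\mathbb C^n$ consists of columns; $z^*$ denotes conjugate transpose; $\mathfrak u(n)=\{a\in M_n(\mathbb C): a^*=-a\}$. Let $(M,g,\Omega)$ be a Kähler manifold of complex dimension $n\ge1$. Its unitary coframe bundle $\pi:P\to M$ has as fiber $P_x$ the set of complex-linear isometries $u:T_xM\to\mathbb C^n$, with right $U(n)$-action $u\cdot a=a^{-1}\circ u$. Let $\omega$ be the $\mathbb C^n$-valued $1$-form on $P$ with $\omega(v)=u(\pi'(v))$ for $v\in T_uP$ (so $\pi^*\Omega=-\frac i2\,\omega^*\wedge\omega$), and let $\phi$ be the unique $\mathfrak u(n)$-valued $1$-form on $P$ with $d\omega=-\phi\wedge\omega$. The structure is called Bochner-Kähler if there are functions $H:P\to i\mathfrak u(n)$ (Hermitian matrices), $T:P\to\mathbb C^n$, $V:P\to\mathbb R$ satisfying $$d\phi=-\phi\wedge\phi+H\,\omega^*\wedge\omega-H\,\omega\wedge\omega^*-\omega\wedge\omega^*H+(\omega^*\wedge H\omega)\,I_n+(\operatorname{tr}H)\bigl(\omega^*\wedge\omega\,I_n-\omega\wedge\omega^*\bigr),$$ $$dH=-\phi H+H\phi+T\omega^*+\omega T^*,\qquad dT=-\phi T+\bigl(H^2+(\operatorname{tr}H)H+V I_n\bigr)\omega,$$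 $$dV=(\operatorname{tr}H)(T^*\omega+\omega^*T)+(T^*H\omega+\omega^*HT).$$ For $n\ge2$ this is equivalent to the vanishing of the Bochner curvature; for $n=1$ it is the definition. The functions $H,T,V$ are unique and satisfy $(H,T,V)(u\cdot a)=(a^{-1}Ha,a^{-1}T,V)(u)$. Bochner-Kähler structures are assumed real-analytic. For $1\le k\le n$, let $h_k$ be the $k$-th elementary symmetric function of the eigenvalues of $H$, a function on $M$. Let $Z_{k+1}$ be the vector field on $M$ with $\Omega(Z_{k+1},\cdot)=-dh_k$, and let $\mathfrak z$ be the real span of $Z_2,\ldots,Z_{n+1}$. The cohomogeneity of a connected Bochner-Kähler structure is $m=\dim\mathfrak z$. The momentum polynomial is $p_h(t)=t^n-h_1t^{n-1}+\cdots+(-1)^nh_n=\det(tI_n-H)$, a polynomial in $t$ whose coefficients are functions on $M$; its roots (counted with multiplicity) are regarded as functions on $M$. *)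

theory Defs
  imports "HOL-Analysis.Analysis" "HOL-Computational_Algebra.Polynomial"
    "HOL-Library.Function_Algebras"
begin

primrec C_k_on :: "nat \<Rightarrow> 'e::real_normed_vector set \<Rightarrow> ('e \<Rightarrow> 'f::real_normed_vector) \<Rightarrow> bool"
where
  "C_k_on 0 S f = continuous_on S f"
| "C_k_on (Suc k) S f =
     ((\<forall>x\<in>S. f differentiable (at x)) \<and>
      (\<forall>v. C_k_on k S (\<lambda>x. frechet_derivative f (at x) v)))"

definition smooth_on :: "'e::real_normed_vector set \<Rightarrow> ('e \<Rightarrow> 'f::real_normed_vector) \<Rightarrow> bool" where
  "smooth_on S f \<longleftrightarrow> open S \<and> (\<forall>k. C_k_on k S f)"

text \<open>Real-analytic: near each point, the sum of an (unconditionally) convergent power series;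
  the multi-indices are the extensional functions on the standard basis.\<close>

definition real_analytic_on :: "'e::euclidean_space set \<Rightarrow> ('e \<Rightarrow> real) \<Rightarrow> bool" where
  "real_analytic_on S f \<longleftrightarrow> open S \<and>
     (\<forall>x\<in>S. \<exists>r>0. \<exists>a :: ('e \<Rightarrow> nat) \<Rightarrow> real. \<forall>h. norm h < r \<longrightarrow>
        ((\<lambda>\<alpha>. a \<alpha> * (\<Prod>b\<in>Basis. (h \<bullet> b) ^ \<alpha> b)) has_sum f (x + h)) (Basis \<rightarrow>\<^sub>E UNIV))"

definition complex_diff_on :: "(complex ^ 'n) set \<Rightarrow> (complex ^ 'n \<Rightarrow> complex) \<Rightarrow> bool" where
  "complex_diff_on S f \<longleftrightarrow> open S \<and>
     (\<forall>y\<in>S. \<exists>f'. (f has_derivative f') (at y) \<and> (\<forall>c v. f' (c *s v) = c * f' v))"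

text \<open>A chart is a pair of a domain and a coordinate map.  The image of a coordinate map is allowed
  to be an embedded submanifold of the coordinate space; this is the case for the charts used
  on the unitary coframe bundle below.

  A tangent vector is the family of its coordinate representations in all charts around its base
  point (and zero in the other charts).\<close>

type_synonym ('p, 'e) chart = "'p set \<times> ('p \<Rightarrow> 'e)"
type_synonym ('p, 'e) tvec = "('p, 'e) chart \<Rightarrow> 'e"

instantiation "fun" :: (type, real_vector) real_vector
begin
definition scaleR_fun :: "real \<Rightarrow> ('a \<Rightarrow> 'b) \<Rightarrow> 'a \<Rightarrow> 'b" where
  "scaleR_fun r f = (\<lambda>x. r *\<^sub>R f x)"
instance
  by standard (simp_all add: scaleR_fun_def fun_eq_iff scaleR_add_right scaleR_add_left)
end

definition points :: "('p, 'e) chart set \<Rightarrow> 'p set" where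
  "points A = \<Union> (fst ` A)"

definition smooth_plot ::
  "('p, 'e::real_normed_vector) chart set \<Rightarrow> 'd::real_normed_vector set \<Rightarrow> ('d \<Rightarrow> 'p) \<Rightarrow> bool" where
  "smooth_plot A D s \<longleftrightarrow> open D \<and> s ` D \<subseteq> points A \<and>
     (\<forall>(U, f)\<in>A. smooth_on {t\<in>D. s t \<in> U} (f \<circ> s))"

definition velocity ::
  "('p, 'e::real_normed_vector) chart set \<Rightarrow> (real \<Rightarrow> 'p) \<Rightarrow> real \<Rightarrow> ('p, 'e) tvec" where
  "velocity A \<gamma> t =
     (\<lambda>\<kappa>. if \<kappa> \<in> A \<and> \<gamma> t \<in> fst \<kappa> then vector_derivative (snd \<kappa> \<circ> \<gamma>) (at t) else 0)"

definition curve_at ::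
  "('p, 'e::real_normed_vector) chart set \<Rightarrow> 'p \<Rightarrow> (real \<Rightarrow> 'p) \<Rightarrow> bool" where
  "curve_at A p \<gamma> \<longleftrightarrow> (\<exists>D. smooth_plot A D \<gamma> \<and> 0 \<in> D \<and> \<gamma> 0 = p)"

definition tangent_space ::
  "('p, 'e::real_normed_vector) chart set \<Rightarrow> 'p \<Rightarrow> ('p, 'e) tvec set" where
  "tangent_space A p = {velocity A \<gamma> 0 | \<gamma>. curve_at A p \<gamma>}"

definition pushforward ::
  "('p, 'e::real_normed_vector) chart set \<Rightarrow> ('q, 'f::real_normed_vector) chart set \<Rightarrow>
   ('p \<Rightarrow> 'q) \<Rightarrow> 'p \<Rightarrow> ('p, 'e) tvec \<Rightarrow> ('q, 'f) tvec" where
  "pushforward A B F p \<xi> =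
     (THE w. \<exists>\<gamma>. curve_at A p \<gamma> \<and> velocity A \<gamma> 0 = \<xi> \<and> w = velocity B (F \<circ> \<gamma>) 0)"

text \<open>The differential of \<open>F\<close> at \<open>p\<close> is \<open>\<alpha>\<close>; this includes the differentiability of \<open>F\<close>
  along all smooth curves through \<open>p\<close>.\<close>

definition has_differential_at ::
  "('p, 'e::real_normed_vector) chart set \<Rightarrow> ('p \<Rightarrow> 'b::real_normed_vector) \<Rightarrow> 'p \<Rightarrow>
   (('p, 'e) tvec \<Rightarrow> 'b) \<Rightarrow> bool" where
  "has_differential_at A F p \<alpha> \<longleftrightarrow>
     (\<forall>\<gamma>. curve_at A p \<gamma> \<longrightarrow> ((F \<circ> \<gamma>) has_vector_derivative \<alpha> (velocity A \<gamma> 0)) (at 0))"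

definition partial_velocity ::
  "('p, 'e::real_normed_vector) chart set \<Rightarrow> ('d::real_normed_vector \<Rightarrow> 'p) \<Rightarrow> 'd \<Rightarrow> 'd \<Rightarrow>
   ('p, 'e) tvec" where
  "partial_velocity A s t e = velocity A (\<lambda>r. s (t + r *\<^sub>R e)) 0"

text \<open>A form is smooth iff its pullbacks along smooth two-parameter maps are (Boman's theorem), and
  the exterior derivative of a one-form \<open>\<alpha>\<close> is the two-form \<open>\<beta>\<close> such that
  \<open>s\<^sup>* \<beta> = d (s\<^sup>* \<alpha>)\<close> for all such maps \<open>s\<close>.  Normalisation:
  \<open>d\<alpha>(X,Y) = X \<alpha>(Y) - Y \<alpha>(X) - \<alpha>[X,Y]\<close>, which matches the definition of \<open>wedge\<close>.\<close>

definition smooth_one_form ::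
  "('p, 'e::real_normed_vector) chart set \<Rightarrow> ('p \<Rightarrow> ('p, 'e) tvec \<Rightarrow> 'b::real_normed_vector) \<Rightarrow> bool"
where
  "smooth_one_form A \<alpha> \<longleftrightarrow>
     (\<forall>p\<in>points A. \<forall>\<xi>\<in>tangent_space A p. \<forall>\<eta>\<in>tangent_space A p. \<forall>r.
        \<alpha> p (\<xi> + \<eta>) = \<alpha> p \<xi> + \<alpha> p \<eta> \<and> \<alpha> p (r *\<^sub>R \<xi>) = r *\<^sub>R \<alpha> p \<xi>) \<and>
     (\<forall>(D :: (real \<times> real) set) s e. smooth_plot A D s \<longrightarrow>
        smooth_on D (\<lambda>t. \<alpha> (s t) (partial_velocity A s t e)))"

definition has_exterior_derivative ::
  "('p, 'e::real_normed_vector) chart set \<Rightarrow> ('p \<Rightarrow> ('p, 'e) tvec \<Rightarrow> 'b::real_normed_vector) \<Rightarrow>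
   ('p \<Rightarrow> ('p, 'e) tvec \<Rightarrow> ('p, 'e) tvec \<Rightarrow> 'b) \<Rightarrow> bool" where
  "has_exterior_derivative A \<alpha> \<beta> \<longleftrightarrow> smooth_one_form A \<alpha> \<and>
     (\<forall>(D :: (real \<times> real) set) s. smooth_plot A D s \<longrightarrow> (\<forall>t\<in>D.
        frechet_derivative (\<lambda>r. \<alpha> (s r) (partial_velocity A s r (0, 1))) (at t) (1, 0)
        - frechet_derivative (\<lambda>r. \<alpha> (s r) (partial_velocity A s r (1, 0))) (at t) (0, 1)
        = \<beta> (s t) (partial_velocity A s t (1, 0)) (partial_velocity A s t (0, 1))))"

definition wedge ::
  "('b \<Rightarrow> 'c \<Rightarrow> 'd::minus) \<Rightarrow> ('v \<Rightarrow> 'b) \<Rightarrow> ('v \<Rightarrow> 'c) \<Rightarrow> 'v \<Rightarrow> 'v \<Rightarrow> 'd" where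
  "wedge mul \<alpha> \<beta> \<xi> \<eta> = mul (\<alpha> \<xi>) (\<beta> \<eta>) - mul (\<alpha> \<eta>) (\<beta> \<xi>)"

definition complex_manifold :: "'a topology \<Rightarrow> ('a, complex ^ 'n) chart set \<Rightarrow> bool" where
  "complex_manifold X A \<longleftrightarrow>
     Hausdorff_space X \<and> second_countable X \<and> points A = topspace X \<and>
     (\<forall>(U, f)\<in>A. openin X U \<and> open (f ` U) \<and>
        homeomorphic_map (subtopology X U) (top_of_set (f ` U)) f) \<and>
     (\<forall>(U, f)\<in>A. \<forall>(V, g)\<in>A. \<forall>i.
        complex_diff_on (f ` (U \<inter> V)) (\<lambda>y. g (inv_into U f y) $ i))"

definition holomorphic_fun_on ::
  "('a, complex ^ 'n) chart set \<Rightarrow> 'a set \<Rightarrow> ('a \<Rightarrow> complex) \<Rightarrow> bool" where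
  "holomorphic_fun_on A W F \<longleftrightarrow>
     (\<forall>(U, f)\<in>A. complex_diff_on (f ` (U \<inter> W)) (\<lambda>y. F (inv_into U f y)))"

definition analytic_fun_on ::
  "('a, complex ^ 'n) chart set \<Rightarrow> 'a set \<Rightarrow> ('a \<Rightarrow> real) \<Rightarrow> bool" where
  "analytic_fun_on A W F \<longleftrightarrow>
     (\<forall>(U, f)\<in>A. real_analytic_on (f ` (U \<inter> W)) (\<lambda>y. F (inv_into U f y)))"

definition closed_analytic_subvariety ::
  "'a topology \<Rightarrow> ('a, complex ^ 'n) chart set \<Rightarrow> 'a set \<Rightarrow> bool" where
  "closed_analytic_subvariety X A N \<longleftrightarrow> closedin X N \<and>
     (\<forall>x\<in>topspace X. \<exists>W \<F>. openin X W \<and> x \<in> W \<and> finite \<F> \<and>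
        (\<forall>F\<in>\<F>. holomorphic_fun_on A W F) \<and> N \<inter> W = {y\<in>W. \<forall>F\<in>\<F>. F y = 0})"

definition cscale :: "complex \<Rightarrow> ('a, complex ^ 'n) tvec \<Rightarrow> ('a, complex ^ 'n) tvec" where
  "cscale c v = (\<lambda>\<kappa>. c *s v \<kappa>)"

text \<open>The tangent vector at \<open>x\<close> whose representation in the chart \<open>\<kappa>\<close> is \<open>e\<close>.\<close>

definition coord_vec ::
  "('a, complex ^ 'n) chart set \<Rightarrow> ('a, complex ^ 'n) chart \<Rightarrow> 'a \<Rightarrow> complex ^ 'n \<Rightarrow>
   ('a, complex ^ 'n) tvec" where
  "coord_vec A \<kappa> x e =
     velocity A (\<lambda>t. inv_into (fst \<kappa>) (snd \<kappa>) (snd \<kappa> x + t *\<^sub>R e)) 0"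

type_synonym ('a, 'n) metric =
  "'a \<Rightarrow> ('a, complex ^ 'n) tvec \<Rightarrow> ('a, complex ^ 'n) tvec \<Rightarrow> real"

definition metric_coeff ::
  "('a, complex ^ 'n) chart set \<Rightarrow> ('a, 'n) metric \<Rightarrow> ('a, complex ^ 'n) chart \<Rightarrow>
   complex ^ 'n \<Rightarrow> complex ^ 'n \<Rightarrow> complex ^ 'n \<Rightarrow> real" where
  "metric_coeff A g \<kappa> e e' y =
     (let x = inv_into (fst \<kappa>) (snd \<kappa>) y in g x (coord_vec A \<kappa> x e) (coord_vec A \<kappa> x e'))"

definition hermitian_metric :: "('a, complex ^ 'n) chart set \<Rightarrow> ('a, 'n) metric \<Rightarrow> bool" where
  "hermitian_metric A g \<longleftrightarrow>
     (\<forall>x\<in>points A. \<forall>v\<in>tangent_space A x. \<forall>w\<in>tangent_space A x.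
        g x v w = g x w v \<and>
        (\<forall>z\<in>tangent_space A x. g x (v + z) w = g x v w + g x z w) \<and>
        (\<forall>r. g x (r *\<^sub>R v) w = r * g x v w) \<and>
        (v \<noteq> 0 \<longrightarrow> g x v v > 0) \<and>
        g x (cscale \<i> v) (cscale \<i> w) = g x v w) \<and>
     (\<forall>(U, f)\<in>A. \<forall>e e'. smooth_on (f ` U) (metric_coeff A g (U, f) e e'))"

text \<open>This sign is the one for which \<open>\<Omega>(v,w) = Im (u(v)\<^sup>* u(w))\<close> for unitary coframes \<open>u\<close>, i.e.
  \<open>\<pi>\<^sup>* \<Omega> = -(i/2) \<omega>\<^sup>* \<and> \<omega>\<close>.\<close>

definition kaehler_form :: "('a, 'n) metric \<Rightarrow> ('a, 'n::finite) metric" where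
  "kaehler_form g x v w = g x (cscale \<i> v) w"

definition kaehler_manifold ::
  "'a topology \<Rightarrow> ('a, complex ^ 'n) chart set \<Rightarrow> ('a, 'n) metric \<Rightarrow> bool" where
  "kaehler_manifold X A g \<longleftrightarrow> complex_manifold X A \<and> hermitian_metric A g \<and>
     (\<forall>(U, f)\<in>A. \<forall>y\<in>f ` U. \<forall>a b c.
        let \<Omega> = metric_coeff A (kaehler_form g) (U, f) in
          frechet_derivative (\<Omega> b c) (at y) a + frechet_derivative (\<Omega> c a) (at y) b
          + frechet_derivative (\<Omega> a b) (at y) c = 0)"

type_synonym ('a, 'n) coframe = "'a \<times> (('a, complex ^ 'n) tvec \<Rightarrow> complex ^ 'n)"

text \<open>The inner product on \<open>complex ^ 'n\<close> is the real part of the standard Hermitian product.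
  Extensionality makes a coframe determined by its values on the tangent space.\<close>

definition coframe_bundle ::
  "('a, complex ^ 'n) chart set \<Rightarrow> ('a, 'n) metric \<Rightarrow> ('a, 'n) coframe set" where
  "coframe_bundle A g = {(x, u). x \<in> points A \<and> u \<in> extensional (tangent_space A x) \<and>
     (\<forall>v\<in>tangent_space A x. \<forall>w\<in>tangent_space A x.
        u (v + w) = u v + u w \<and> (\<forall>c. u (cscale c v) = c *s u v) \<and> u v \<bullet> u w = g x v w)}"

text \<open>The local trivialisation over a chart identifies \<open>u\<close> with its matrix in the coordinate frame.\<close>

definition coframe_atlas ::
  "('a, complex ^ 'n) chart set \<Rightarrow> ('a, 'n) metric \<Rightarrow>
   (('a, 'n) coframe, (complex ^ 'n) \<times> (complex ^ 'n ^ 'n)) chart set" where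
  "coframe_atlas A g =
     (\<lambda>\<kappa>. ({(x, u)\<in>coframe_bundle A g. x \<in> fst \<kappa>},
            \<lambda>(x, u). (snd \<kappa> x, matrix (\<lambda>e. u (coord_vec A \<kappa> x e))))) ` A"

type_synonym ('a, 'n) coframe_tvec =
  "(('a, 'n) coframe, (complex ^ 'n) \<times> (complex ^ 'n ^ 'n)) tvec"

definition tautological_form ::
  "('a, complex ^ 'n) chart set \<Rightarrow> ('a, 'n) metric \<Rightarrow>
   ('a, 'n) coframe \<Rightarrow> ('a, 'n) coframe_tvec \<Rightarrow> complex ^ 'n" where
  "tautological_form A g p \<xi> = snd p (pushforward (coframe_atlas A g) A fst p \<xi>)"

definition ctranspose :: "complex ^ 'n ^ 'm \<Rightarrow> complex ^ 'm ^ 'n" where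
  "ctranspose a = (\<chi> i j. cnj (a $ j $ i))"

text \<open>For columns \<open>a\<close>, \<open>b\<close>: the scalar \<open>a\<^sup>* b\<close> and the matrix \<open>a b\<^sup>*\<close>.\<close>

definition herm :: "complex ^ 'n \<Rightarrow> complex ^ 'n \<Rightarrow> complex" where
  "herm a b = (\<Sum>i\<in>UNIV. cnj (a $ i) * b $ i)"

definition outer :: "complex ^ 'n \<Rightarrow> complex ^ 'n \<Rightarrow> complex ^ 'n ^ 'n" where
  "outer a b = (\<chi> i j. a $ i * cnj (b $ j))"

definition unitary_connection ::
  "('a, complex ^ 'n) chart set \<Rightarrow> ('a, 'n) metric \<Rightarrow>
   (('a, 'n) coframe \<Rightarrow> ('a, 'n) coframe_tvec \<Rightarrow> complex ^ 'n ^ 'n) \<Rightarrow> bool" where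
  "unitary_connection A g \<phi> \<longleftrightarrow>
     (let P = coframe_bundle A g; B = coframe_atlas A g; \<omega> = tautological_form A g in
       smooth_one_form B \<phi> \<and>
       (\<forall>p\<in>P. \<forall>\<xi>\<in>tangent_space B p. ctranspose (\<phi> p \<xi>) = - \<phi> p \<xi>) \<and>
       has_exterior_derivative B \<omega> (\<lambda>p \<xi> \<eta>. - wedge (*v) (\<phi> p) (\<omega> p) \<xi> \<eta>))"

text \<open>\<open>mat c\<close> is \<open>c\<close> times the identity matrix.  The structure equations determine \<open>\<phi>\<close>, \<open>H\<close>, \<open>T\<close>
  and \<open>V\<close>, which are hence smooth (analytic, if the metric is).\<close>

definition bochner_kaehler ::
  "('a, complex ^ 'n) chart set \<Rightarrow> ('a, 'n) metric \<Rightarrow>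
   (('a, 'n) coframe \<Rightarrow> complex ^ 'n ^ 'n) \<Rightarrow> (('a, 'n) coframe \<Rightarrow> complex ^ 'n) \<Rightarrow>
   (('a, 'n) coframe \<Rightarrow> real) \<Rightarrow> bool" where
  "bochner_kaehler A g H T V \<longleftrightarrow>
     (\<forall>(U, f)\<in>A. \<forall>e e'. real_analytic_on (f ` U) (metric_coeff A g (U, f) e e')) \<and>
     (let P = coframe_bundle A g; B = coframe_atlas A g; \<omega> = tautological_form A g in
      \<exists>\<phi>. unitary_connection A g \<phi> \<and>
        (\<forall>p\<in>P. ctranspose (H p) = H p) \<and>
        has_exterior_derivative B \<phi> (\<lambda>p \<xi> \<eta>.
          - wedge (**) (\<phi> p) (\<phi> p) \<xi> \<eta>
          + mat (wedge herm (\<omega> p) (\<omega> p) \<xi> \<eta>) ** H p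
          - H p ** wedge outer (\<omega> p) (\<omega> p) \<xi> \<eta>
          - wedge outer (\<omega> p) (\<omega> p) \<xi> \<eta> ** H p
          + mat (wedge herm (\<omega> p) (\<lambda>\<zeta>. H p *v \<omega> p \<zeta>) \<xi> \<eta>)
          + mat (trace (H p)) **
              (mat (wedge herm (\<omega> p) (\<omega> p) \<xi> \<eta>) - wedge outer (\<omega> p) (\<omega> p) \<xi> \<eta>)) \<and>
        (\<forall>p\<in>P. has_differential_at B H p (\<lambda>\<xi>.
          - (\<phi> p \<xi> ** H p) + H p ** \<phi> p \<xi> + outer (T p) (\<omega> p \<xi>) + outer (\<omega> p \<xi>) (T p))) \<and>
        (\<forall>p\<in>P. has_differential_at B T p (\<lambda>\<xi>.
          - (\<phi> p \<xi> *v T p)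
          + (H p ** H p + mat (trace (H p)) ** H p + mat (complex_of_real (V p))) *v \<omega> p \<xi>)) \<and>
        (\<forall>p\<in>P. has_differential_at B (\<lambda>q. complex_of_real (V q)) p (\<lambda>\<xi>.
          trace (H p) * (herm (T p) (\<omega> p \<xi>) + herm (\<omega> p \<xi>) (T p))
          + (herm (T p) (H p *v \<omega> p \<xi>) + herm (\<omega> p \<xi>) (H p *v T p)))))"

definition eigenvalue_list :: "complex ^ 'n ^ 'n \<Rightarrow> ('n \<Rightarrow> real) \<Rightarrow> bool" where
  "eigenvalue_list K ev \<longleftrightarrow>
     det (\<chi> i j. [:- (K $ i $ j), if i = j then 1 else 0:]) =
     (\<Prod>i\<in>UNIV. [:- complex_of_real (ev i), 1:])"

definition elem_sym :: "nat \<Rightarrow> ('n::finite \<Rightarrow> real) \<Rightarrow> real" where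
  "elem_sym k ev = (\<Sum>S | card S = k. \<Prod>i\<in>S. ev i)"

definition h_fun ::
  "('a, complex ^ 'n) chart set \<Rightarrow> ('a, 'n) metric \<Rightarrow>
   (('a, 'n) coframe \<Rightarrow> complex ^ 'n ^ 'n) \<Rightarrow> nat \<Rightarrow> 'a \<Rightarrow> real" where
  "h_fun A g H k x =
     (THE s. \<exists>u ev. (x, u) \<in> coframe_bundle A g \<and> eigenvalue_list (H (x, u)) ev \<and>
        s = elem_sym k ev)"

definition momentum_polynomial ::
  "('a, complex ^ 'n) chart set \<Rightarrow> ('a, 'n) metric \<Rightarrow>
   (('a, 'n) coframe \<Rightarrow> complex ^ 'n ^ 'n) \<Rightarrow> 'a \<Rightarrow> real poly" where
  "momentum_polynomial A g H x =
     monom 1 CARD('n) + (\<Sum>k=1..CARD('n). monom ((-1) ^ k * h_fun A g H k x) (CARD('n) - k))"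

text \<open>The vector field \<open>Z\<close> with \<open>\<Omega>(Z, \<cdot>) = -dF\<close>.\<close>

definition hamiltonian_field ::
  "('a, complex ^ 'n) chart set \<Rightarrow> ('a, 'n) metric \<Rightarrow> ('a \<Rightarrow> real) \<Rightarrow>
   'a \<Rightarrow> ('a, complex ^ 'n) tvec" where
  "hamiltonian_field A g F =
     (THE Z. (\<forall>x\<in>points A. Z x \<in> tangent_space A x \<and>
                has_differential_at A F x (\<lambda>v. - kaehler_form g x (Z x) v)) \<and>
             (\<forall>x. x \<notin> points A \<longrightarrow> Z x = 0))"

definition cohomogeneity ::
  "('a, complex ^ 'n) chart set \<Rightarrow> ('a, 'n) metric \<Rightarrow>
   (('a, 'n) coframe \<Rightarrow> complex ^ 'n ^ 'n) \<Rightarrow> nat" where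
  "cohomogeneity A g H =
     dim (span ((\<lambda>k. hamiltonian_field A g (h_fun A g H k)) ` {1..CARD('n)}))"

definition functionally_independent_at ::
  "('a, complex ^ 'n) chart set \<Rightarrow> 'a \<Rightarrow> nat \<Rightarrow> (nat \<Rightarrow> 'a \<Rightarrow> real) \<Rightarrow> bool" where
  "functionally_independent_at A x m F \<longleftrightarrow>
     (\<exists>\<alpha>. (\<forall>j<m. has_differential_at A (F j) x (\<alpha> j)) \<and>
        (\<forall>c. (\<forall>v\<in>tangent_space A x. (\<Sum>j<m. c j * \<alpha> j v) = 0) \<longrightarrow> (\<forall>j<m. c j = 0)))"

end

(* Pulling the structure equations back along a local unitary frame shows that H, T, V are
   differentiable and that t |-> det (t - H) is a function on M whose differential is
   v |-> -2 Re <w_t, v> with w_t = det (t - H) (t - H)^(-1) T. The vector field dual to w_t is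
   holomorphic, and the Hermitian products of the w_t are real. Hence the fields Z_k are holomorphic,
   and if one of them is near some point a real combination of others that are independent there,
   then the coefficients are real and holomorphic, i.e. constant, and the relation holds globally by
   the identity theorem. So a maximal independent family of m fields Z_j spans all of them, and N is
   the analytic set where these m fields become dependent.

   The differentials of p_h at x form a space I of real polynomials of degree < n which is closed under
   multiplication by t modulo p_h, because H is self-adjoint and H w_t = t w_t - p_h(t) T. Hence I
   consists of the multiples of a monic divisor s of p_h. Off N the space I is the annihilator of the
   global relations, so that s does not depend on x and has degree n - m. The differences of the values
   of p_h also lie in this space, so s divides p_h everywhere and its roots are the constant roots.
   Off N the roots of p_h / s are simple by self-adjointness of H, hence analytic, and they are
   independent because I contains s times all polynomials of degree < m. *)

theory Submission
  imports Defs "HOL-Complex_Analysis.Complex_Analysis"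
    "HOL-Computational_Algebra.Fundamental_Theorem_Algebra"
begin

no_notation fps_nth (infixl \<open>$\<close> 75)

subsection \<open>Smooth functions\<close>

text \<open>The hypotheses make \<open>H\<close>, \<open>T\<close>, \<open>V\<close> differentiable
  only along smooth curves and relate them to \<phi> only on velocities. Regularity therefore has to
  be derived: in a local frame, torsion-freeness and skewness express \<phi> by the first
  derivatives of the frame, so that \<open>(H, T, V)\<close> solves a closed total differential
  equation with continuous right-hand side. That p_h descends to M is obtained by integrating dH
  along curves in the fibres, where it is a commutator. The resolvent exists only off the spectrum;
  so the computations are made at real t with p_h(t) nonzero and reach the coefficients h_k by
  interpolation at n such t. Reality of the Hermitian products also makes real and complex
  dependence of the fields equivalent, which is why N, defined by real dependence, is cut out by
  holomorphic determinants. Analyticity is handled through holomorphic extensions to the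
  complexification, where simple roots are contour integrals of the coefficients; power series enter
  only at the two ends, for the metric and for the roots.\<close>

lemma C_k_on_imp_continuous: "C_k_on k S f \<Longrightarrow> continuous_on S f"
  by (cases k) (auto intro!: continuous_at_imp_continuous_on differentiable_imp_continuous_within)

lemma C_k_on_Suc_D: "C_k_on (Suc k) S f \<Longrightarrow> C_k_on k S f"
proof (induction k arbitrary: f)
  case 0
  then show ?case using C_k_on_imp_continuous[of "Suc 0"] by simp
next
  case (Suc k)
  then show ?case by (metis C_k_on.simps(2))
qed

lemma C_k_on_cong:
  assumes "open S" "\<And>x. x \<in> S \<Longrightarrow> f x = g x" "C_k_on k S f"
  shows "C_k_on k S g"
  using assms(2,3)
proof (induction k arbitrary: f g)
  case 0
  then show ?case by (simp cong: continuous_on_cong)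
next
  case (Suc k)
  have *: "(g has_derivative frechet_derivative f (at x)) (at x)" if "x \<in> S" for x
  proof (rule has_derivative_transform_within_open[OF _ \<open>open S\<close> that])
    show "(f has_derivative frechet_derivative f (at x)) (at x)"
      using Suc.prems(2) that by (simp add: frechet_derivative_works)
  qed (use Suc.prems in auto)
  then have "frechet_derivative g (at x) = frechet_derivative f (at x)" if "x \<in> S" for x
    using that frechet_derivative_at by metis
  with * Suc show ?case by (simp, metis (no_types, lifting) differentiableI)
qed

lemma C_k_on_SucI:
  assumes "open S" "\<And>x. x \<in> S \<Longrightarrow> (f has_derivative f' x) (at x)"
    and "\<And>v. C_k_on k S (\<lambda>x. f' x v)"
  shows "C_k_on (Suc k) S f"
proof -
  have "frechet_derivative f (at x) = f' x" if "x \<in> S" for x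
    using assms(2)[OF that] frechet_derivative_at by metis
  then show ?thesis
    using assms by (auto intro: differentiableI intro!: C_k_on_cong[OF assms(1) _ assms(3)])
qed

lemma C_k_on_SucD:
  assumes "C_k_on (Suc k) S f"
  shows "x \<in> S \<Longrightarrow> (f has_derivative frechet_derivative f (at x)) (at x)"
    "C_k_on k S (\<lambda>x. frechet_derivative f (at x) v)"
  using assms by (auto simp: frechet_derivative_works)

lemma C_k_on_subset:
  assumes "C_k_on k S f" "T \<subseteq> S"
  shows "C_k_on k T f"
  using assms by (induction k arbitrary: f) (auto intro: continuous_on_subset)

lemma C_k_on_const: "open S \<Longrightarrow> C_k_on k S (\<lambda>x. c)"
  by (induction k arbitrary: c) (auto simp del: C_k_on.simps(2) intro!: C_k_on_SucI[OF _ has_derivative_const])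

lemma C_k_on_bounded_linear_compose:
  assumes "bounded_linear L" "open S" "C_k_on k S f"
  shows "C_k_on k S (\<lambda>x. L (f x))"
  using assms(3)
proof (induction k arbitrary: f)
  case 0
  then show ?case
    using assms(1) by (auto intro: bounded_linear.continuous_on)
next
  case (Suc k)
  show ?case
    by (rule C_k_on_SucI[OF assms(2) bounded_linear.has_derivative[OF assms(1) C_k_on_SucD(1)]])
       (use Suc in \<open>auto intro: Suc.IH\<close>)
qed

lemma C_k_on_add:
  assumes "open S" "C_k_on k S f" "C_k_on k S g"
  shows "C_k_on k S (\<lambda>x. f x + g x)"
  using assms(2,3)
proof (induction k arbitrary: f g)
  case 0
  then show ?case by (auto intro: continuous_intros)
next
  case (Suc k)
  show ?case
    by (rule C_k_on_SucI[OF assms(1) has_derivative_add[OF C_k_on_SucD(1) C_k_on_SucD(1)]])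
       (use Suc in \<open>auto intro: Suc.IH\<close>)
qed

lemma C_k_on_bilinear:
  assumes "bounded_bilinear B" "open S" "C_k_on k S f" "C_k_on k S g"
  shows "C_k_on k S (\<lambda>x. B (f x) (g x))"
  using assms(3,4)
proof (induction k arbitrary: f g)
  case 0
  then show ?case using assms(1) by (auto intro: bounded_bilinear.continuous_on)
next
  case (Suc k)
  show ?case
    by (rule C_k_on_SucI[OF assms(2) bounded_bilinear.FDERIV[OF assms(1) C_k_on_SucD(1) C_k_on_SucD(1)]])
       (use Suc.prems Suc.prems[THEN C_k_on_Suc_D] in \<open>auto intro!: C_k_on_add assms(2) Suc.IH C_k_on_SucD(2) simp del: C_k_on.simps\<close>)
qed

lemma C_k_on_sum:
  assumes "open S" "\<And>i. i \<in> I \<Longrightarrow> C_k_on k S (f i)"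
  shows "C_k_on k S (\<lambda>x. \<Sum>i\<in>I. f i x)"
  using assms(2) 
  by (induction I rule: infinite_finite_induct) (auto intro: C_k_on_const C_k_on_add assms(1))

text \<open>The derivative of the composite applies the derivative of g to a vector that itself
  depends on x, while the induction hypothesis concerns a fixed vector. Expanding that vector in
  \<open>Basis\<close> leaves a finite sum of products of functions of class C^k.\<close>

lemma C_k_on_compose:
  fixes f :: "'d::real_normed_vector \<Rightarrow> 'e::euclidean_space"
    and g :: "'e \<Rightarrow> 'f::real_normed_vector"
  assumes "open S" "open T" "C_k_on k S f" "C_k_on k T g" "f ` S \<subseteq> T"
  shows "C_k_on k S (\<lambda>x. g (f x))"
  using assms(3,4)
proof (induction k arbitrary: g)
  case 0
  then show ?case 
    using continuous_on_compose2 assms(5) by (metis C_k_on.simps(1))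
next
  case (Suc k)
  have "C_k_on k S (\<lambda>x. frechet_derivative g (at (f x)) (frechet_derivative f (at x) v))" for v
  proof (rule C_k_on_cong[OF assms(1)])
    show "C_k_on k S (\<lambda>x. \<Sum>b\<in>Basis. (frechet_derivative f (at x) v \<bullet> b) *\<^sub>R
              frechet_derivative g (at (f x)) b)"
      by (intro C_k_on_sum assms(1) C_k_on_bilinear[OF bounded_bilinear_scaleR] Suc.IH
          C_k_on_bounded_linear_compose[OF bounded_linear_inner_left]
          C_k_on_SucD(2)[OF Suc.prems(1)] C_k_on_Suc_D[OF Suc.prems(1)] C_k_on_SucD(2)[OF Suc.prems(2)])
    fix x assume "x \<in> S"
    with assms(5) have "(g has_derivative frechet_derivative g (at (f x))) (at (f x))"
      by (intro C_k_on_SucD(1)[OF Suc.prems(2)]) auto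
    then have lin: "linear (frechet_derivative g (at (f x)))"
      by (rule has_derivative_linear)
    have "frechet_derivative g (at (f x)) (\<Sum>b\<in>Basis. (frechet_derivative f (at x) v \<bullet> b) *\<^sub>R b) =
        (\<Sum>b\<in>Basis. (frechet_derivative f (at x) v \<bullet> b) *\<^sub>R frechet_derivative g (at (f x)) b)"
      by (simp add: linear_sum[OF lin] linear_scale[OF lin])
    then show "(\<Sum>b\<in>Basis. (frechet_derivative f (at x) v \<bullet> b) *\<^sub>R
              frechet_derivative g (at (f x)) b) = 
            frechet_derivative g (at (f x)) (frechet_derivative f (at x) v)"
      by (simp add: euclidean_representation)
  qed
  then show ?case
    by (intro C_k_on_SucI[OF assms(1) has_derivative_compose[OF C_k_on_SucD(1)[OF Suc.prems(1)] C_k_on_SucD(1)[OF Suc.prems(2)]]])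
       (use assms(5) in auto)
qed

lemma smooth_on_open: "smooth_on S f \<Longrightarrow> open S"
  by (simp add: smooth_on_def)

lemma smooth_on_cong:
  assumes "smooth_on S f" "\<And>x. x \<in> S \<Longrightarrow> f x = g x"
  shows "smooth_on S g"
  using assms C_k_on_cong unfolding smooth_on_def by metis

lemma smooth_on_subset: "smooth_on S f \<Longrightarrow> open T \<Longrightarrow> T \<subseteq> S \<Longrightarrow> smooth_on T f"
  unfolding smooth_on_def by (blast intro: C_k_on_subset)

lemma smooth_on_const: "open S \<Longrightarrow> smooth_on S (\<lambda>x. c)"
  by (simp add: smooth_on_def C_k_on_const)

lemma smooth_on_bounded_linear: 
  "bounded_linear L \<Longrightarrow> smooth_on S f \<Longrightarrow> smooth_on S (\<lambda>x. L (f x))"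
  by (auto simp: smooth_on_def intro: C_k_on_bounded_linear_compose)

lemma smooth_on_linear:
  fixes L :: "'a::euclidean_space \<Rightarrow> 'b::real_normed_vector"
  shows "linear L \<Longrightarrow> smooth_on S f \<Longrightarrow> smooth_on S (\<lambda>x. L (f x))"
  by (simp add: linear_conv_bounded_linear smooth_on_bounded_linear)

lemma smooth_on_id: "open S \<Longrightarrow> smooth_on S (\<lambda>x. x)"
proof -
  assume S: "open S"
  have "C_k_on k S (\<lambda>x. x)" for k
    by (cases k) (auto intro!: C_k_on_SucI S C_k_on_const has_derivative_ident simp del: C_k_on.simps(2))
  with S show ?thesis by (simp add: smooth_on_def)
qed

lemma smooth_on_add: "smooth_on S f \<Longrightarrow> smooth_on S g \<Longrightarrow> smooth_on S (\<lambda>x. f x + g x)"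
  by (auto simp: smooth_on_def intro: C_k_on_add)

lemma smooth_on_bilinear: 
  "bounded_bilinear B \<Longrightarrow> smooth_on S f \<Longrightarrow> smooth_on S g \<Longrightarrow> smooth_on S (\<lambda>x. B (f x) (g x))"
  by (auto simp: smooth_on_def intro: C_k_on_bilinear)

lemma smooth_on_minus: "smooth_on S f \<Longrightarrow> smooth_on S (\<lambda>x. - f x)"
  by (intro smooth_on_bounded_linear[of uminus] bounded_linear_minus bounded_linear_ident)

lemma smooth_on_diff: "smooth_on S f \<Longrightarrow> smooth_on S g \<Longrightarrow> smooth_on S (\<lambda>x. f x - g x)"
  using smooth_on_add[OF _ smooth_on_minus, of S f g] by simp

lemma smooth_on_sum: 
  "open S \<Longrightarrow> (\<And>i. i \<in> I \<Longrightarrow> smooth_on S (f i)) \<Longrightarrow> smooth_on S (\<lambda>x. \<Sum>i\<in>I. f i x)"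
  by (auto simp: smooth_on_def intro: C_k_on_sum)

lemma smooth_on_compose:
  fixes f :: "'d::real_normed_vector \<Rightarrow> 'e::euclidean_space"
  shows "smooth_on S f \<Longrightarrow> smooth_on T g \<Longrightarrow> f ` S \<subseteq> T \<Longrightarrow> smooth_on S (\<lambda>x. g (f x))"
  by (auto simp: smooth_on_def intro: C_k_on_compose)

lemmas smooth_on_mult = smooth_on_bilinear[OF bounded_bilinear_mult]
lemmas smooth_on_scaleR = smooth_on_bilinear[OF bounded_bilinear_scaleR]

lemma smooth_on_imp_continuous: "smooth_on S f \<Longrightarrow> continuous_on S f"
  using C_k_on_imp_continuous by (auto simp: smooth_on_def)

lemma smooth_on_has_derivative: 
  "smooth_on S f \<Longrightarrow> x \<in> S \<Longrightarrow> (f has_derivative frechet_derivative f (at x)) (at x)"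
  unfolding smooth_on_def by (blast intro: C_k_on_SucD(1))

lemma smooth_on_frechet: "smooth_on S f \<Longrightarrow> smooth_on S (\<lambda>x. frechet_derivative f (at x) v)"
  unfolding smooth_on_def by (blast intro: C_k_on_SucD(2))

lemma smooth_on_has_vector_derivative: 
  "smooth_on S (f :: real \<Rightarrow> _) \<Longrightarrow> x \<in> S \<Longrightarrow> (f has_vector_derivative vector_derivative f (at x)) (at x)"
  using smooth_on_has_derivative differentiableI vector_derivative_works by blast

lemma smooth_on_Pair: 
  assumes "smooth_on S f" "smooth_on S g" shows "smooth_on S (\<lambda>x. (f x, g x))"
proof -
  have "smooth_on S (\<lambda>x. (f x, 0) + (0, g x))"
    by (intro smooth_on_add smooth_on_bounded_linear[OF _ assms(1)] 
        smooth_on_bounded_linear[OF _ assms(2)] bounded_linear_Pair bounded_linear_ident bounded_linear_zero)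
  then show ?thesis by simp
qed

lemma smooth_on_fst: "smooth_on S f \<Longrightarrow> smooth_on S (\<lambda>x. fst (f x))"
  by (rule smooth_on_bounded_linear[OF bounded_linear_fst])

lemma smooth_on_snd: "smooth_on S f \<Longrightarrow> smooth_on S (\<lambda>x. snd (f x))"
  by (rule smooth_on_bounded_linear[OF bounded_linear_snd])

lemma smooth_on_vec_nth:
  fixes f :: "'d::real_normed_vector \<Rightarrow> 'f::real_normed_vector ^ 'n"
  shows "smooth_on S f \<Longrightarrow> smooth_on S (\<lambda>x. f x $ i)"
  by (rule smooth_on_bounded_linear[OF bounded_linear_vec_nth])

lemma linear_axis: "linear (axis i :: 'f::real_normed_vector \<Rightarrow> 'f ^ 'n)"
  by (auto simp: linear_iff vec_eq_iff axis_def)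

lemma smooth_on_vec_lambda:
  fixes f :: "'n::finite \<Rightarrow> 'd::real_normed_vector \<Rightarrow> 'f::euclidean_space"
  assumes "open S" "\<And>i. smooth_on S (f i)"
  shows "smooth_on S (\<lambda>x. \<chi> i. f i x)"
proof (rule smooth_on_cong)
  show "smooth_on S (\<lambda>x. \<Sum>i\<in>UNIV. axis i (f i x))"
    by (intro smooth_on_sum assms(1) smooth_on_linear[OF linear_axis] assms(2))
qed (auto simp: vec_eq_iff axis_def if_distrib[of "\<lambda>z. z $ _"] sum.If_cases)

text \<open>The derivative of 1/x is a polynomial in 1/x, so the induction closes.
  \<open>inverse\<close> and \<open>sqrt\<close> will normalise vectors in the Gram-Schmidt
  process.\<close>

lemma C_k_on_inverse: "C_k_on k {0::real<..} inverse"
proof (induction k)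
  case 0
  then show ?case by (auto intro!: continuous_intros)
next
  case (Suc k)
  show ?case
  proof (rule C_k_on_SucI)
    show "(inverse has_derivative (\<lambda>v. - (inverse x * (inverse x * v)))) (at x)" if "x \<in> {0<..}" for x :: real
      using has_derivative_inverse'[of x UNIV] that by (simp add: algebra_simps)
    show "C_k_on k {0<..} (\<lambda>x. - (inverse x * (inverse x * v)))" for v :: real
      by (intro C_k_on_bounded_linear_compose[of uminus] bounded_linear_minus bounded_linear_ident
          C_k_on_bilinear[OF bounded_bilinear_mult] Suc C_k_on_const) auto
  qed auto
qed

lemma C_k_on_sqrt: "C_k_on k {0::real<..} sqrt"
proof (induction k)
  case 0
  show ?case unfolding C_k_on.simps by (rule continuous_on_real_sqrt[OF continuous_on_id])
next
  case (Suc k)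
  show ?case
  proof (rule C_k_on_SucI)
    show "(sqrt has_derivative (\<lambda>v. (inverse (sqrt x)) * (v / 2))) (at x)" if "x \<in> {0<..}" for x :: real
      using DERIV_real_sqrt[of x] that unfolding has_field_derivative_def
      by (auto elim!: has_derivative_eq_rhs)
    show "C_k_on k {0<..} (\<lambda>x. (inverse (sqrt x)) * (v/2))" for v :: real
      by (intro C_k_on_bilinear[OF bounded_bilinear_mult] C_k_on_const C_k_on_compose[OF _ _ Suc C_k_on_inverse]) auto
  qed auto
qed

lemma smooth_on_inverse: 
  "smooth_on S f \<Longrightarrow> (\<And>x. x \<in> S \<Longrightarrow> f x > 0) \<Longrightarrow> smooth_on S (\<lambda>x. inverse (f x :: real))"
  by (rule smooth_on_compose[of S f "{0<..}" inverse]) (auto simp: smooth_on_def C_k_on_inverse)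

lemma smooth_on_sqrt: 
  "smooth_on S f \<Longrightarrow> (\<And>x. x \<in> S \<Longrightarrow> f x > 0) \<Longrightarrow> smooth_on S (\<lambda>x. sqrt (f x))"
  by (rule smooth_on_compose[of S f "{0<..}" sqrt]) (auto simp: smooth_on_def C_k_on_sqrt)

text \<open>Derivatives from \<open>has_differential_at\<close> come at time 0 of a re-based curve;
  this carries them to an arbitrary time r of the original one.\<close>

lemma has_vector_derivative_at_shift:
  assumes "(f \<circ> (\<lambda>s. s + r) has_vector_derivative d) (at (0::real))"
  shows "(f has_vector_derivative d) (at r)"
proof -
  have "((\<lambda>s. s - r) has_vector_derivative 1) (at r)"
    by (auto intro!: derivative_eq_intros)
  then have "((f \<circ> (\<lambda>s. s + r)) \<circ> (\<lambda>s. s - r) has_vector_derivative 1 *\<^sub>R d) (at r)"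
    by (rule vector_diff_chain_at) (use assms in simp)
  then show ?thesis by (simp add: o_def)
qed

section \<open>From directional derivatives to Frechet derivatives\<close>

lemma bound_linear_family:
  fixes \<Phi> :: "'p \<Rightarrow> 'e::euclidean_space \<Rightarrow> 'f::real_normed_vector"
  assumes "\<And>b. b \<in> Basis \<Longrightarrow> \<exists>B. \<forall>p\<in>K. norm (\<Phi> p b) \<le> B" and "\<And>p. p \<in> K \<Longrightarrow> linear (\<Phi> p)"
  obtains C where "C > 0" "\<And>p v. p \<in> K \<Longrightarrow> norm (\<Phi> p v) \<le> C * norm v"
proof -
  obtain B where B: "\<And>b p. b \<in> Basis \<Longrightarrow> p \<in> K \<Longrightarrow> norm (\<Phi> p b) \<le> B b"
    using assms(1) by metis
  \<comment> \<open>The added 1 keeps \<open>C\<close> positive even if all bounds vanish, so that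
    one can divide by it.\<close>
  define C where "C = (\<Sum>b\<in>(Basis::'e set). \<bar>B b\<bar>) + 1"
  have "norm (\<Phi> p v) \<le> C * norm v" if p: "p \<in> K" for p v
  proof -
    have "\<Phi> p v = \<Phi> p (\<Sum>b\<in>Basis. (v \<bullet> b) *\<^sub>R b)"
      by (simp add: euclidean_representation)
    also have "\<dots> = (\<Sum>b\<in>Basis. (v \<bullet> b) *\<^sub>R \<Phi> p b)"
      using assms(2)[OF p] by (simp add: linear_sum linear_scale)
    also have "norm \<dots> \<le> (\<Sum>b\<in>Basis. norm v * \<bar>B b\<bar>)"
    proof (rule sum_norm_le)
      fix b :: 'e assume b: "b \<in> Basis"
      have "norm ((v \<bullet> b) *\<^sub>R \<Phi> p b) = \<bar>v \<bullet> b\<bar> * norm (\<Phi> p b)" by simp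
      also have "\<dots> \<le> norm v * \<bar>B b\<bar>"
        using B[OF b p] Basis_le_norm[OF b, of v] by (intro mult_mono) auto
      finally show "norm ((v \<bullet> b) *\<^sub>R \<Phi> p b) \<le> norm v * \<bar>B b\<bar>" .
    qed
    also have "\<dots> \<le> C * norm v"
      by (simp add: C_def sum_distrib_left[symmetric] algebra_simps)
    finally show ?thesis .
  qed
  moreover have "C > 0" unfolding C_def by (simp add: add_nonneg_pos sum_nonneg)
  ultimately show ?thesis using that by blast
qed

text \<open>Along every ray, \<open>F\<close> solves an ordinary differential equation; the a priori bound that this
  gives makes \<open>F\<close> continuous.\<close>

lemma directional_derivatives_imp_continuous:
  fixes F :: "'e::euclidean_space \<Rightarrow> 'f::euclidean_space"
  assumes S: "open S"
    and der: "\<And>y v. y \<in> S \<Longrightarrow> ((\<lambda>r. F (y + r *\<^sub>R v)) has_vector_derivative \<Phi> y (F y) v) (at 0)"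
    and cont: "\<And>v. continuous_on (S \<times> UNIV) (\<lambda>(y, z). \<Phi> y z v)"
    and lin: "\<And>y z. y \<in> S \<Longrightarrow> linear (\<Phi> y z)"
  shows "continuous_on S F"
proof (rule continuous_at_imp_continuous_on, rule ballI)
  fix y0 assume y0: "y0 \<in> S"
  from S y0 obtain d where d: "d > 0" "cball y0 d \<subseteq> S" using open_contains_cball by blast
  \<comment> \<open>On this compact set the directional derivatives are bounded by one constant
    \<open>C\<close>; the bound is valid as long as \<open>F\<close> stays within distance 1 of its
    value at \<open>y0\<close>.\<close>
  let ?K = "cball y0 d \<times> cball (F y0) 1"
  obtain C where C: "C > 0" "\<And>p v. p \<in> ?K \<Longrightarrow> norm ((\<lambda>(y,z). \<Phi> y z) p v) \<le> C * norm v"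
  proof (rule bound_linear_family[of ?K "\<lambda>(y,z). \<Phi> y z"])
    show "\<exists>B. \<forall>p\<in>?K. norm ((\<lambda>(y,z). \<Phi> y z) p b) \<le> B" for b
    proof -
      have "compact ((\<lambda>(y, z). \<Phi> y z b) ` ?K)"
        by (intro compact_continuous_image continuous_on_subset[OF cont] compact_Times) (use d in auto)
      then have "bounded ((\<lambda>(y, z). \<Phi> y z b) ` ?K)" by (rule compact_imp_bounded)
      then show ?thesis unfolding bounded_iff by (auto simp: case_prod_unfold)
    qed
  qed (use lin d in auto)
  have est: "norm (F (y0 + h) - F y0) \<le> C * norm h" if h: "norm h \<le> d" "C * norm h < 1" for h
  proof -
    define G where "G r = F (y0 + r *\<^sub>R h)" for r
    have inS: "y0 + r *\<^sub>R h \<in> cball y0 d" if "0 \<le> r" "r \<le> 1" for r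
      using h(1) that mult_left_le_one_le[of "norm h" r] by (simp add: dist_norm)
    have G': "(G has_vector_derivative \<Phi> (y0 + r *\<^sub>R h) (G r) h) (at r)" if "0 \<le> r" "r \<le> 1" for r
    proof -
      have "((\<lambda>s. F (y0 + r *\<^sub>R h + s *\<^sub>R h)) has_vector_derivative \<Phi> (y0 + r *\<^sub>R h) (G r) h) (at 0)"
        unfolding G_def using inS[OF that] d by (intro der) auto
      then have "(G \<circ> (\<lambda>s. s + r) has_vector_derivative \<Phi> (y0 + r *\<^sub>R h) (G r) h) (at 0)"
        by (simp add: o_def G_def algebra_simps)
      then show ?thesis by (rule has_vector_derivative_at_shift)
    qed
    have contG: "continuous_on {0..1} G"
      by (intro continuous_at_imp_continuous_on ballI has_vector_derivative_continuous[OF G']) auto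
    have bnd: "norm (G b - G 0) \<le> C * norm h * b" if b: "0 \<le> b" "b \<le> 1"
      and sm: "\<And>r. 0 < r \<Longrightarrow> r < b \<Longrightarrow> norm (G r - G 0) \<le> 1" for b
    proof (cases "b = 0")
      case False
      have "norm (G b - G 0) \<le> C * norm h * b - C * norm h * 0"
      proof (rule differentiable_bound_general[where f' = "\<lambda>r. \<Phi> (y0 + r *\<^sub>R h) (G r) h" and \<phi>' = "\<lambda>_. C * norm h"])
        show "0 < b" using False b by auto
        show "continuous_on {0..b} G" using contG b by (auto intro: continuous_on_subset)
        show "continuous_on {0..b} ((*) (C * norm h))" by (intro continuous_intros)
        fix r assume r: "0 < r" "r < b"
        show "(G has_vector_derivative \<Phi> (y0 + r *\<^sub>R h) (G r) h) (at r)" using G' r b by auto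
        show "((*) (C * norm h) has_vector_derivative C * norm h) (at r)"
          by (auto intro!: derivative_eq_intros simp: has_real_derivative_iff_has_vector_derivative[symmetric])
        have "(y0 + r *\<^sub>R h, G r) \<in> ?K"
          using inS[of r] sm[OF r] r b by (auto simp: dist_norm norm_minus_commute G_def)
        then show "norm (\<Phi> (y0 + r *\<^sub>R h) (G r) h) \<le> C * norm h" using C(2) by fastforce
      qed
      then show ?thesis by simp
    qed auto
    \<comment> \<open>Continuation argument: at the first time at which \<open>G\<close> has moved
      by 1, the bound so far gives a displacement of at most \<open>C * norm h\<close>, which is
      less than 1.\<close>
    have small: "norm (G r - G 0) < 1" if "0 \<le> r" "r \<le> 1" for r
    proof (rule ccontr)
      assume "\<not> norm (G r - G 0) < 1"
      let ?B = "{r\<in>{0..1}. norm (G r - G 0) \<in> {1..}}"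
      have "closed ({0..1} \<inter> (\<lambda>r. norm (G r - G 0)) -` {1..})"
        by (intro continuous_closed_preimage continuous_intros contG)
      then have "closed ?B" by (simp add: vimage_def Int_def)
      then have "compact ?B" 
        by (metis (no_types, lifting) compact_Icc closed_Int_compact Int_absorb2 mem_Collect_eq subsetI)
      moreover have "r \<in> ?B" using that \<open>\<not> norm (G r - G 0) < 1\<close> by auto
      ultimately obtain b where b: "b \<in> ?B" "\<And>s. s \<in> ?B \<Longrightarrow> b \<le> s"
        using compact_attains_inf[of ?B] by blast
      have "norm (G b - G 0) \<le> C * norm h * b"
      proof (rule bnd)
        show "norm (G s - G 0) \<le> 1" if "0 < s" "s < b" for s
          using b(2)[of s] that b(1) by force
      qed (use b in auto)
      also have "\<dots> \<le> C * norm h" using b(1) C(1) by (simp add: mult_left_le)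
      finally show False using h b(1) by auto
    qed
    have "norm (G 1 - G 0) \<le> C * norm h * 1" by (rule bnd) (use small in \<open>auto intro: less_imp_le\<close>)
    then show ?thesis by (simp add: G_def)
  qed
  show "isCont F y0"
    unfolding continuous_at_eps_delta dist_norm
  proof (intro allI impI)
    fix e :: real assume e: "e > 0"
    \<comment> \<open>1/C makes the displacement estimate applicable, e/C makes the displacement
      smaller than e.\<close>
    define \<delta> where "\<delta> = min d (min (1/C) (e/C))"
    have "\<delta> > 0" using d C e by (auto simp: \<delta>_def)
    moreover have "norm (F y - F y0) < e" if "norm (y - y0) < \<delta>" for y
    proof -
      have "norm (F (y0 + (y - y0)) - F y0) \<le> C * norm (y - y0)"
        using that C by (intro est) (auto simp: \<delta>_def field_simps)
      also have "\<dots> < e" using that C by (auto simp: \<delta>_def field_simps)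
      finally show ?thesis by simp
    qed
    ultimately show "\<exists>\<delta>>0. \<forall>y. norm (y - y0) < \<delta> \<longrightarrow> norm (F y - F y0) < e" by blast
  qed
qed

text \<open>Mean value inequality for F(y0 + rh) - r D(y0) h on the unit interval: continuity of
  \<open>D\<close> in the point keeps the derivative in r below e |h|.\<close>

lemma continuous_directional_derivatives_imp_has_derivative:
  fixes F :: "'e::euclidean_space \<Rightarrow> 'f::real_normed_vector"
  assumes S: "open S"
    and der: "\<And>y v. y \<in> S \<Longrightarrow> ((\<lambda>r. F (y + r *\<^sub>R v)) has_vector_derivative D y v) (at 0)"
    and cont: "\<And>v. continuous_on S (\<lambda>y. D y v)"
    and lin: "\<And>y. y \<in> S \<Longrightarrow> linear (D y)"
    and y0: "y0 \<in> S"
  shows "(F has_derivative D y0) (at y0)"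
proof -
  have "\<exists>d>0. \<forall>y. norm (y - y0) < d \<longrightarrow> norm (F y - F y0 - D y0 (y - y0)) \<le> e * norm (y - y0)"
    if e: "e > 0" for e
  proof -
    \<comment> \<open>The tolerance is spread over the basis vectors: errors of \<open>e'\<close> on
      each of them add up to at most \<open>e\<close> times the norm of the vector.\<close>
    define e' where "e' = e / (real DIM('e))"
    have e': "e' > 0" using e by (simp add: e'_def)
    have "\<forall>\<^sub>F y in at y0. \<forall>b\<in>Basis. norm (D y b - D y0 b) < e'"
    proof (intro eventually_ball_finite ballI finite_Basis)
      fix b :: 'e
      have "isCont (\<lambda>y. D y b) y0" using cont[of b] S y0 by (simp add: continuous_on_eq_continuous_at)
      then have "((\<lambda>y. D y b) \<longlongrightarrow> D y0 b) (at y0)" by (simp add: isCont_def)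
      then show "\<forall>\<^sub>F y in at y0. norm (D y b - D y0 b) < e'"
        using e' by (auto simp: tendsto_iff dist_norm)
    qed
    then obtain d1 where d1: "d1 > 0" "\<And>y. y \<noteq> y0 \<Longrightarrow> dist y y0 < d1 \<Longrightarrow> \<forall>b\<in>Basis. norm (D y b - D y0 b) < e'"
      by (auto simp: eventually_at)
    from S y0 obtain d2 where d2: "d2 > 0" "ball y0 d2 \<subseteq> S" using open_contains_ball by blast
    have Dest: "norm (D y v - D y0 v) \<le> e * norm v" if y: "y \<in> S" "dist y y0 < d1" for y v
    proof -
      have *: "norm (D y b - D y0 b) \<le> e'" if "b \<in> Basis" for b
        using d1(2)[of y] y that e' by (cases "y = y0") (auto intro: less_imp_le)
      have "D y v - D y0 v = (\<Sum>b\<in>Basis. (v \<bullet> b) *\<^sub>R (D y b - D y0 b))"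
      proof -
        have "linear (\<lambda>v. D y v - D y0 v)" using lin[OF y(1)] lin[OF y0] by (rule linear_compose_sub)
        then have "D y (\<Sum>b\<in>Basis. (v \<bullet> b) *\<^sub>R b) - D y0 (\<Sum>b\<in>Basis. (v \<bullet> b) *\<^sub>R b) = (\<Sum>b\<in>Basis. (v \<bullet> b) *\<^sub>R (D y b - D y0 b))"
          using linear_sum[of "\<lambda>v. D y v - D y0 v" "\<lambda>b. (v \<bullet> b) *\<^sub>R b" Basis] linear_scale[of "\<lambda>v. D y v - D y0 v"] by simp
        then show ?thesis by (simp add: euclidean_representation)
      qed
      also have "norm \<dots> \<le> (\<Sum>b\<in>(Basis::'e set). norm v * e')"
      proof (rule sum_norm_le)
        fix b :: 'e assume b: "b \<in> Basis"
        show "norm ((v \<bullet> b) *\<^sub>R (D y b - D y0 b)) \<le> norm v * e'"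
          using *[OF b] Basis_le_norm[OF b, of v] by (auto intro!: mult_mono)
      qed
      also have "\<dots> = e * norm v" by (simp add: e'_def)
      finally show ?thesis .
    qed
    have "norm (F y - F y0 - D y0 (y - y0)) \<le> e * norm (y - y0)" if y: "norm (y - y0) < min d1 d2" for y
    proof -
      define h where "h = y - y0"
      define G where "G r = F (y0 + r *\<^sub>R h) - r *\<^sub>R D y0 h" for r
      have near: "norm (r *\<^sub>R h) < min d1 d2" if "0 \<le> r" "r \<le> 1" for r
        using y that mult_left_le_one_le[of "norm h" r] by (simp add: h_def)
      then have inS: "y0 + r *\<^sub>R h \<in> S" if "0 \<le> r" "r \<le> 1" for r
        using that d2 by (force simp: dist_norm)
      have G': "(G has_vector_derivative D (y0 + r *\<^sub>R h) h - D y0 h) (at r)" if "0 \<le> r" "r \<le> 1" for r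
      proof -
        have "((\<lambda>s. F (y0 + r *\<^sub>R h + s *\<^sub>R h)) has_vector_derivative D (y0 + r *\<^sub>R h) h) (at 0)"
          by (intro der inS that)
        then have "((\<lambda>s. F (y0 + s *\<^sub>R h)) \<circ> (\<lambda>s. s + r) has_vector_derivative D (y0 + r *\<^sub>R h) h) (at 0)"
          by (simp add: o_def algebra_simps)
        then have "((\<lambda>s. F (y0 + s *\<^sub>R h)) has_vector_derivative D (y0 + r *\<^sub>R h) h) (at r)" 
          by (rule has_vector_derivative_at_shift)
        then show ?thesis unfolding G_def
          by (auto intro!: derivative_eq_intros)
      qed
      have "norm (G 1 - G 0) \<le> e * norm h * 1 - e * norm h * 0"
      proof (rule differentiable_bound_general[where f' = "\<lambda>r. D (y0 + r *\<^sub>R h) h - D y0 h" and \<phi>' = "\<lambda>_. e * norm h"])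
        show "continuous_on {0..1} G" 
          by (intro continuous_at_imp_continuous_on ballI has_vector_derivative_continuous[OF G']) auto
        show "continuous_on {0..1} ((*) (e * norm h))" by (intro continuous_intros)
        fix r :: real assume r: "0 < r" "r < 1"
        show "(G has_vector_derivative D (y0 + r *\<^sub>R h) h - D y0 h) (at r)" using G' r by auto
        show "((*) (e * norm h) has_vector_derivative e * norm h) (at r)"
          by (auto intro!: derivative_eq_intros simp: has_real_derivative_iff_has_vector_derivative[symmetric])
        show "norm (D (y0 + r *\<^sub>R h) h - D y0 h) \<le> e * norm h"
          using r near[of r] inS[of r] by (intro Dest) (auto simp: dist_norm)
      qed auto
      then show ?thesis by (simp add: G_def h_def algebra_simps)
    qed
    then show ?thesis using d1(1) d2(1) by (intro exI[of _ "min d1 d2"]) auto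
  qed
  then show ?thesis
    using lin[OF y0] by (auto simp: has_derivative_at_alt linear_conv_bounded_linear)
qed

text \<open>Continuity of \<open>F\<close> is not given. It follows from the form of the equation,
  in which the derivative is a continuous function of the point and of the value; then the
  derivative itself becomes continuous in the point.\<close>

lemma directional_derivatives_imp_has_derivative:
  fixes F :: "'e::euclidean_space \<Rightarrow> 'f::euclidean_space"
  assumes "open S"
    and "\<And>y v. y \<in> S \<Longrightarrow> ((\<lambda>r. F (y + r *\<^sub>R v)) has_vector_derivative \<Phi> y (F y) v) (at 0)"
    and cont: "\<And>v. continuous_on (S \<times> UNIV) (\<lambda>(y, z). \<Phi> y z v)"
    and "\<And>y z. y \<in> S \<Longrightarrow> linear (\<Phi> y z)"
    and "y \<in> S"
  shows "(F has_derivative \<Phi> y (F y)) (at y)"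
proof (rule continuous_directional_derivatives_imp_has_derivative[of S F "\<lambda>y. \<Phi> y (F y)"])
  have "continuous_on S F" by (rule directional_derivatives_imp_continuous) fact+
  then have "continuous_on S (\<lambda>y. (\<lambda>(y, z). \<Phi> y z v) (y, F y))" for v
    by (intro continuous_on_compose2[OF cont] continuous_intros) auto
  then show "continuous_on S (\<lambda>y. \<Phi> y (F y) v)" for v by simp
qed (use assms in auto)

subsection \<open>Complex differentiability on a vector space with a complex structure\<close>

text \<open>The complex structure is a parameter, so that one theory serves both
  \<open>complex ^ 'n\<close> with multiplication by i and the complexification
  \<open>'e \<times> 'e\<close> of a real space. Continuity of the derivative will be a consequence
  of Cauchy's formula.\<close>

definition cdiff :: "('c::real_normed_vector \<Rightarrow> 'c) \<Rightarrow> 'c set \<Rightarrow> ('c \<Rightarrow> complex) \<Rightarrow> bool" where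
  "cdiff J S F \<longleftrightarrow> open S \<and>
     (\<forall>z\<in>S. \<exists>F'. (F has_derivative F') (at z) \<and> (\<forall>v. F' (J v) = \<i> * F' v))"

lemma cdiffI:
  assumes "open S" "\<And>z. z \<in> S \<Longrightarrow> (F has_derivative F' z) (at z)"
    and "\<And>z v. z \<in> S \<Longrightarrow> F' z (J v) = \<i> * F' z v"
  shows "cdiff J S F"
  using assms unfolding cdiff_def by blast

lemma cdiff_open: "cdiff J S F \<Longrightarrow> open S"
  by (simp add: cdiff_def)

lemma cdiffD:
  assumes "cdiff J S F" "z \<in> S"
  shows "(F has_derivative frechet_derivative F (at z)) (at z)"
    and "frechet_derivative F (at z) (J v) = \<i> * frechet_derivative F (at z) v"
proof -
  obtain F' where "(F has_derivative F') (at z)" "\<And>v. F' (J v) = \<i> * F' v"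
    using assms unfolding cdiff_def by blast
  then show "(F has_derivative frechet_derivative F (at z)) (at z)"
    and "frechet_derivative F (at z) (J v) = \<i> * frechet_derivative F (at z) v"
    using frechet_derivative_at by metis+
qed

lemma cdiff_continuous_on: "cdiff J S F \<Longrightarrow> continuous_on S F"
  by (meson cdiffD(1) continuous_at_imp_continuous_on has_derivative_continuous)

lemma cdiff_cong:
  assumes "cdiff J S F" "\<And>z. z \<in> S \<Longrightarrow> F z = G z"
  shows "cdiff J S G"
proof (rule cdiffI)
  show "(G has_derivative frechet_derivative F (at z)) (at z)" if "z \<in> S" for z
    by (rule has_derivative_transform_within_open[OF cdiffD(1)[OF assms(1) that] cdiff_open[OF assms(1)] that assms(2)])
qed (auto intro: cdiff_open[OF assms(1)] cdiffD(2)[OF assms(1)])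

lemma cdiff_subset: "cdiff J S F \<Longrightarrow> open T \<Longrightarrow> T \<subseteq> S \<Longrightarrow> cdiff J T F"
  unfolding cdiff_def by blast

lemma cdiff_local:
  assumes "\<And>z. z \<in> S \<Longrightarrow> \<exists>U. z \<in> U \<and> U \<subseteq> S \<and> cdiff J U F"
  shows "cdiff J S F"
proof -
  have "\<exists>U. open U \<and> z \<in> U \<and> U \<subseteq> S" if "z \<in> S" for z
    using assms[OF that] cdiff_open by metis
  then have "open S" by (subst open_subopen) blast
  moreover have "(F has_derivative frechet_derivative F (at z)) (at z)"
      "frechet_derivative F (at z) (J v) = \<i> * frechet_derivative F (at z) v" if "z \<in> S" for z v
    using assms[OF that] cdiffD by metis+
  ultimately show ?thesis by (rule cdiffI)
qed

lemma cdiff_const: "open S \<Longrightarrow> cdiff J S (\<lambda>z. c)"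
  by (rule cdiffI[where F' = "\<lambda>_ _. 0"]) auto

lemma cdiff_add: "cdiff J S F \<Longrightarrow> cdiff J S G \<Longrightarrow> cdiff J S (\<lambda>z. F z + G z)"
  by (rule cdiffI[OF cdiff_open has_derivative_add[OF cdiffD(1) cdiffD(1)]])
     (auto simp: cdiffD(2) algebra_simps)

lemma cdiff_mult: "cdiff J S F \<Longrightarrow> cdiff J S G \<Longrightarrow> cdiff J S (\<lambda>z. F z * G z)"
  by (rule cdiffI[OF cdiff_open has_derivative_mult[OF cdiffD(1) cdiffD(1)]])
     (auto simp: cdiffD(2) algebra_simps)

lemma cdiff_sum:
  "open S \<Longrightarrow> (\<And>i. i \<in> I \<Longrightarrow> cdiff J S (F i)) \<Longrightarrow> cdiff J S (\<lambda>z. \<Sum>i\<in>I. F i z)"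
  by (induction I rule: infinite_finite_induct) (auto intro: cdiff_const cdiff_add)

lemma cdiff_prod:
  "open S \<Longrightarrow> (\<And>i. i \<in> I \<Longrightarrow> cdiff J S (F i)) \<Longrightarrow> cdiff J S (\<lambda>z. \<Prod>i\<in>I. F i z)"
  by (induction I rule: infinite_finite_induct) (auto intro: cdiff_const cdiff_mult)

lemma cdiff_power: "cdiff J S F \<Longrightarrow> cdiff J S (\<lambda>z. F z ^ k)"
  by (induction k) (auto intro: cdiff_const cdiff_mult dest: cdiff_open)

lemma cdiff_inverse:
  assumes "cdiff J S F" "\<And>z. z \<in> S \<Longrightarrow> F z \<noteq> 0"
  shows "cdiff J S (\<lambda>z. inverse (F z))"
  by (rule cdiffI[OF cdiff_open[OF assms(1)] Deriv.has_derivative_inverse[OF _ cdiffD(1)[OF assms(1)]]])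
     (auto simp: assms cdiffD(2)[OF assms(1)])

lemma cdiff_divide:
  "cdiff J S F \<Longrightarrow> cdiff J S G \<Longrightarrow> (\<And>z. z \<in> S \<Longrightarrow> G z \<noteq> 0) \<Longrightarrow> cdiff J S (\<lambda>z. F z / G z)"
  by (simp add: divide_inverse cdiff_mult cdiff_inverse)

lemma cdiff_linear_compose:
  assumes "cdiff J S F" "bounded_linear L" "\<And>v. L (K v) = J (L v)"
  shows "cdiff K ((\<lambda>z. L z + c) -` S) (\<lambda>z. F (L z + c))"
proof (rule cdiffI)
  show "open ((\<lambda>z. L z + c) -` S)"
    using assms(2) cdiff_open[OF assms(1)] 
    by (intro open_vimage continuous_intros) (auto simp: linear_continuous_on)
  fix z assume z: "z \<in> (\<lambda>z. L z + c) -` S"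
  have "((\<lambda>z. L z + c) has_derivative L) (at z)"
    using has_derivative_add_const[OF bounded_linear_imp_has_derivative[OF assms(2)]] by simp
  from has_derivative_compose[OF this cdiffD(1)[OF assms(1)]] z
  show "((\<lambda>z. F (L z + c)) has_derivative (\<lambda>v. frechet_derivative F (at (L z + c)) (L v))) (at z)" 
    by auto
  show "frechet_derivative F (at (L z + c)) (L (K v)) = \<i> * frechet_derivative F (at (L z + c)) (L v)" for v
    using z cdiffD(2)[OF assms(1), of "L z + c"] by (simp add: assms(3))
qed

text \<open>Cauchy's formula for the derivative: on the circle r exp(2 pi i s) the form dz / (2 pi i
  z) is ds, which leaves a plain average over s.\<close>

lemma deriv_eq_circle_average:
  assumes "continuous_on (cball 0 r) f" "f holomorphic_on ball 0 r" "0 < r"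
  shows "deriv f 0 = integral {0..1} (\<lambda>s. f (circlepath 0 r s) / circlepath 0 r s)"
proof -
  have "2 * pi * \<i> * deriv f 0 = contour_integral (circlepath 0 r) (\<lambda>u. f u / (u - 0)^2)"
    using Cauchy_contour_integral_circlepath_2[OF assms(1,2), of 0] assms(3) by simp
  also have "\<dots> = integral {0..1} (\<lambda>s. (2 * pi * \<i>) * (f (circlepath 0 r s) / circlepath 0 r s))"
    unfolding contour_integral_integral vector_derivative_circlepath
    by (rule integral_cong) (use assms(3) in \<open>auto simp: circlepath power2_eq_square field_simps\<close>)
  also have "\<dots> = (2 * pi * \<i>) * integral {0..1} (\<lambda>s. f (circlepath 0 r s) / circlepath 0 r s)"
    by (rule integral_mult_right)
  finally show ?thesis by simp
qed

lemma continuous_on_circlepath [continuous_intros]: "continuous_on S (circlepath z r)"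
  unfolding circlepath by (intro continuous_intros)

lemma circlepath_0_nonzero: "r > 0 \<Longrightarrow> circlepath 0 r s \<noteq> 0"
  by (simp add: circlepath)

lemma norm_circlepath_0: "r > 0 \<Longrightarrow> norm (circlepath 0 r s) = r"
  by (simp add: circlepath norm_mult)

locale complex_structure =
  fixes J :: "'c::euclidean_space \<Rightarrow> 'c"
  assumes lin: "linear J" and sq: "J (J v) = - v"
begin

text \<open>The complex affine line through z in direction v, with \<zeta> v built from v and
  \<open>J v\<close>.\<close>

definition cline :: "'c \<Rightarrow> 'c \<Rightarrow> complex \<Rightarrow> 'c" where
  "cline z v \<zeta> = z + Re \<zeta> *\<^sub>R v + Im \<zeta> *\<^sub>R J v"

lemma cline_0 [simp]: "cline z v 0 = z"
  by (simp add: cline_def)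

lemma cline_1 [simp]: "cline z v 1 = z + v"
  by (simp add: cline_def)

lemma cline_cline: "cline (cline z v \<zeta>) v \<eta> = cline z v (\<zeta> + \<eta>)"
  by (simp add: cline_def algebra_simps)

lemma cline_of_real: "cline z v (of_real r) = z + r *\<^sub>R v"
  by (simp add: cline_def)

lemma continuous_on_cline [continuous_intros]:
  fixes f :: "_::topological_space \<Rightarrow> 'c"
  assumes "continuous_on A f" "continuous_on A h"
  shows "continuous_on A (\<lambda>x. cline (f x) v (h x))"
  unfolding cline_def using assms by (intro continuous_intros)

lemma dist_cline: "dist (cline z v \<zeta>) z \<le> norm \<zeta> * (norm v + norm (J v))"
proof -
  have "dist (cline z v \<zeta>) z \<le> \<bar>Re \<zeta>\<bar> * norm v + \<bar>Im \<zeta>\<bar> * norm (J v)"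
    unfolding cline_def dist_norm using norm_triangle_ineq[of "Re \<zeta> *\<^sub>R v" "Im \<zeta> *\<^sub>R J v"] by simp
  also have "\<dots> \<le> norm \<zeta> * norm v + norm \<zeta> * norm (J v)"
    by (intro add_mono mult_right_mono abs_Re_le_cmod abs_Im_le_cmod norm_ge_zero)
  finally show ?thesis by (simp add: algebra_simps)
qed

text \<open>The radii are uniform for z near \<open>z0\<close>, so that the same circle can be used
  in Cauchy's formula at all nearby points.\<close>

lemma cline_in_open:
  assumes "open S" "z0 \<in> S"
  obtains \<delta> \<epsilon> where "\<delta> > 0" "\<epsilon> > 0" "ball z0 \<delta> \<subseteq> S"
    "\<And>z \<zeta>. z \<in> ball z0 \<delta> \<Longrightarrow> norm \<zeta> \<le> \<epsilon> \<Longrightarrow> cline z v \<zeta> \<in> S"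
proof -
  obtain d where d: "d > 0" "ball z0 d \<subseteq> S" using assms open_contains_ball by blast
  define C where "C = norm v + norm (J v) + 1"
  have C: "C > 0" by (simp add: C_def add_nonneg_pos)
  show ?thesis
  proof (rule that[of "d/2" "d/(2*C)"])
    show "d/2 > 0" "d/(2*C) > 0" "ball z0 (d/2) \<subseteq> S" using d C by (auto simp: subset_eq)
    fix z :: 'c and \<zeta> :: complex assume z: "z \<in> ball z0 (d/2)" and \<zeta>: "norm \<zeta> \<le> d/(2*C)"
    have "dist (cline z v \<zeta>) z \<le> norm \<zeta> * C"
      by (intro order_trans[OF dist_cline] mult_left_mono) (auto simp: C_def)
    also have "\<dots> \<le> d / 2" using \<zeta> C by (simp add: field_simps)
    finally have "dist z0 (cline z v \<zeta>) < d"
      using z dist_triangle[of z0 "cline z v \<zeta>" z] by (auto simp: dist_commute)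
    then show "cline z v \<zeta> \<in> S" using d by auto
  qed
qed

lemma has_derivative_cline: "(cline z v has_derivative (\<lambda>h. Re h *\<^sub>R v + Im h *\<^sub>R J v)) (at \<zeta>)"
  unfolding cline_def by (auto intro!: derivative_eq_intros)

lemma cdiff_cline:
  assumes "cdiff J S F" "cline z v \<zeta> \<in> S"
  shows "((\<lambda>\<zeta>. F (cline z v \<zeta>)) has_field_derivative frechet_derivative F (at (cline z v \<zeta>)) v) (at \<zeta>)"
proof -
  let ?D = "frechet_derivative F (at (cline z v \<zeta>))"
  have "linear ?D" using cdiffD(1)[OF assms] has_derivative_linear by blast
  then have "?D (Re h *\<^sub>R v + Im h *\<^sub>R J v) = ?D v * h" for h
    using cdiffD(2)[OF assms, of v]
    by (simp add: linear_add linear_scale complex_eq_iff algebra_simps)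
  then have "(\<lambda>h. ?D (Re h *\<^sub>R v + Im h *\<^sub>R J v)) = (*) (?D v)" by auto
  then show ?thesis
    using has_derivative_compose[OF has_derivative_cline cdiffD(1)[OF assms]]
    by (simp add: has_field_derivative_def)
qed

lemma open_cline_vimage: "open S \<Longrightarrow> open (cline z v -` S)"
  by (rule open_vimage[OF _ continuous_on_cline[OF continuous_on_const continuous_on_id]])

text \<open>A function that is holomorphic along all complex lines is dealt with by the Cauchy formula
  on circles in the lines; the parameter \<open>t\<close> is for integrals depending on a parameter.\<close>

context
  fixes S :: "'c set" and Tm :: "real set" and F :: "'c \<Rightarrow> real \<Rightarrow> complex"
    and D :: "'c \<Rightarrow> real \<Rightarrow> complex" and v :: 'c
  assumes S: "open S"
    and contF: "continuous_on (S \<times> Tm) (\<lambda>(z, t). F z t)"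
    and der: "\<And>z t. z \<in> S \<Longrightarrow> t \<in> Tm \<Longrightarrow> ((\<lambda>\<zeta>. F (cline z v \<zeta>) t) has_field_derivative D z t) (at 0)"
begin

lemma line_has_field_derivative:
  assumes "cline z v \<zeta> \<in> S" "t \<in> Tm"
  shows "((\<lambda>\<zeta>. F (cline z v \<zeta>) t) has_field_derivative D (cline z v \<zeta>) t) (at \<zeta>)"
proof -
  have "((\<lambda>\<eta>. F (cline z v (\<zeta> + \<eta>)) t) has_field_derivative D (cline z v \<zeta>) t) (at 0)"
    using der[OF assms] by (simp add: cline_cline)
  then show ?thesis using DERIV_shift[of "\<lambda>\<zeta>. F (cline z v \<zeta>) t" _ 0 \<zeta>] by (simp add: add.commute)
qed

text \<open>Differentiability along the line at 0 for every base point in \<open>S\<close> gives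
  holomorphy on the disc, so the derivative is an average of values of \<open>F\<close>
  itself.\<close>

lemma line_derivative_eq_circle_average:
  assumes "\<epsilon> > 0" "\<And>\<zeta>. norm \<zeta> \<le> \<epsilon> \<Longrightarrow> cline z v \<zeta> \<in> S" "t \<in> Tm"
  shows "D z t = integral {0..1} (\<lambda>s. F (cline z v (circlepath 0 \<epsilon> s)) t / circlepath 0 \<epsilon> s)"
proof -
  have "z \<in> S" using assms(2)[of 0] assms(1) by simp
  have d: "((\<lambda>\<zeta>. F (cline z v \<zeta>) t) has_field_derivative D (cline z v \<zeta>) t) (at \<zeta>)" if "norm \<zeta> \<le> \<epsilon>" for \<zeta>
    using assms that by (intro line_has_field_derivative) auto
  have "D z t = deriv (\<lambda>\<zeta>. F (cline z v \<zeta>) t) 0"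
    using DERIV_imp_deriv[OF der[OF \<open>z \<in> S\<close> assms(3)]] by simp
  also have "\<dots> = integral {0..1} (\<lambda>s. F (cline z v (circlepath 0 \<epsilon> s)) t / circlepath 0 \<epsilon> s)"
  proof (rule deriv_eq_circle_average)
    show "continuous_on (cball 0 \<epsilon>) (\<lambda>\<zeta>. F (cline z v \<zeta>) t)"
      by (intro continuous_at_imp_continuous_on ballI DERIV_isCont[OF d]) auto
    show "(\<lambda>\<zeta>. F (cline z v \<zeta>) t) holomorphic_on ball 0 \<epsilon>"
      using d less_imp_le by (fastforce simp: holomorphic_on_open)
  qed fact
  finally show ?thesis .
qed

text \<open>No continuity of \<open>D\<close> is assumed: as an average of the continuous function
  \<open>F\<close> over a fixed circle it is continuous in both variables.\<close>

lemma line_derivative_continuous: "continuous_on (S \<times> Tm) (\<lambda>(z, t). D z t)"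
proof (clarsimp simp: continuous_on_eq_continuous_within)
  fix z0 t0 assume z0: "z0 \<in> S" and t0: "t0 \<in> Tm"
  obtain \<delta> \<epsilon> where \<delta>: "\<delta> > 0" "\<epsilon> > 0" "ball z0 \<delta> \<subseteq> S"
    "\<And>z \<zeta>. z \<in> ball z0 \<delta> \<Longrightarrow> norm \<zeta> \<le> \<epsilon> \<Longrightarrow> cline z v \<zeta> \<in> S"
    using cline_in_open[OF S z0] by metis
  have "continuous_on (ball z0 \<delta> \<times> Tm) (\<lambda>p. integral (cbox 0 1)
      (\<lambda>s. (case p of (z, t) \<Rightarrow> F (cline z v (circlepath 0 \<epsilon> s)) t / circlepath 0 \<epsilon> s)))"
  proof (rule integral_continuous_on_param)
    have "continuous_on ((ball z0 \<delta> \<times> Tm) \<times> cbox 0 (1::real)) 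
        (\<lambda>p. (\<lambda>(z, t). F z t) (cline (fst (fst p)) v (circlepath 0 \<epsilon> (snd p)), snd (fst p)) / circlepath 0 \<epsilon> (snd p))"
      using \<delta>(2) 
      by (intro continuous_on_divide continuous_on_compose2[OF contF] continuous_intros
            continuous_on_compose2[OF continuous_on_circlepath[of UNIV]])
         (auto simp: circlepath_0_nonzero norm_circlepath_0 intro!: \<delta>(4))
    then show "continuous_on ((ball z0 \<delta> \<times> Tm) \<times> cbox 0 (1::real))
      (\<lambda>(p, s). case p of (z, t) \<Rightarrow> F (cline z v (circlepath 0 \<epsilon> s)) t / circlepath 0 \<epsilon> s)"
      by (simp add: case_prod_unfold)
  qed
  then have "continuous_on (ball z0 \<delta> \<times> Tm) (\<lambda>(z, t). D z t)"
    by (rule continuous_on_eq) (use \<delta> in \<open>auto simp: line_derivative_eq_circle_average[OF \<delta>(2)]\<close>)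
  then have "continuous (at (z0, t0) within ball z0 \<delta> \<times> Tm) (\<lambda>(z, t). D z t)"
    using \<delta>(1) t0 by (simp add: continuous_on_eq_continuous_within)
  moreover have "at (z0, t0) within ball z0 \<delta> \<times> Tm = at (z0, t0) within S \<times> Tm"
    by (rule at_within_nhd[of _ "ball z0 \<delta> \<times> UNIV"]) (use \<delta> in \<open>auto intro!: open_Times\<close>)
  ultimately show "continuous (at (z0, t0) within S \<times> Tm) (\<lambda>(z, t). D z t)" by simp
qed

end

text \<open>Differentiation under the integral needs a derivative that is jointly continuous in z
  and t; \<open>line_derivative_continuous\<close> obtains this from the continuity of
  \<open>K\<close>.\<close>

lemma cdiff_integral:
  assumes "open S" and cd: "\<And>t. t \<in> {0..1} \<Longrightarrow> cdiff J S (\<lambda>z. K z t)"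
    and cont: "continuous_on (S \<times> {0..1::real}) (\<lambda>(z, t). K z t)"
  shows "cdiff J S (\<lambda>z. integral {0..1} (K z))"
  unfolding cdiff_def
proof (intro conjI ballI assms(1))
  fix z0 assume z0: "z0 \<in> S"
  define DK where "DK z t = Blinfun (frechet_derivative (\<lambda>z. K z t) (at z))" for z t
  have DK: "blinfun_apply (DK z t) = frechet_derivative (\<lambda>z. K z t) (at z)" if "z \<in> S" "t \<in> {0..1}" for z t
    unfolding DK_def using cdiffD(1)[OF cd[OF that(2)] that(1)]
    by (intro bounded_linear_Blinfun_apply) (rule has_derivative_bounded_linear)
  obtain r where r: "r > 0" "ball z0 r \<subseteq> S" using z0 assms(1) open_contains_ball by blast
  have contDK: "continuous_on (S \<times> {0..1}) (\<lambda>(z, t). DK z t)"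
  proof (rule continuous_on_blinfun_componentwise)
    fix v :: 'c
    have "continuous_on (S \<times> {0..1}) (\<lambda>(z, t). frechet_derivative (\<lambda>z. K z t) (at z) v)"
      by (rule line_derivative_continuous[where v = v, OF assms(1) cont])
         (use cdiff_cline[OF cd, where v = v and \<zeta> = 0] in simp)
    then show "continuous_on (S \<times> {0..1}) (\<lambda>p. blinfun_apply (case p of (z, t) \<Rightarrow> DK z t) v)"
      by (rule continuous_on_eq) (auto simp: DK)
  qed
  have "((\<lambda>z. integral (cbox 0 1) (K z)) has_derivative integral (cbox 0 1) (DK z0)) (at z0 within ball z0 r)"
  proof (rule leibniz_rule)
    fix z and t :: real assume z: "z \<in> ball z0 r" and t: "t \<in> cbox 0 1"
    then have "z \<in> S" "t \<in> {0..1}" using r(2) by auto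
    then show "((\<lambda>z. K z t) has_derivative blinfun_apply (DK z t)) (at z within ball z0 r)"
      using cdiffD(1)[OF cd] by (simp add: DK has_derivative_at_withinI)
  next
    fix z assume "z \<in> ball z0 r"
    then have "continuous_on {0..1} (\<lambda>t. (\<lambda>(z, t). K z t) (z, t))"
      using r by (intro continuous_on_compose2[OF cont] continuous_intros) auto
    then show "K z integrable_on cbox 0 1" by (simp add: integrable_continuous_interval)
  next
    show "continuous_on (ball z0 r \<times> cbox 0 1) (\<lambda>(z, t). DK z t)"
      using r by (intro continuous_on_subset[OF contDK]) auto
  qed (use r in auto)
  then have "((\<lambda>z. integral {0..1} (K z)) has_derivative integral {0..1} (DK z0)) (at z0)"
    using r by (simp add: at_within_open[of z0 "ball z0 r"])
  moreover have int: "DK z0 integrable_on {0..1}"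
  proof -
    have "continuous_on {0..1} (\<lambda>t. (\<lambda>(z, t). DK z t) (z0, t))"
      using z0 by (intro continuous_on_compose2[OF contDK] continuous_intros) auto
    then show ?thesis by (simp add: integrable_continuous_interval)
  qed
  have app: "blinfun_apply (integral {0..1} (DK z0)) v = integral {0..1} (\<lambda>t. DK z0 t v)" for v
    using integral_linear[OF int, of "\<lambda>L. blinfun_apply L v"] 
    by (simp add: o_def blinfun.bounded_linear_left)
  have "integral {0..1} (DK z0) (J v) = \<i> * integral {0..1} (DK z0) v" for v
  proof -
    have "integral {0..1} (\<lambda>t. DK z0 t (J v)) = integral {0..1} (\<lambda>t. \<i> * DK z0 t v)"
      using z0 by (intro integral_cong) (simp add: DK cdiffD(2)[OF cd])
    then show ?thesis unfolding app by simp
  qed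
  ultimately show "\<exists>F'. ((\<lambda>z. integral {0..1} (K z)) has_derivative F') (at z0) \<and> (\<forall>v. F' (J v) = \<i> * F' v)"
    by blast
qed

lemma cdiff_shift:
  assumes "cdiff J S F"
  shows "cdiff J ((\<lambda>z. cline z v \<zeta>) -` S) (\<lambda>z. F (cline z v \<zeta>))"
  using cdiff_linear_compose[OF assms, of "\<lambda>z. z" J "Re \<zeta> *\<^sub>R v + Im \<zeta> *\<^sub>R J v"]
  by (simp add: cline_def add.assoc bounded_linear_ident)

text \<open>Locally the derivative is an average of translates of \<open>F\<close> over a circle,
  and such an average is holomorphic by \<open>cdiff_integral\<close>. Iteration gives all higher
  regularity.\<close>

lemma cdiff_frechet_derivative:
  assumes F: "cdiff J S F"
  shows "cdiff J S (\<lambda>z. frechet_derivative F (at z) v)"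
proof (rule cdiff_local)
  note S = cdiff_open[OF F]
  fix z0 assume z0: "z0 \<in> S"
  obtain \<delta> \<epsilon> where \<delta>: "\<delta> > 0" "\<epsilon> > 0" "ball z0 \<delta> \<subseteq> S"
    "\<And>z \<zeta>. z \<in> ball z0 \<delta> \<Longrightarrow> norm \<zeta> \<le> \<epsilon> \<Longrightarrow> cline z v \<zeta> \<in> S"
    using cline_in_open[OF S z0] by metis
  have "cdiff J (ball z0 \<delta>) (\<lambda>z. integral {0..1} (\<lambda>s. F (cline z v (circlepath 0 \<epsilon> s)) / circlepath 0 \<epsilon> s))"
  proof (rule cdiff_integral)
    fix t :: real
    show "cdiff J (ball z0 \<delta>) (\<lambda>z. F (cline z v (circlepath 0 \<epsilon> t)) / circlepath 0 \<epsilon> t)"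
      using \<delta> by (intro cdiff_divide cdiff_subset[OF cdiff_shift[OF F]] cdiff_const) 
        (auto simp: circlepath_0_nonzero norm_circlepath_0)
  next
    have "continuous_on (ball z0 \<delta> \<times> {0..1}) 
        (\<lambda>p. F (cline (fst p) v (circlepath 0 \<epsilon> (snd p))) / circlepath 0 \<epsilon> (snd p))"
      using \<delta>(2) 
      by (intro continuous_on_divide continuous_on_compose2[OF cdiff_continuous_on[OF F]] continuous_intros
            continuous_on_compose2[OF continuous_on_circlepath[of UNIV]])
         (auto simp: circlepath_0_nonzero norm_circlepath_0 intro!: \<delta>(4))
    then show "continuous_on (ball z0 \<delta> \<times> {0..1}) 
        (\<lambda>(z, s). F (cline z v (circlepath 0 \<epsilon> s)) / circlepath 0 \<epsilon> s)"
      by (simp add: case_prod_unfold)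
  qed auto
  then have "cdiff J (ball z0 \<delta>) (\<lambda>z. frechet_derivative F (at z) v)"
  proof (rule cdiff_cong)
    fix z assume z: "z \<in> ball z0 \<delta>"
    show "integral {0..1} (\<lambda>s. F (cline z v (circlepath 0 \<epsilon> s)) / circlepath 0 \<epsilon> s) = frechet_derivative F (at z) v"
      by (rule line_derivative_eq_circle_average[where t = 0 and Tm = UNIV and S = S and
            F = "\<lambda>z t. F z" and D = "\<lambda>z t. frechet_derivative F (at z) v", symmetric])
         (use S \<delta> z cdiff_cline[OF F, where v = v and \<zeta> = 0] in 
           \<open>auto simp: case_prod_unfold intro!: continuous_on_compose2[OF cdiff_continuous_on[OF F]] continuous_on_fst continuous_on_id\<close>)
  qed
  with \<delta> show "\<exists>U. z0 \<in> U \<and> U \<subseteq> S \<and> cdiff J U (\<lambda>z. frechet_derivative F (at z) v)"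
    by (intro exI[of _ "ball z0 \<delta>"]) auto
qed

lemma cdiff_imp_smooth_on:
  assumes "cdiff J S F"
  shows "smooth_on S F"
proof -
  have "C_k_on k S F" for k
    using assms
  proof (induction k arbitrary: F)
    case 0
    then show ?case by (simp add: cdiff_continuous_on)
  next
    case (Suc k)
    show ?case
      by (rule C_k_on_SucI[OF cdiff_open[OF Suc.prems] cdiffD(1)[OF Suc.prems]])
         (auto intro: Suc.IH cdiff_frechet_derivative[OF Suc.prems])
  qed
  then show ?thesis using cdiff_open[OF assms] by (simp add: smooth_on_def)
qed

text \<open>Weierstrass' theorem. The one-variable version on each complex line yields the limits of
  the derivatives. These are linear and compatible with J as limits, and continuous by the circle
  average, so they form a Frechet derivative.\<close>

lemma cdiff_uniform_limit:
  assumes S: "open S" and cd: "\<forall>\<^sub>F n in net. cdiff J S (f n)" and lim: "uniform_limit S f F net"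
    and net: "net \<noteq> bot"
  shows "cdiff J S F"
proof -
  have "\<exists>d. ((\<lambda>\<zeta>. F (cline z v \<zeta>)) has_field_derivative d) (at 0) \<and>
          ((\<lambda>n. frechet_derivative (f n) (at z) v) \<longlongrightarrow> d) net" if z: "z \<in> S" for z v
  proof -
    obtain \<delta> \<epsilon> where \<delta>: "\<delta> > 0" "\<epsilon> > 0" "ball z \<delta> \<subseteq> S"
      "\<And>z' \<zeta>. z' \<in> ball z \<delta> \<Longrightarrow> norm \<zeta> \<le> \<epsilon> \<Longrightarrow> cline z' v \<zeta> \<in> S"
      using cline_in_open[OF S z] by metis
    then have in_S: "cline z v \<zeta> \<in> S" if "norm \<zeta> \<le> \<epsilon>" for \<zeta> using that by auto
    have ul: "uniform_limit (cball 0 \<epsilon>) (\<lambda>n \<zeta>. f n (cline z v \<zeta>)) (\<lambda>\<zeta>. F (cline z v \<zeta>)) net"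
      using lim in_S unfolding uniform_limit_iff by (auto elim!: eventually_mono)
    have ev: "\<forall>\<^sub>F n in net. continuous_on (cball 0 \<epsilon>) (\<lambda>\<zeta>. f n (cline z v \<zeta>)) \<and>
        (\<forall>w\<in>ball 0 \<epsilon>. ((\<lambda>\<zeta>. f n (cline z v \<zeta>)) has_field_derivative frechet_derivative (f n) (at (cline z v w)) v) (at w))"
      using cd
    proof eventually_elim
      case (elim n)
      show ?case
        using in_S by (auto intro!: cdiff_cline[OF elim] continuous_on_compose2[OF cdiff_continuous_on[OF elim]] continuous_intros)
    qed
    from has_complex_derivative_uniform_limit[OF ev ul net \<delta>(2)]
    obtain g' where "\<And>w. w \<in> ball 0 \<epsilon> \<Longrightarrow> ((\<lambda>\<zeta>. F (cline z v \<zeta>)) has_field_derivative g' w) (at w) \<and>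
         ((\<lambda>n. frechet_derivative (f n) (at (cline z v w)) v) \<longlongrightarrow> g' w) net"
      by blast
    from this[of 0] \<delta>(2) show ?thesis by auto
  qed
  then obtain D where D: "\<And>z v. z \<in> S \<Longrightarrow> ((\<lambda>\<zeta>. F (cline z v \<zeta>)) has_field_derivative D z v) (at 0)"
    "\<And>z v. z \<in> S \<Longrightarrow> ((\<lambda>n. frechet_derivative (f n) (at z) v) \<longlongrightarrow> D z v) net"
    by metis
  have contF: "continuous_on S F"
    by (rule uniform_limit_theorem[OF _ lim net]) (use cd in \<open>auto elim!: eventually_mono simp: cdiff_continuous_on\<close>)
  have linD: "linear (D z)" and JD: "D z (J v) = \<i> * D z v" if z: "z \<in> S" for z v
  proof -
    have ev: "\<forall>\<^sub>F n in net. linear (frechet_derivative (f n) (at z)) \<and> 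
        (\<forall>v. frechet_derivative (f n) (at z) (J v) = \<i> * frechet_derivative (f n) (at z) v)"
      using cd by eventually_elim (use z cdiffD has_derivative_linear in blast)
    show "linear (D z)"
    proof (rule linearI)
      fix u w and r :: real
      have "((\<lambda>n. frechet_derivative (f n) (at z) (u + w)) \<longlongrightarrow> D z u + D z w) net"
        by (rule Lim_transform_eventually[OF tendsto_add[OF D(2)[OF z, of u] D(2)[OF z, of w]]])
           (use ev in \<open>auto elim!: eventually_mono simp: linear_add\<close>)
      then show "D z (u + w) = D z u + D z w" using D(2)[OF z, of "u + w"] tendsto_unique[OF net] by blast
      have "((\<lambda>n. frechet_derivative (f n) (at z) (r *\<^sub>R u)) \<longlongrightarrow> r *\<^sub>R D z u) net"
        by (rule Lim_transform_eventually[OF tendsto_scaleR[OF tendsto_const D(2)[OF z, of u]]])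
           (use ev in \<open>auto elim!: eventually_mono simp: linear_scale\<close>)
      then show "D z (r *\<^sub>R u) = r *\<^sub>R D z u" using D(2)[OF z, of "r *\<^sub>R u"] tendsto_unique[OF net] by blast
    qed
    have "((\<lambda>n. frechet_derivative (f n) (at z) (J v)) \<longlongrightarrow> \<i> * D z v) net"
      by (rule Lim_transform_eventually[OF tendsto_mult[OF tendsto_const D(2)[OF z, of v]]])
         (use ev in \<open>auto elim!: eventually_mono\<close>)
    then show "D z (J v) = \<i> * D z v" using D(2)[OF z, of "J v"] tendsto_unique[OF net] by blast
  qed
  show ?thesis
  proof (rule cdiffI[OF S])
    show "(F has_derivative D z) (at z)" if z: "z \<in> S" for z
    proof (rule continuous_directional_derivatives_imp_has_derivative[OF S _ _ linD z])
      fix y v assume y: "y \<in> S"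
      have "((\<lambda>\<zeta>. F (cline y v \<zeta>)) \<circ> of_real has_vector_derivative D y v) (at (0::real))"
      proof -
        have "(complex_of_real has_vector_derivative 1) (at 0)"
          using bounded_linear_imp_has_derivative[OF bounded_linear_of_real]
          by (simp add: has_vector_derivative_def scaleR_conv_of_real)
        from field_vector_diff_chain_at[OF this, of "\<lambda>\<zeta>. F (cline y v \<zeta>)" "D y v"] D(1)[OF y, of v]
        show ?thesis by simp
      qed
      then show "((\<lambda>r. F (y + r *\<^sub>R v)) has_vector_derivative D y v) (at 0)"
        by (simp add: o_def cline_of_real)
    next
      fix v
      have "continuous_on (S \<times> UNIV) (\<lambda>(z, t::real). D z v)"
        by (rule line_derivative_continuous[where F = "\<lambda>z t. F z", OF S])
           (use D(1) contF in \<open>auto simp: case_prod_unfold intro!: continuous_on_compose2[OF contF] continuous_intros\<close>)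
      then have "continuous_on S (\<lambda>z. (\<lambda>(z, t::real). D z v) (z, 0))"
        by (rule continuous_on_compose2) (auto intro!: continuous_intros)
      then show "continuous_on S (\<lambda>z. D z v)" by simp
    qed
  qed (use JD in auto)
qed

text \<open>A complex line joins the point to some point of \<open>U\<close>. Its part in the ball
  is convex, hence connected, and the one-variable identity theorem applies there.\<close>

lemma cdiff_eq_0_on_ball:
  assumes F: "cdiff J (ball c r) F" and U: "open U" "U \<subseteq> ball c r" "U \<noteq> {}"
    and 0: "\<And>z. z \<in> U \<Longrightarrow> F z = 0" and z: "z \<in> ball c r"
  shows "F z = 0"
proof -
  obtain y where y: "y \<in> U" using U(3) by blast
  define v where "v = z - y"
  let ?T = "cline y v -` ball c r"
  have T: "open ?T" by (rule open_cline_vimage[OF open_ball])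
  have "convex ?T"
  proof (rule convexI)
    fix a b and s t :: real assume *: "a \<in> ?T" "b \<in> ?T" "0 \<le> s" "0 \<le> t" "s + t = 1"
    have "cline y v (s *\<^sub>R a + t *\<^sub>R b) = s *\<^sub>R cline y v a + t *\<^sub>R cline y v b"
    proof -
      have "y = (s + t) *\<^sub>R y" using * by simp
      then show ?thesis by (simp add: cline_def algebra_simps)
    qed
    also have "\<dots> \<in> ball c r" using * convex_ball[of c r] unfolding convex_def by auto
    finally show "s *\<^sub>R a + t *\<^sub>R b \<in> ?T" by simp
  qed
  have "F (cline y v 1) = 0"
  proof (rule analytic_continuation[where w = 1 and f = "\<lambda>\<zeta>. F (cline y v \<zeta>)" and S = ?T and U = "cline y v -` U" and \<xi> = 0])
    show "(\<lambda>\<zeta>. F (cline y v \<zeta>)) holomorphic_on ?T"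
      unfolding holomorphic_on_open[OF T] by (auto intro!: exI cdiff_cline[OF F])
    show "connected ?T" by (rule convex_connected) fact
    show "0 islimpt cline y v -` U"
      using open_cline_vimage[OF U(1), of y v] y by (intro interior_limit_point) (simp add: interior_open)
  qed (use T U y z 0 in \<open>auto simp: v_def\<close>)
  then show ?thesis by (simp add: v_def)
qed

end

subsection \<open>Holomorphic extensions of real-analytic functions\<close>

text \<open>Multiplication by i on the complexification, a pair (x, y) standing for x + iy.\<close>

definition cJ :: "'e::euclidean_space \<times> 'e \<Rightarrow> 'e \<times> 'e" where
  "cJ p = (- snd p, fst p)"

global_interpretation cplx: complex_structure cJ
  by unfold_locales (auto simp: cJ_def linear_iff prod_eq_iff)

definition zc :: "'e::euclidean_space \<Rightarrow> 'e \<times> 'e \<Rightarrow> complex" where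
  "zc b p = complex_of_real (fst p \<bullet> b) + \<i> * complex_of_real (snd p \<bullet> b)"

lemma has_derivative_zc: "(zc b has_derivative zc b) (at p)"
  unfolding zc_def by (auto intro!: derivative_eq_intros)

lemma cdiff_zc: "open S \<Longrightarrow> cdiff cJ S (zc b)"
  by (rule cdiffI[OF _ has_derivative_zc]) (auto simp: zc_def cJ_def algebra_simps)

lemma norm_zc_le:
  assumes "b \<in> Basis" shows "norm (zc b p) \<le> norm p"
proof -
  have "norm (zc b p) = sqrt ((fst p \<bullet> b)\<^sup>2 + (snd p \<bullet> b)\<^sup>2)"
    by (simp add: zc_def cmod_def)
  also have "\<dots> \<le> sqrt ((norm (fst p))\<^sup>2 + (norm (snd p))\<^sup>2)"
    using Basis_le_norm[OF assms] by (intro real_sqrt_le_mono add_mono power2_le_iff_abs_le[THEN iffD2]) auto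
  also have "\<dots> = norm p" by (simp add: norm_prod_def)
  finally show ?thesis .
qed

text \<open>The point of the complexification with coordinates \<open>z b\<close> for b in
  \<open>S\<close> and 0 for all other basis vectors; \<open>S\<close> grows by one coordinate at a
  time in the induction for power series.\<close>

definition polypoint :: "'e::euclidean_space set \<Rightarrow> ('e \<Rightarrow> complex) \<Rightarrow> 'e \<times> 'e" where
  "polypoint S z = (\<Sum>b\<in>S. Re (z b) *\<^sub>R b, \<Sum>b\<in>S. Im (z b) *\<^sub>R b)"

lemma cline_polypoint:
  assumes "finite S" "c \<notin> S"
  shows "cplx.cline (polypoint S z) (c, 0) \<zeta> = polypoint (insert c S) (z(c := \<zeta>))"
proof -
  have "(\<Sum>b\<in>S. Re ((z(c := \<zeta>)) b) *\<^sub>R b) = (\<Sum>b\<in>S. Re (z b) *\<^sub>R b)"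
    "(\<Sum>b\<in>S. Im ((z(c := \<zeta>)) b) *\<^sub>R b) = (\<Sum>b\<in>S. Im (z b) *\<^sub>R b)"
    using assms by (auto intro!: sum.cong)
  with assms show ?thesis
    by (simp add: polypoint_def cplx.cline_def cJ_def add.commute)
qed

lemma norm_polypoint_le:
  assumes "S \<subseteq> Basis" "\<And>b. b \<in> S \<Longrightarrow> norm (z b) \<le> R"
  shows "norm (polypoint S z :: 'e::euclidean_space \<times> 'e) \<le> 2 * real (card S) * R"
proof -
  have fin: "finite S" using assms(1) finite_Basis finite_subset by blast
  have 1: "norm (\<Sum>b\<in>S. Re (z b) *\<^sub>R b) \<le> real (card S) * R"
    by (rule order_trans[OF sum_norm_le[of S _ "\<lambda>_. R"]])
       (use assms order_trans[OF abs_Re_le_cmod] in \<open>auto simp: subset_eq\<close>)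
  have 2: "norm (\<Sum>b\<in>S. Im (z b) *\<^sub>R b) \<le> real (card S) * R"
    by (rule order_trans[OF sum_norm_le[of S _ "\<lambda>_. R"]])
       (use assms order_trans[OF abs_Im_le_cmod] in \<open>auto simp: subset_eq\<close>)
  show ?thesis
    unfolding polypoint_def using 1 2 norm_Pair_le[of "\<Sum>b\<in>S. Re (z b) *\<^sub>R b" "\<Sum>b\<in>S. Im (z b) *\<^sub>R b"] by simp
qed

text \<open>Taylor coefficients along a line, read as functions of the base point, are again
  holomorphic; this allows an expansion in one coordinate at a time.\<close>

lemma (in complex_structure) iterated_line_derivative:
  assumes F: "cdiff J U F"
  shows "cdiff J U (((\<lambda>G p. frechet_derivative G (at p) v) ^^ k) F)"
    and "cline p v \<zeta> \<in> U \<Longrightarrow> (deriv ^^ k) (\<lambda>\<zeta>. F (cline p v \<zeta>)) \<zeta> =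
           ((\<lambda>G p. frechet_derivative G (at p) v) ^^ k) F (cline p v \<zeta>)"
proof -
  define DF where "DF k = ((\<lambda>G p. frechet_derivative G (at p) v) ^^ k) F" for k
  have cd: "cdiff J U (DF k)" for k
    unfolding DF_def by (induction k) (auto intro: assms cdiff_frechet_derivative)
  then show "cdiff J U (((\<lambda>G p. frechet_derivative G (at p) v) ^^ k) F)" by (simp add: DF_def)
  have "(deriv ^^ k) (\<lambda>\<zeta>. F (cline p v \<zeta>)) \<zeta> = DF k (cline p v \<zeta>)" if "cline p v \<zeta> \<in> U" for \<zeta>
    using that
  proof (induction k arbitrary: \<zeta>)
    case 0
    then show ?case by (simp add: DF_def)
  next
    case (Suc k)
    have "eventually (\<lambda>w. w \<in> cline p v -` U) (nhds \<zeta>)"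
      using Suc.prems cdiff_open[OF F] by (intro eventually_nhds_in_open open_cline_vimage) auto
    then have "deriv ((deriv ^^ k) (\<lambda>\<zeta>. F (cline p v \<zeta>))) \<zeta> = deriv (\<lambda>\<zeta>. DF k (cline p v \<zeta>)) \<zeta>"
      by (intro deriv_cong_ev) (auto elim!: eventually_mono simp: Suc.IH)
    also have "\<dots> = DF (Suc k) (cline p v \<zeta>)"
      using DERIV_imp_deriv[OF cdiff_cline[OF cd Suc.prems]] by (simp add: DF_def)
    finally show ?case by simp
  qed
  then show "cline p v \<zeta> \<in> U \<Longrightarrow> (deriv ^^ k) (\<lambda>\<zeta>. F (cline p v \<zeta>)) \<zeta> =
           ((\<lambda>G p. frechet_derivative G (at p) v) ^^ k) F (cline p v \<zeta>)" by (simp add: DF_def)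
qed

lemma geometric_has_sum:
  fixes x :: real assumes "0 \<le> x" "x < 1"
  shows "((\<lambda>k. c * x ^ k) has_sum c * (1 / (1 - x))) UNIV"
proof -
  have "(\<lambda>k. x ^ k) sums (1 / (1 - x))" using assms by (intro geometric_sums) auto
  then have "((\<lambda>k. x ^ k) has_sum (1 / (1 - x))) UNIV"
    using assms by (intro norm_summable_imp_has_sum) (auto simp: summable_geometric)
  then show ?thesis by (rule has_sum_cmult_right)
qed

text \<open>Induction on the number of coordinates. The Taylor coefficients in the new coordinate
  \<open>c\<close> are holomorphic in the others and bounded by M / R^k by Cauchy's inequality. The
  bound on the sum of absolute values belongs to the statement because it makes the resulting double
  series absolutely summable.\<close>

lemma polydisc_power_series:
  fixes F :: "'e::euclidean_space \<times> 'e \<Rightarrow> complex"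
  assumes "finite S" "S \<subseteq> Basis" and \<rho>: "0 < \<rho>" "\<rho> < R"
    and "cdiff cJ U F" and "\<And>z. \<forall>b\<in>S. norm (z b) \<le> R \<Longrightarrow> polypoint S z \<in> U"
    and "\<And>z. \<forall>b\<in>S. norm (z b) \<le> R \<Longrightarrow> norm (F (polypoint S z)) \<le> M"
  shows "\<exists>a :: ('e \<Rightarrow> nat) \<Rightarrow> complex.
    (\<lambda>\<alpha>. norm (a \<alpha>) * (\<Prod>b\<in>S. \<rho> ^ \<alpha> b)) summable_on (S \<rightarrow>\<^sub>E UNIV) \<and>
    (\<Sum>\<^sub>\<infinity>\<alpha>\<in>S \<rightarrow>\<^sub>E UNIV. norm (a \<alpha>) * (\<Prod>b\<in>S. \<rho> ^ \<alpha> b)) \<le> M * (1 / (1 - \<rho> / R)) ^ card S \<and>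
    (\<forall>z. (\<forall>b\<in>S. norm (z b) \<le> \<rho>) \<longrightarrow>
       ((\<lambda>\<alpha>. a \<alpha> * (\<Prod>b\<in>S. z b ^ \<alpha> b)) has_sum F (polypoint S z)) (S \<rightarrow>\<^sub>E UNIV))"
  using assms(1,2,5-7)
proof (induction S arbitrary: F M rule: finite_induct)
  case empty
  have "((\<lambda>\<alpha>::'e \<Rightarrow> nat. F (0, 0)) has_sum (\<Sum>\<alpha>\<in>{\<lambda>x. undefined::nat}. F (0, 0))) {\<lambda>x. undefined}"
    using has_sum_finite[of "{\<lambda>x::'e. undefined::nat}" "\<lambda>_. F (0, 0)"] by simp
  then show ?case
    using empty.prems(4)[of "\<lambda>_. 0"]
    by (intro exI[of _ "\<lambda>_. F (0, 0)"]) (auto simp: polypoint_def)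
next
  case (insert c S)
  \<comment> \<open>\<open>Fk k\<close> is the k-th Taylor coefficient in direction
    \<open>c\<close>, as a function of the remaining coordinates.\<close>
  define Fk where "Fk k p = ((\<lambda>G p. frechet_derivative G (at p) (c, 0)) ^^ k) F p / fact k" for k p
  note cdF = insert.prems(2)
  have cdFk: "cdiff cJ U (Fk k)" for k
    unfolding Fk_def divide_inverse
    using cplx.iterated_line_derivative(1)[OF cdF, where v = "(c, 0)" and k = k] cdiff_open[OF cdF]
    by (intro cdiff_mult cdiff_const) auto
  have line: "cplx.cline (polypoint S z) (c, 0) \<zeta> \<in> U" "norm (F (cplx.cline (polypoint S z) (c, 0) \<zeta>)) \<le> M"
    if "\<forall>b\<in>S. norm (z b) \<le> R" "norm \<zeta> \<le> R" for z \<zeta>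
  proof -
    have "\<forall>b\<in>insert c S. norm ((z(c := \<zeta>)) b) \<le> R"
      using that by auto
    from insert.prems(3,4)[where z = "z(c := \<zeta>)", OF this]
    show "cplx.cline (polypoint S z) (c, 0) \<zeta> \<in> U" "norm (F (cplx.cline (polypoint S z) (c, 0) \<zeta>)) \<le> M"
      unfolding cline_polypoint[OF insert.hyps] .
  qed
  have hol: "(\<lambda>\<zeta>. F (cplx.cline (polypoint S z) (c, 0) \<zeta>)) holomorphic_on ball 0 R"
    and contl: "continuous_on (cball 0 R) (\<lambda>\<zeta>. F (cplx.cline (polypoint S z) (c, 0) \<zeta>))"
    and Fk_eq: "Fk k (polypoint S z) = (deriv ^^ k) (\<lambda>\<zeta>. F (cplx.cline (polypoint S z) (c, 0) \<zeta>)) 0 / fact k"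
    if "\<forall>b\<in>S. norm (z b) \<le> R" for z k
  proof -
    have d: "((\<lambda>\<zeta>. F (cplx.cline (polypoint S z) (c, 0) \<zeta>)) has_field_derivative
        frechet_derivative F (at (cplx.cline (polypoint S z) (c, 0) \<zeta>)) (c, 0)) (at \<zeta>)" if "norm \<zeta> \<le> R" for \<zeta>
      using cplx.cdiff_cline[OF cdF line(1)[OF \<open>\<forall>b\<in>S. norm (z b) \<le> R\<close> that]] .
    show "(\<lambda>\<zeta>. F (cplx.cline (polypoint S z) (c, 0) \<zeta>)) holomorphic_on ball 0 R"
      unfolding holomorphic_on_open[OF open_ball] by (auto intro!: exI d)
    show "continuous_on (cball 0 R) (\<lambda>\<zeta>. F (cplx.cline (polypoint S z) (c, 0) \<zeta>))"
      by (intro continuous_at_imp_continuous_on ballI DERIV_isCont[OF d]) auto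
    show "Fk k (polypoint S z) = (deriv ^^ k) (\<lambda>\<zeta>. F (cplx.cline (polypoint S z) (c, 0) \<zeta>)) 0 / fact k"
      using cplx.iterated_line_derivative(2)[OF cdF line(1)[where z = z and \<zeta> = 0], where k = k] that \<rho> by (simp add: Fk_def)
  qed
  define Q where "Q k a \<longleftrightarrow>
      (\<lambda>\<alpha>. norm (a \<alpha>) * (\<Prod>b\<in>S. \<rho> ^ \<alpha> b)) summable_on (S \<rightarrow>\<^sub>E UNIV) \<and>
      (\<Sum>\<^sub>\<infinity>\<alpha>\<in>S \<rightarrow>\<^sub>E UNIV. norm (a \<alpha>) * (\<Prod>b\<in>S. \<rho> ^ \<alpha> b)) \<le> (M / R ^ k) * (1 / (1 - \<rho> / R)) ^ card S \<and>
      (\<forall>z. (\<forall>b\<in>S. norm (z b) \<le> \<rho>) \<longrightarrow>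
         ((\<lambda>\<alpha>. a \<alpha> * (\<Prod>b\<in>S. z b ^ \<alpha> b)) has_sum Fk k (polypoint S z)) (S \<rightarrow>\<^sub>E UNIV))" for k and a :: "('e \<Rightarrow> nat) \<Rightarrow> complex"
  have "\<exists>a. Q k a" for k
    unfolding Q_def
  proof (rule insert.IH)
    show "polypoint S z \<in> U" if "\<forall>b\<in>S. norm (z b) \<le> R" for z
      using line(1)[where z = z and \<zeta> = 0] that \<rho> by simp
    show "norm (Fk k (polypoint S z)) \<le> M / R ^ k" if z: "\<forall>b\<in>S. norm (z b) \<le> R" for z
    proof -
      have "norm ((deriv ^^ k) (\<lambda>\<zeta>. F (cplx.cline (polypoint S z) (c, 0) \<zeta>)) 0) \<le> fact k * M / R ^ k"
        using \<rho> by (intro Cauchy_inequality hol[OF z] contl[OF z] line(2)[OF z]) auto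
      then show ?thesis unfolding Fk_eq[OF z] by (simp add: norm_divide norm_fact field_simps)
    qed
  qed (use insert.prems cdFk in auto)
  then obtain a where "\<And>k. Q k (a k)" by metis
  then have a1: "\<And>k. (\<lambda>\<alpha>. norm (a k \<alpha>) * (\<Prod>b\<in>S. \<rho> ^ \<alpha> b)) summable_on (S \<rightarrow>\<^sub>E UNIV)" and
    a2: "\<And>k. (\<Sum>\<^sub>\<infinity>\<alpha>\<in>S \<rightarrow>\<^sub>E UNIV. norm (a k \<alpha>) * (\<Prod>b\<in>S. \<rho> ^ \<alpha> b)) \<le> (M / R ^ k) * (1 / (1 - \<rho> / R)) ^ card S" and
    a3: "\<And>k z. \<forall>b\<in>S. norm (z b) \<le> \<rho> \<Longrightarrow>
         ((\<lambda>\<alpha>. a k \<alpha> * (\<Prod>b\<in>S. z b ^ \<alpha> b)) has_sum Fk k (polypoint S z)) (S \<rightarrow>\<^sub>E UNIV)"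
    unfolding Q_def by blast+
  \<comment> \<open>A multi-index on the enlarged set is an exponent of \<open>c\<close> together
    with a multi-index on \<open>S\<close>.\<close>
  define A where "A \<alpha> = a (\<alpha> c) (restrict \<alpha> S)" for \<alpha>
  let ?ins = "\<lambda>(k, \<beta>). \<beta>(c := k)"
  let ?P = "UNIV \<times> (S \<rightarrow>\<^sub>E (UNIV::nat set))"
  have img: "(insert c S \<rightarrow>\<^sub>E UNIV) = ?ins ` ?P"
    by (simp add: PiE_insert_eq)
  have inj: "inj_on ?ins ?P"
    using inj_combinator[of c S "\<lambda>_. UNIV"] insert.hyps by simp
  have A_ins: "A (\<beta>(c := k)) = a k \<beta>" if "\<beta> \<in> S \<rightarrow>\<^sub>E UNIV" for \<beta> k
  proof -
    have "restrict (\<beta>(c := k)) S = \<beta>" using that insert.hyps by (auto simp: fun_eq_iff restrict_def PiE_def extensional_def)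
    then show ?thesis by (simp add: A_def)
  qed
  have prod_ins: "(\<Prod>b\<in>insert c S. w b ^ (\<beta>(c := k)) b) = w c ^ k * (\<Prod>b\<in>S. w b ^ \<beta> b)" 
    for w :: "'e \<Rightarrow> 'x::comm_monoid_mult" and \<beta> k
  proof -
    have "(\<Prod>b\<in>S. w b ^ (\<beta>(c := k)) b) = (\<Prod>b\<in>S. w b ^ \<beta> b)"
      using insert.hyps by (intro prod.cong) auto
    then show ?thesis using insert.hyps by simp
  qed
  define g where "g = (\<lambda>(k, \<beta>). norm (a k \<beta>) * (\<rho> ^ k * (\<Prod>b\<in>S. \<rho> ^ \<beta> b)))"
  define B where "B k = (\<Sum>\<^sub>\<infinity>\<alpha>\<in>S \<rightarrow>\<^sub>E UNIV. norm (a k \<alpha>) * (\<Prod>b\<in>S. \<rho> ^ \<alpha> b))" for k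
  have g_slice: "((\<lambda>\<beta>. g (k, \<beta>)) has_sum \<rho> ^ k * B k) (S \<rightarrow>\<^sub>E UNIV)" for k
  proof -
    have "((\<lambda>\<beta>. \<rho> ^ k * (norm (a k \<beta>) * (\<Prod>b\<in>S. \<rho> ^ \<beta> b))) has_sum \<rho> ^ k * B k) (S \<rightarrow>\<^sub>E UNIV)"
      unfolding B_def by (intro has_sum_cmult_right has_sum_infsum a1)
    then show ?thesis by (simp add: g_def mult_ac)
  qed
  have B0: "0 \<le> B k" for k
    unfolding B_def using \<rho> by (intro infsum_nonneg) (auto intro!: mult_nonneg_nonneg prod_nonneg)
  \<comment> \<open>Each further power of \<open>c\<close> costs a factor \<rho> / R; the geometric
    series supplies the extra factor 1 / (1 - \<rho> / R) of the bound.\<close>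
  have geo: "((\<lambda>k. (M * (1 / (1 - \<rho> / R)) ^ card S) * (\<rho> / R) ^ k) has_sum 
      (M * (1 / (1 - \<rho> / R)) ^ card S) * (1 / (1 - \<rho> / R))) UNIV"
    using \<rho> by (intro geometric_has_sum) auto
  have B_le: "\<rho> ^ k * B k \<le> (M * (1 / (1 - \<rho> / R)) ^ card S) * (\<rho> / R) ^ k" for k
  proof -
    have "\<rho> ^ k * B k \<le> \<rho> ^ k * ((M / R ^ k) * (1 / (1 - \<rho> / R)) ^ card S)"
      using a2[of k] \<rho> by (intro mult_left_mono) (auto simp: B_def)
    then show ?thesis by (simp add: power_divide mult_ac)
  qed
  have Bsum: "(\<lambda>k. \<rho> ^ k * B k) summable_on UNIV"
    by (rule summable_on_comparison_test[OF has_sum_imp_summable[OF geo] B_le]) (use B0 \<rho> in auto)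
  have gsum: "g summable_on ?P"
    by (rule summable_on_SigmaI[OF g_slice Bsum]) (use \<rho> in \<open>auto simp: g_def intro!: mult_nonneg_nonneg prod_nonneg\<close>)
  have ginf: "(g has_sum (\<Sum>\<^sub>\<infinity>k. \<rho> ^ k * B k)) ?P"
    by (rule has_sum_SigmaI[OF g_slice has_sum_infsum[OF Bsum] gsum])
  have g_eq: "((\<lambda>\<alpha>. norm (A \<alpha>) * (\<Prod>b\<in>insert c S. \<rho> ^ \<alpha> b)) \<circ> ?ins) p = g p" if "p \<in> ?P" for p
    using that by (auto simp: g_def A_ins prod_ins[of "\<lambda>_. \<rho>"] simp del: fun_upd_apply prod_constant)
  have h1: "((\<lambda>\<alpha>. norm (A \<alpha>) * (\<Prod>b\<in>insert c S. \<rho> ^ \<alpha> b)) has_sum (\<Sum>\<^sub>\<infinity>k. \<rho> ^ k * B k)) (insert c S \<rightarrow>\<^sub>E UNIV)"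
    unfolding img has_sum_reindex[OF inj] by (subst has_sum_cong[OF g_eq]) (assumption, rule ginf)
  have h2: "(\<Sum>\<^sub>\<infinity>k. \<rho> ^ k * B k) \<le> M * (1 / (1 - \<rho> / R)) ^ card (insert c S)"
    using has_sum_mono[OF has_sum_infsum[OF Bsum] geo B_le] insert.hyps by (simp add: mult_ac)
  have h3: "((\<lambda>\<alpha>. A \<alpha> * (\<Prod>b\<in>insert c S. z b ^ \<alpha> b)) has_sum F (polypoint (insert c S) z)) (insert c S \<rightarrow>\<^sub>E UNIV)"
    if z: "\<forall>b\<in>insert c S. norm (z b) \<le> \<rho>" for z :: "'e \<Rightarrow> complex"
  proof -
    have zR: "\<forall>b\<in>S. norm (z b) \<le> R" using z \<rho> by force
    define f where "f = (\<lambda>(k, \<beta>). a k \<beta> * (z c ^ k * (\<Prod>b\<in>S. z b ^ \<beta> b)))"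
    have nf: "norm (f p) \<le> g p" for p
      unfolding f_def g_def using z \<rho>
      by (auto simp: norm_mult norm_power prod_norm[symmetric] case_prod_unfold
            intro!: mult_left_mono mult_mono power_mono prod_mono prod_nonneg simp del: prod_constant)
    have "(\<lambda>p. norm (f p)) summable_on ?P"
      by (rule summable_on_comparison_test[OF gsum nf]) auto
    then have fsum: "f summable_on ?P" by (rule abs_summable_summable)
    have f_slice: "((\<lambda>\<beta>. f (k, \<beta>)) has_sum Fk k (polypoint S z) * z c ^ k) (S \<rightarrow>\<^sub>E UNIV)" for k
      using has_sum_cmult_right[OF a3[of z k], of "z c ^ k"] z by (simp add: f_def mult_ac)
    obtain s where s: "(f has_sum s) ?P" using fsum by (auto simp: summable_on_def)
    \<comment> \<open>Summing over the other coordinates leaves the one-variable Taylor series in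
      \<open>c\<close>, which identifies the value of the double series.\<close>
    from has_sum_SigmaD[OF s f_slice] have "(\<lambda>k. Fk k (polypoint S z) * z c ^ k) sums s"
      by (rule has_sum_imp_sums)
    moreover have "(\<lambda>k. Fk k (polypoint S z) * z c ^ k) sums F (cplx.cline (polypoint S z) (c, 0) (z c))"
      using holomorphic_power_series[OF hol[OF zR], of "z c"] z \<rho> by (simp add: Fk_eq[OF zR])
    ultimately have "s = F (cplx.cline (polypoint S z) (c, 0) (z c))" by (rule sums_unique2)
    then have s_eq: "s = F (polypoint (insert c S) z)"
      using insert.hyps by (simp add: cline_polypoint)
    have f_eq: "((\<lambda>\<alpha>. A \<alpha> * (\<Prod>b\<in>insert c S. z b ^ \<alpha> b)) \<circ> ?ins) p = f p" if "p \<in> ?P" for p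
      using that by (auto simp: f_def A_ins prod_ins simp del: fun_upd_apply)
    have "((\<lambda>\<alpha>. A \<alpha> * (\<Prod>b\<in>insert c S. z b ^ \<alpha> b)) has_sum s) (insert c S \<rightarrow>\<^sub>E UNIV)"
      unfolding img has_sum_reindex[OF inj] by (subst has_sum_cong[OF f_eq]) (assumption, rule s)
    then show ?thesis unfolding s_eq .
  qed
  show ?case
  proof (intro exI[of _ A] conjI allI impI)
    show "(\<Sum>\<^sub>\<infinity>\<alpha>\<in>insert c S \<rightarrow>\<^sub>E UNIV. norm (A \<alpha>) * (\<Prod>b\<in>insert c S. \<rho> ^ \<alpha> b)) \<le> 
        M * (1 / (1 - \<rho> / R)) ^ card (insert c S)"
      unfolding infsumI[OF h1] by (rule h2)
  qed (use has_sum_imp_summable[OF h1] h3 in blast)+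
qed

text \<open>\<open>f\<close> extends near \<open>x\<close> to a holomorphic function on the complexification, which is encoded as
  \<open>'e \<times> 'e\<close>.\<close>

definition canal :: "('e::euclidean_space \<Rightarrow> complex) \<Rightarrow> 'e \<Rightarrow> bool" where
  "canal f x \<longleftrightarrow> (\<exists>r>0. \<exists>F. cdiff cJ (ball 0 r) F \<and> (\<forall>h. norm h < r \<longrightarrow> F (h, 0) = f (x + h)))"

lemma canalI:
  assumes "r > 0" "cdiff cJ (ball 0 r) F" "\<And>h. norm h < r \<Longrightarrow> F (h, 0) = f (x + h)"
  shows "canal f x"
  using assms unfolding canal_def by blast

lemma canalE:
  assumes "canal f x" "R > 0"
  obtains r F where "0 < r" "r \<le> R" "cdiff cJ (ball 0 r) F" "\<And>h. norm h < r \<Longrightarrow> F (h, 0) = f (x + h)"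
proof -
  obtain r F where F: "r > 0" "cdiff cJ (ball 0 r) F" "\<And>h. norm h < r \<Longrightarrow> F (h, 0) = f (x + h)"
    using assms(1) unfolding canal_def by blast
  show ?thesis
    by (rule that[of "min r R" F]) (use F assms(2) in \<open>auto intro: cdiff_subset[OF F(2)]\<close>)
qed

lemma canal_const: "canal (\<lambda>x. c) x"
  by (rule canalI[of 1 "\<lambda>_. c"]) (auto intro: cdiff_const)

lemma canal_combine:
  fixes f g :: "'e::euclidean_space \<Rightarrow> complex"
  assumes "canal f x" "canal g x"
    and "\<And>r F (G :: 'e \<times> 'e \<Rightarrow> complex). cdiff cJ (ball 0 r) F \<Longrightarrow> cdiff cJ (ball 0 r) G \<Longrightarrow> cdiff cJ (ball 0 r) (\<lambda>p. C (F p) (G p))"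
  shows "canal (\<lambda>x. C (f x) (g x)) x"
proof -
  obtain r F where F: "0 < r" "cdiff cJ (ball 0 r) F" "\<And>h. norm h < r \<Longrightarrow> F (h, 0) = f (x + h)"
    using assms(1) unfolding canal_def by blast
  obtain s G where G: "0 < s" "s \<le> r" "cdiff cJ (ball 0 s) G" "\<And>h. norm h < s \<Longrightarrow> G (h, 0) = g (x + h)"
    using canalE[OF assms(2), of r] F(1) by auto
    have "cdiff cJ (ball 0 s) (\<lambda>p. C (F p) (G p))"
      using G(2) by (intro assms(3) G(3) cdiff_subset[OF F(2)]) auto
    then show ?thesis using F G by (intro canalI[OF G(1)]) auto
qed

lemma canal_add: "canal f x \<Longrightarrow> canal g x \<Longrightarrow> canal (\<lambda>x. f x + g x) x"
  by (rule canal_combine[where C = "(+)"]) (auto intro: cdiff_add)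

lemma canal_mult: "canal f x \<Longrightarrow> canal g x \<Longrightarrow> canal (\<lambda>x. f x * g x) x"
  by (rule canal_combine[where C = "(*)"]) (auto intro: cdiff_mult)

lemma canal_sum: "(\<And>i. i \<in> I \<Longrightarrow> canal (f i) x) \<Longrightarrow> canal (\<lambda>x. \<Sum>i\<in>I. f i x) x"
  by (induction I rule: infinite_finite_induct) (auto intro: canal_add canal_const)

lemma canal_cong:
  assumes "canal f x" "open S" "x \<in> S" "\<And>y. y \<in> S \<Longrightarrow> f y = g y"
  shows "canal g x"
proof -
  obtain d where d: "d > 0" "ball x d \<subseteq> S" using assms(2,3) open_contains_ball by blast
  obtain r F where F: "0 < r" "r \<le> d" "cdiff cJ (ball 0 r) F" "\<And>h. norm h < r \<Longrightarrow> F (h, 0) = f (x + h)"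
    using canalE[OF assms(1) d(1)] by metis
  have "x + h \<in> S" if "norm h < r" for h
    using that F(2) d(2) by (auto simp: subset_eq dist_norm)
  then show ?thesis using F assms(4) by (intro canalI[OF F(1,3)]) auto
qed

text \<open>The extension is conjugated both outside and, through the conjugation of the
  complexification, inside: two conjugations preserve holomorphy, and the inner one fixes the real
  points \<open>(h, 0)\<close>.\<close>

lemma canal_cnj:
  assumes "canal f x" shows "canal (\<lambda>x. cnj (f x)) x"
proof -
  obtain r F where F: "0 < r" "cdiff cJ (ball 0 r) F" "\<And>h. norm h < r \<Longrightarrow> F (h, 0) = f (x + h)"
    using assms unfolding canal_def by blast
  let ?L = "\<lambda>p::'a \<times> 'a. (fst p, - snd p)"
  have L: "bounded_linear ?L" 
    by (intro bounded_linear_Pair bounded_linear_fst bounded_linear_minus bounded_linear_snd)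
  have nL: "norm (?L p) = norm p" for p by (simp add: norm_prod_def)
  have "cdiff cJ (ball 0 r) (\<lambda>p. cnj (F (?L p)))"
  proof (rule cdiffI)
    fix p :: "'a \<times> 'a" assume p: "p \<in> ball 0 r"
    then have Lp: "?L p \<in> ball 0 r" using nL[of p] by simp
    note dF = cdiffD[OF F(2) Lp]
    show "((\<lambda>p. cnj (F (?L p))) has_derivative (\<lambda>v. cnj (frechet_derivative F (at (?L p)) (?L v)))) (at p)"
      by (intro bounded_linear.has_derivative[OF bounded_linear_cnj] 
          has_derivative_compose[OF bounded_linear_imp_has_derivative[OF L] dF(1)])
    fix v :: "'a \<times> 'a"
    have "?L (cJ v) = - cJ (?L v)" by (simp add: cJ_def)
    then show "cnj (frechet_derivative F (at (?L p)) (?L (cJ v))) = \<i> * cnj (frechet_derivative F (at (?L p)) (?L v))"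
      using dF(2)[of "?L v"] linear_neg[OF has_derivative_linear[OF dF(1)], of "cJ (?L v)"] by simp
  qed auto
  then show ?thesis by (rule canalI[OF F(1)]) (simp add: F(3))
qed

lemma canal_Re: "canal f x \<Longrightarrow> canal (\<lambda>x. of_real (Re (f x))) x"
proof -
  assume f: "canal f x"
  have "(\<lambda>x. complex_of_real (Re (f x))) = (\<lambda>x. (1/2) * (f x + cnj (f x)))"
    by (auto simp: complex_eq_iff)
  then show ?thesis by (simp only:) (intro canal_mult canal_const canal_add canal_cnj f)
qed

lemma canal_has_derivative:
  assumes "canal f x"
  shows "\<exists>f'. (f has_derivative f') (at x)"
proof -
  obtain r F where F: "0 < r" "cdiff cJ (ball 0 r) F" "\<And>h. norm h < r \<Longrightarrow> F (h, 0) = f (x + h)"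
    using assms unfolding canal_def by blast
  have "((\<lambda>y. (y - x, 0)) has_derivative (\<lambda>v. (v, 0 :: 'a))) (at x)"
    by (auto intro!: derivative_eq_intros)
  moreover have "(F has_derivative frechet_derivative F (at (x - x, 0))) (at (x - x, 0))"
    using F(1) by (intro cdiffD(1)[OF F(2)]) (simp add: zero_prod_def[symmetric])
  ultimately have "((\<lambda>y. F (y - x, 0)) has_derivative (\<lambda>v. frechet_derivative F (at (x - x, 0)) (v, 0))) (at x)"
    by (rule has_derivative_compose)
  then have "(f has_derivative (\<lambda>v. frechet_derivative F (at (x - x, 0)) (v, 0))) (at x)"
    by (rule has_derivative_transform_within_open[OF _ open_ball[of x r]])
       (use F in \<open>auto simp: dist_norm norm_minus_commute\<close>)
  then show ?thesis by blast
qed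

lemma canal_real_has_derivative:
  assumes "canal (\<lambda>x. of_real (f x)) x"
  shows "\<exists>f'. (f has_derivative f') (at x)"
proof -
  obtain f' where "((\<lambda>x. complex_of_real (f x)) has_derivative f') (at x)"
    using canal_has_derivative[OF assms] by blast
  from bounded_linear.has_derivative[OF bounded_linear_Re this] show ?thesis by auto
qed

text \<open>This is the power series of the extension on a polydisc, restricted to real points. The
  monomials and f are real there, so the coefficients may be replaced by their real parts.\<close>

lemma canal_imp_real_analytic_on:
  fixes f :: "'e::euclidean_space \<Rightarrow> real"
  assumes S: "open S" and f: "\<And>x. x \<in> S \<Longrightarrow> canal (\<lambda>x. of_real (f x)) x"
  shows "real_analytic_on S f"
  unfolding real_analytic_on_def
proof (intro conjI ballI S)
  fix x assume x: "x \<in> S"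
  obtain r F where F: "0 < r" "cdiff cJ (ball 0 r) F" "\<And>h. norm h < r \<Longrightarrow> F (h, 0) = of_real (f (x + h))"
    using f[OF x] unfolding canal_def by blast
  \<comment> \<open>A point whose coordinates have modulus at most R has norm at most 2 DIM R = r/2,
    by \<open>norm_polypoint_le\<close>.\<close>
  define R where "R = r / (4 * real DIM('e))"
  have R: "R > 0" using F(1) by (simp add: R_def)
  have "compact (F ` cball 0 (r/2))"
    by (intro compact_continuous_image continuous_on_subset[OF cdiff_continuous_on[OF F(2)]]) (use F(1) in auto)
  then have "bounded (F ` cball 0 (r/2))" by (rule compact_imp_bounded)
  then obtain M where "\<forall>y\<in>F ` cball 0 (r/2). norm y \<le> M"
    unfolding bounded_iff by blast
  then have M: "\<And>p. norm p \<le> r/2 \<Longrightarrow> norm (F p) \<le> M" by simp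
  have pp: "norm (polypoint Basis z :: 'e \<times> 'e) \<le> r / 2" if "\<forall>b\<in>Basis. norm (z b) \<le> R" for z
    using norm_polypoint_le[of Basis z R] that by (simp add: R_def)
  note series = polydisc_power_series[OF finite_Basis subset_refl, of "R/2" R "ball 0 r" F M]
  have "polypoint Basis z \<in> ball (0 :: 'e \<times> 'e) r" if "\<forall>b\<in>Basis. norm (z b) \<le> R" for z
    using pp[OF that] F(1) by simp
  then obtain a :: "('e \<Rightarrow> nat) \<Rightarrow> complex" where
    a: "\<forall>z. (\<forall>b\<in>Basis. norm (z b) \<le> R/2) \<longrightarrow>
       ((\<lambda>\<alpha>. a \<alpha> * (\<Prod>b\<in>Basis. z b ^ \<alpha> b)) has_sum F (polypoint Basis z)) (Basis \<rightarrow>\<^sub>E UNIV)"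
    using series[OF _ _ F(2) _ M[OF pp]] R by auto
  have "((\<lambda>\<alpha>. Re (a \<alpha>) * (\<Prod>b\<in>Basis. (h \<bullet> b) ^ \<alpha> b)) has_sum f (x + h)) (Basis \<rightarrow>\<^sub>E UNIV)" 
    if h: "norm h < min (R/2) r" for h
  proof -
    have "\<forall>b\<in>Basis. norm (complex_of_real (h \<bullet> b)) \<le> R/2"
      using h Basis_le_norm[of _ h] by fastforce
    from a[rule_format, OF this[rule_format]] have *: "((\<lambda>\<alpha>. a \<alpha> * (\<Prod>b\<in>Basis. of_real (h \<bullet> b) ^ \<alpha> b)) has_sum 
        F (polypoint Basis (\<lambda>b. of_real (h \<bullet> b)))) (Basis \<rightarrow>\<^sub>E UNIV)" .
    have "polypoint Basis (\<lambda>b. complex_of_real (h \<bullet> b)) = (h, 0)"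
      by (simp add: polypoint_def euclidean_representation)
    moreover have "Re (a \<alpha> * (\<Prod>b\<in>Basis. of_real (h \<bullet> b) ^ \<alpha> b)) = Re (a \<alpha>) * (\<Prod>b\<in>Basis. (h \<bullet> b) ^ \<alpha> b)" for \<alpha>
      by (simp flip: of_real_power of_real_prod)
    ultimately show ?thesis
      using has_sum_Re[OF *] F(3)[of h] h by simp
  qed
  then show "\<exists>r>0. \<exists>a. \<forall>h. norm h < r \<longrightarrow> ((\<lambda>\<alpha>. a \<alpha> * (\<Prod>b\<in>Basis. (h \<bullet> b) ^ \<alpha> b)) has_sum f (x + h)) (Basis \<rightarrow>\<^sub>E UNIV)"
    using R F(1) by (intro exI[of _ "min (R/2) r"] conjI exI[of _ "\<lambda>\<alpha>. Re (a \<alpha>)"]) auto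
qed

text \<open>The series converges unconditionally at the real point with all coordinates \<rho>,
  hence absolutely. Its terms there dominate those on the complex ball of radius \<rho>, where the
  sum is thus a uniform limit of polynomials.\<close>

lemma real_analytic_on_imp_canal:
  fixes f :: "'e::euclidean_space \<Rightarrow> real"
  assumes "real_analytic_on S f" "x \<in> S"
  shows "canal (\<lambda>x. of_real (f x)) x"
proof -
  have "\<exists>r>0. \<exists>a. \<forall>h. norm h < r \<longrightarrow>
      ((\<lambda>\<alpha>. a \<alpha> * (\<Prod>b\<in>Basis. (h \<bullet> b) ^ \<alpha> b)) has_sum f (x + h)) (Basis \<rightarrow>\<^sub>E UNIV)"
    using assms unfolding real_analytic_on_def by (elim conjE bspec)
  then obtain r a where r: "r > 0" and a: "\<And>h. norm h < r \<Longrightarrow>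
      ((\<lambda>\<alpha>. a \<alpha> * (\<Prod>b\<in>Basis. (h \<bullet> b) ^ \<alpha> b)) has_sum f (x + h)) (Basis \<rightarrow>\<^sub>E UNIV)"
    by (elim exE conjE) auto
  \<comment> \<open>The vector with all coordinates \<rho> has norm at most DIM \<rho> = r/2, inside
    the domain of the series.\<close>
  define \<rho> where "\<rho> = r / (2 * real DIM('e))"
  have "1 \<le> 2 * real DIM('e)" using DIM_ge_Suc0[where 'a = 'e] by linarith
  then have \<rho>: "\<rho> > 0" "\<rho> \<le> r" using r by (auto simp: \<rho>_def divide_le_eq)
  define h0 :: 'e where "h0 = (\<Sum>b\<in>Basis. \<rho> *\<^sub>R b)"
  have "norm h0 \<le> (\<Sum>b\<in>(Basis :: 'e set). \<rho>)"
    unfolding h0_def using \<rho> by (intro sum_norm_le) auto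
  also have "\<dots> < r" using r by (simp add: \<rho>_def)
  finally have h0: "norm h0 < r" .
  have h0b: "h0 \<bullet> b = \<rho>" if "b \<in> Basis" for b
    using that by (simp add: h0_def inner_sum_left inner_Basis if_distrib[of "\<lambda>x. \<rho> * x"] cong: if_cong)
  let ?I = "(Basis :: 'e set) \<rightarrow>\<^sub>E (UNIV :: nat set)"
  have "(\<lambda>\<alpha>. a \<alpha> * (\<Prod>b\<in>Basis. \<rho> ^ \<alpha> b)) summable_on ?I"
    using has_sum_imp_summable[OF a[OF h0]] h0b by simp
  then have Msum: "(\<lambda>\<alpha>. \<bar>a \<alpha> * (\<Prod>b\<in>Basis. \<rho> ^ \<alpha> b)\<bar>) summable_on ?I"
    using summable_on_iff_abs_summable_on_real by force
  let ?f = "\<lambda>\<alpha> p. of_real (a \<alpha>) * (\<Prod>b\<in>Basis. zc b p ^ \<alpha> b)"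
  have ul: "uniform_limit (ball 0 \<rho>) (\<lambda>X p. \<Sum>\<alpha>\<in>X. ?f \<alpha> p) (\<lambda>p. \<Sum>\<^sub>\<infinity>\<alpha>\<in>?I. ?f \<alpha> p) (finite_subsets_at_top ?I)"
  proof (rule Weierstrass_m_test_general[OF _ Msum])
    fix \<alpha> and p :: "'e \<times> 'e" assume "p \<in> ball 0 \<rho>"
    then have p: "norm p \<le> \<rho>" by simp
    have "norm (\<Prod>b\<in>Basis. zc b p ^ \<alpha> b) = (\<Prod>b\<in>Basis. norm (zc b p) ^ \<alpha> b)"
      by (simp add: prod_norm[symmetric] norm_power)
    also have "\<dots> \<le> (\<Prod>b\<in>(Basis :: 'e set). \<rho> ^ \<alpha> b)"
      using order_trans[OF norm_zc_le p] by (intro prod_mono conjI power_mono) auto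
    finally show "norm (?f \<alpha> p) \<le> \<bar>a \<alpha> * (\<Prod>b\<in>Basis. \<rho> ^ \<alpha> b)\<bar>"
      using \<rho> by (simp add: norm_mult abs_mult mult_left_mono prod_nonneg abs_prod)
  qed
  have "cdiff cJ (ball 0 \<rho>) (\<lambda>p. \<Sum>\<^sub>\<infinity>\<alpha>\<in>?I. ?f \<alpha> p)"
    by (rule cplx.cdiff_uniform_limit[OF open_ball _ ul finite_subsets_at_top_neq_bot])
       (intro always_eventually allI cdiff_sum cdiff_mult cdiff_const cdiff_prod cdiff_power cdiff_zc open_ball)
  then show ?thesis
  proof (rule canalI[OF \<rho>(1)])
    fix h :: 'e assume "norm h < \<rho>"
    then have "((\<lambda>\<alpha>. complex_of_real (a \<alpha> * (\<Prod>b\<in>Basis. (h \<bullet> b) ^ \<alpha> b))) has_sum of_real (f (x + h))) ?I"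
      using \<rho> by (intro has_sum_of_real a) auto
    then show "(\<Sum>\<^sub>\<infinity>\<alpha>\<in>?I. ?f \<alpha> (h, 0)) = of_real (f (x + h))"
      by (intro infsumI) (simp add: zc_def)
  qed
qed

text \<open>f(x + h) - f(x) is the integral over t in [0, 1] of the sum of h_b f'_b(x + th).
  Coordinates, partial derivatives and the scaling by t all extend holomorphically, and so does the
  integral.\<close>

lemma canal_antiderivative:
  fixes f :: "'e::euclidean_space \<Rightarrow> complex"
  assumes S: "open S" "x \<in> S" and der: "\<And>y. y \<in> S \<Longrightarrow> (f has_derivative f' y) (at y)"
    and f': "\<And>b. b \<in> Basis \<Longrightarrow> canal (\<lambda>y. f' y b) x"
  shows "canal f x"
proof -
  define Q where "Q b r F \<longleftrightarrow> r > 0 \<and> cdiff cJ (ball 0 r) F \<and> (\<forall>h. norm h < r \<longrightarrow> F (h, 0) = f' (x + h) b)" for b r F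
  have "\<exists>r F. Q b r F" if "b \<in> Basis" for b
    using f'[OF that] unfolding canal_def Q_def by blast
  then obtain rr G where "\<And>b. b \<in> Basis \<Longrightarrow> Q b (rr b) (G b)" by metis
  then have G: "\<And>b. b \<in> Basis \<Longrightarrow> rr b > 0" "\<And>b. b \<in> Basis \<Longrightarrow> cdiff cJ (ball 0 (rr b)) (G b)"
    "\<And>b h. b \<in> Basis \<Longrightarrow> norm h < rr b \<Longrightarrow> G b (h, 0) = f' (x + h) b"
    by (auto simp: Q_def)
  obtain d where d: "d > 0" "ball x d \<subseteq> S" using S open_contains_ball by blast
  define r where "r = Min (insert d (rr ` Basis))"
  have r: "r > 0" "r \<le> d" "\<And>b. b \<in> Basis \<Longrightarrow> r \<le> rr b"
    using G(1) d by (auto simp: r_def simp del: Min_insert intro!: Min_le)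
  have cdG: "cdiff cJ (ball 0 r) (G b)" if "b \<in> Basis" for b
    using r(3)[OF that] by (intro cdiff_subset[OF G(2)[OF that]]) auto
  define K where "K p t = (\<Sum>b\<in>Basis. zc b p * G b (t *\<^sub>R p))" for p and t :: real
  have scale: "t *\<^sub>R p \<in> ball 0 r" if "p \<in> ball 0 r" "0 \<le> t" "t \<le> 1" for p :: "'e \<times> 'e" and t
    using that mult_left_le_one_le[of "norm p" t] by simp
  have "cdiff cJ (ball 0 r) (\<lambda>p. integral {0..1} (K p))"
  proof (rule cplx.cdiff_integral)
    fix t :: real assume t: "t \<in> {0..1}"
    have "cdiff cJ (ball 0 r) (\<lambda>p. G b (t *\<^sub>R p))" if "b \<in> Basis" for b
    proof -
      have "cdiff cJ ((\<lambda>p. t *\<^sub>R p + 0) -` ball 0 r) (\<lambda>p. G b (t *\<^sub>R p + 0))"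
        by (rule cdiff_linear_compose[OF cdG[OF that] bounded_linear_scaleR_right]) (simp add: cJ_def)
      then show ?thesis
        unfolding add_0_right
      proof (rule cdiff_subset)
        show "ball (0 :: 'e \<times> 'e) r \<subseteq> (\<lambda>p. t *\<^sub>R p) -` ball 0 r"
        proof
          fix p :: "'e \<times> 'e" assume "p \<in> ball 0 r"
          then have "t *\<^sub>R p \<in> ball 0 r" by (rule scale) (use t in auto)
          then show "p \<in> (\<lambda>p. t *\<^sub>R p) -` ball 0 r" by (rule vimageI2)
        qed
      qed simp
    qed
    then show "cdiff cJ (ball 0 r) (\<lambda>p. K p t)"
      unfolding K_def by (intro cdiff_sum cdiff_mult cdiff_zc) auto
  next
    let ?B = "ball (0 :: 'e \<times> 'e) r \<times> {0..1::real}"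
    have "continuous_on ?B (\<lambda>q. G b (snd q *\<^sub>R fst q))" if "b \<in> Basis" for b
    proof (rule continuous_on_compose2[OF cdiff_continuous_on[OF cdG[OF that]]])
      show "continuous_on ?B (\<lambda>q. snd q *\<^sub>R fst q)"
        by (intro continuous_on_scaleR continuous_on_fst continuous_on_snd continuous_on_id)
      show "(\<lambda>q. snd q *\<^sub>R fst q) ` ?B \<subseteq> ball 0 r"
        by (rule image_subsetI, rule scale) (simp_all add: mem_Times_iff)
    qed
    moreover have "continuous_on ?B (\<lambda>q. zc b (fst q))" for b
      unfolding zc_def by (intro continuous_intros)
    ultimately have "continuous_on ?B (\<lambda>q. \<Sum>b\<in>Basis. zc b (fst q) * G b (snd q *\<^sub>R fst q))"
      by (intro continuous_on_sum continuous_on_mult)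
    then show "continuous_on (ball 0 r \<times> {0..1}) (\<lambda>(p, t). K p t)"
      by (simp add: K_def case_prod_unfold)
  qed auto
  then have "cdiff cJ (ball 0 r) (\<lambda>p. f x + integral {0..1} (K p))"
    by (intro cdiff_add cdiff_const) auto
  then show ?thesis
  proof (rule canalI[OF r(1)])
    fix h :: 'e assume h: "norm h < r"
    have inS: "x + t *\<^sub>R h \<in> S" and small: "norm (t *\<^sub>R h) < r" if "0 \<le> t" "t \<le> 1" for t
    proof -
      show "norm (t *\<^sub>R h) < r" using that h mult_left_le_one_le[of "norm h" t] by simp
      then show "x + t *\<^sub>R h \<in> S" using r(2) d(2) by (force simp: dist_norm)
    qed
    have "((\<lambda>t. K (h, 0) t) has_integral f (x + 1 *\<^sub>R h) - f (x + 0 *\<^sub>R h)) {0..1}"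
    proof (rule fundamental_theorem_of_calculus)
      fix t :: real assume t: "t \<in> {0..1}"
      have vd: "((\<lambda>t. x + t *\<^sub>R h) has_derivative (\<lambda>s. s *\<^sub>R h)) (at t within {0..1})"
        using has_derivative_add[OF has_derivative_const[of x] has_derivative_scaleR_left[OF has_derivative_ident, of h]] by simp
      have fd: "(f has_derivative f' (x + t *\<^sub>R h)) (at (x + t *\<^sub>R h))"
        by (rule der[OF inS]) (use t in auto)
      from has_derivative_compose[OF vd fd] have "((\<lambda>t. f (x + t *\<^sub>R h)) has_vector_derivative f' (x + t *\<^sub>R h) h) (at t within {0..1})"
        unfolding has_vector_derivative_def using has_derivative_linear[OF fd] by (simp add: linear_scale)
      moreover have "f' (x + t *\<^sub>R h) h = K (h, 0) t"
      proof -
        have 1: "f' (x + t *\<^sub>R h) (\<Sum>b\<in>Basis. (h \<bullet> b) *\<^sub>R b) = (\<Sum>b\<in>Basis. (h \<bullet> b) *\<^sub>R f' (x + t *\<^sub>R h) b)"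
          using has_derivative_linear[OF fd] by (simp add: linear_sum linear_scale)
        have 2: "(\<Sum>b\<in>Basis. (h \<bullet> b) *\<^sub>R f' (x + t *\<^sub>R h) b) = K (h, 0) t"
          unfolding K_def
        proof (rule sum.cong)
          fix b :: 'e assume b: "b \<in> Basis"
          have "G b (t *\<^sub>R h, 0) = f' (x + t *\<^sub>R h) b"
            using small[of t] t r(3)[OF b] by (intro G(3) b) auto
          then show "(h \<bullet> b) *\<^sub>R f' (x + t *\<^sub>R h) b = zc b (h, 0) * G b (t *\<^sub>R (h, 0))"
            by (simp add: zc_def scaleR_conv_of_real)
        qed simp
        show ?thesis using trans[OF 1 2] by (simp only: euclidean_representation)
      qed
      ultimately show "((\<lambda>t. f (x + t *\<^sub>R h)) has_vector_derivative K (h, 0) t) (at t within {0..1})" by (simp only:)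
    qed simp
    then have "integral {0..1} (K (h, 0)) = f (x + h) - f x"
      by (intro integral_unique) simp
    then show "f x + integral {0..1} (K (h, 0)) = f (x + h)" by simp
  qed
qed

subsection \<open>Simple roots of real polynomials with analytic coefficients\<close>

text \<open>Induction from below gives j \<le> \<sigma> j, induction from above the reverse. This
  serves to match two increasing lists of roots.\<close>

lemma strict_mono_self_map_id:
  fixes \<sigma> :: "nat \<Rightarrow> nat"
  assumes mono: "\<And>i j. i < j \<Longrightarrow> j < m \<Longrightarrow> \<sigma> i < \<sigma> j" and lt: "\<And>j. j < m \<Longrightarrow> \<sigma> j < m" and j: "j < m"
  shows "\<sigma> j = j"
proof -
  have "j < m \<Longrightarrow> j \<le> \<sigma> j" for j
  proof (induction j)
    case (Suc j)
    then show ?case using mono[of j "Suc j"] by auto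
  qed simp
  moreover have "k < m \<Longrightarrow> \<sigma> (m - 1 - k) \<le> m - 1 - k" for k
  proof (induction k)
    case 0
    then show ?case using lt[of "m - 1"] by auto
  next
    case (Suc k)
    then have "m - 1 - Suc k < m - 1 - k" "m - 1 - k < m" "k < m" by auto
    then show ?case using mono[of "m - 1 - Suc k" "m - 1 - k"] Suc.IH by linarith
  qed
  from this[of "m - 1 - j"] j have "\<sigma> j \<le> j" by auto
  ultimately show ?thesis using j by (simp add: le_antisym)
qed

lemma degree_prod_linear: "degree (\<Prod>j\<in>A. [:- r j, 1:] :: 'a::idom poly) = card A"
  by (cases "finite A") (auto simp: degree_prod_eq_sum_degree)

lemma coeff_prod_of_real:
  "coeff (\<Prod>j<m::nat. [:- complex_of_real (r j), 1:]) i = of_real (coeff (\<Prod>j<m. [:- r j, 1:]) i)"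
proof (induction m arbitrary: i)
  case 0
  then show ?case by (cases i) auto
next
  case (Suc m)
  then show ?case by (simp add: prod.lessThan_Suc coeff_pCons split: nat.split)
qed

lemma poly_eq_sum_atMost:
  fixes p :: "'a::comm_ring_1 poly" assumes "degree p = m"
  shows "poly p x = (\<Sum>i\<le>m. coeff p i * x ^ i)"
  using assms by (simp add: poly_altdef)

text \<open>By the argument principle the integral of \<tau> Q'(\<tau>) / Q(\<tau>) over a small
  circle is 2 pi i times the root inside. Only the coefficients of Q enter, and these extend
  holomorphically. The ordering of the roots ensures that the root inside the circle around
  \<open>r j x0\<close> is still the j-th one.\<close>

lemma canal_simple_root:
  fixes r :: "nat \<Rightarrow> 'e::euclidean_space \<Rightarrow> real"
  assumes S: "open S" "x0 \<in> S"
    and coeffs: "\<And>i. canal (\<lambda>x. of_real (coeff (\<Prod>j<m. [:- r j x, 1:]) i)) x0"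
    and mono: "\<And>x i j. x \<in> S \<Longrightarrow> i \<le> j \<Longrightarrow> j < m \<Longrightarrow> r i x \<le> r j x"
    and inj: "\<And>i j. i < j \<Longrightarrow> j < m \<Longrightarrow> r i x0 < r j x0"
    and j: "j < m"
  shows "canal (\<lambda>x. of_real (r j x)) x0"
proof -
  define c where "c i = r i x0" for i
  \<comment> \<open>At most a third of the smallest gap, so that roots that have moved by less than
    \<rho> keep their order and stay out of the other circles; the 1 covers the case of a single
    root.\<close>
  define \<rho> where "\<rho> = Min (insert 1 ((\<lambda>(i, k). \<bar>c i - c k\<bar>) ` {(i, k). i < m \<and> k < m \<and> i \<noteq> k})) / 3"
  have fin: "finite {(i, k). i < m \<and> k < m \<and> i \<noteq> k}"
    by (rule finite_subset[of _ "{..<m} \<times> {..<m}"]) auto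
  have cne: "c i \<noteq> c k" if "i < m" "k < m" "i \<noteq> k" for i k
    using inj[of i k] inj[of k i] that by (cases "i < k") (auto simp: c_def)
  have "0 < Min (insert 1 ((\<lambda>(i, k). \<bar>c i - c k\<bar>) ` {(i, k). i < m \<and> k < m \<and> i \<noteq> k}))"
    using fin cne by (subst Min_gr_iff) auto
  then have \<rho>: "\<rho> > 0" by (simp add: \<rho>_def)
  have sep: "3 * \<rho> \<le> \<bar>c i - c k\<bar>" if "i < m" "k < m" "i \<noteq> k" for i k
    unfolding \<rho>_def using fin that by (auto intro!: Min_le simp del: Min_insert)
  define q where "q x = (\<Prod>j<m. [:- r j x, 1:])" for x
  have qeval: "poly (q x) t = (\<Prod>j<m. t - r j x)" for x t by (simp add: q_def poly_prod)
  have cont: "isCont (\<lambda>x. poly (q x) t) x0" for t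
  proof -
    have "isCont (\<lambda>x. coeff (q x) i) x0" for i
      using canal_real_has_derivative[OF coeffs[of i]] by (auto simp: q_def dest: has_derivative_continuous)
    then have "isCont (\<lambda>x. \<Sum>i\<le>m. coeff (q x) i * t ^ i) x0"
      by (intro continuous_sum continuous_mult continuous_const)
    moreover have "poly (q x) t = (\<Sum>i\<le>m. coeff (q x) i * t ^ i)" for x
      by (rule poly_eq_sum_atMost) (simp add: q_def degree_prod_linear)
    ultimately show ?thesis by simp
  qed
  have "\<forall>\<^sub>F x in nhds x0. poly (q x) (c i - \<rho>) * poly (q x) (c i + \<rho>) < 0" if i: "i < m" for i
  proof -
    \<comment> \<open>Between the two points only the factor of \<open>c i\<close> changes sign; the
      values of every other factor have a positive product.\<close>
    have "poly (q x0) (c i - \<rho>) * poly (q x0) (c i + \<rho>) = (\<Prod>k<m. (c i - \<rho> - c k) * (c i + \<rho> - c k))"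
      by (simp add: qeval prod.distrib c_def)
    also have "\<dots> = (c i - \<rho> - c i) * (c i + \<rho> - c i) * (\<Prod>k\<in>{..<m} - {i}. (c i - \<rho> - c k) * (c i + \<rho> - c k))"
      using i by (subst prod.remove[of _ i]) auto
    also have "\<dots> < 0"
    proof -
      have "0 < (c i - \<rho> - c k) * (c i + \<rho> - c k)" if "k \<in> {..<m} - {i}" for k
      proof -
        have "\<rho> < \<bar>c i - c k\<bar>" using sep[of i k] that i \<rho> by auto
        then have "\<rho>\<^sup>2 < (c i - c k)\<^sup>2" using \<rho> by (metis abs_of_pos abs_ge_zero power2_abs power_strict_mono zero_less_numeral)
        then show ?thesis by (simp add: power2_eq_square algebra_simps)
      qed
      then have "0 < (\<Prod>k\<in>{..<m} - {i}. (c i - \<rho> - c k) * (c i + \<rho> - c k))" by (rule prod_pos)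
      then show ?thesis using \<rho> by (simp add: mult_neg_pos)
    qed
    finally have "poly (q x0) (c i - \<rho>) * poly (q x0) (c i + \<rho>) < 0" .
    moreover have "((\<lambda>x. poly (q x) (c i - \<rho>) * poly (q x) (c i + \<rho>)) \<longlongrightarrow> poly (q x0) (c i - \<rho>) * poly (q x0) (c i + \<rho>)) (nhds x0)"
      by (intro tendsto_mult tendsto_at_iff_tendsto_nhds[THEN iffD1] cont[unfolded isCont_def])
    ultimately show ?thesis by (rule order_tendstoD(2)[rotated])
  qed
  then have "\<forall>\<^sub>F x in nhds x0. \<forall>i\<in>{..<m}. poly (q x) (c i - \<rho>) * poly (q x) (c i + \<rho>) < 0"
    by (intro eventually_ball_finite) auto
  moreover have "\<forall>\<^sub>F x in nhds x0. x \<in> S" using S by (rule eventually_nhds_in_open)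
  ultimately have "\<forall>\<^sub>F x in nhds x0. \<forall>i<m. \<bar>c i - r i x\<bar> < \<rho>"
  proof eventually_elim
    case (elim x)
    \<comment> \<open>Without a root within \<rho> of \<open>c i\<close> every factor would have a
      nonnegative product of values at the two ends, contrary to the sign change.\<close>
    have ex: "\<exists>k<m. \<bar>c i - r k x\<bar> < \<rho>" if i: "i < m" for i
    proof (rule ccontr)
      assume *: "\<not> (\<exists>k<m. \<bar>c i - r k x\<bar> < \<rho>)"
      have "0 \<le> (c i - \<rho> - r k x) * (c i + \<rho> - r k x)" if "k < m" for k
      proof -
        have "\<rho> \<le> \<bar>c i - r k x\<bar>" using * that by force
        then have "\<rho>\<^sup>2 \<le> (c i - r k x)\<^sup>2" using \<rho> by (metis abs_ge_zero less_imp_le power2_abs power_mono)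
        then show ?thesis by (simp add: power2_eq_square algebra_simps)
      qed
      then have "0 \<le> (\<Prod>k<m. (c i - \<rho> - r k x) * (c i + \<rho> - r k x))" by (intro prod_nonneg) auto
      also have "\<dots> = poly (q x) (c i - \<rho>) * poly (q x) (c i + \<rho>)" by (simp add: qeval prod.distrib)
      finally show False using elim(1) i by force
    qed
    then obtain \<sigma> where \<sigma>: "\<And>i. i < m \<Longrightarrow> \<sigma> i < m" "\<And>i. i < m \<Longrightarrow> \<bar>c i - r (\<sigma> i) x\<bar> < \<rho>" by metis
    \<comment> \<open>Roots attached to different centres keep the order of the centres, so \<sigma>
      is increasing and hence the identity.\<close>
    have "\<sigma> i < \<sigma> k" if "i < k" "k < m" for i k
    proof -
      have "c i < c k" using inj[OF that] by (simp add: c_def)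
      then have "3 * \<rho> \<le> c k - c i" using sep[of i k] that by auto
      then have "r (\<sigma> i) x < r (\<sigma> k) x" using \<sigma>(2)[of i] \<sigma>(2)[of k] that \<rho> by auto
      then show ?thesis using mono[OF elim(2), of "\<sigma> k" "\<sigma> i"] \<sigma>(1)[of i] that by (meson less_le_trans less_trans not_less)
    qed
    then have "\<sigma> i = i" if "i < m" for i using strict_mono_self_map_id[of m \<sigma> i] \<sigma>(1) that by blast
    with \<sigma>(2) show ?case by auto
  qed
  then obtain d1 where d1: "d1 > 0" "\<And>x i. dist x x0 < d1 \<Longrightarrow> i < m \<Longrightarrow> \<bar>c i - r i x\<bar> < \<rho>"
    unfolding eventually_nhds_metric by blast

  define E where "E i R C \<longleftrightarrow> R > 0 \<and> cdiff cJ (ball 0 R) C \<and> (\<forall>h. norm h < R \<longrightarrow> C (h, 0) = of_real (coeff (q (x0 + h)) i))" for i R C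
  have "\<exists>R C. E i R C" for i
    using coeffs[of i] unfolding canal_def E_def q_def by blast
  then obtain RR C where "\<And>i. E i (RR i) (C i)" by metis
  then have C: "RR i > 0" "cdiff cJ (ball 0 (RR i)) (C i)" "norm h < RR i \<Longrightarrow> C i (h, 0) = of_real (coeff (q (x0 + h)) i)" for i h
    by (auto simp: E_def)
  define R where "R = Min (RR ` {..m})"
  have R: "R > 0" "\<And>i. i \<le> m \<Longrightarrow> R \<le> RR i" using C(1) by (auto simp: R_def intro!: Min_le)
  have cdC: "cdiff cJ (ball 0 R) (C i)" if "i \<le> m" for i
    using R(2)[OF that] by (intro cdiff_subset[OF C(2)]) auto
  define Q where "Q p \<tau> = (\<Sum>i\<le>m. C i p * \<tau> ^ i)" for p \<tau>
  define dQ where "dQ p \<tau> = (\<Sum>i\<le>m. C i p * (of_nat i * \<tau> ^ (i - 1)))" for p \<tau>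
  define P where "P x = (\<Prod>i<m. [:- complex_of_real (r i x), 1:])" for x
  have Q_real: "Q (h, 0) \<tau> = poly (P (x0 + h)) \<tau>" and dQ_real: "dQ (h, 0) \<tau> = poly (pderiv (P (x0 + h))) \<tau>" 
    if h: "norm h < R" for h \<tau>
  proof -
    have eq: "Q (h, 0) = poly (P (x0 + h))"
    proof
      fix \<tau>
      have "Q (h, 0) \<tau> = (\<Sum>i\<le>m. coeff (P (x0 + h)) i * \<tau> ^ i)"
        unfolding Q_def using C(3)[OF less_le_trans[OF h R(2)]] by (simp add: q_def P_def coeff_prod_of_real)
      also have "\<dots> = poly (P (x0 + h)) \<tau>"
        by (rule poly_eq_sum_atMost[symmetric]) (simp add: P_def degree_prod_linear)
      finally show "Q (h, 0) \<tau> = poly (P (x0 + h)) \<tau>" .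
    qed
    then show "Q (h, 0) \<tau> = poly (P (x0 + h)) \<tau>" by simp
    have "(Q (h, 0) has_field_derivative dQ (h, 0) \<tau>) (at \<tau>)"
      unfolding Q_def[abs_def] dQ_def by (rule DERIV_sum, rule DERIV_cmult) (auto intro!: derivative_eq_intros)
    then show "dQ (h, 0) \<tau> = poly (pderiv (P (x0 + h))) \<tau>"
      unfolding eq using poly_DERIV DERIV_unique by blast
  qed
  have P_eval: "poly (P x) \<tau> = (\<Prod>i<m. \<tau> - of_real (r i x))" for x \<tau>
    by (simp add: P_def poly_prod)
  have dP_eval: "poly (pderiv (P x)) \<tau> = (\<Sum>i<m. \<Prod>k\<in>{..<m} - {i}. \<tau> - of_real (r k x))" for x \<tau>
    by (simp add: P_def pderiv_prod pderiv_pCons poly_sum poly_prod)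

  define circ where "circ = circlepath (complex_of_real (c j)) \<rho>"
  have circ_norm: "norm (circ s - of_real (c j)) = \<rho>" for s
    using \<rho> by (simp add: circ_def circlepath norm_mult)
  have off: "circ s \<noteq> of_real (r i x)" if "dist x x0 < d1" "i < m" for s i x
  proof
    assume eq: "circ s = of_real (r i x)"
    have "norm (complex_of_real (r i x - c j)) = \<rho>" using circ_norm[of s] unfolding eq by simp
    then have 1: "\<bar>r i x - c j\<bar> = \<rho>" by (simp only: norm_of_real)
    show False
    proof (cases "i = j")
      case True then show False using 1 d1(2)[OF that] by auto
    next
      case False then show False using 1 d1(2)[OF that] sep[of i j] that j \<rho> by auto
    qed
  qed
  have contC: "continuous_on (ball 0 R \<times> UNIV) (\<lambda>z. C i (fst z))" if "i \<le> m" for i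
    by (rule continuous_on_compose2[OF cdiff_continuous_on[OF cdC[OF that]] continuous_on_fst[OF continuous_on_id]]) auto
  have contcirc: "continuous_on (ball 0 R \<times> UNIV) (\<lambda>z::('e \<times> 'e) \<times> real. circ (snd z))"
    unfolding circ_def by (rule continuous_on_compose2[OF continuous_on_circlepath[of UNIV] continuous_on_snd[OF continuous_on_id]]) auto
  have contQ: "continuous_on (ball 0 R \<times> UNIV) (\<lambda>z. Q (fst z) (circ (snd z)))"
    unfolding Q_def by (intro continuous_on_sum continuous_on_mult contC continuous_on_power contcirc) auto
  have contdQ: "continuous_on (ball 0 R \<times> UNIV) (\<lambda>z. dQ (fst z) (circ (snd z)))"
    unfolding dQ_def by (intro continuous_on_sum continuous_on_mult contC continuous_on_power contcirc continuous_on_const) auto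
  let ?W = "(ball 0 R \<times> UNIV) \<inter> (\<lambda>z. Q (fst z) (circ (snd z))) -` (- {0})"
  have "open ?W"
    by (rule continuous_open_preimage[OF contQ]) (auto intro: open_Times)
  moreover have "{0} \<times> {0..1} \<subseteq> ?W"
  proof -
    have "Q (0, 0) (circ s) \<noteq> 0" for s
      unfolding Q_real[of 0, unfolded norm_zero, OF R(1)] P_eval using off[of x0 _ s] d1(1) by auto
    then show ?thesis using R(1) by (auto simp: zero_prod_def)
  qed
  \<comment> \<open>Tube lemma: \<open>Q\<close> stays nonzero on the whole circle for all complex
    parameters near 0, not only for the real ones.\<close>
  ultimately obtain X0 where X0: "0 \<in> X0" "open X0" "X0 \<times> {0..1} \<subseteq> ?W"
    using Elementary_Topology.tube_lemma[of "{0..1::real}" ?W 0] by auto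
  then obtain d2 where d2: "d2 > 0" "ball 0 d2 \<subseteq> X0" using open_contains_ball by blast
  define \<delta> where "\<delta> = min R (min d1 d2)"
  have \<delta>: "\<delta> > 0" "\<delta> \<le> R" "\<delta> \<le> d1" "\<delta> \<le> d2" using R(1) d1(1) d2(1) by (auto simp: \<delta>_def)
  have Q_ne: "Q p (circ s) \<noteq> 0" if "p \<in> ball 0 \<delta>" "s \<in> {0..1}" for p s
  proof -
    have "p \<in> X0" using that(1) \<delta>(4) d2(2) by auto
    then have "(p, s) \<in> ?W" using X0(3) that(2) by blast
    then show ?thesis by auto
  qed
  \<comment> \<open>The last factor comes from the parametrisation of the circle: d\<tau> = 2 pi i
    (\<tau> - c_j) ds.\<close>
  define K where "K p s = circ s * dQ p (circ s) / Q p (circ s) * (circ s - of_real (c j))" for p and s :: real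
  have sub: "ball 0 \<delta> \<times> {0..1} \<subseteq> ball (0 :: 'e \<times> 'e) R \<times> (UNIV :: real set)" using \<delta> by auto
  have "cdiff cJ (ball 0 \<delta>) (\<lambda>p. integral {0..1} (K p))"
  proof (rule cplx.cdiff_integral)
    fix s :: real assume s: "s \<in> {0..1}"
    have "cdiff cJ (ball 0 \<delta>) (C i)" if "i \<le> m" for i
      using \<delta>(2) by (intro cdiff_subset[OF cdC[OF that]]) auto
    then have "cdiff cJ (ball 0 \<delta>) (\<lambda>p. Q p (circ s))" "cdiff cJ (ball 0 \<delta>) (\<lambda>p. dQ p (circ s))"
      unfolding Q_def dQ_def by (intro cdiff_sum cdiff_mult cdiff_const; simp)+
    then show "cdiff cJ (ball 0 \<delta>) (\<lambda>p. K p s)"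
      unfolding K_def using Q_ne s by (intro cdiff_mult cdiff_divide cdiff_const) auto
  next
    have "continuous_on (ball 0 \<delta> \<times> {0..1}) (\<lambda>z. circ (snd z) * dQ (fst z) (circ (snd z)) / Q (fst z) (circ (snd z)) * (circ (snd z) - of_real (c j)))"
      by (intro continuous_on_mult continuous_on_divide continuous_on_diff continuous_on_const
          continuous_on_subset[OF contQ sub] continuous_on_subset[OF contdQ sub] continuous_on_subset[OF contcirc sub])
        (use Q_ne in \<open>auto simp: mem_Times_iff\<close>)
    then show "continuous_on (ball 0 \<delta> \<times> {0..1}) (\<lambda>(p, s). K p s)"
      by (simp add: K_def case_prod_unfold)
  qed auto
  then show ?thesis
  proof (rule canalI[OF \<delta>(1)])
    fix h :: 'e assume h: "norm h < \<delta>"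
    let ?x = "x0 + h"
    have x: "dist ?x x0 < d1" using h \<delta> by (simp add: dist_norm)
    define rj where "rj = complex_of_real (r j ?x)"
    \<comment> \<open>This is \<tau> (\<tau> - r_j) Q'(\<tau>) / Q(\<tau>) with the pole at r_j
      cancelled. It is holomorphic on the closed disc and has the value r_j at r_j, so Cauchy's
      integral formula replaces the residue theorem.\<close>
    define f where "f \<tau> = \<tau> * (1 + (\<Sum>i\<in>{..<m} - {j}. (\<tau> - rj) / (\<tau> - of_real (r i ?x))))" for \<tau>
    have out: "\<tau> \<noteq> of_real (r i ?x)" if "\<tau> \<in> cball (of_real (c j)) \<rho>" "i \<in> {..<m} - {j}" for \<tau> :: complex and i
    proof
      assume eq: "\<tau> = of_real (r i ?x)"
      have "norm (complex_of_real (c j - r i ?x)) \<le> \<rho>" using that(1) unfolding eq mem_cball dist_norm by (simp only: of_real_diff)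
      then have "\<bar>c j - r i ?x\<bar> \<le> \<rho>" by (simp only: norm_of_real)
      then show False using d1(2)[OF x, of i] sep[of i j] that(2) j \<rho> by auto
    qed
    have holf: "f holomorphic_on cball (of_real (c j)) \<rho>"
      unfolding f_def using out by (intro holomorphic_intros) auto
    have "norm (complex_of_real (c j - r j ?x)) < \<rho>" using d1(2)[OF x j] by (simp only: norm_of_real)
    then have rj: "norm (rj - of_real (c j)) < \<rho>" by (simp add: rj_def norm_minus_commute)
    have "((\<lambda>u. f u / (u - rj)) has_contour_integral 2 * of_real pi * \<i> * f rj) (circlepath (of_real (c j)) \<rho>)"
      by (rule Cauchy_integral_circlepath[OF holomorphic_on_imp_continuous_on[OF holf] holomorphic_on_subset[OF holf] rj]) auto
    then have "2 * of_real pi * \<i> * f rj = contour_integral (circlepath (of_real (c j)) \<rho>) (\<lambda>u. f u / (u - rj))"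
      by (rule contour_integral_unique[symmetric])
    also have "\<dots> = integral {0..1} (\<lambda>s. f (circ s) / (circ s - rj) * vector_derivative circ (at s))"
      by (simp add: circ_def contour_integral_integral)
    also have "\<dots> = integral {0..1} (\<lambda>s. 2 * of_real pi * \<i> * K (h, 0) s)"
    proof (rule integral_cong)
      fix s :: real assume "s \<in> {0..1}"
      have vd: "vector_derivative circ (at s) = 2 * of_real pi * \<i> * (circ s - of_real (c j))"
        unfolding circ_def vector_derivative_circlepath by (simp add: circlepath)
      let ?\<tau> = "circ s"
      have ne: "?\<tau> - of_real (r i ?x) \<noteq> 0" if "i < m" for i using off[OF x that, of s] by auto
      have "dQ (h, 0) ?\<tau> = (\<Sum>i<m. Q (h, 0) ?\<tau> / (?\<tau> - of_real (r i ?x)))"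
      proof -
        have hR: "norm h < R" using h \<delta> by simp
        have "(\<Prod>k\<in>{..<m} - {i}. ?\<tau> - of_real (r k ?x)) = (\<Prod>k<m. ?\<tau> - of_real (r k ?x)) / (?\<tau> - of_real (r i ?x))" if "i < m" for i
          using that ne[OF that] by (subst prod.remove[of "{..<m}" i]) auto
        then show ?thesis unfolding Q_real[OF hR] dQ_real[OF hR] P_eval dP_eval by (intro sum.cong) auto
      qed
      moreover have "Q (h, 0) ?\<tau> \<noteq> 0" 
        using Q_ne[of "(h, 0)" s] h \<open>s \<in> {0..1}\<close> by (auto simp: norm_Pair)
      ultimately have "dQ (h, 0) ?\<tau> / Q (h, 0) ?\<tau> = (\<Sum>i<m. 1 / (?\<tau> - of_real (r i ?x)))"
        by (simp add: sum_divide_distrib)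
      also have "\<dots> = 1 / (?\<tau> - rj) + (\<Sum>i\<in>{..<m} - {j}. 1 / (?\<tau> - of_real (r i ?x)))"
        using j by (subst sum.remove[of _ j]) (auto simp: rj_def)
      also have "\<dots> = (1 + (\<Sum>i\<in>{..<m} - {j}. (?\<tau> - rj) / (?\<tau> - of_real (r i ?x)))) / (?\<tau> - rj)"
        using ne[OF j] by (simp add: rj_def[symmetric] add_divide_distrib sum_divide_distrib)
      finally have "f ?\<tau> / (?\<tau> - rj) = ?\<tau> * (dQ (h, 0) ?\<tau> / Q (h, 0) ?\<tau>)"
        by (simp add: f_def)
      then show "f ?\<tau> / (?\<tau> - rj) * vector_derivative circ (at s) = 2 * of_real pi * \<i> * K (h, 0) s"
        unfolding vd K_def by simp
    qed
    also have "\<dots> = 2 * of_real pi * \<i> * integral {0..1} (K (h, 0))" by (rule integral_mult_right)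
    finally have "integral {0..1} (K (h, 0)) = f rj" by simp
    then show "integral {0..1} (K (h, 0)) = complex_of_real (r j ?x)" by (simp add: f_def rj_def)
  qed
qed

subsection \<open>Complex matrices\<close>

lemma bounded_bilinear_matrix_mult:
  "bounded_bilinear ((**) :: complex^'n^'m \<Rightarrow> complex^'k^'n \<Rightarrow> complex^'k^'m)"
  unfolding bilinear_conv_bounded_bilinear[symmetric]
  by (auto simp: bilinear_def linear_iff vec_eq_iff matrix_matrix_mult_def sum.distrib algebra_simps scaleR_sum_right)

lemma bounded_bilinear_matrix_vector_mult:
  "bounded_bilinear ((*v) :: complex^'n^'m \<Rightarrow> complex^'n \<Rightarrow> complex^'m)"
  unfolding bilinear_conv_bounded_bilinear[symmetric]
  by (auto simp: bilinear_def linear_iff vec_eq_iff matrix_vector_mult_def sum.distrib algebra_simps scaleR_sum_right)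

lemma bounded_bilinear_outer: "bounded_bilinear (outer :: complex^'n \<Rightarrow> complex^'n \<Rightarrow> complex^'n^'n)"
  unfolding bilinear_conv_bounded_bilinear[symmetric]
  by (auto simp: bilinear_def linear_iff vec_eq_iff outer_def algebra_simps)

lemma bounded_bilinear_herm: "bounded_bilinear (herm :: complex^'n \<Rightarrow> complex^'n \<Rightarrow> complex)"
  unfolding bilinear_conv_bounded_bilinear[symmetric]
  by (auto simp: bilinear_def linear_iff herm_def sum.distrib algebra_simps scaleR_sum_right)

lemma bounded_linear_ctranspose: "bounded_linear (ctranspose :: complex^'n^'m \<Rightarrow> complex^'m^'n)"
  unfolding linear_conv_bounded_linear[symmetric]
  by (auto simp: linear_iff vec_eq_iff ctranspose_def)

lemma bounded_linear_trace: "bounded_linear (trace :: complex^'n^'n \<Rightarrow> complex)"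
  unfolding linear_conv_bounded_linear[symmetric]
  by (auto simp: linear_iff trace_def sum.distrib scaleR_sum_right)

lemma bounded_linear_mat: "bounded_linear (mat :: complex \<Rightarrow> complex^'n^'n)"
  unfolding linear_conv_bounded_linear[symmetric]
  by (auto simp: linear_iff mat_def vec_eq_iff)

lemmas matrix_add_simps =
  bounded_bilinear.add_left[OF bounded_bilinear_matrix_mult] bounded_bilinear.add_right[OF bounded_bilinear_matrix_mult]
  bounded_bilinear.diff_left[OF bounded_bilinear_matrix_mult] bounded_bilinear.diff_right[OF bounded_bilinear_matrix_mult]
  bounded_bilinear.minus_left[OF bounded_bilinear_matrix_mult] bounded_bilinear.minus_right[OF bounded_bilinear_matrix_mult]
  bounded_bilinear.add_left[OF bounded_bilinear_matrix_vector_mult] bounded_bilinear.add_right[OF bounded_bilinear_matrix_vector_mult]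
  bounded_bilinear.diff_left[OF bounded_bilinear_matrix_vector_mult] bounded_bilinear.diff_right[OF bounded_bilinear_matrix_vector_mult]
  bounded_bilinear.minus_left[OF bounded_bilinear_matrix_vector_mult] bounded_bilinear.minus_right[OF bounded_bilinear_matrix_vector_mult]

lemma ctranspose_ctranspose [simp]: "ctranspose (ctranspose a) = a"
  by (simp add: ctranspose_def vec_eq_iff)

lemma ctranspose_mult: "ctranspose (a ** b) = ctranspose b ** ctranspose (a :: complex^'n^'m)"
  by (simp add: ctranspose_def vec_eq_iff matrix_matrix_mult_def mult.commute)

lemma ctranspose_mat: "ctranspose (mat c :: complex^'n^'n) = mat (cnj c)"
  by (auto simp: ctranspose_def vec_eq_iff mat_def)

lemma ctranspose_add: "ctranspose (a + b) = ctranspose a + ctranspose b"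
  by (simp add: ctranspose_def vec_eq_iff)

lemma ctranspose_diff: "ctranspose (a - b) = ctranspose a - ctranspose b"
  by (simp add: ctranspose_def vec_eq_iff)

lemma herm_commute: "cnj (herm a b) = herm b a"
  by (simp add: herm_def mult.commute)

lemma herm_smult: "herm a (c *s b) = c * herm a b" "herm (c *s a) b = cnj c * herm a b"
  by (simp_all add: herm_def sum_distrib_left mult_ac)

lemma herm_matrix: "herm (A *v x) y = herm x (ctranspose A *v y)"
proof -
  have "herm (A *v x) y = (\<Sum>i\<in>UNIV. \<Sum>j\<in>UNIV. cnj (A $ i $ j) * cnj (x $ j) * y $ i)"
    by (simp add: herm_def matrix_vector_mult_def sum_distrib_right)
  also have "\<dots> = (\<Sum>j\<in>UNIV. \<Sum>i\<in>UNIV. cnj (A $ i $ j) * cnj (x $ j) * y $ i)"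
    by (rule sum.swap)
  also have "\<dots> = herm x (ctranspose A *v y)"
    by (simp add: herm_def matrix_vector_mult_def ctranspose_def sum_distrib_left mult_ac)
  finally show ?thesis .
qed

lemma inner_eq_Re_herm: "a \<bullet> b = Re (herm a b)"
  by (simp add: herm_def inner_vec_def inner_complex_def)

lemma herm_self: "herm a a = of_real (a \<bullet> a)"
proof -
  have "herm a a \<in> \<real>" by (subst complex_is_Real_iff) (simp add: herm_def mult.commute)
  then show ?thesis by (simp add: inner_eq_Re_herm)
qed

lemma outer_mult_vector: "outer a b *v c = herm b c *s a"
  by (simp add: outer_def herm_def vec_eq_iff matrix_vector_mult_def sum_distrib_left mult_ac)

lemma trace_outer: "trace (A ** outer a b) = herm b (A *v a)"
proof -
  have "trace (A ** outer a b) = (\<Sum>i\<in>UNIV. \<Sum>j\<in>UNIV. A $ i $ j * (a $ j * cnj (b $ i)))"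
    by (simp add: trace_def outer_def matrix_matrix_mult_def)
  also have "\<dots> = herm b (A *v a)"
    by (simp add: herm_def matrix_vector_mult_def sum_distrib_left sum_distrib_right mult_ac)
  finally show ?thesis .
qed

lemma mat_mult_vector: "mat c *v (x :: complex^'n) = c *s x"
  by (simp add: mat_def matrix_vector_mult_def vec_eq_iff if_distrib[of "\<lambda>z. z * _"] sum.If_cases cong: if_cong)

lemma mat_mult_commute: "mat c ** (A :: complex^'n^'n) = A ** mat c"
  by (simp add: mat_def matrix_matrix_mult_def vec_eq_iff if_distrib[of "\<lambda>z. z * _"] if_distrib[of "\<lambda>z. _ * z"] mult.commute cong: if_cong)

lemma matrix_vector_smult: "(A :: complex^'n^'m) *v (c *s x) = c *s (A *v x)"
  by (simp add: vector_scalar_commute)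

section \<open>Determinants and inverses of matrix functions\<close>

lemma det_ctranspose: "det (ctranspose (A :: complex^'n^'n)) = cnj (det A)"
proof -
  have "det (ctranspose A) = det (transpose (ctranspose A))" by simp
  also have "\<dots> = cnj (det A)"
    by (simp add: det_def transpose_def ctranspose_def)
  finally show ?thesis .
qed

text \<open>A permutation other than the identity moves at least two indices, so at the identity
  matrix its product still has a vanishing factor after one factor has been differentiated.\<close>

lemma det_has_derivative_at_one:
  fixes N :: "'z::real_normed_vector \<Rightarrow> complex^'n^'n"
  assumes N: "(N has_derivative N') (at x)" and one: "N x = mat 1"
  shows "((\<lambda>x. det (N x)) has_derivative (\<lambda>v. trace (N' v))) (at x)"
proof -
  have ent: "((\<lambda>x. N x $ i $ k) has_derivative (\<lambda>v. N' v $ i $ k)) (at x)" for i k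
    using bounded_linear.has_derivative[OF bounded_linear_vec_nth bounded_linear.has_derivative[OF bounded_linear_vec_nth N]] .
  let ?P = "{p. p permutes (UNIV :: 'n set)}"
  have "((\<lambda>x. det (N x)) has_derivative
      (\<lambda>v. \<Sum>p\<in>?P. of_int (sign p) * (\<Sum>i\<in>UNIV. N' v $ i $ p i * (\<Prod>k\<in>UNIV - {i}. N x $ k $ p k)))) (at x)"
    unfolding det_def by (intro has_derivative_sum has_derivative_mult_right has_derivative_prod ent)
  moreover have "(\<Sum>p\<in>?P. of_int (sign p) * (\<Sum>i\<in>UNIV. N' v $ i $ p i * (\<Prod>k\<in>UNIV - {i}. N x $ k $ p k))) = trace (N' v)" for v
  proof -
    have zero: "(\<Prod>k\<in>UNIV - {i}. N x $ k $ p k) = 0" if p: "p permutes UNIV" "p \<noteq> id" for p and i :: 'n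
    proof (rule ccontr)
      assume "(\<Prod>k\<in>UNIV - {i}. N x $ k $ p k) \<noteq> 0"
      then have fixed: "p k = k" if "k \<noteq> i" for k
        using that unfolding one mat_def by (auto split: if_splits)
      have "p i = i"
      proof (rule ccontr)
        assume "p i \<noteq> i"
        then have "p (p i) = p i" by (rule fixed)
        then show False using permutes_inj[OF p(1)] \<open>p i \<noteq> i\<close> by (auto dest: injD)
      qed
      then have "p = id" using fixed by (metis eq_id_iff)
      then show False using p by simp
    qed
    have "(\<Sum>p\<in>?P. of_int (sign p) * (\<Sum>i\<in>UNIV. N' v $ i $ p i * (\<Prod>k\<in>UNIV - {i}. N x $ k $ p k))) =
        (\<Sum>p\<in>{id}. of_int (sign p) * (\<Sum>i\<in>UNIV. N' v $ i $ p i * (\<Prod>k\<in>UNIV - {i}. N x $ k $ p k)))"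
      by (rule sum.mono_neutral_right) (auto simp: zero permutes_id finite_permutations)
    also have "\<dots> = trace (N' v)" by (simp add: one mat_def trace_def sign_id)
    finally show ?thesis .
  qed
  ultimately show ?thesis by simp
qed

text \<open>Jacobi's formula, reduced to the identity matrix by the constant factor
  \<open>R\<close>: det M(y) = det M(x) det (R M(y)).\<close>

lemma det_has_derivative:
  fixes M :: "'z::real_normed_vector \<Rightarrow> complex^'n^'n"
  assumes M: "(M has_derivative M') (at x)" and R: "R ** M x = mat 1"
  shows "((\<lambda>x. det (M x)) has_derivative (\<lambda>v. det (M x) * trace (R ** M' v))) (at x)"
proof -
  have "((\<lambda>x. R ** M x) has_derivative (\<lambda>v. R ** M' v)) (at x)"
    by (rule bounded_linear.has_derivative[OF bounded_bilinear.bounded_linear_right[OF bounded_bilinear_matrix_mult] M])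
  from det_has_derivative_at_one[OF this R]
  have "((\<lambda>y. det (M x) * det (R ** M y)) has_derivative (\<lambda>v. det (M x) * trace (R ** M' v))) (at x)"
    by (rule has_derivative_mult_right)
  moreover have "det (M x) * det R = 1"
    using arg_cong[OF R, of det] by (simp add: det_mul mult.commute)
  then have "det (M x) * det (R ** M y) = det (M y)" for y
    by (simp add: det_mul mult.assoc[symmetric])
  ultimately show ?thesis by simp
qed

lemma det_differentiable:
  fixes M :: "'z::real_normed_vector \<Rightarrow> complex^'n^'n"
  assumes "\<And>i k. (\<lambda>x. M x $ i $ k) differentiable (at x)"
  shows "(\<lambda>x. det (M x)) differentiable (at x)"
proof -
  obtain e' where "\<And>i k. ((\<lambda>x. M x $ i $ k) has_derivative e' i k) (at x)"
    using assms unfolding differentiable_def by metis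
  then have "((\<lambda>x. det (M x)) has_derivative
      (\<lambda>v. \<Sum>p | p permutes UNIV. of_int (sign p) * (\<Sum>i\<in>UNIV. e' i (p i) v * (\<Prod>k\<in>UNIV - {i}. M x $ k $ p k)))) (at x)"
    unfolding det_def by (intro has_derivative_sum has_derivative_mult_right has_derivative_prod)
  then show ?thesis by (rule differentiableI)
qed

lemma differentiable_vec_lambda:
  fixes f :: "'i::finite \<Rightarrow> 'z::real_normed_vector \<Rightarrow> 'f::euclidean_space"
  assumes "\<And>i. f i differentiable (at x)"
  shows "(\<lambda>x. \<chi> i. f i x) differentiable (at x)"
proof -
  have "(\<lambda>x. \<Sum>i\<in>UNIV. axis i (f i x)) differentiable (at x)"
  proof (intro differentiable_sum ballI)
    fix i
    obtain f' where "(f i has_derivative f') (at x)" using assms unfolding differentiable_def by blast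
    from bounded_linear.has_derivative[OF linear_conv_bounded_linear[THEN iffD1, OF linear_axis] this, of i]
    show "(\<lambda>x. axis i (f i x) :: 'f^'i) differentiable (at x)" by (rule differentiableI)
  qed simp
  moreover have "(\<Sum>i\<in>UNIV. axis i (f i y)) = (\<chi> i. f i y)" for y
    by (auto simp: vec_eq_iff axis_def if_distrib[of "\<lambda>z. z $ _"] sum.If_cases)
  ultimately show ?thesis by simp
qed

text \<open>Cramer's rule shows that the entries of the inverse are differentiable; the formula then
  comes from differentiating RM = 1.\<close>

lemma matrix_inverse_has_derivative:
  fixes M R :: "'z::real_normed_vector \<Rightarrow> complex^'n^'n"
  assumes S: "open S" "x \<in> S" and M: "(M has_derivative M') (at x)"
    and R: "\<And>y. y \<in> S \<Longrightarrow> R y ** M y = mat 1"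
  shows "(R has_derivative (\<lambda>v. - (R x ** M' v ** R x))) (at x)"
proof -
  have MR: "M y ** R y = mat 1" if "y \<in> S" for y
    using R[OF that] matrix_left_right_inverse by blast
  have dne: "det (M y) \<noteq> 0" if "y \<in> S" for y
    using arg_cong[OF R[OF that], of det] by (auto simp: det_mul)
  \<comment> \<open>\<open>M\<close> with its k-th column replaced by the l-th unit vector, as in
    Cramer's rule.\<close>
  define N where "N k l y = (\<chi> i j. if j = k then (if i = l then 1 else 0) else M y $ i $ j)" for k l y
  have Rent: "R y $ k $ l = det (N k l y) / det (M y)" if y: "y \<in> S" for y k l
  proof -
    have "M y *v (\<chi> i. R y $ i $ l) = (\<chi> i. if i = l then 1 else 0)"
      using MR[OF y] by (simp add: vec_eq_iff matrix_vector_mult_def matrix_matrix_mult_def mat_def)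
    then have "(\<chi> i. R y $ i $ l) = (\<chi> k. det (\<chi> i j. if j = k then (\<chi> i. if i = l then 1 else 0) $ i else M y $ i $ j) / det (M y))"
      using cramer[OF dne[OF y]] by blast
    from arg_cong[OF this, of "\<lambda>v. v $ k"] show ?thesis by (simp add: N_def cong: if_cong)
  qed
  have dM: "(\<lambda>x. M x $ i $ k) differentiable (at x)" for i k
    using bounded_linear.has_derivative[OF bounded_linear_vec_nth bounded_linear.has_derivative[OF bounded_linear_vec_nth M]]
    by (rule differentiableI)
  have dN: "(\<lambda>x. N k l x $ i $ j) differentiable (at x)" for k l i j
    using dM by (cases "j = k") (auto simp: N_def)
  have "(\<lambda>y. det (N k l y) / det (M y)) differentiable (at x)" for k l
    using dne[OF S(2)] by (intro differentiable_divide det_differentiable dN dM) auto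
  then have "(\<lambda>y. \<chi> k l. det (N k l y) / det (M y)) differentiable (at x)"
    by (intro differentiable_vec_lambda)
  then obtain D where D: "((\<lambda>y. \<chi> k l. det (N k l y) / det (M y)) has_derivative D) (at x)"
    unfolding differentiable_def by blast
  have RD: "(R has_derivative D) (at x)"
    by (rule has_derivative_transform_within_open[OF D S]) (simp add: vec_eq_iff Rent)
  have d1: "((\<lambda>y. R y ** M y) has_derivative (\<lambda>v. R x ** M' v + D v ** M x)) (at x)"
    by (rule bounded_bilinear.FDERIV[OF bounded_bilinear_matrix_mult RD M])
  have d2: "((\<lambda>y. R y ** M y) has_derivative (\<lambda>v. 0)) (at x)"
    by (rule has_derivative_transform_within_open[OF has_derivative_const S]) (simp add: R)
  have eq: "R x ** M' v + D v ** M x = 0" for v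
    using fun_cong[OF has_derivative_unique[OF d1 d2]] .
  have "D v = - (R x ** M' v ** R x)" for v
  proof -
    have "(R x ** M' v + D v ** M x) ** R x = 0" unfolding eq by (simp add: matrix_matrix_mult_def vec_eq_iff)
    then have "R x ** M' v ** R x + D v = 0"
      by (simp add: matrix_add_simps matrix_mul_assoc[symmetric] MR[OF S(2)])
    then show ?thesis by (simp add: eq_neg_iff_add_eq_0 add.commute)
  qed
  then have "D = (\<lambda>v. - (R x ** M' v ** R x))" by auto
  with RD show ?thesis by simp
qed

text \<open>The derivative of the inverse is a polynomial in the inverse and the derivative of
  \<open>M\<close>, so smoothness passes from order k to order k + 1.\<close>

lemma smooth_on_matrix_inverse:
  fixes M R :: "'z::real_normed_vector \<Rightarrow> complex^'n^'n"
  assumes M: "smooth_on S M" and R: "\<And>y. y \<in> S \<Longrightarrow> R y ** M y = mat 1"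
  shows "smooth_on S R"
proof -
  note S = smooth_on_open[OF M]
  have der: "(R has_derivative (\<lambda>v. - (R x ** frechet_derivative M (at x) v ** R x))) (at x)" if "x \<in> S" for x
    by (rule matrix_inverse_has_derivative[OF S that smooth_on_has_derivative[OF M that] R])
  have "C_k_on k S R" for k
  proof (induction k)
    case 0
    show ?case unfolding C_k_on.simps by (intro continuous_at_imp_continuous_on ballI has_derivative_continuous[OF der])
  next
    case (Suc k)
    have "C_k_on k S (\<lambda>x. frechet_derivative M (at x) v)" for v
      using smooth_on_frechet[OF M] by (simp add: smooth_on_def)
    then show ?case
      by (intro C_k_on_SucI[OF S der] C_k_on_bounded_linear_compose[OF bounded_linear_minus[OF bounded_linear_ident] S]
          C_k_on_bilinear[OF bounded_bilinear_matrix_mult S] Suc)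
  qed
  then show ?thesis using S by (simp add: smooth_on_def)
qed

section \<open>Hermitian matrices and their characteristic polynomials\<close>

lemma hermitian_eigenvalue_real:
  assumes "ctranspose K = K" "K *v x = c *s x" "x \<noteq> 0"
  shows "c \<in> \<real>"
proof -
  have "c * herm x x = herm x (K *v x)" by (simp add: assms(2) herm_smult)
  also have "\<dots> = herm (K *v x) x" by (simp add: herm_matrix assms(1))
  also have "\<dots> = cnj c * herm x x" by (simp add: assms(2) herm_smult)
  finally have "c = cnj c" using assms(3) by (simp add: herm_self)
  then show ?thesis by (metis Reals_cnj_iff)
qed

lemma det_eq_0_imp_eigenvector:
  assumes "det (mat t - K :: complex^'n^'n) = 0"
  obtains x where "x \<noteq> 0" "K *v x = t *s x"
proof -
  have "\<not> (\<exists>B. B ** (mat t - K) = mat 1)"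
    using assms invertible_det_nz invertible_left_inverse by blast
  then obtain x where "x \<noteq> 0" "(mat t - K) *v x = 0"
    unfolding matrix_left_invertible_ker by blast
  then show ?thesis using that[of x] by (simp add: matrix_add_simps mat_mult_vector)
qed

definition charpoly :: "complex^'n^'n \<Rightarrow> complex poly" where
  "charpoly K = det (\<chi> i j. [:- (K $ i $ j), if i = j then 1 else 0:])"

lemma poly_charpoly: "poly (charpoly K) t = det (mat t - K :: complex^'n^'n)"
  by (auto simp: charpoly_def det_def poly_sum poly_prod mat_def sign_def intro!: sum.cong prod.cong)

text \<open>The identity permutation contributes a product of n monic linear factors; any other
  permutation picks a constant entry, so its degree is smaller than n.\<close>

lemma charpoly_monic: "degree (charpoly (K :: complex^'n^'n)) = CARD('n)" "lead_coeff (charpoly K) = 1"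
proof -
  define M where "M i j = [:- (K $ i $ j), if i = j then 1 else 0:]" for i j :: 'n
  let ?P = "{p. p permutes (UNIV :: 'n set)}"
  have deg1: "degree (M i i) = 1" "lead_coeff (M i i) = 1" for i by (auto simp: M_def)
  have d: "degree (\<Prod>i\<in>UNIV. M i i) = CARD('n)"
    by (subst degree_prod_eq_sum_degree) (auto simp: deg1 M_def)
  have l: "lead_coeff (\<Prod>i\<in>UNIV. M i i) = 1"
    by (subst lead_coeff_prod) (simp add: deg1(2))
  have small: "degree (of_int (sign p) * (\<Prod>i\<in>UNIV. M i (p i))) < CARD('n)" if p: "p \<in> ?P" "p \<noteq> id" for p
  proof -
    obtain i where i: "p i \<noteq> i" using p(2) by (metis eq_id_iff)
    have "degree (of_int (sign p) * (\<Prod>i\<in>UNIV. M i (p i))) \<le> degree (of_int (sign p) :: complex poly) + degree (\<Prod>i\<in>UNIV. M i (p i))"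
      by (rule degree_mult_le)
    also have "\<dots> \<le> 0 + (\<Sum>i\<in>UNIV. degree (M i (p i)))"
      using degree_prod_sum_le[of UNIV "\<lambda>i. M i (p i)"] by (intro add_mono) (auto simp: o_def)
    also have "(\<Sum>i\<in>UNIV. degree (M i (p i))) < (\<Sum>i\<in>(UNIV :: 'n set). 1)"
      by (rule sum_strict_mono_ex1) (use i in \<open>auto simp: M_def intro!: exI[of _ i]\<close>)
    finally show ?thesis by simp
  qed
  have eq: "charpoly K = (\<Prod>i\<in>UNIV. M i i) + (\<Sum>p\<in>?P - {id}. of_int (sign p) * (\<Prod>i\<in>UNIV. M i (p i)))"
    unfolding charpoly_def det_def
    by (subst sum.remove[of _ id]) (auto simp: permutes_id finite_permutations M_def sign_id)
  have "degree (\<Sum>p\<in>?P - {id}. of_int (sign p) * (\<Prod>i\<in>UNIV. M i (p i))) < CARD('n)"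
    by (rule degree_sum_less) (use small in auto)
  then show "degree (charpoly K) = CARD('n)" "lead_coeff (charpoly K) = 1"
    unfolding eq using d l by (auto simp: degree_add_eq_left coeff_eq_0)
qed

text \<open>The characteristic polynomial splits over the complex numbers and its roots are real.
  They are indexed by \<open>'n\<close> through an arbitrary bijection, as
  \<open>eigenvalue_list\<close> requires.\<close>

lemma hermitian_has_eigenvalue_list:
  assumes "ctranspose (K :: complex^'n^'n) = K"
  shows "\<exists>ev. eigenvalue_list K ev"
proof -
  define A where "A = proots (charpoly K)"
  have A: "size A = CARD('n)"
    using size_proots_complex[of "charpoly K"] by (simp add: A_def charpoly_monic)
  have A2: "charpoly K = (\<Prod>x\<in>#A. [:-x, 1:])"
    using complex_poly_decompose_multiset[of "charpoly K"] unfolding charpoly_monic(2) smult_1_left A_def by (rule sym)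
  obtain xs where xs: "mset xs = A" using ex_mset by blast
  then have len: "length xs = CARD('n)" using A by auto
  obtain h :: "'n \<Rightarrow> nat" where h: "bij_betw h UNIV {..<CARD('n)}"
    using finite_same_card_bij[of "UNIV :: 'n set" "{..<CARD('n)}"] by auto
  have real: "xs ! k \<in> \<real>" if "k < length xs" for k
  proof -
    have "xs ! k \<in># A" using that xs by auto
    then have "poly (charpoly K) (xs ! k) = 0"
      unfolding A2 by (auto simp: poly_prod_mset prod_mset_zero_iff)
    then obtain x where "x \<noteq> 0" "K *v x = xs ! k *s x"
      unfolding poly_charpoly using det_eq_0_imp_eigenvector by blast
    then show ?thesis using hermitian_eigenvalue_real[OF assms] by blast
  qed
  have "charpoly K = (\<Prod>x\<leftarrow>xs. [:-x, 1:])"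
    by (simp add: A2 xs[symmetric] flip: prod_mset_prod_list)
  also have "\<dots> = (\<Prod>k<length xs. [:- (xs ! k), 1:])"
    by (simp add: prod.list_conv_set_nth atLeast0LessThan)
  also have "\<dots> = (\<Prod>i\<in>UNIV. [:- (xs ! h i), 1:])"
    unfolding len by (rule prod.reindex_bij_betw[OF h, symmetric])
  also have "\<dots> = (\<Prod>i\<in>UNIV. [:- complex_of_real (Re (xs ! h i)), 1:])"
  proof (rule prod.cong)
    fix i :: 'n
    have "h i < length xs" using h len by (auto simp: bij_betw_def)
    then show "[:- (xs ! h i), 1:] = [:- complex_of_real (Re (xs ! h i)), 1:]" using real by simp
  qed simp
  finally have "eigenvalue_list K (\<lambda>i. Re (xs ! h i))" unfolding eigenvalue_list_def charpoly_def .
  then show ?thesis by blast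
qed

text \<open>Vieta's formulas: the product is expanded over subsets of the indices, which are then
  grouped by size; the empty set gives the leading term.\<close>

lemma elem_sym_eval:
  fixes ev :: "'n::finite \<Rightarrow> real"
  shows "(\<Prod>i\<in>UNIV. [:- ev i, 1:]) = monom 1 CARD('n) + (\<Sum>k=1..CARD('n). monom ((-1) ^ k * elem_sym k ev) (CARD('n) - k))"
proof -
  have c: "card X \<le> CARD('n)" for X :: "'n set" by (rule card_mono) auto
  have fin: "finite {X :: 'n set. card X = k}" for k by simp
  have s1: "(\<Prod>i\<in>UNIV. [:- ev i, 1:]) = (\<Prod>i\<in>UNIV. [:- ev i:] + monom 1 1)"
    by (intro prod.cong) (auto simp: monom_altdef)
  have s2: "(\<Prod>i\<in>UNIV. [:- ev i:] + monom 1 1) = (\<Sum>X\<in>Pow UNIV. (\<Prod>i\<in>X. [:- ev i:]) * (\<Prod>i\<in>UNIV - X. monom 1 1))"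
    by (rule prod_add) simp
  have s3: "(\<Sum>X\<in>Pow UNIV. (\<Prod>i\<in>X. [:- ev i:]) * (\<Prod>i\<in>UNIV - X. monom 1 1)) = (\<Sum>X\<in>UNIV. monom ((-1) ^ card X * (\<Prod>i\<in>X. ev i)) (CARD('n) - card X))"
  proof (rule sum.cong)
    fix X :: "'n set"
    have "(\<Prod>i\<in>X. [:- ev i:]) = [:\<Prod>i\<in>X. - ev i:]"
      by (induction X rule: infinite_finite_induct) (auto simp: one_pCons)
    also have "\<dots> = [:(-1) ^ card X * (\<Prod>i\<in>X. ev i):]" by (simp add: prod_uminus)
    finally have 1: "(\<Prod>i\<in>X. [:- ev i:]) = [:(-1) ^ card X * (\<Prod>i\<in>X. ev i):]" .
    have 2: "(\<Prod>i\<in>UNIV - X. monom 1 1) = (monom 1 (CARD('n) - card X) :: real poly)"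
      by (simp add: monom_power card_Diff_subset)
    show "(\<Prod>i\<in>X. [:- ev i:]) * (\<Prod>i\<in>UNIV - X. monom 1 1) = monom ((-1) ^ card X * (\<Prod>i\<in>X. ev i)) (CARD('n) - card X)"
      unfolding 1 2 by (simp add: smult_monom)
  qed auto
  have s4: "(\<Sum>X\<in>UNIV. monom ((-1) ^ card X * (\<Prod>i\<in>X. ev i)) (CARD('n) - card X)) = (\<Sum>k\<in>{0..CARD('n)}. \<Sum>X | X \<in> UNIV \<and> card X = k. monom ((-1) ^ card X * (\<Prod>i\<in>X. ev i)) (CARD('n) - card X))"
    by (rule sum.group[symmetric]) (use c in auto)
  have s5: "(\<Sum>k\<in>{0..CARD('n)}. \<Sum>X | X \<in> UNIV \<and> card X = k. monom ((-1) ^ card X * (\<Prod>i\<in>X. ev i)) (CARD('n) - card X)) = (\<Sum>k\<in>{0..CARD('n)}. monom ((-1) ^ k * elem_sym k ev) (CARD('n) - k))"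
    by (intro sum.cong) (simp_all add: elem_sym_def sum_distrib_left monom_sum)
  have s6: "(\<Sum>k\<in>{0..CARD('n)}. monom ((-1) ^ k * elem_sym k ev) (CARD('n) - k)) = monom 1 CARD('n) + (\<Sum>k=1..CARD('n). monom ((-1) ^ k * elem_sym k ev) (CARD('n) - k))"
  proof -
    have "{X :: 'n set. card X = 0} = {{}}" by auto
    then have e0: "elem_sym 0 ev = 1" by (simp add: elem_sym_def)
    have "(\<Sum>k\<in>{0..N}. F k) = F 0 + (\<Sum>k=1..N. F k)" for F :: "nat \<Rightarrow> real poly" and N
      using sum.atLeast_Suc_atMost[of 0 N F] by simp
    from this[of "\<lambda>k. monom ((-1) ^ k * elem_sym k ev) (CARD('n) - k)" "CARD('n)"] show ?thesis
      by (simp only: e0 power_0 mult_1 diff_zero)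
  qed
  show ?thesis by (rule trans[OF s1 trans[OF s2 trans[OF s3 trans[OF s4 trans[OF s5 s6]]]]])
qed

lemma eigenvalue_list_eval:
  assumes "eigenvalue_list (K :: complex^'n^'n) ev"
  shows "det (mat (of_real t) - K) = of_real (poly (\<Prod>i\<in>UNIV. [:- ev i, 1:]) t)"
proof -
  have "charpoly K = (\<Prod>i\<in>UNIV. [:- complex_of_real (ev i), 1:])"
    using assms by (simp add: eigenvalue_list_def charpoly_def)
  then show ?thesis using poly_charpoly[of K "of_real t"] by (simp add: poly_prod)
qed

lemma poly_eqI_infinite:
  fixes p q :: "'a::idom poly"
  assumes "infinite A" "\<And>x. x \<in> A \<Longrightarrow> poly p x = poly q x"
  shows "p = q"
proof (rule ccontr)
  assume "p \<noteq> q"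
  then have "finite {x. poly (p - q) x = 0}" by (intro poly_roots_finite) auto
  moreover have "A \<subseteq> {x. poly (p - q) x = 0}" using assms(2) by auto
  ultimately show False using assms(1) finite_subset by blast
qed

text \<open>\<mu> k t is the k-th coefficient of the Lagrange polynomial of the node t. The lemma
  carries statements about values p_h(t) off the spectrum over to the coefficients.\<close>

lemma lagrange_coefficients:
  fixes A :: "real set"
  assumes "finite A" "card A = n"
  shows "\<exists>\<mu> :: nat \<Rightarrow> real \<Rightarrow> real. \<forall>p. degree p < n \<longrightarrow> (\<forall>k. coeff p k = (\<Sum>t\<in>A. \<mu> k t * poly p t))"
proof -
  define L where "L t = (\<Prod>s\<in>A - {t}. smult (1 / (t - s)) [:- s, 1:])" for t
  have L: "poly (L t) s = (if s = t then 1 else 0)" if "s \<in> A" "t \<in> A" for s t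
    using that assms(1) by (auto simp: L_def poly_prod diff_divide_distrib[symmetric] intro!: prod.neutral prod_zero)
  have degL: "degree (L t) < n" if "t \<in> A" for t
  proof -
    have "degree (L t) \<le> (\<Sum>s\<in>A - {t}. 1)"
      unfolding L_def by (rule order_trans[OF degree_prod_sum_le]) (use assms in \<open>auto intro!: sum_mono simp: o_def\<close>)
    also have "\<dots> < n" using that assms card_gt_0_iff[of A] by auto
    finally show ?thesis .
  qed
  have "coeff p k = (\<Sum>t\<in>A. coeff (L t) k * poly p t)" if p: "degree p < n" for p k
  proof -
    have "p = (\<Sum>t\<in>A. smult (poly p t) (L t))"
    proof (rule poly_eqI_degree[of A])
      fix s assume s: "s \<in> A"
      have "(\<Sum>t\<in>A. poly p t * poly (L t) s) = (\<Sum>t\<in>A. if s = t then poly p t else 0)"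
        using s by (intro sum.cong) (auto simp: L)
      then show "poly p s = poly (\<Sum>t\<in>A. smult (poly p t) (L t)) s"
        using s assms(1) by (simp add: poly_sum)
    next
      show "degree (\<Sum>t\<in>A. smult (poly p t) (L t)) < card A"
        using p assms degL by (intro degree_sum_less) (auto intro: le_less_trans[OF degree_smult_le])
    qed (use p assms in auto)
    from arg_cong[OF this, of "\<lambda>p. coeff p k"] show ?thesis
      by (simp add: coeff_sum mult.commute)
  qed
  then show ?thesis by (intro exI[of _ "\<lambda>k t. coeff (L t) k"]) auto
qed

lemma smooth_on_matrix_mult: 
  fixes f :: "'z::real_normed_vector \<Rightarrow> complex^'n^'m" and g :: "'z \<Rightarrow> complex^'k^'n"
  shows "smooth_on S f \<Longrightarrow> smooth_on S g \<Longrightarrow> smooth_on S (\<lambda>x. f x ** g x)"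
  by (rule smooth_on_bilinear[OF bounded_bilinear_matrix_mult])

lemma finite_charpoly_roots: "finite {t. det (mat t - (K :: complex^'n^'n)) = 0}"
proof -
  have "charpoly K \<noteq> 0" using charpoly_monic(2)[of K] by auto
  then have "finite {t. poly (charpoly K) t = 0}" by (rule poly_roots_finite)
  then show ?thesis by (simp add: poly_charpoly)
qed

section \<open>Connectedness of the unitary group\<close>

lemma infinite_unit_circle: "infinite {z :: complex. norm z = 1}"
proof
  assume "finite {z :: complex. norm z = 1}"
  then have "finite (Re ` {z :: complex. norm z = 1})" by (rule finite_imageI)
  moreover have "{0<..<1} \<subseteq> Re ` {z :: complex. norm z = 1}"
  proof
    fix x :: real assume x: "x \<in> {0<..<1}"
    then have "x\<^sup>2 \<le> 1" by (simp add: power_le_one)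
    then have "norm (Complex x (sqrt (1 - x\<^sup>2))) = 1" by (simp add: cmod_def)
    then show "x \<in> Re ` {z :: complex. norm z = 1}" by (intro image_eqI[of _ _ "Complex x (sqrt (1 - x\<^sup>2))"]) auto
  qed
  ultimately have "finite {0::real<..<1}" by (rule rev_finite_subset)
  then show False by (simp add: infinite_Ioo)
qed

lemma mat_mult_mat: "mat c ** mat d = (mat (c * d) :: complex^'n^'n)"
  by (simp add: mat_def matrix_matrix_mult_def vec_eq_iff if_distrib[of "\<lambda>z. z * _"] if_distrib[of "\<lambda>z. _ * z"] sum.If_cases cong: if_cong)

lemma mat_2_mult: "mat 2 ** (A :: complex^'n^'n) = A + A"
  by (simp add: mat_def matrix_matrix_mult_def vec_eq_iff if_distrib[of "\<lambda>z. z * _"] sum.If_cases cong: if_cong)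

lemma mat_0_mult: "mat 0 ** (A :: complex^'n^'n) = 0"
  by (simp add: mat_def matrix_matrix_mult_def vec_eq_iff)

lemma mat_left_commute: "(A :: complex^'n^'n) ** (mat c ** B) = mat c ** (A ** (B :: complex^'n^'n))"
  by (simp only: matrix_mul_assoc mat_mult_commute[of c A, symmetric])

lemma mat_mult_mult: "mat c ** (mat d ** B) = mat (c * d) ** (B :: complex^'n^'n)"
  by (simp add: matrix_mul_assoc mat_mult_mat)

lemma linear_bilinear_right: "bounded_bilinear B \<Longrightarrow> linear L \<Longrightarrow> linear (\<lambda>v. B c (L v))"
  using linear_compose[of L "B c"] bounded_linear.linear[OF bounded_bilinear.bounded_linear_right] by (auto simp: o_def)

lemma linear_bilinear_left: "bounded_bilinear B \<Longrightarrow> linear L \<Longrightarrow> linear (\<lambda>v. B (L v) c)"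
  using linear_compose[of L "\<lambda>x. B x c"] bounded_linear.linear[OF bounded_bilinear.bounded_linear_left] by (auto simp: o_def)

text \<open>For skew S the number <x, Sx> is imaginary, so a kernel vector x = - r S x has <x, x> =
  0.\<close>

lemma skew_one_plus_invertible:
  fixes S :: "complex^'n^'n"
  assumes "ctranspose S = - S"
  shows "\<exists>R. R ** (mat 1 + mat (of_real r) ** S) = mat 1"
  unfolding matrix_left_invertible_ker
proof (intro allI impI)
  fix x assume "(mat 1 + mat (of_real r) ** S) *v x = 0"
  then have eq: "x = - (of_real r *s (S *v x))"
    by (simp add: matrix_add_simps matrix_vector_mul_assoc[symmetric] mat_mult_vector eq_neg_iff_add_eq_0)
  have neg: "herm x (- z) = - herm x z" for z
    using bounded_bilinear.minus_right[OF bounded_bilinear_herm] .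
  have "herm x x = - (of_real r * herm x (S *v x))"
    by (subst (2) eq) (simp add: neg herm_smult)
  moreover have "cnj (herm x (S *v x)) = - herm x (S *v x)"
    by (simp add: herm_commute herm_matrix assms matrix_add_simps neg)
  then have "Re (herm x (S *v x)) = 0" by (metis add.inverse_inverse cnj.sel(1) eq_neg_iff_add_eq_0 minus_complex.sel(1) mult_2 mult_eq_0_iff uminus_complex.sel(1) zero_neq_numeral)
  ultimately have "Re (herm x x) = 0" by simp
  then show "x = 0" by (simp add: inner_eq_Re_herm[symmetric])
qed

text \<open>The unitary group is connected by smooth curves: multiplication by phases leads to a matrix
  in the domain of the Cayley transform.\<close>

lemma unitary_connected:
  fixes a :: "complex^'n^'n"
  assumes a: "ctranspose a ** a = mat 1"
  shows "\<exists>(c1 :: real \<Rightarrow> complex^'n^'n) (c2 :: real \<Rightarrow> complex^'n^'n). smooth_on UNIV c1 \<and> smooth_on UNIV c2 \<and>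
    (\<forall>r. ctranspose (c1 r) ** c1 r = mat 1) \<and> (\<forall>r. ctranspose (c2 r) ** c2 r = mat 1) \<and>
    c1 0 = a \<and> c1 1 = c2 1 \<and> c2 0 = mat 1"
proof -
  have "infinite ({z. norm z = 1} - {t. det (mat t - (- a)) = 0})"
    using infinite_unit_circle finite_charpoly_roots by (rule Diff_infinite_finite[rotated])
  then have "{z. norm z = 1} - {t. det (mat t - (- a)) = 0} \<noteq> {}"
    by (metis finite.emptyI)
  \<comment> \<open>A phase z such that -z is not an eigenvalue of \<open>a\<close>.\<close>
  then obtain z where z: "norm z = 1" "det (mat z - (- a)) \<noteq> 0" by blast
  define \<theta> where "\<theta> = - Arg z"
  have zexp: "z = exp (\<i> * of_real (Arg z))"
    using Arg_eq[of z] z(1) by force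
  have z1: "exp (\<i> * of_real \<theta>) * z = 1"
    by (subst zexp) (simp add: \<theta>_def exp_add[symmetric])
  \<comment> \<open>Rotates \<open>a\<close> by phases to a / z, which does not have the eigenvalue
    -1, so that its Cayley transform exists.\<close>
  define c1 where "c1 r = mat (exp (\<i> * of_real (r * \<theta>))) ** a" for r :: real
  define b where "b = c1 1"
  have c1_smooth: "smooth_on UNIV c1"
  proof -
    have "C_k_on k UNIV (\<lambda>r. c * exp (\<i> * of_real (r * \<theta>)))" for k c
    proof (induction k arbitrary: c)
      case 0
      show ?case by (auto intro!: continuous_intros)
    next
      case (Suc k)
      show ?case
      proof (rule C_k_on_SucI)
        fix r :: real
        have g: "((\<lambda>r. \<i> * complex_of_real (r * \<theta>)) has_derivative (\<lambda>v. \<i> * of_real (v * \<theta>))) (at r)"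
          by (auto intro!: derivative_eq_intros)
        note e = has_derivative_compose[OF g DERIV_exp[unfolded has_field_derivative_def]]
        show "((\<lambda>r. c * exp (\<i> * of_real (r * \<theta>))) has_derivative (\<lambda>v. v *\<^sub>R ((c * \<i> * of_real \<theta>) * exp (\<i> * of_real (r * \<theta>))))) (at r)"
          by (rule has_derivative_eq_rhs[OF has_derivative_mult_right[OF e, of c]])
             (auto simp: scaleR_conv_of_real algebra_simps)
      next
        show "C_k_on k UNIV (\<lambda>r. v *\<^sub>R ((c * \<i> * of_real \<theta>) * exp (\<i> * of_real (r * \<theta>))))" for v :: real
          by (intro C_k_on_bounded_linear_compose[OF bounded_linear_scaleR_right] Suc) simp
      qed simp
    qed
    from this[of _ 1] have "smooth_on UNIV (\<lambda>r. exp (\<i> * complex_of_real (r * \<theta>)))" by (simp add: smooth_on_def)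
    then show ?thesis
      unfolding c1_def by (intro smooth_on_matrix_mult smooth_on_const open_UNIV smooth_on_bounded_linear[OF bounded_linear_mat])
  qed
  have c1_unitary: "ctranspose (c1 r) ** c1 r = mat 1" for r
  proof -
    have "ctranspose (c1 r) ** c1 r = ctranspose a ** (mat (cnj (exp (\<i> * of_real (r * \<theta>)))) ** mat (exp (\<i> * of_real (r * \<theta>)))) ** a"
      by (simp add: c1_def ctranspose_mult ctranspose_mat matrix_mul_assoc)
    moreover have "cnj (exp (\<i> * of_real (r * \<theta>))) * exp (\<i> * of_real (r * \<theta>)) = 1"
      by (simp add: exp_cnj exp_add[symmetric])
    ultimately show ?thesis by (simp only: mat_mult_mat matrix_mul_rid a)
  qed
  have b: "ctranspose b ** b = mat 1" using c1_unitary by (simp add: b_def)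
  have b': "b ** ctranspose b = mat 1" using b matrix_left_right_inverse by blast
  have "mat 1 + b = mat (exp (\<i> * of_real \<theta>)) ** (mat z - (- a))"
    by (simp add: b_def c1_def matrix_add_simps mat_mult_mat z1)
  moreover have "det (mat (exp (\<i> * of_real \<theta>)) :: complex^'n^'n) \<noteq> 0"
  proof -
    have "(mat z :: complex^'n^'n) ** mat (exp (\<i> * of_real \<theta>)) = mat 1"
      using z1 by (simp add: mat_mult_mat mult.commute)
    from arg_cong[OF this, of det] show ?thesis by (auto simp: det_mul)
  qed
  ultimately have "det (mat 1 + b) \<noteq> 0" using z(2) by (simp add: det_mul)
  then obtain B where B: "(mat 1 + b) ** B = mat 1" "B ** (mat 1 + b) = mat 1"
    unfolding invertible_det_nz[symmetric] invertible_def by blast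
  \<comment> \<open>The Cayley transform of \<open>b\<close>; it is skew, and the same formula
    recovers \<open>b\<close> from it.\<close>
  define S where "S = (mat 1 - b) ** B"
  have comm: "B ** (mat 1 - b) = S"
  proof -
    have "(mat 1 + b) ** (mat 1 - b) = (mat 1 - b) ** (mat 1 + b)" by (simp add: matrix_add_simps)
    then have "B ** ((mat 1 + b) ** (mat 1 - b)) ** B = B ** ((mat 1 - b) ** (mat 1 + b)) ** B" by simp
    then show ?thesis
      unfolding S_def by (metis B matrix_mul_assoc matrix_mul_lid matrix_mul_rid)
  qed
  have skew: "ctranspose S = - S"
  proof -
    let ?B = "ctranspose B"
    have B2: "?B ** (mat 1 + ctranspose b) = mat 1"
      using arg_cong[OF B(1), of ctranspose] by (simp add: ctranspose_mult ctranspose_add ctranspose_mat)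
    have "mat 1 - ctranspose b = - (ctranspose b ** (mat 1 - b))" "mat 1 + ctranspose b = ctranspose b ** (mat 1 + b)"
      by (simp_all add: matrix_add_simps b)
    then have "?B ** (ctranspose b ** (mat 1 + b)) = mat 1" using B2 by simp
    then have "?B ** ctranspose b ** (mat 1 + b) ** B = B" by (simp add: matrix_mul_assoc)
    then have "?B ** ctranspose b = B" by (simp add: matrix_mul_assoc[symmetric] B(1))
    moreover have "ctranspose S = ?B ** (mat 1 - ctranspose b)"
      by (simp add: S_def ctranspose_mult ctranspose_diff ctranspose_mat)
    ultimately show ?thesis
      by (simp only: \<open>mat 1 - ctranspose b = _\<close> bounded_bilinear.minus_right[OF bounded_bilinear_matrix_mult] matrix_mul_assoc comm)
  qed
  obtain R where R: "\<And>r. R r ** (mat 1 + mat (of_real r) ** S) = mat 1"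
    using skew_one_plus_invertible[OF skew] by metis
  have R': "(mat 1 + mat (of_real r) ** S) ** R r = mat 1" for r using R matrix_left_right_inverse by blast
  \<comment> \<open>The inverse Cayley transform of the segment from 0 to \<open>S\<close>, a curve
    of unitary matrices from 1 to \<open>b\<close>.\<close>
  define c2 where "c2 r = (mat 1 - mat (of_real r) ** S) ** R r" for r
  have smN: "smooth_on UNIV (\<lambda>r. mat (of_real r) ** S)"
    by (intro smooth_on_matrix_mult smooth_on_const open_UNIV smooth_on_bounded_linear[OF bounded_linear_mat]
        smooth_on_bounded_linear[OF bounded_linear_of_real] smooth_on_id)
  have c2_smooth: "smooth_on UNIV c2"
    unfolding c2_def
    by (intro smooth_on_matrix_mult smooth_on_diff smooth_on_const open_UNIV smN smooth_on_matrix_inverse[OF _ R] smooth_on_add)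
  have c2_unitary: "ctranspose (c2 r) ** c2 r = mat 1" for r
  proof -
    let ?N = "mat (of_real r) ** S"
    have cN: "ctranspose ?N = - ?N"
      by (simp add: ctranspose_mult ctranspose_mat skew matrix_add_simps mat_mult_commute)
    have cR: "ctranspose (R r) ** (mat 1 - ?N) = mat 1"
      using arg_cong[OF R'[of r], of ctranspose]
      by (simp add: ctranspose_mult[of "mat 1 + ?N" "R r"] ctranspose_add ctranspose_mat cN)
    have "ctranspose (c2 r) ** c2 r = ctranspose (R r) ** ((mat 1 + ?N) ** (mat 1 - ?N)) ** R r"
      by (simp add: c2_def ctranspose_mult[of "mat 1 - ?N" "R r"] ctranspose_diff ctranspose_mat cN matrix_mul_assoc)
    also have "(mat 1 + ?N) ** (mat 1 - ?N) = (mat 1 - ?N) ** (mat 1 + ?N)" by (simp add: matrix_add_simps)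
    also have "ctranspose (R r) ** ((mat 1 - ?N) ** (mat 1 + ?N)) ** R r = (ctranspose (R r) ** (mat 1 - ?N)) ** ((mat 1 + ?N) ** R r)"
      by (simp add: matrix_mul_assoc)
    finally show ?thesis by (simp add: cR R')
  qed
  have "c2 0 = mat 1"
    using R[of 0] by (simp add: c2_def mat_0_mult)
  moreover have "c2 1 = b"
  proof -
    have 1: "mat 1 + S = mat 2 ** B" 
    proof -
      have "(mat 1 + b) ** B + (mat 1 - b) ** B = mat 1 + S" by (simp add: B S_def)
      then show ?thesis by (simp add: matrix_add_simps mat_2_mult)
    qed
    have 2: "mat 1 - S = b ** (mat 2 ** B)"
    proof -
      have "(mat 1 + b) ** B - (mat 1 - b) ** B = mat 1 - S" by (simp add: B S_def)
      moreover have "(mat 1 + b) ** B - (mat 1 - b) ** B = b ** B + b ** B" by (simp add: matrix_add_simps)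
      ultimately show ?thesis by (simp only: mat_2_mult matrix_add_simps)
    qed
    have "c2 1 = b ** ((mat 1 + S) ** R 1)" by (simp add: c2_def 1 2 matrix_mul_assoc)
    also have "(mat 1 + S) ** R 1 = mat 1" using R'[of 1] by simp
    finally show ?thesis by simp
  qed
  moreover have "c1 0 = a" by (simp add: c1_def)
  ultimately show ?thesis
    using c1_smooth c2_smooth c1_unitary c2_unitary unfolding b_def by metis
qed

lemma hermitian_real_det:
  assumes "ctranspose (K :: complex^'n^'n) = K"
  shows "cnj (det (mat (of_real t) - K)) = det (mat (of_real t) - K)"
  using det_ctranspose[of "mat (of_real t) - K"] by (simp add: ctranspose_diff ctranspose_mat assms)

section \<open>The structure equations in a local frame\<close>

text \<open>The differential equations of \<open>(H, T, V)\<close> pulled back along a local section, i.e. a smooth field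
  \<open>a\<close> of unitary coframes on an open subset of \<open>complex ^ 'n\<close>.\<close>

locale bk_local =
  fixes S :: "(complex^'n) set" and a E Hs :: "complex^'n \<Rightarrow> complex^'n^'n" and Ts :: "complex^'n \<Rightarrow> complex^'n"
    and Vs :: "complex^'n \<Rightarrow> complex" and \<phi> :: "complex^'n \<Rightarrow> complex^'n \<Rightarrow> complex^'n^'n"
  assumes a_smooth: "smooth_on S a"
    and E: "y \<in> S \<Longrightarrow> E y ** a y = mat 1"
    and Hs: "y \<in> S \<Longrightarrow> ctranspose (Hs y) = Hs y"
    and torsion: "y \<in> S \<Longrightarrow> frechet_derivative a (at y) v *v w - frechet_derivative a (at y) w *v v =
       - (\<phi> y v *v (a y *v w) - \<phi> y w *v (a y *v v))"
    and skew: "y \<in> S \<Longrightarrow> ctranspose (\<phi> y v) = - \<phi> y v"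
    and dirH: "y \<in> S \<Longrightarrow> ((\<lambda>r. Hs (y + r *\<^sub>R v)) has_vector_derivative
       - (\<phi> y v ** Hs y) + Hs y ** \<phi> y v + outer (Ts y) (a y *v v) + outer (a y *v v) (Ts y)) (at 0)"
    and dirT: "y \<in> S \<Longrightarrow> ((\<lambda>r. Ts (y + r *\<^sub>R v)) has_vector_derivative
       - (\<phi> y v *v Ts y) + (Hs y ** Hs y + mat (trace (Hs y)) ** Hs y + mat (Vs y)) *v (a y *v v)) (at 0)"
    and dirV: "y \<in> S \<Longrightarrow> ((\<lambda>r. Vs (y + r *\<^sub>R v)) has_vector_derivative
       trace (Hs y) * (herm (Ts y) (a y *v v) + herm (a y *v v) (Ts y)) +
       (herm (Ts y) (Hs y *v (a y *v v)) + herm (a y *v v) (Hs y *v Ts y))) (at 0)"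
begin

lemma open_S: "open S" using a_smooth by (rule smooth_on_open)

lemma aE: "y \<in> S \<Longrightarrow> a y ** E y = mat 1"
  using E matrix_left_right_inverse by blast

lemma E_smooth: "smooth_on S E"
  by (rule smooth_on_matrix_inverse[OF a_smooth E])

definition Da where "Da y = frechet_derivative a (at y)"

lemma Da: "y \<in> S \<Longrightarrow> (a has_derivative Da y) (at y)"
  unfolding Da_def by (rule smooth_on_has_derivative[OF a_smooth])

lemma linear_Da: "y \<in> S \<Longrightarrow> linear (Da y)"
  using Da has_derivative_linear by blast

text \<open>Up to the factor \<open>E y\<close> this is the connection form in the coordinates of
  the chart, i.e. the gauge transform of \<phi> by the frame.\<close>

definition \<Gamma> where "\<Gamma> y v = Da y v + \<phi> y v ** a y"

lemma \<Gamma>_sym: "y \<in> S \<Longrightarrow> \<Gamma> y v *v w = \<Gamma> y w *v v"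
  using torsion[of y v w]
  by (simp add: \<Gamma>_def Da_def matrix_add_simps matrix_vector_mul_assoc[symmetric] algebra_simps)

lemma \<Gamma>_add: "y \<in> S \<Longrightarrow> \<Gamma> y (v + w) = \<Gamma> y v + \<Gamma> y w"
  by (subst matrix_eq) (simp add: matrix_add_simps \<Gamma>_sym[of y _ x for x] del: vector_matrix_mult_def)

text \<open>Torsion-freeness makes \<open>\<Gamma> y v *v w\<close> symmetric in v and w, and it is
  complex linear in w; hence it is complex linear in v, i.e. the connection has type (1,0).\<close>

lemma \<Gamma>_smult: "y \<in> S \<Longrightarrow> \<Gamma> y (c *s v) = mat c ** \<Gamma> y v"
proof (subst matrix_eq, rule allI)
  fix x assume y: "y \<in> S"
  have "\<Gamma> y (c *s v) *v x = c *s (\<Gamma> y v *v x)"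
    by (simp add: \<Gamma>_sym[OF y, of _ x] matrix_vector_smult)
  then show "\<Gamma> y (c *s v) *v x = mat c ** \<Gamma> y v *v x"
    by (simp add: matrix_vector_mul_assoc[symmetric] mat_mult_vector)
qed

text \<open>The derivative of the Gram matrix \<open>ctranspose (a y) ** a y\<close> of the metric
  in direction v.\<close>

definition DG where "DG y v = ctranspose (Da y v) ** a y + ctranspose (a y) ** Da y v"

text \<open>Skewness of \<phi> splits \<open>DG y v\<close> into a part linear and a part antilinear
  in v. The combination with the direction \<open>\<i> *s v\<close> isolates the linear one, so
  \<Gamma> and \<phi> are given by the frame and its first derivatives.\<close>

lemma \<Gamma>_eq:
  assumes y: "y \<in> S"
  shows "\<Gamma> y v = mat (1/2) ** ctranspose (E y) ** (DG y v - mat \<i> ** DG y (\<i> *s v))"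
proof -
  have G: "DG y v = ctranspose (a y) ** \<Gamma> y v + ctranspose (\<Gamma> y v) ** a y" for v
    by (simp add: \<Gamma>_def DG_def ctranspose_add ctranspose_mult skew[OF y] matrix_add_simps matrix_mul_assoc)
  have i: "mat \<i> ** (ctranspose (a y) ** (mat \<i> ** \<Gamma> y v)) = - (ctranspose (a y) ** \<Gamma> y v)"
  proof -
    have "mat \<i> ** (ctranspose (a y) ** (mat \<i> ** \<Gamma> y v)) = (mat \<i> ** mat \<i>) ** (ctranspose (a y) ** \<Gamma> y v)"
      by (simp only: mat_left_commute[of "ctranspose (a y)"] mat_mult_mult mat_mult_mat)
    also have "(mat \<i> :: complex^'n^'n) ** mat \<i> = - mat 1"
      by (simp add: mat_mult_mat) (simp add: mat_def vec_eq_iff)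
    finally show ?thesis by (simp add: matrix_add_simps)
  qed
  have j: "mat \<i> ** (ctranspose (mat \<i> ** \<Gamma> y v) ** a y) = ctranspose (\<Gamma> y v) ** a y"
  proof -
    have "mat \<i> ** (ctranspose (mat \<i> ** \<Gamma> y v) ** a y) = (mat \<i> ** mat (- \<i>)) ** (ctranspose (\<Gamma> y v) ** a y)"
      by (simp only: ctranspose_mult ctranspose_mat complex_cnj_i mat_mult_commute[of "- \<i>" "ctranspose (\<Gamma> y v)", symmetric] matrix_mul_assoc)
    then show ?thesis by (simp add: mat_mult_mat)
  qed
  have "DG y v - mat \<i> ** DG y (\<i> *s v) = ctranspose (a y) ** \<Gamma> y v + ctranspose (a y) ** \<Gamma> y v"
    unfolding G \<Gamma>_smult[OF y] by (simp add: matrix_add_simps i j)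
  also have "\<dots> = mat 2 ** (ctranspose (a y) ** \<Gamma> y v)"
    by (simp add: mat_def matrix_matrix_mult_def vec_eq_iff if_distrib[of "\<lambda>z. z * _"] sum.If_cases cong: if_cong)
  finally have e: "DG y v - mat \<i> ** DG y (\<i> *s v) = mat 2 ** (ctranspose (a y) ** \<Gamma> y v)" .
  have "ctranspose (E y) ** ctranspose (a y) = mat 1"
    by (simp add: ctranspose_mult[symmetric] aE[OF y] ctranspose_mat)
  then have "ctranspose (E y) ** (ctranspose (a y) ** \<Gamma> y v) = \<Gamma> y v"
    by (simp add: matrix_mul_assoc)
  then show ?thesis
    by (simp add: e matrix_mul_assoc[symmetric] mat_left_commute[of "ctranspose (E y)"] mat_mult_mult)
qed

lemma \<phi>_eq: "y \<in> S \<Longrightarrow> \<phi> y v = (\<Gamma> y v - Da y v) ** E y"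
  by (simp add: \<Gamma>_def matrix_mul_assoc[symmetric] aE)

lemma continuous_on_\<phi>: "continuous_on S (\<lambda>y. \<phi> y v)"
proof -
  have Da': "smooth_on S (\<lambda>y. Da y v)" for v
    unfolding Da_def by (rule smooth_on_frechet[OF a_smooth])
  have "smooth_on S (\<lambda>y. (mat (1/2) ** ctranspose (E y) ** (DG y v - mat \<i> ** DG y (\<i> *s v)) - Da y v) ** E y)"
    unfolding DG_def
    by (intro smooth_on_matrix_mult smooth_on_diff smooth_on_add smooth_on_const open_S Da' E_smooth a_smooth
        smooth_on_bounded_linear[OF bounded_linear_ctranspose])
  then show ?thesis
    by (rule continuous_on_eq[OF smooth_on_imp_continuous]) (simp add: \<phi>_eq \<Gamma>_eq)
qed

lemma linear_\<Gamma>: assumes y: "y \<in> S" shows "linear (\<Gamma> y)"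
proof (rule linearI)
  show "\<Gamma> y (r *\<^sub>R v) = r *\<^sub>R \<Gamma> y v" for r v
  proof -
    have "r *\<^sub>R v = of_real r *s v" by (simp add: vec_eq_iff scaleR_conv_of_real[symmetric])
    moreover have "mat (of_real r) ** \<Gamma> y v = r *\<^sub>R \<Gamma> y v"
      by (simp add: mat_def matrix_matrix_mult_def vec_eq_iff if_distrib[of "\<lambda>z. z * _"] scaleR_conv_of_real[symmetric] sum.If_cases cong: if_cong)
    ultimately show ?thesis by (simp add: \<Gamma>_smult[OF y])
  qed
qed (simp add: \<Gamma>_add[OF y])

lemma linear_\<phi>: assumes y: "y \<in> S" shows "linear (\<phi> y)"
proof -
  have "linear (\<lambda>v. (\<Gamma> y v - Da y v) ** E y)"
    using linear_compose[OF linear_compose_sub[OF linear_\<Gamma>[OF y] linear_Da[OF y]]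
        bounded_linear.linear[OF bounded_bilinear.bounded_linear_left[OF bounded_bilinear_matrix_mult]], of "E y"]
    by (simp add: o_def)
  then show ?thesis by (simp add: \<phi>_eq[OF y, abs_def])
qed

text \<open>The right-hand side of the equation for the triple \<open>(H, T, V)\<close>, with the
  triple q as an independent variable; this is the form that
  \<open>directional_derivatives_imp_has_derivative\<close> asks for.\<close>

definition \<Phi> where
  "\<Phi> y q v = (let h = fst q; t = fst (snd q); w = snd (snd q); u = a y *v v in
     (- (\<phi> y v ** h) + h ** \<phi> y v + outer t u + outer u t,
      - (\<phi> y v *v t) + (h ** h + mat (trace h) ** h + mat w) *v u,
      trace h * (herm t u + herm u t) + (herm t (h *v u) + herm u (h *v t))))"

lemma \<Phi>_continuous: "continuous_on (S \<times> UNIV) (\<lambda>(y, q). \<Phi> y q v)"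
proof -
  note cf = continuous_on_fst[OF continuous_on_id] continuous_on_snd[OF continuous_on_id]
  have 1: "continuous_on (S \<times> UNIV) (\<lambda>p. \<phi> (fst p) v)"
    by (rule continuous_on_compose2[OF continuous_on_\<phi> cf(1)]) auto
  have 2: "continuous_on (S \<times> UNIV) (\<lambda>p. a (fst p))"
    by (rule continuous_on_compose2[OF smooth_on_imp_continuous[OF a_smooth] cf(1)]) auto
  note cmm = bounded_bilinear.continuous_on[OF bounded_bilinear_matrix_mult]
  note cmv = bounded_bilinear.continuous_on[OF bounded_bilinear_matrix_vector_mult]
  note co = bounded_bilinear.continuous_on[OF bounded_bilinear_outer]
  note ch = bounded_bilinear.continuous_on[OF bounded_bilinear_herm]
  note ct = bounded_linear.continuous_on[OF bounded_linear_trace]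
  note cm = bounded_linear.continuous_on[OF bounded_linear_mat]
  show ?thesis
    unfolding \<Phi>_def Let_def case_prod_unfold
    by (intro continuous_on_Pair continuous_on_add continuous_on_mult continuous_on_minus cmm cmv co ch ct cm 1 2
        continuous_on_fst continuous_on_snd continuous_on_id continuous_on_const)
qed

lemma \<Phi>_linear: assumes y: "y \<in> S" shows "linear (\<Phi> y q)"
proof -
  have la: "linear (\<lambda>v. a y *v v)"
    using bounded_linear.linear[OF bounded_bilinear.bounded_linear_right[OF bounded_bilinear_matrix_vector_mult]] .
  note l = linear_\<phi>[OF y] la
  note lb = linear_bilinear_right[OF bounded_bilinear_matrix_mult] linear_bilinear_left[OF bounded_bilinear_matrix_mult]
    linear_bilinear_right[OF bounded_bilinear_matrix_vector_mult] linear_bilinear_left[OF bounded_bilinear_matrix_vector_mult]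
    linear_bilinear_right[OF bounded_bilinear_outer] linear_bilinear_left[OF bounded_bilinear_outer]
    linear_bilinear_right[OF bounded_bilinear_herm] linear_bilinear_left[OF bounded_bilinear_herm]
    linear_bilinear_right[OF bounded_bilinear_mult]
  have "linear (\<lambda>v. fst (\<Phi> y q v))" "linear (\<lambda>v. fst (snd (\<Phi> y q v)))" "linear (\<lambda>v. snd (snd (\<Phi> y q v)))"
    unfolding \<Phi>_def Let_def fst_conv snd_conv
    by (intro linear_compose_add linear_compose_neg lb l)+
  then show ?thesis by (simp add: linear_iff prod_eq_iff)
qed

lemma has_derivatives:
  assumes y: "y \<in> S"
  shows "(Hs has_derivative (\<lambda>v. - (\<phi> y v ** Hs y) + Hs y ** \<phi> y v + outer (Ts y) (a y *v v) + outer (a y *v v) (Ts y))) (at y)"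
    and "(Ts has_derivative (\<lambda>v. - (\<phi> y v *v Ts y) + (Hs y ** Hs y + mat (trace (Hs y)) ** Hs y + mat (Vs y)) *v (a y *v v))) (at y)"
proof -
  have F: "((\<lambda>y. (Hs y, Ts y, Vs y)) has_derivative \<Phi> y (Hs y, Ts y, Vs y)) (at y)"
  proof (rule directional_derivatives_imp_has_derivative[OF open_S _ \<Phi>_continuous \<Phi>_linear y])
    fix z v assume "z \<in> S"
    then show "((\<lambda>r. (Hs (z + r *\<^sub>R v), Ts (z + r *\<^sub>R v), Vs (z + r *\<^sub>R v))) has_vector_derivative \<Phi> z (Hs z, Ts z, Vs z) v) (at 0)"
      using dirH[of z v] dirT[of z v] dirV[of z v] unfolding \<Phi>_def Let_def fst_conv snd_conv
      by (intro has_vector_derivative_Pair)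
  qed
  from has_derivative_fst[OF F] has_derivative_fst[OF has_derivative_snd[OF F]]
  show "(Hs has_derivative (\<lambda>v. - (\<phi> y v ** Hs y) + Hs y ** \<phi> y v + outer (Ts y) (a y *v v) + outer (a y *v v) (Ts y))) (at y)"
    and "(Ts has_derivative (\<lambda>v. - (\<phi> y v *v Ts y) + (Hs y ** Hs y + mat (trace (Hs y)) ** Hs y + mat (Vs y)) *v (a y *v v))) (at y)"
    by (simp_all add: \<Phi>_def Let_def)
qed

definition Pt where "Pt t y = det (mat (of_real t) - Hs y)"
definition Rt where "Rt t y = matrix_inv (mat (of_real t) - Hs y)"
text \<open>Where \<open>Pt t y\<close> is nonzero this is the adjugate of t - H applied to T;
  elsewhere \<open>Rt\<close> is an unspecified matrix.\<close>

definition wt where "wt t y = Pt t y *s (Rt t y *v Ts y)"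

lemma Rt:
  assumes "Pt t y \<noteq> 0"
  shows "Rt t y ** (mat (of_real t) - Hs y) = mat 1" "(mat (of_real t) - Hs y) ** Rt t y = mat 1"
proof -
  have "invertible (mat (of_real t) - Hs y)" using assms by (simp add: Pt_def invertible_det_nz)
  then show "(mat (of_real t) - Hs y) ** Rt t y = mat 1"
    unfolding Rt_def matrix_inv_def invertible_def by (rule someI2_ex) simp
  then show "Rt t y ** (mat (of_real t) - Hs y) = mat 1" using matrix_left_right_inverse by blast
qed

lemma Hs_wt: "Pt t y \<noteq> 0 \<Longrightarrow> Hs y *v wt t y = of_real t *s wt t y - Pt t y *s Ts y"
proof -
  assume P: "Pt t y \<noteq> 0"
  have "(mat (of_real t) - Hs y) *v wt t y = Pt t y *s Ts y"
    by (simp add: wt_def matrix_vector_smult matrix_vector_mul_assoc Rt(2)[OF P])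
  then show ?thesis by (simp add: matrix_add_simps mat_mult_vector algebra_simps)
qed

lemma Rt_hermitian: "y \<in> S \<Longrightarrow> Pt t y \<noteq> 0 \<Longrightarrow> ctranspose (Rt t y) = Rt t y"
proof -
  assume y: "y \<in> S" and P: "Pt t y \<noteq> 0"
  have "ctranspose (Rt t y) ** (mat (of_real t) - Hs y) = mat 1"
    using arg_cong[OF Rt(2)[OF P], of ctranspose] by (simp add: ctranspose_mult ctranspose_diff ctranspose_mat Hs[OF y])
  then have "ctranspose (Rt t y) ** (mat (of_real t) - Hs y) ** Rt t y = Rt t y" by simp
  then show ?thesis by (simp add: matrix_mul_assoc[symmetric] Rt(2)[OF P])
qed

lemma Pt_real: "y \<in> S \<Longrightarrow> cnj (Pt t y) = Pt t y"
  unfolding Pt_def using hermitian_real_det Hs by blast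

lemma resolvent_has_derivative:
  assumes y: "y \<in> S"
  shows "((\<lambda>y. mat c - Hs y) has_derivative
     (\<lambda>v. - (- (\<phi> y v ** Hs y) + Hs y ** \<phi> y v + outer (Ts y) (a y *v v) + outer (a y *v v) (Ts y)))) (at y)"
  using has_derivative_diff[OF has_derivative_const has_derivatives(1)[OF y], of "mat c"] by simp

text \<open>By Jacobi's formula only trace (R dH) matters. R commutes with H, so the commutator with
  \<phi> drops out, and the two outer products contribute a Hermitian product and its
  conjugate.\<close>

lemma Pt_has_derivative:
  assumes y: "y \<in> S" and P: "Pt t y \<noteq> 0"
  shows "(Pt t has_derivative (\<lambda>v. - (herm (wt t y) (a y *v v) + herm (a y *v v) (wt t y)))) (at y)"
proof -
  let ?R = "Rt t y"
  have R1: "?R ** Hs y = mat (of_real t) ** ?R - mat 1" "Hs y ** ?R = mat (of_real t) ** ?R - mat 1"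
    using Rt[OF P] by (simp_all add: matrix_add_simps mat_mult_commute[of _ ?R] algebra_simps)
  have "Pt t y * trace (?R ** - (- (\<phi> y v ** Hs y) + Hs y ** \<phi> y v + outer (Ts y) u + outer u (Ts y))) =
      - (herm (wt t y) u + herm u (wt t y))" for v u
  proof -
    have tr: "trace (?R ** (\<phi> y v ** Hs y)) = trace (?R ** (Hs y ** \<phi> y v))"
      using R1 trace_mul_sym[of "?R ** \<phi> y v" "Hs y"] by (simp add: matrix_mul_assoc)
    have "trace (?R ** - (- (\<phi> y v ** Hs y) + Hs y ** \<phi> y v + outer (Ts y) u + outer u (Ts y))) =
       - (herm u (?R *v Ts y) + herm (Ts y) (?R *v u))"
      using tr by (simp add: matrix_add_simps trace_add trace_sub trace_outer)
    also have "herm (Ts y) (?R *v u) = herm (?R *v Ts y) u"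
      by (simp add: herm_matrix Rt_hermitian[OF y P])
    finally have F: "trace (?R ** - (- (\<phi> y v ** Hs y) + Hs y ** \<phi> y v + outer (Ts y) u + outer u (Ts y))) =
       - (herm u (?R *v Ts y) + herm (?R *v Ts y) u)" .
    show ?thesis
      unfolding F by (simp add: wt_def herm_smult Pt_real[OF y] algebra_simps)
  qed
  then show ?thesis
    using det_has_derivative[OF resolvent_has_derivative[OF y] Rt(1)[OF P]]
    by (simp add: Pt_def[abs_def])
qed

text \<open>\<open>E y *v wt t y\<close> is the dual vector field in coordinates. Its derivative
  combines the covariant derivative of \<open>wt\<close> with the connection \<Gamma>, both complex
  linear in the direction: the antilinear terms from the determinant and from the resolvent
  cancel.\<close>

lemma EW_has_derivative:
  assumes y: "y \<in> S" and P: "Pt t y \<noteq> 0"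
  shows "\<exists>D. ((\<lambda>y. E y *v wt t y) has_derivative D) (at y) \<and> (\<forall>c v. D (c *s v) = c *s D v)"
proof -
  let ?R = "Rt t y" and ?T = "Ts y" and ?H = "Hs y" and ?p = "Pt t y"
  define DH where "DH v = - (\<phi> y v ** ?H) + ?H ** \<phi> y v + outer ?T (a y *v v) + outer (a y *v v) ?T" for v
  define L where "L = ?H ** ?H + mat (trace ?H) ** ?H + mat (Vs y)"
  have "continuous_on S (Pt t)"
    unfolding Pt_def
  proof (intro continuous_at_imp_continuous_on ballI)
    fix z assume z: "z \<in> S"
    have "(\<lambda>y. (mat (of_real t) - Hs y) $ i $ k) differentiable (at z)" for i k
      using bounded_linear.has_derivative[OF bounded_linear_vec_nth bounded_linear.has_derivative[OF bounded_linear_vec_nth resolvent_has_derivative[OF z]]]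
      by (rule differentiableI)
    from differentiable_imp_continuous_within[OF det_differentiable[of "\<lambda>y. mat (of_real t) - Hs y", OF this]]
    show "isCont (\<lambda>y. det (mat (complex_of_real t) - Hs y)) z" .
  qed
  then have "open (S \<inter> Pt t -` (- {0}))"
    by (rule continuous_open_preimage) (auto intro: open_S)
  then have dR: "(Rt t has_derivative (\<lambda>v. - (?R ** - DH v ** ?R))) (at y)"
    unfolding DH_def
    by (rule matrix_inverse_has_derivative[OF _ _ resolvent_has_derivative[OF y]]) (use y P Rt in auto)
  have dT: "(Ts has_derivative (\<lambda>v. - (\<phi> y v *v ?T) + L *v (a y *v v))) (at y)"
    unfolding L_def by (rule has_derivatives(2)[OF y])
  have sm: "bounded_bilinear (\<lambda>(c :: complex) (x :: complex^'n). c *s x)"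
    unfolding bilinear_conv_bounded_bilinear[symmetric] by (auto simp: bilinear_def linear_iff vec_eq_iff algebra_simps)
  have dw: "(wt t has_derivative (\<lambda>v. ?p *s (?R *v (- (\<phi> y v *v ?T) + L *v (a y *v v)) + (- (?R ** - DH v ** ?R)) *v ?T) +
      (- (herm (wt t y) (a y *v v) + herm (a y *v v) (wt t y))) *s (?R *v ?T))) (at y)"
    unfolding wt_def[abs_def]
    by (rule bounded_bilinear.FDERIV[OF sm Pt_has_derivative[OF y P, unfolded wt_def]
          bounded_bilinear.FDERIV[OF bounded_bilinear_matrix_vector_mult dR dT]])
  \<comment> \<open>The covariant derivative of \<open>wt\<close> as a function of u =
    \<open>a y *v v\<close>, after the terms antilinear in u have cancelled.\<close>
  define Lin where "Lin u = ?p *s (?R *v (L *v u)) + (?p * herm ?T (?R *v ?T)) *s (?R *v u) - herm (wt t y) u *s (?R *v ?T)" for u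
  have dw_eq: "?p *s (?R *v (- (\<phi> y v *v ?T) + L *v (a y *v v)) + (- (?R ** - DH v ** ?R)) *v ?T) +
      (- (herm (wt t y) (a y *v v) + herm (a y *v v) (wt t y))) *s (?R *v ?T) = - (\<phi> y v *v wt t y) + Lin (a y *v v)" for v
  proof -
    let ?u = "?R *v ?T"
    have T: "?T = of_real t *s ?u - ?H *v ?u"
    proof -
      have "(mat (of_real t) - ?H) *v ?u = ?T" by (simp add: matrix_vector_mul_assoc Rt(2)[OF P])
      then show ?thesis by (simp add: matrix_add_simps mat_mult_vector)
    qed
    have Rinv: "?R *v (of_real t *s z - ?H *v z) = z" for z
    proof -
      have "?R *v ((mat (of_real t) - ?H) *v z) = z" by (simp add: matrix_vector_mul_assoc Rt(1)[OF P])
      then show ?thesis by (simp add: matrix_add_simps mat_mult_vector)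
    qed
    have "(- (?R ** - DH v ** ?R)) *v ?T = ?R *v (DH v *v ?u)"
      by (simp add: matrix_add_simps matrix_vector_mul_assoc matrix_mul_assoc)
    also have "DH v *v ?u = - (\<phi> y v *v (?H *v ?u)) + ?H *v (\<phi> y v *v ?u) + herm (a y *v v) ?u *s ?T + herm ?T ?u *s (a y *v v)"
      by (simp add: DH_def matrix_add_simps matrix_vector_mul_assoc[symmetric] outer_mult_vector)
    finally have 1: "(- (?R ** - DH v ** ?R)) *v ?T =
        ?R *v (- (\<phi> y v *v (?H *v ?u)) + ?H *v (\<phi> y v *v ?u)) + herm (a y *v v) ?u *s ?u + herm ?T ?u *s (?R *v (a y *v v))"
      by (simp add: matrix_add_simps matrix_vector_smult)
    have 2: "\<phi> y v *v ?T = of_real t *s (\<phi> y v *v ?u) - \<phi> y v *v (?H *v ?u)"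
      by (subst T) (simp add: matrix_add_simps matrix_vector_smult)
    have 3: "?R *v (- (\<phi> y v *v (?H *v ?u)) + ?H *v (\<phi> y v *v ?u)) + ?R *v (- (\<phi> y v *v ?T)) = - (\<phi> y v *v ?u)"
    proof -
      have q: "- (\<phi> y v *v (?H *v ?u)) + ?H *v (\<phi> y v *v ?u) + - (\<phi> y v *v ?T) = - (of_real t *s (\<phi> y v *v ?u) - ?H *v (\<phi> y v *v ?u))"
        unfolding 2 by simp
      have r: "?R *v (- (\<phi> y v *v (?H *v ?u)) + ?H *v (\<phi> y v *v ?u) + - (\<phi> y v *v ?T)) = - (\<phi> y v *v ?u)"
        by (simp only: q bounded_bilinear.minus_right[OF bounded_bilinear_matrix_vector_mult] Rinv)
      show ?thesis
        by (rule trans[OF bounded_bilinear.add_right[OF bounded_bilinear_matrix_vector_mult, symmetric] r])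
    qed
    have 4: "herm (a y *v v) (wt t y) = ?p * herm (a y *v v) ?u" by (simp add: wt_def herm_smult)
    have 5: "\<phi> y v *v wt t y = ?p *s (\<phi> y v *v ?u)" by (simp add: wt_def matrix_vector_smult)
    have e: "?R *v (- (\<phi> y v *v ?T) + L *v (a y *v v)) = ?R *v (- (\<phi> y v *v ?T)) + ?R *v (L *v (a y *v v))"
      by (simp only: matrix_add_simps)
    have eq: "?R *v (- (\<phi> y v *v ?T) + L *v (a y *v v)) + (- (?R ** - DH v ** ?R)) *v ?T =
      - (\<phi> y v *v ?u) + ?R *v (L *v (a y *v v)) + herm (a y *v v) ?u *s ?u + herm ?T ?u *s (?R *v (a y *v v))"
      unfolding e 1 3[symmetric] by (simp only: add_ac)
    show ?thesis
      unfolding eq Lin_def 4 5 by (simp add: vec_eq_iff algebra_simps)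
  qed
  have dw': "(wt t has_derivative (\<lambda>v. - (\<phi> y v *v wt t y) + Lin (a y *v v))) (at y)"
    using dw unfolding dw_eq .
  have dE: "(E has_derivative (\<lambda>v. - (E y ** Da y v ** E y))) (at y)"
    by (rule matrix_inverse_has_derivative[OF open_S y Da[OF y] E])
  let ?D = "\<lambda>v. E y *v (- (\<phi> y v *v wt t y) + Lin (a y *v v)) + (- (E y ** Da y v ** E y)) *v wt t y"
  have D: "((\<lambda>y. E y *v wt t y) has_derivative ?D) (at y)"
    by (rule bounded_bilinear.FDERIV[OF bounded_bilinear_matrix_vector_mult dE dw'])
  have D_eq: "?D v = - (E y *v (\<Gamma> y v *v (E y *v wt t y))) + E y *v Lin (a y *v v)" for v
  proof -
    have "a y *v (E y *v wt t y) = wt t y" by (simp add: matrix_vector_mul_assoc aE[OF y])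
    then have "\<Gamma> y v *v (E y *v wt t y) = Da y v *v (E y *v wt t y) + \<phi> y v *v wt t y"
      by (simp add: \<Gamma>_def matrix_add_simps matrix_vector_mul_assoc[symmetric])
    then show ?thesis by (simp add: matrix_add_simps matrix_vector_mul_assoc[symmetric])
  qed
  have Lin_smult: "Lin (c *s u) = c *s Lin u" for c u
    by (simp add: Lin_def matrix_vector_smult herm_smult vec_eq_iff algebra_simps)
  define G where "G v = - (E y *v (\<Gamma> y v *v (E y *v wt t y))) + E y *v Lin (a y *v v)" for v
  have "(\<lambda>v. ?D v) = G" unfolding G_def using D_eq by (rule ext)
  moreover have "G (c *s v) = c *s G v" for c v
    by (simp only: G_def \<Gamma>_smult[OF y] Lin_smult matrix_vector_smult matrix_vector_mul_assoc[symmetric] mat_mult_vector)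
       (simp add: vec_eq_iff algebra_simps)
  ultimately show ?thesis using D by (intro exI[of _ G]) simp
qed

text \<open>The resolvents are Hermitian and commute, so <R_s T, R_t T> = <T, R_s R_t T> equals its
  own conjugate.\<close>

lemma herm_wt_real:
  assumes y: "y \<in> S" and P: "Pt s y \<noteq> 0" "Pt t y \<noteq> 0"
  shows "cnj (herm (wt s y) (wt t y)) = herm (wt s y) (wt t y)"
proof -
  let ?T = "Ts y"
  have P_out: "herm (wt s y) (wt t y) = Pt s y * Pt t y * herm (Rt s y *v ?T) (Rt t y *v ?T)"
    by (simp add: wt_def herm_smult Pt_real[OF y])
  have comm: "Rt s y ** Rt t y = Rt t y ** Rt s y"
  proof -
    let ?A = "mat (of_real s) - Hs y" and ?B = "mat (of_real t) - Hs y"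
    have AB: "?A ** ?B = ?B ** ?A"
      by (simp add: matrix_add_simps mat_mult_commute[of _ "Hs y"] mat_mult_mat mult.commute)
    have X: "(Rt s y ** Rt t y) ** (?B ** ?A) = mat 1"
    proof -
      have "(Rt s y ** Rt t y) ** (?B ** ?A) = Rt s y ** (Rt t y ** ?B) ** ?A" by (simp only: matrix_mul_assoc)
      then show ?thesis by (simp only: Rt(1)[OF P(2)] Rt(1)[OF P(1)] matrix_mul_rid)
    qed
    have Y: "(?A ** ?B) ** (Rt t y ** Rt s y) = mat 1"
    proof -
      have "(?A ** ?B) ** (Rt t y ** Rt s y) = ?A ** (?B ** Rt t y) ** Rt s y" by (simp only: matrix_mul_assoc)
      then show ?thesis by (simp only: Rt(2)[OF P(2)] Rt(2)[OF P(1)] matrix_mul_rid)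
    qed
    have "Rt s y ** Rt t y = (Rt s y ** Rt t y) ** ((?B ** ?A) ** (Rt t y ** Rt s y))"
      using Y by (simp only: AB matrix_mul_rid)
    also have "\<dots> = ((Rt s y ** Rt t y) ** (?B ** ?A)) ** (Rt t y ** Rt s y)" by (simp only: matrix_mul_assoc)
    finally show ?thesis unfolding X by simp
  qed
  have "herm (Rt s y *v ?T) (Rt t y *v ?T) = herm ?T (Rt s y ** Rt t y *v ?T)"
    by (simp add: herm_matrix Rt_hermitian[OF y P(1)] matrix_vector_mul_assoc)
  moreover have "cnj (herm (Rt s y *v ?T) (Rt t y *v ?T)) = herm ?T (Rt t y ** Rt s y *v ?T)"
    by (simp only: herm_commute herm_matrix[of "Rt t y"] Rt_hermitian[OF y P(2)] matrix_vector_mul_assoc)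
  ultimately show ?thesis unfolding P_out by (simp add: comm Pt_real[OF y])
qed

end

global_interpretation vecJ: complex_structure "(*s) \<i> :: complex^'n \<Rightarrow> complex^'n"
  by unfold_locales (auto simp: linear_iff vec_eq_iff algebra_simps)

lemma smult_eq_real_combination: "c *s (v :: complex^'n) = Re c *\<^sub>R v + Im c *\<^sub>R (\<i> *s v)"
  by (simp add: vec_eq_iff complex_eq_iff)

lemma complex_diff_on_iff_cdiff: "complex_diff_on S f \<longleftrightarrow> cdiff ((*s) \<i>) S f"
proof
  assume "cdiff ((*s) \<i>) S f"
  then show "complex_diff_on S f"
    unfolding complex_diff_on_def
  proof (intro conjI ballI exI allI)
    fix y c v assume y: "y \<in> S"
    note d = cdiffD[OF \<open>cdiff ((*s) \<i>) S f\<close> y]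
    show "(f has_derivative frechet_derivative f (at y)) (at y)" by (rule d)
    show "frechet_derivative f (at y) (c *s v) = c * frechet_derivative f (at y) v"
      using has_derivative_linear[OF d(1)] d(2)[of v]
      by (simp add: smult_eq_real_combination[of c v] linear_add linear_scale complex_eq_iff)
  qed (rule cdiff_open)
qed (unfold complex_diff_on_def cdiff_def, blast)

lemma complex_diff_on_linear:
  assumes "complex_diff_on S f" "y \<in> S"
  shows "frechet_derivative f (at y) (c *s v) = c * frechet_derivative f (at y) v"
    "(f has_derivative frechet_derivative f (at y)) (at y)"
  using assms unfolding complex_diff_on_def using frechet_derivative_at by metis+

subsection \<open>Curves and plots\<close>

lemma smooth_plot_chart:
  assumes "smooth_plot A D s" "\<kappa> \<in> A"
  shows "smooth_on {t \<in> D. s t \<in> fst \<kappa>} (snd \<kappa> \<circ> s)"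
  using assms by (cases \<kappa>) (auto simp: smooth_plot_def)

lemma smooth_plotI:
  assumes "open D" "s ` D \<subseteq> points A" "\<And>\<kappa>. \<kappa> \<in> A \<Longrightarrow> smooth_on {t \<in> D. s t \<in> fst \<kappa>} (snd \<kappa> \<circ> s)"
  shows "smooth_plot A D s"
  using assms by (fastforce simp: smooth_plot_def)

lemma smooth_on_line: "open D \<Longrightarrow> smooth_on D (\<lambda>r::real. t + r *\<^sub>R (e :: 'd::real_normed_vector))"
  by (intro smooth_on_add smooth_on_const smooth_on_scaleR smooth_on_id)

lemma open_line_vimage: 
  assumes "open D" shows "open {r::real. t + r *\<^sub>R (e :: 'd::real_normed_vector) \<in> D}"
  using open_vimage[OF assms, of "\<lambda>r. t + r *\<^sub>R e"] by (simp add: vimage_def continuous_intros)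

lemma curve_at_chart:
  assumes "curve_at A p \<gamma>" "\<kappa> \<in> A" "p \<in> fst \<kappa>"
  shows "((snd \<kappa> \<circ> \<gamma>) has_vector_derivative velocity A \<gamma> 0 \<kappa>) (at 0)"
    and "\<exists>N. open N \<and> 0 \<in> N \<and> (\<forall>t\<in>N. \<gamma> t \<in> fst \<kappa>)"
proof -
  obtain D where D: "smooth_plot A D \<gamma>" "0 \<in> D" "\<gamma> 0 = p" using assms(1) by (auto simp: curve_at_def)
  note sm = smooth_plot_chart[OF D(1) assms(2)]
  have 0: "0 \<in> {t \<in> D. \<gamma> t \<in> fst \<kappa>}" using D assms by auto
  show "((snd \<kappa> \<circ> \<gamma>) has_vector_derivative velocity A \<gamma> 0 \<kappa>) (at 0)"
    using smooth_on_has_vector_derivative[OF sm 0] D(3) assms by (simp add: velocity_def)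
  show "\<exists>N. open N \<and> 0 \<in> N \<and> (\<forall>t\<in>N. \<gamma> t \<in> fst \<kappa>)"
    using smooth_on_open[OF sm] 0 by (intro exI[of _ "{t \<in> D. \<gamma> t \<in> fst \<kappa>}"]) auto
qed

lemma velocity_outside: "\<kappa> \<notin> A \<or> \<gamma> t \<notin> fst \<kappa> \<Longrightarrow> velocity A \<gamma> t \<kappa> = 0"
  by (auto simp: velocity_def)

lemma curve_at_0: "curve_at A p \<gamma> \<Longrightarrow> \<gamma> 0 = p"
  by (auto simp: curve_at_def)

lemma vector_derivative_transform:
  assumes "(f has_vector_derivative d) (at x)" "open N" "x \<in> N" "\<And>t. t \<in> N \<Longrightarrow> f t = h t"
  shows "(h has_vector_derivative d) (at x)"
  using assms has_vector_derivative_transform_within_open by blast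

lemma has_vector_derivative_compose_derivative:
  assumes "(f has_vector_derivative d) (at t)" "(F has_derivative F') (at (f t))"
  shows "((\<lambda>t. F (f t)) has_vector_derivative F' d) (at t)"
proof -
  have "((\<lambda>t. F (f t)) has_derivative (\<lambda>s. F' (s *\<^sub>R d))) (at t)"
    using has_derivative_compose[OF assms(1)[unfolded has_vector_derivative_def] assms(2)] .
  then show ?thesis
    unfolding has_vector_derivative_def using has_derivative_linear[OF assms(2)] by (simp add: linear_scale)
qed

section \<open>Charts, transition maps and tangent vectors\<close>

locale complex_mfd =
  fixes X :: "'a topology" and A :: "('a, complex^'n) chart set"
  assumes cm: "complex_manifold X A"
begin

definition ic :: "('a, complex^'n) chart \<Rightarrow> complex^'n \<Rightarrow> 'a" where
  "ic \<kappa> = inv_into (fst \<kappa>) (snd \<kappa>)"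

definition im :: "('a, complex^'n) chart \<Rightarrow> (complex^'n) set" where
  "im \<kappa> = snd \<kappa> ` fst \<kappa>"

lemma points_A: "points A = topspace X" using cm by (simp add: complex_manifold_def)

lemma chart:
  assumes "\<kappa> \<in> A"
  shows "openin X (fst \<kappa>)" "open (im \<kappa>)" "homeomorphic_map (subtopology X (fst \<kappa>)) (top_of_set (im \<kappa>)) (snd \<kappa>)"
  using assms cm by (cases \<kappa>; auto simp: complex_manifold_def im_def)+

lemma chart_inj: "\<kappa> \<in> A \<Longrightarrow> inj_on (snd \<kappa>) (fst \<kappa>)"
  using homeomorphic_imp_injective_map[OF chart(3)] chart(1)[THEN openin_subset]
  by (simp add: Int_absorb1)

lemma ic_co [simp]: "\<kappa> \<in> A \<Longrightarrow> x \<in> fst \<kappa> \<Longrightarrow> ic \<kappa> (snd \<kappa> x) = x"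
  unfolding ic_def by (rule inv_into_f_f[OF chart_inj])

lemma co_ic [simp]: "y \<in> im \<kappa> \<Longrightarrow> snd \<kappa> (ic \<kappa> y) = y"
  unfolding ic_def im_def by (rule f_inv_into_f)

lemma ic_dom [simp]: "y \<in> im \<kappa> \<Longrightarrow> ic \<kappa> y \<in> fst \<kappa>"
  unfolding ic_def im_def by (rule inv_into_into)

lemma co_im [simp]: "x \<in> fst \<kappa> \<Longrightarrow> snd \<kappa> x \<in> im \<kappa>"
  by (simp add: im_def)

lemma chart_ex: "x \<in> topspace X \<Longrightarrow> \<exists>\<kappa>\<in>A. x \<in> fst \<kappa>"
  using points_A by (auto simp: points_def)

lemma chart_subset: "\<kappa> \<in> A \<Longrightarrow> fst \<kappa> \<subseteq> topspace X"
  using points_A by (auto simp: points_def)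

lemma chart_open_image:
  assumes "\<kappa> \<in> A" "openin X W"
  shows "open (snd \<kappa> ` (fst \<kappa> \<inter> W))"
proof -
  have "openin (subtopology X (fst \<kappa>)) (fst \<kappa> \<inter> W)"
    using assms(2) by (auto simp: openin_subtopology)
  then have "openin (top_of_set (im \<kappa>)) (snd \<kappa> ` (fst \<kappa> \<inter> W))"
    using homeomorphic_imp_open_map[OF chart(3)[OF assms(1)]] by (auto simp: open_map_def)
  then show ?thesis using chart(2)[OF assms(1)] openin_open_eq by blast
qed

lemma chart_open_preimage:
  assumes "\<kappa> \<in> A" "open N"
  shows "openin X {x \<in> fst \<kappa>. snd \<kappa> x \<in> N}"
proof -
  have "continuous_map (subtopology X (fst \<kappa>)) (top_of_set (im \<kappa>)) (snd \<kappa>)"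
    using homeomorphic_imp_continuous_map[OF chart(3)[OF assms(1)]] .
  moreover have "openin (top_of_set (im \<kappa>)) (im \<kappa> \<inter> N)" using assms(2) by (auto simp: openin_open)
  ultimately have "openin (subtopology X (fst \<kappa>)) {x \<in> topspace (subtopology X (fst \<kappa>)). snd \<kappa> x \<in> im \<kappa> \<inter> N}"
    by (rule openin_continuous_map_preimage)
  then have "openin X {x \<in> topspace (subtopology X (fst \<kappa>)). snd \<kappa> x \<in> im \<kappa> \<inter> N}"
    using chart(1)[OF assms(1)] openin_trans_full by blast
  moreover have "{x \<in> topspace (subtopology X (fst \<kappa>)). snd \<kappa> x \<in> im \<kappa> \<inter> N} = {x \<in> fst \<kappa>. snd \<kappa> x \<in> N}"
    using chart_subset[OF assms(1)] by auto
  ultimately show ?thesis by simp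
qed

definition tr :: "('a, complex^'n) chart \<Rightarrow> ('a, complex^'n) chart \<Rightarrow> complex^'n \<Rightarrow> complex^'n" where
  "tr \<kappa> \<kappa>' y = snd \<kappa>' (ic \<kappa> y)"

definition Dtr :: "('a, complex^'n) chart \<Rightarrow> ('a, complex^'n) chart \<Rightarrow> complex^'n \<Rightarrow> complex^'n \<Rightarrow> complex^'n" where
  "Dtr \<kappa> \<kappa>' y = frechet_derivative (tr \<kappa> \<kappa>') (at y)"

lemma tr_complex_diff: 
  "\<kappa> \<in> A \<Longrightarrow> \<kappa>' \<in> A \<Longrightarrow> complex_diff_on (snd \<kappa> ` (fst \<kappa> \<inter> fst \<kappa>')) (\<lambda>y. tr \<kappa> \<kappa>' y $ i)"
  using cm by (cases \<kappa>; cases \<kappa>') (fastforce simp: complex_manifold_def tr_def ic_def)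

text \<open>Transition maps are given as complex differentiable; their smoothness comes from
  Cauchy's formula, through \<open>cdiff_imp_smooth_on\<close>.\<close>

lemma tr_smooth:
  assumes "\<kappa> \<in> A" "\<kappa>' \<in> A"
  shows "smooth_on (snd \<kappa> ` (fst \<kappa> \<inter> fst \<kappa>')) (tr \<kappa> \<kappa>')"
proof -
  have "smooth_on (snd \<kappa> ` (fst \<kappa> \<inter> fst \<kappa>')) (\<lambda>y. \<chi> i. tr \<kappa> \<kappa>' y $ i)"
    using tr_complex_diff[OF assms] 
    by (intro smooth_on_vec_lambda vecJ.cdiff_imp_smooth_on) (auto simp: complex_diff_on_iff_cdiff dest: cdiff_open)
  then show ?thesis by simp
qed

lemma tr_has_derivative:
  assumes "\<kappa> \<in> A" "\<kappa>' \<in> A" "x \<in> fst \<kappa>" "x \<in> fst \<kappa>'"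
  shows "(tr \<kappa> \<kappa>' has_derivative Dtr \<kappa> \<kappa>' (snd \<kappa> x)) (at (snd \<kappa> x))"
  unfolding Dtr_def by (rule smooth_on_has_derivative[OF tr_smooth[OF assms(1,2)]]) (use assms in auto)

lemma Dtr_linear:
  assumes "\<kappa> \<in> A" "\<kappa>' \<in> A" "x \<in> fst \<kappa>" "x \<in> fst \<kappa>'"
  shows "linear (Dtr \<kappa> \<kappa>' (snd \<kappa> x))" "Dtr \<kappa> \<kappa>' (snd \<kappa> x) (c *s v) = c *s Dtr \<kappa> \<kappa>' (snd \<kappa> x) v"
proof -
  note d = tr_has_derivative[OF assms]
  show "linear (Dtr \<kappa> \<kappa>' (snd \<kappa> x))" using d by (rule has_derivative_linear)
  have xin: "snd \<kappa> x \<in> snd \<kappa> ` (fst \<kappa> \<inter> fst \<kappa>')" using assms by auto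
  have "Dtr \<kappa> \<kappa>' (snd \<kappa> x) v $ i = frechet_derivative (\<lambda>y. tr \<kappa> \<kappa>' y $ i) (at (snd \<kappa> x)) v" for v i
    using frechet_derivative_at[OF bounded_linear.has_derivative[OF bounded_linear_vec_nth d]] by metis
  then show "Dtr \<kappa> \<kappa>' (snd \<kappa> x) (c *s v) = c *s Dtr \<kappa> \<kappa>' (snd \<kappa> x) v"
    by (simp add: vec_eq_iff complex_diff_on_linear(1)[OF tr_complex_diff[OF assms(1,2)] xin])
qed

text \<open>\<open>smooth_plot\<close> quantifies over all charts; a plot inside one chart domain is
  carried to the others by the smooth transition maps. The parameters that land in another chart
  form an open set because the overlap of the domains has open image.\<close>

lemma plot_in_chart:
  fixes s :: "'d::real_normed_vector \<Rightarrow> 'a"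
  assumes k: "\<kappa> \<in> A" and D: "s ` D \<subseteq> fst \<kappa>" and sm: "smooth_on D (\<lambda>t. snd \<kappa> (s t))"
  shows "smooth_plot A D s"
proof (rule smooth_plotI)
  note oD = smooth_on_open[OF sm]
  show "open D" by (rule oD)
  show "s ` D \<subseteq> points A" using D k by (auto simp: points_def)
  fix \<kappa>' assume k': "\<kappa>' \<in> A"
  let ?N = "snd \<kappa> ` (fst \<kappa> \<inter> fst \<kappa>')"
  have eq: "{t \<in> D. s t \<in> fst \<kappa>'} = D \<inter> (\<lambda>t. snd \<kappa> (s t)) -` ?N"
  proof (intro equalityI subsetI)
    fix t assume "t \<in> D \<inter> (\<lambda>t. snd \<kappa> (s t)) -` ?N"
    then obtain x where x: "t \<in> D" "x \<in> fst \<kappa>" "x \<in> fst \<kappa>'" "snd \<kappa> (s t) = snd \<kappa> x" by auto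
    then have "s t = x" using chart_inj[OF k] D by (auto dest: inj_onD)
    then show "t \<in> {t \<in> D. s t \<in> fst \<kappa>'}" using x by auto
  qed (use D in auto)
  have op: "open {t \<in> D. s t \<in> fst \<kappa>'}"
    unfolding eq by (rule continuous_open_preimage[OF smooth_on_imp_continuous[OF sm] oD chart_open_image[OF k chart(1)[OF k']]])
  have "smooth_on {t \<in> D. s t \<in> fst \<kappa>'} (\<lambda>t. tr \<kappa> \<kappa>' (snd \<kappa> (s t)))"
    by (rule smooth_on_compose[OF smooth_on_subset[OF sm op] tr_smooth[OF k k']]) (use D in auto)
  then show "smooth_on {t \<in> D. s t \<in> fst \<kappa>'} (snd \<kappa>' \<circ> s)"
    by (rule smooth_on_cong) (use D k in \<open>auto simp: tr_def\<close>)
qed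

lemma velocity_transition:
  assumes "curve_at A x \<gamma>" "\<kappa> \<in> A" "\<kappa>' \<in> A" "x \<in> fst \<kappa>" "x \<in> fst \<kappa>'"
  shows "velocity A \<gamma> 0 \<kappa>' = Dtr \<kappa> \<kappa>' (snd \<kappa> x) (velocity A \<gamma> 0 \<kappa>)"
proof -
  have g0: "\<gamma> 0 = x" using assms(1) by (rule curve_at_0)
  note c = curve_at_chart[OF assms(1,2,4)]
  note c' = curve_at_chart[OF assms(1,3,5)]
  obtain N where N: "open N" "0 \<in> N" "\<forall>t\<in>N. \<gamma> t \<in> fst \<kappa>" using c(2) by blast
  have "((\<lambda>t. tr \<kappa> \<kappa>' ((snd \<kappa> \<circ> \<gamma>) t)) has_vector_derivative Dtr \<kappa> \<kappa>' (snd \<kappa> x) (velocity A \<gamma> 0 \<kappa>)) (at 0)"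
    by (rule has_vector_derivative_compose_derivative[OF c(1)]) (use tr_has_derivative[OF assms(2-5)] g0 in simp)
  then have "((snd \<kappa>' \<circ> \<gamma>) has_vector_derivative Dtr \<kappa> \<kappa>' (snd \<kappa> x) (velocity A \<gamma> 0 \<kappa>)) (at 0)"
    by (rule vector_derivative_transform[OF _ N(1,2)]) (use N(3) assms(2) in \<open>auto simp: tr_def\<close>)
  then show ?thesis using c'(1) vector_derivative_unique_at by blast
qed

lemma line_in_chart:
  assumes k: "\<kappa> \<in> A" and y: "y \<in> im \<kappa>"
  shows "curve_at A (ic \<kappa> y) (\<lambda>r. ic \<kappa> (y + r *\<^sub>R e))" "velocity A (\<lambda>r. ic \<kappa> (y + r *\<^sub>R e)) 0 \<kappa> = e"
proof -
  let ?D = "{r::real. y + r *\<^sub>R e \<in> im \<kappa>}"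
  have o: "open ?D" by (rule open_line_vimage[OF chart(2)[OF k]])
  have sm: "smooth_on ?D (\<lambda>r. snd \<kappa> (ic \<kappa> (y + r *\<^sub>R e)))"
    by (rule smooth_on_cong[OF smooth_on_line[OF o, of y e]]) auto
  have pl: "smooth_plot A ?D (\<lambda>r. ic \<kappa> (y + r *\<^sub>R e))"
    by (rule plot_in_chart[OF k _ sm]) auto
  then show c: "curve_at A (ic \<kappa> y) (\<lambda>r. ic \<kappa> (y + r *\<^sub>R e))"
    unfolding curve_at_def using y by (intro exI[of _ ?D]) auto
  have "((\<lambda>r. y + r *\<^sub>R e) has_vector_derivative e) (at 0)"
    by (auto intro!: derivative_eq_intros)
  then have "((snd \<kappa> \<circ> (\<lambda>r. ic \<kappa> (y + r *\<^sub>R e))) has_vector_derivative e) (at 0)"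
    by (rule vector_derivative_transform[OF _ o]) (use y in auto)
  with curve_at_chart(1)[OF c k] y show "velocity A (\<lambda>r. ic \<kappa> (y + r *\<^sub>R e)) 0 \<kappa> = e"
    using vector_derivative_unique_at by auto
qed

lemma coord_vec_eq: "coord_vec A \<kappa> x e = velocity A (\<lambda>t. ic \<kappa> (snd \<kappa> x + t *\<^sub>R e)) 0"
  by (simp add: coord_vec_def ic_def)

lemma coord_vec_tangent: "\<kappa> \<in> A \<Longrightarrow> x \<in> fst \<kappa> \<Longrightarrow> coord_vec A \<kappa> x e \<in> tangent_space A x"
  unfolding tangent_space_def coord_vec_eq using line_in_chart(1)[of \<kappa> "snd \<kappa> x" e] by auto

lemma coord_vec_comp: "\<kappa> \<in> A \<Longrightarrow> x \<in> fst \<kappa> \<Longrightarrow> coord_vec A \<kappa> x e \<kappa> = e"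
  unfolding coord_vec_eq by (rule line_in_chart(2)) auto

lemma tangent_transition:
  assumes "v \<in> tangent_space A x" "\<kappa> \<in> A" "x \<in> fst \<kappa>"
  shows "v \<kappa>' = (if \<kappa>' \<in> A \<and> x \<in> fst \<kappa>' then Dtr \<kappa> \<kappa>' (snd \<kappa> x) (v \<kappa>) else 0)"
proof -
  obtain \<gamma> where g: "curve_at A x \<gamma>" "v = velocity A \<gamma> 0" using assms(1) by (auto simp: tangent_space_def)
  then show ?thesis
    using velocity_transition[OF g(1) assms(2) _ assms(3), of \<kappa>'] velocity_outside[of \<kappa>' A \<gamma> 0] curve_at_0[OF g(1)] by auto
qed

text \<open>A tangent vector carries components in all charts; one of them determines the rest
  through the derivatives of the transition maps.\<close>

lemma tangent_eqI:
  assumes "v \<in> tangent_space A x" "w \<in> tangent_space A x" "\<kappa> \<in> A" "x \<in> fst \<kappa>" "v \<kappa> = w \<kappa>"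
  shows "v = w"
  using tangent_transition[OF assms(1,3,4)] tangent_transition[OF assms(2,3,4)] assms(5) by (auto simp: fun_eq_iff)

lemma tangent_eq_coord_vec: "v \<in> tangent_space A x \<Longrightarrow> \<kappa> \<in> A \<Longrightarrow> x \<in> fst \<kappa> \<Longrightarrow> v = coord_vec A \<kappa> x (v \<kappa>)"
  by (rule tangent_eqI) (auto simp: coord_vec_tangent coord_vec_comp)

lemma coord_vec_apply:
  "\<kappa> \<in> A \<Longrightarrow> x \<in> fst \<kappa> \<Longrightarrow> coord_vec A \<kappa> x e \<kappa>' = (if \<kappa>' \<in> A \<and> x \<in> fst \<kappa>' then Dtr \<kappa> \<kappa>' (snd \<kappa> x) e else 0)"
  using tangent_transition[OF coord_vec_tangent[of \<kappa> x e], of \<kappa> \<kappa>'] by (simp add: coord_vec_comp)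

lemma coord_vec_linear:
  assumes "\<kappa> \<in> A" "x \<in> fst \<kappa>"
  shows "coord_vec A \<kappa> x (e + e') = coord_vec A \<kappa> x e + coord_vec A \<kappa> x e'"
    "coord_vec A \<kappa> x (r *\<^sub>R e) = r *\<^sub>R coord_vec A \<kappa> x e"
    "coord_vec A \<kappa> x (c *s e) = cscale c (coord_vec A \<kappa> x e)"
    "coord_vec A \<kappa> x 0 = 0"
  using assms Dtr_linear
  by (auto simp: fun_eq_iff coord_vec_apply linear_add linear_scale linear_0 scaleR_fun_def cscale_def)

lemma tangent_ops:
  assumes "x \<in> topspace X" "v \<in> tangent_space A x" "w \<in> tangent_space A x"
  shows "v + w \<in> tangent_space A x" "r *\<^sub>R v \<in> tangent_space A x" "cscale c v \<in> tangent_space A x" "0 \<in> tangent_space A x"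
proof -
  obtain \<kappa> where k: "\<kappa> \<in> A" "x \<in> fst \<kappa>" using chart_ex[OF assms(1)] by blast
  note v = tangent_eq_coord_vec[OF assms(2) k] and w = tangent_eq_coord_vec[OF assms(3) k]
  show "v + w \<in> tangent_space A x" by (subst v, subst w) (simp add: coord_vec_linear(1)[OF k, symmetric] coord_vec_tangent[OF k])
  show "r *\<^sub>R v \<in> tangent_space A x" by (subst v) (simp add: coord_vec_linear(2)[OF k, symmetric] coord_vec_tangent[OF k])
  show "cscale c v \<in> tangent_space A x" by (subst v) (simp add: coord_vec_linear(3)[OF k, symmetric] coord_vec_tangent[OF k])
  show "0 \<in> tangent_space A x" by (simp add: coord_vec_linear(4)[OF k, symmetric] coord_vec_tangent[OF k])
qed

end

subsection \<open>Unitary coframes\<close>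

lemma smooth_on_of_real: "smooth_on S f \<Longrightarrow> smooth_on S (\<lambda>x. complex_of_real (f x))"
  by (rule smooth_on_bounded_linear[OF bounded_linear_of_real])

locale herm_mfd = complex_mfd X A for X :: "'a topology" and A :: "('a, complex^'n) chart set" +
  fixes g :: "('a, 'n) metric"
  assumes hm: "hermitian_metric A g"
begin

lemma g_props:
  assumes "x \<in> topspace X" "v \<in> tangent_space A x" "w \<in> tangent_space A x"
  shows "g x v w = g x w v" "z \<in> tangent_space A x \<Longrightarrow> g x (v + z) w = g x v w + g x z w"
    "g x (r *\<^sub>R v) w = r * g x v w" "v \<noteq> 0 \<Longrightarrow> g x v v > 0" "g x (cscale \<i> v) (cscale \<i> w) = g x v w"
  using hm assms unfolding hermitian_metric_def points_A by blast+

definition \<beta> :: "('a, complex^'n) chart \<Rightarrow> complex^'n \<Rightarrow> complex^'n \<Rightarrow> complex^'n \<Rightarrow> real" where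
  "\<beta> \<kappa> y e e' = metric_coeff A g \<kappa> e e' y"

lemma \<beta>_eq: "\<beta> \<kappa> y e e' = g (ic \<kappa> y) (coord_vec A \<kappa> (ic \<kappa> y) e) (coord_vec A \<kappa> (ic \<kappa> y) e')"
  by (simp add: \<beta>_def metric_coeff_def Let_def ic_def)

lemma \<beta>_co: "\<kappa> \<in> A \<Longrightarrow> x \<in> fst \<kappa> \<Longrightarrow> \<beta> \<kappa> (snd \<kappa> x) e e' = g x (coord_vec A \<kappa> x e) (coord_vec A \<kappa> x e')"
  by (simp add: \<beta>_eq)

lemma \<beta>_smooth: "\<kappa> \<in> A \<Longrightarrow> smooth_on (im \<kappa>) (\<lambda>y. \<beta> \<kappa> y e e')"
  using hm unfolding hermitian_metric_def \<beta>_def im_def by (cases \<kappa>) fastforce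

context
  fixes \<kappa> y assumes k: "\<kappa> \<in> A" and y: "y \<in> im \<kappa>"
begin

lemma ic_top: "ic \<kappa> y \<in> topspace X"
  using chart_subset[OF k] ic_dom[OF y] by blast

lemma \<beta>_sym: "\<beta> \<kappa> y e e' = \<beta> \<kappa> y e' e"
  unfolding \<beta>_eq using k y by (intro g_props(1) ic_top coord_vec_tangent) auto

lemma \<beta>_linear: "linear (\<lambda>e. \<beta> \<kappa> y e e')"
proof (rule linearI)
  show "\<beta> \<kappa> y (e + f) e' = \<beta> \<kappa> y e e' + \<beta> \<kappa> y f e'" for e f
    unfolding \<beta>_eq coord_vec_linear(1)[OF k ic_dom[OF y]] using k y by (intro g_props(2) ic_top coord_vec_tangent) auto
  show "\<beta> \<kappa> y (r *\<^sub>R e) e' = r *\<^sub>R \<beta> \<kappa> y e e'" for r e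
    unfolding \<beta>_eq coord_vec_linear(2)[OF k ic_dom[OF y]] using k y by (simp add: g_props(3) ic_top coord_vec_tangent)
qed

lemma \<beta>_linear2: "linear (\<lambda>e'. \<beta> \<kappa> y e e')"
  using \<beta>_linear[of e] by (simp add: \<beta>_sym[of e])

lemma \<beta>_pos: "e \<noteq> 0 \<Longrightarrow> \<beta> \<kappa> y e e > 0"
proof -
  assume e: "e \<noteq> 0"
  have "coord_vec A \<kappa> (ic \<kappa> y) e \<noteq> 0"
    using coord_vec_comp[OF k ic_dom[OF y], of e] e by auto
  then show ?thesis unfolding \<beta>_eq
    using g_props(4)[OF ic_top coord_vec_tangent[OF k ic_dom[OF y]] coord_vec_tangent[OF k ic_dom[OF y]]] by blast
qed

lemma \<beta>_J: "\<beta> \<kappa> y (\<i> *s e) (\<i> *s e') = \<beta> \<kappa> y e e'"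
  unfolding \<beta>_eq coord_vec_linear(3)[OF k ic_dom[OF y]] using k y by (intro g_props(5) ic_top coord_vec_tangent) auto

end

text \<open>The Hermitian form with real part \<beta>, antilinear in the first argument like
  \<open>herm\<close>.\<close>

definition \<eta> where "\<eta> \<kappa> y e e' = complex_of_real (\<beta> \<kappa> y e e') + \<i> * complex_of_real (\<beta> \<kappa> y (\<i> *s e) e')"

lemma \<eta>_linear:
  assumes k: "\<kappa> \<in> A" and y: "y \<in> im \<kappa>"
  shows "\<eta> \<kappa> y e (f + f') = \<eta> \<kappa> y e f + \<eta> \<kappa> y e f'" "\<eta> \<kappa> y e (c *s f) = c * \<eta> \<kappa> y e f"
    "cnj (\<eta> \<kappa> y e f) = \<eta> \<kappa> y f e"
proof -
  note l = linear_add[OF \<beta>_linear2[OF k y]] linear_scale[OF \<beta>_linear2[OF k y]]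
  show add: "\<eta> \<kappa> y e (f + f') = \<eta> \<kappa> y e f + \<eta> \<kappa> y e f'" for f f' by (simp add: \<eta>_def l algebra_simps)
  have ii: "\<i> *s (\<i> *s e) = - e" for e :: "complex^'n" by (simp add: vec_eq_iff)
  have neg: "\<beta> \<kappa> y (- e) f = - \<beta> \<kappa> y e f" for e f using linear_neg[OF \<beta>_linear[OF k y]] .
  have skew: "\<beta> \<kappa> y e (\<i> *s f) = - \<beta> \<kappa> y (\<i> *s e) f" for e f
    using \<beta>_J[OF k y, of "\<i> *s e" f] by (simp add: ii neg)
  have i: "\<eta> \<kappa> y e (\<i> *s f) = \<i> * \<eta> \<kappa> y e f" for f
    using \<beta>_J[OF k y, of e f] by (simp add: \<eta>_def skew complex_eq_iff)
  have r: "\<eta> \<kappa> y e (r *\<^sub>R f) = of_real r * \<eta> \<kappa> y e f" for r f by (simp add: \<eta>_def l algebra_simps)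
  show "\<eta> \<kappa> y e (c *s f) = c * \<eta> \<kappa> y e f"
    by (subst smult_eq_real_combination) (simp add: add r i complex_eq_iff algebra_simps)
  show "cnj (\<eta> \<kappa> y e f) = \<eta> \<kappa> y f e"
    using \<beta>_sym[OF k y, of f e] \<beta>_sym[OF k y, of "\<i> *s f" e] by (simp add: \<eta>_def skew complex_eq_iff)
qed

section \<open>Smooth unitary frames\<close>

lemma smooth_bilinear_form:
  fixes u v :: "complex^'n \<Rightarrow> complex^'n"
  assumes k: "\<kappa> \<in> A" and u: "smooth_on (im \<kappa>) u" and v: "smooth_on (im \<kappa>) v"
  shows "smooth_on (im \<kappa>) (\<lambda>y. \<beta> \<kappa> y (u y) (v y))"
proof (rule smooth_on_cong)
  note O = chart(2)[OF k]
  show "smooth_on (im \<kappa>) (\<lambda>y. \<Sum>b\<in>Basis. \<Sum>b'\<in>Basis. (u y \<bullet> b) * ((v y \<bullet> b') * \<beta> \<kappa> y b b'))"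
    by (intro smooth_on_sum O smooth_on_mult \<beta>_smooth k 
        smooth_on_bounded_linear[OF bounded_linear_inner_left] u v)
  fix y assume y: "y \<in> im \<kappa>"
  have "\<beta> \<kappa> y (\<Sum>b\<in>Basis. (u y \<bullet> b) *\<^sub>R b) w = (\<Sum>b\<in>Basis. (u y \<bullet> b) * \<beta> \<kappa> y b w)" for w
    by (simp add: linear_sum[OF \<beta>_linear[OF k y]] linear_scale[OF \<beta>_linear[OF k y]])
  note 1 = this
  have 2: "\<beta> \<kappa> y b (\<Sum>b'\<in>Basis. (v y \<bullet> b') *\<^sub>R b') = (\<Sum>b'\<in>Basis. (v y \<bullet> b') * \<beta> \<kappa> y b b')" for b
    by (simp add: linear_sum[OF \<beta>_linear2[OF k y]] linear_scale[OF \<beta>_linear2[OF k y]])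
  have "\<beta> \<kappa> y (\<Sum>b\<in>Basis. (u y \<bullet> b) *\<^sub>R b) (\<Sum>b'\<in>Basis. (v y \<bullet> b') *\<^sub>R b') = 
     (\<Sum>b\<in>Basis. \<Sum>b'\<in>Basis. (u y \<bullet> b) * ((v y \<bullet> b') * \<beta> \<kappa> y b b'))"
    unfolding 1 unfolding 2 sum_distrib_left ..
  then show "(\<Sum>b\<in>Basis. \<Sum>b'\<in>Basis. (u y \<bullet> b) * ((v y \<bullet> b') * \<beta> \<kappa> y b b')) = \<beta> \<kappa> y (u y) (v y)"
    by (simp add: euclidean_representation)
qed

lemma smooth_hermitian_form:
  fixes u v :: "complex^'n \<Rightarrow> complex^'n"
  assumes k: "\<kappa> \<in> A" and u: "smooth_on (im \<kappa>) u" and v: "smooth_on (im \<kappa>) v"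
  shows "smooth_on (im \<kappa>) (\<lambda>y. \<eta> \<kappa> y (u y) (v y))"
  unfolding \<eta>_def 
  by (intro smooth_on_add smooth_on_mult smooth_on_const chart(2)[OF k] smooth_on_of_real smooth_bilinear_form k u v
      smooth_on_linear[OF vecJ.lin])

lemma smooth_on_smult:
  "smooth_on S c \<Longrightarrow> smooth_on S (v :: _ \<Rightarrow> complex^'n) \<Longrightarrow> smooth_on S (\<lambda>x. c x *s v x)"
proof -
  have "bounded_bilinear (\<lambda>(c :: complex) (x :: complex^'n). c *s x)"
    unfolding bilinear_conv_bounded_bilinear[symmetric] by (auto simp: bilinear_def linear_iff vec_eq_iff algebra_simps)
  then show "smooth_on S c \<Longrightarrow> smooth_on S v \<Longrightarrow> smooth_on S (\<lambda>x. c x *s v x)" by (rule smooth_on_bilinear)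
qed

text \<open>Orthonormalisation of the unit vectors in turn. The last clause, that the vectors built
  so far have no components outside \<open>F\<close>, gives the next vector the l-th component 1
  before it is normalised; so it vanishes nowhere, and the frame exists on the whole chart
  image.\<close>

lemma gram_schmidt:
  fixes F :: "'n set"
  assumes k: "\<kappa> \<in> A" and "finite F"
  shows "\<exists>e :: 'n \<Rightarrow> complex^'n \<Rightarrow> complex^'n. (\<forall>i\<in>F. smooth_on (im \<kappa>) (e i)) \<and>
    (\<forall>y\<in>im \<kappa>. \<forall>i\<in>F. \<forall>j\<in>F. \<eta> \<kappa> y (e i y) (e j y) = (if i = j then 1 else 0)) \<and>
    (\<forall>y\<in>im \<kappa>. \<forall>i\<in>F. \<forall>j. j \<notin> F \<longrightarrow> e i y $ j = 0)"
  using assms(2)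
proof (induction F rule: finite_induct)
  case empty
  then show ?case by simp
next
  case (insert l F)
  note O = chart(2)[OF k]
  obtain e where e: "\<And>i. i \<in> F \<Longrightarrow> smooth_on (im \<kappa>) (e i)"
    "\<And>y i j. y \<in> im \<kappa> \<Longrightarrow> i \<in> F \<Longrightarrow> j \<in> F \<Longrightarrow> \<eta> \<kappa> y (e i y) (e j y) = (if i = j then 1 else 0)"
    "\<And>y i j. y \<in> im \<kappa> \<Longrightarrow> i \<in> F \<Longrightarrow> j \<notin> F \<Longrightarrow> e i y $ j = 0"
    using insert.IH by blast
  define v where "v y = axis l 1 - (\<Sum>i\<in>F. \<eta> \<kappa> y (e i y) (axis l 1) *s e i y)" for y
  have vs: "smooth_on (im \<kappa>) v"
    unfolding v_def by (intro smooth_on_diff smooth_on_const O smooth_on_sum smooth_on_smult smooth_hermitian_form k e(1))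
  have vl: "v y $ l = 1" if "y \<in> im \<kappa>" for y
  proof -
    have "(\<Sum>i\<in>F. \<eta> \<kappa> y (e i y) (axis l 1) *s e i y) $ l = 0"
      using e(3)[OF that _ insert.hyps(2)] by simp
    then show ?thesis by (simp add: v_def)
  qed
  have v0: "v y \<noteq> 0" if "y \<in> im \<kappa>" for y using vl[OF that] by auto
  have pos: "\<beta> \<kappa> y (v y) (v y) > 0" if "y \<in> im \<kappa>" for y using \<beta>_pos[OF k that v0[OF that]] .
  define w where "w y = complex_of_real (inverse (sqrt (\<beta> \<kappa> y (v y) (v y)))) *s v y" for y
  have ws: "smooth_on (im \<kappa>) w"
    unfolding w_def using pos
    by (intro smooth_on_smult smooth_on_of_real smooth_on_inverse smooth_on_sqrt smooth_bilinear_form k vs) auto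
  have orth: "\<eta> \<kappa> y (e i y) (v y) = 0" if y: "y \<in> im \<kappa>" and i: "i \<in> F" for y i
  proof -
    note l = \<eta>_linear(1,2)[OF k y]
    have lin: "linear (\<lambda>x. \<eta> \<kappa> y (e i y) x)"
    proof (rule linearI)
      show "\<eta> \<kappa> y (e i y) (r *\<^sub>R f) = r *\<^sub>R \<eta> \<kappa> y (e i y) f" for r f
        using l(2)[of "e i y" "of_real r" f] smult_eq_real_combination[of "of_real r" f] by (simp add: scaleR_conv_of_real)
    qed (rule l(1))
    have "\<eta> \<kappa> y (e i y) (v y) = \<eta> \<kappa> y (e i y) (axis l 1) - (\<Sum>j\<in>F. \<eta> \<kappa> y (e j y) (axis l 1) * \<eta> \<kappa> y (e i y) (e j y))"
      unfolding v_def linear_diff[OF lin] linear_sum[OF lin] l(2) ..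
    also have "(\<Sum>j\<in>F. \<eta> \<kappa> y (e j y) (axis l 1) * \<eta> \<kappa> y (e i y) (e j y)) = (\<Sum>j\<in>F. if i = j then \<eta> \<kappa> y (e j y) (axis l 1) else 0)"
      using e(2)[OF y i] by (intro sum.cong) auto
    also have "\<dots> = \<eta> \<kappa> y (e i y) (axis l 1)" using i insert.hyps by simp
    finally show ?thesis by simp
  qed
  have ortho: "\<eta> \<kappa> y (e i y) (w y) = 0" "\<eta> \<kappa> y (w y) (e i y) = 0" if "y \<in> im \<kappa>" "i \<in> F" for y i
  proof -
    show 1: "\<eta> \<kappa> y (e i y) (w y) = 0" unfolding w_def \<eta>_linear(2)[OF k that(1)] by (simp add: orth[OF that])
    show "\<eta> \<kappa> y (w y) (e i y) = 0" using \<eta>_linear(3)[OF k that(1), of "e i y" "w y"] 1 by simp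
  qed
  have norm: "\<eta> \<kappa> y (w y) (w y) = 1" if y: "y \<in> im \<kappa>" for y
  proof -
    let ?b = "\<beta> \<kappa> y (v y) (v y)" and ?s = "complex_of_real (inverse (sqrt (\<beta> \<kappa> y (v y) (v y))))"
    have vv: "\<eta> \<kappa> y (v y) (v y) = of_real ?b"
    proof -
      have "\<eta> \<kappa> y (v y) (v y) \<in> \<real>" using \<eta>_linear(3)[OF k y, of "v y" "v y"] by (simp add: Reals_cnj_iff)
      then show ?thesis by (auto simp: \<eta>_def complex_is_Real_iff complex_eq_iff)
    qed
    have "\<eta> \<kappa> y (w y) (w y) = ?s * \<eta> \<kappa> y (w y) (v y)" unfolding w_def[of y] by (rule \<eta>_linear(2)[OF k y])
    also have "\<eta> \<kappa> y (w y) (v y) = cnj (\<eta> \<kappa> y (v y) (w y))" by (simp add: \<eta>_linear(3)[OF k y])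
    also have "\<eta> \<kappa> y (v y) (w y) = ?s * \<eta> \<kappa> y (v y) (v y)" unfolding w_def[of y] by (rule \<eta>_linear(2)[OF k y])
    finally have "\<eta> \<kappa> y (w y) (w y) = of_real (inverse (sqrt ?b) * inverse (sqrt ?b) * ?b)" by (simp add: vv)
    also have "inverse (sqrt ?b) * inverse (sqrt ?b) * ?b = 1"
      using pos[OF y] by (simp add: field_simps flip: real_sqrt_mult)
    finally show ?thesis by simp
  qed
  have supp: "w y $ j = 0" if "y \<in> im \<kappa>" "j \<notin> insert l F" for y j
    using e(3)[OF that(1)] that(2) by (simp add: w_def v_def axis_def)
  show ?case
  proof (intro exI[of _ "e(l := w)"] conjI ballI allI impI)
    fix i assume "i \<in> insert l F"
    then show "smooth_on (im \<kappa>) ((e(l := w)) i)" using e(1) ws by auto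
  next
    fix y i j assume "y \<in> im \<kappa>" "i \<in> insert l F" "j \<in> insert l F"
    then show "\<eta> \<kappa> y ((e(l := w)) i y) ((e(l := w)) j y) = (if i = j then 1 else 0)"
      using e(2) ortho norm insert.hyps(2) by auto
  next
    fix y i j assume "y \<in> im \<kappa>" "i \<in> insert l F" "j \<notin> insert l F"
    then show "(e(l := w)) i y $ j = 0" using e(3) supp by auto
  qed
qed

text \<open>Row i of \<open>a\<close> is the functional \<open>\<eta> \<kappa> y (e i y)\<close>, so
  \<open>a\<close> is the coframe dual to the orthonormal frame, and the frame vectors are the
  columns of its inverse \<open>E\<close>.\<close>

lemma unitary_frame_exists:
  assumes k: "\<kappa> \<in> A"
  shows "\<exists>(a :: complex^'n \<Rightarrow> complex^'n^'n) E. smooth_on (im \<kappa>) a \<and> (\<forall>y\<in>im \<kappa>. E y ** a y = (mat 1 :: complex^'n^'n) \<and>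
     (\<forall>e e'. (a y *v e) \<bullet> (a y *v e') = \<beta> \<kappa> y e e'))"
proof -
  obtain e :: "'n \<Rightarrow> complex^'n \<Rightarrow> complex^'n" where e: "\<And>i. smooth_on (im \<kappa>) (e i)"
    "\<And>y i j. y \<in> im \<kappa> \<Longrightarrow> \<eta> \<kappa> y (e i y) (e j y) = (if i = j then 1 else 0)"
    using gram_schmidt[OF k finite_class.finite_UNIV] by blast
  define a where "a y = (\<chi> i j. \<eta> \<kappa> y (e i y) (axis j 1))" for y
  define E where "E y = (\<chi> i j. e j y $ i)" for y
  have av: "(a y *v x) $ i = \<eta> \<kappa> y (e i y) x" if y: "y \<in> im \<kappa>" for y x i
  proof -
    have lin: "linear (\<lambda>x. \<eta> \<kappa> y (e i y) x)"
    proof (rule linearI)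
      show "\<eta> \<kappa> y (e i y) (r *\<^sub>R f) = r *\<^sub>R \<eta> \<kappa> y (e i y) f" for r f
        using \<eta>_linear(2)[OF k y, of "e i y" "of_real r" f] smult_eq_real_combination[of "of_real r" f] by (simp add: scaleR_conv_of_real)
    qed (rule \<eta>_linear(1)[OF k y])
    have x: "x = (\<Sum>j\<in>UNIV. x $ j *s axis j 1)" by (rule basis_expansion[symmetric])
    have "\<eta> \<kappa> y (e i y) x = (\<Sum>j\<in>UNIV. x $ j * \<eta> \<kappa> y (e i y) (axis j 1))"
      by (subst x) (simp only: linear_sum[OF lin] \<eta>_linear(2)[OF k y])
    then show ?thesis by (simp add: a_def matrix_vector_mult_def mult.commute)
  qed
  have aE: "a y ** E y = mat 1" if y: "y \<in> im \<kappa>" for y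
  proof -
    have "(a y ** E y) $ i $ j = (a y *v e j y) $ i" for i j
      unfolding matrix_matrix_mult_def matrix_vector_mult_def by (simp add: E_def)
    then show ?thesis by (simp add: vec_eq_iff av[OF y] e(2)[OF y] mat_def)
  qed
  then have Ea: "E y ** a y = mat 1" if "y \<in> im \<kappa>" for y using that matrix_left_right_inverse by blast
  have iso: "(a y *v x) \<bullet> (a y *v x') = \<beta> \<kappa> y x x'" if y: "y \<in> im \<kappa>" for y x x'
  proof -
    have "x' = E y *v (a y *v x')" by (simp add: matrix_vector_mul_assoc Ea[OF y])
    also have "\<dots> = (\<Sum>j\<in>UNIV. (a y *v x') $ j *s e j y)"
      unfolding vec_eq_iff matrix_vector_mult_def[of "E y"] by (simp add: E_def mult.commute)
    finally have x': "x' = (\<Sum>j\<in>UNIV. \<eta> \<kappa> y (e j y) x' *s e j y)" by (simp add: av[OF y])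
    have lin: "linear (\<lambda>z. \<eta> \<kappa> y x z)"
    proof (rule linearI)
      show "\<eta> \<kappa> y x (r *\<^sub>R f) = r *\<^sub>R \<eta> \<kappa> y x f" for r f
        using \<eta>_linear(2)[OF k y, of x "of_real r" f] smult_eq_real_combination[of "of_real r" f] by (simp add: scaleR_conv_of_real)
    qed (rule \<eta>_linear(1)[OF k y])
    have "\<eta> \<kappa> y x x' = (\<Sum>j\<in>UNIV. \<eta> \<kappa> y (e j y) x' * \<eta> \<kappa> y x (e j y))"
      by (subst x') (simp only: linear_sum[OF lin] \<eta>_linear(2)[OF k y])
    also have "\<dots> = herm (a y *v x) (a y *v x')"
      by (simp add: herm_def av[OF y] \<eta>_linear(3)[OF k y] mult.commute)
    finally have "\<beta> \<kappa> y x x' = Re (herm (a y *v x) (a y *v x'))" by (auto simp: \<eta>_def complex_eq_iff)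
    then show ?thesis by (simp add: inner_eq_Re_herm)
  qed
  have "smooth_on (im \<kappa>) a"
    unfolding a_def by (intro smooth_on_vec_lambda chart(2)[OF k] smooth_hermitian_form k e(1) smooth_on_const)
  then show ?thesis using Ea iso by blast
qed

section \<open>Points, charts and curves of the coframe bundle\<close>

definition isom :: "('a, complex^'n) chart \<Rightarrow> 'a \<Rightarrow> complex^'n^'n \<Rightarrow> bool" where
  "isom \<kappa> x M \<longleftrightarrow> (\<forall>e e'. (M *v e) \<bullet> (M *v e') = \<beta> \<kappa> (snd \<kappa> x) e e')"

text \<open>The coframe at x with matrix \<open>M\<close> in the coordinates of \<kappa>. Coframes
  are extensional by definition, hence the restriction to the tangent space.\<close>

definition cof :: "('a, complex^'n) chart \<Rightarrow> 'a \<Rightarrow> complex^'n^'n \<Rightarrow> ('a, 'n) coframe" where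
  "cof \<kappa> x M = (x, restrict (\<lambda>v. M *v (v \<kappa>)) (tangent_space A x))"

lemma fst_cof [simp]: "fst (cof \<kappa> x M) = x" by (simp add: cof_def)

lemma cof_apply: "v \<in> tangent_space A x \<Longrightarrow> snd (cof \<kappa> x M) v = M *v (v \<kappa>)" by (simp add: cof_def)

lemma cof_in_bundle:
  assumes k: "\<kappa> \<in> A" "x \<in> fst \<kappa>" and M: "isom \<kappa> x M"
  shows "cof \<kappa> x M \<in> coframe_bundle A g"
proof -
  have x: "x \<in> topspace X" using chart_subset[OF k(1)] k(2) by blast
  have "(M *v (v \<kappa>)) \<bullet> (M *v (w \<kappa>)) = g x v w" if "v \<in> tangent_space A x" "w \<in> tangent_space A x" for v w
  proof -
    have "(M *v (v \<kappa>)) \<bullet> (M *v (w \<kappa>)) = g x (coord_vec A \<kappa> x (v \<kappa>)) (coord_vec A \<kappa> x (w \<kappa>))"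
      using M by (simp add: isom_def \<beta>_co[OF k])
    then show ?thesis using tangent_eq_coord_vec[OF that(1) k] tangent_eq_coord_vec[OF that(2) k] by simp
  qed
  then show ?thesis
    using x tangent_ops[OF x]
    by (auto simp: coframe_bundle_def cof_def points_A matrix_add_simps cscale_def matrix_vector_smult)
qed

lemma bundle_eq_cof:
  assumes p: "(x, u) \<in> coframe_bundle A g" and k: "\<kappa> \<in> A" "x \<in> fst \<kappa>"
  defines "M \<equiv> matrix (\<lambda>e. u (coord_vec A \<kappa> x e))"
  shows "(x, u) = cof \<kappa> x M" "isom \<kappa> x M" "u (coord_vec A \<kappa> x e) = M *v e"
proof -
  have u: "u \<in> extensional (tangent_space A x)"
    "\<And>v w. v \<in> tangent_space A x \<Longrightarrow> w \<in> tangent_space A x \<Longrightarrow> u (v + w) = u v + u w"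
    "\<And>v c. v \<in> tangent_space A x \<Longrightarrow> u (cscale c v) = c *s u v"
    "\<And>v w. v \<in> tangent_space A x \<Longrightarrow> w \<in> tangent_space A x \<Longrightarrow> u v \<bullet> u w = g x v w"
    using p unfolding coframe_bundle_def by auto
  note t = coord_vec_tangent[OF k]
  have "Vector_Spaces.linear (*s) (*s) (\<lambda>e. u (coord_vec A \<kappa> x e))"
    by unfold_locales (auto simp: coord_vec_linear[OF k] u(2,3) t vec_eq_iff algebra_simps)
  then show M: "u (coord_vec A \<kappa> x e) = M *v e" for e
    unfolding M_def by (rule matrix_works[symmetric])
  show "isom \<kappa> x M"
    unfolding isom_def M[symmetric] by (simp add: u(4) t \<beta>_co[OF k])
  have "u v = M *v (v \<kappa>)" if "v \<in> tangent_space A x" for v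
    using M[of "v \<kappa>"] tangent_eq_coord_vec[OF that k] by simp
  then have "u = restrict (\<lambda>v. M *v (v \<kappa>)) (tangent_space A x)"
    using u(1) by (intro extensionalityI[of _ "tangent_space A x"]) auto
  then show "(x, u) = cof \<kappa> x M" by (simp add: cof_def)
qed

definition Bch :: "('a, complex^'n) chart \<Rightarrow> (('a, 'n) coframe, (complex^'n) \<times> (complex^'n^'n)) chart" where
  "Bch \<kappa> = ({(x, u) \<in> coframe_bundle A g. x \<in> fst \<kappa>}, \<lambda>(x, u). (snd \<kappa> x, matrix (\<lambda>e. u (coord_vec A \<kappa> x e))))"

lemma coframe_atlas_eq: "coframe_atlas A g = Bch ` A"
  by (simp add: coframe_atlas_def Bch_def[abs_def])

lemma points_coframe_atlas: "points (coframe_atlas A g) = coframe_bundle A g"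
  using points_A chart_ex by (auto simp: points_def coframe_atlas_eq Bch_def coframe_bundle_def)

lemma Bch_dom: "p \<in> fst (Bch \<kappa>) \<longleftrightarrow> p \<in> coframe_bundle A g \<and> fst p \<in> fst \<kappa>"
  by (auto simp: Bch_def)

lemma Bch_fst: "fst (snd (Bch \<kappa>) p) = snd \<kappa> (fst p)"
  by (auto simp: Bch_def case_prod_unfold)

lemma Bch_cof:
  assumes "\<kappa> \<in> A" "\<kappa>' \<in> A" "x \<in> fst \<kappa>" "x \<in> fst \<kappa>'"
  shows "snd (Bch \<kappa>') (cof \<kappa> x M) = (snd \<kappa>' x, \<chi> i j. (M *v Dtr \<kappa>' \<kappa> (snd \<kappa>' x) (axis j 1)) $ i)"
  using assms
  by (simp add: Bch_def cof_def matrix_def coord_vec_tangent coord_vec_apply[of \<kappa>' x _ \<kappa>])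

text \<open>Plots of the bundle are given by a base map and a matrix function; in another chart the
  matrix gets multiplied by the derivative of a transition map, which is smooth.\<close>

lemma plot_in_bundle:
  fixes b :: "'d::real_normed_vector \<Rightarrow> 'a" and M :: "'d \<Rightarrow> complex^'n^'n"
  assumes k: "\<kappa> \<in> A" and b: "b ` D \<subseteq> fst \<kappa>" "smooth_on D (\<lambda>t. snd \<kappa> (b t))" and M: "smooth_on D M"
    and iso: "\<And>t. t \<in> D \<Longrightarrow> isom \<kappa> (b t) (M t)"
  shows "smooth_plot (coframe_atlas A g) D (\<lambda>t. cof \<kappa> (b t) (M t))"
proof (rule smooth_plotI)
  have inP: "cof \<kappa> (b t) (M t) \<in> coframe_bundle A g" if "t \<in> D" for t
    using b(1) that by (intro cof_in_bundle k iso) auto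
  show "open D" using M by (rule smooth_on_open)
  show "(\<lambda>t. cof \<kappa> (b t) (M t)) ` D \<subseteq> points (coframe_atlas A g)"
    using inP by (auto simp: points_coframe_atlas)
  fix \<kappa>'' assume "\<kappa>'' \<in> coframe_atlas A g"
  then obtain \<kappa>' where k': "\<kappa>' \<in> A" "\<kappa>'' = Bch \<kappa>'" by (auto simp: coframe_atlas_eq)
  have dom: "{t \<in> D. cof \<kappa> (b t) (M t) \<in> fst \<kappa>''} = {t \<in> D. b t \<in> fst \<kappa>'}" (is "_ = ?D")
    unfolding k'(2) Bch_dom using inP by auto
  have s1: "smooth_on ?D (\<lambda>t. snd \<kappa>' (b t))"
    using smooth_plot_chart[OF plot_in_chart[OF k b] k'(1)] by (simp add: o_def)
  have M': "smooth_on ?D M" using M smooth_on_open[OF s1] by (rule smooth_on_subset) auto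
  have s2: "smooth_on ?D (\<lambda>t. Dtr \<kappa>' \<kappa> (snd \<kappa>' (b t)) e)" for e
    unfolding Dtr_def using b(1)
    by (intro smooth_on_compose[OF s1 smooth_on_frechet[OF tr_smooth[OF k'(1) k]]]) auto
  have "smooth_on ?D (\<lambda>t. (snd \<kappa>' (b t), \<chi> i j. (M t *v Dtr \<kappa>' \<kappa> (snd \<kappa>' (b t)) (axis j 1)) $ i))"
    by (intro smooth_on_Pair s1 smooth_on_vec_lambda smooth_on_open[OF s1] smooth_on_vec_nth 
        smooth_on_bilinear[OF bounded_bilinear_matrix_vector_mult] M' s2)
  then show "smooth_on {t \<in> D. cof \<kappa> (b t) (M t) \<in> fst \<kappa>''} (snd \<kappa>'' \<circ> (\<lambda>t. cof \<kappa> (b t) (M t)))"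
    unfolding dom
  proof (rule smooth_on_cong)
    fix t assume "t \<in> ?D"
    then show "(snd \<kappa>' (b t), \<chi> i j. (M t *v Dtr \<kappa>' \<kappa> (snd \<kappa>' (b t)) (axis j 1)) $ i) = (snd \<kappa>'' \<circ> (\<lambda>t. cof \<kappa> (b t) (M t))) t"
      using b(1) by (auto simp: k'(2) Bch_cof[OF k k'(1)])
  qed
qed

lemma bundle_curve_projection:
  assumes c: "curve_at (coframe_atlas A g) p \<gamma>"
  shows "curve_at A (fst p) (fst \<circ> \<gamma>)"
    and "\<kappa> \<in> A \<Longrightarrow> fst p \<in> fst \<kappa> \<Longrightarrow> velocity A (fst \<circ> \<gamma>) 0 \<kappa> = fst (velocity (coframe_atlas A g) \<gamma> 0 (Bch \<kappa>))"
proof -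
  obtain D where D: "smooth_plot (coframe_atlas A g) D \<gamma>" "0 \<in> D" "\<gamma> 0 = p" using c by (auto simp: curve_at_def)
  have inP: "\<gamma> t \<in> coframe_bundle A g" if "t \<in> D" for t
    using D(1) that by (auto simp: smooth_plot_def points_coframe_atlas)
  have pl: "smooth_plot A D (fst \<circ> \<gamma>)"
  proof (rule smooth_plotI)
    show "open D" using D(1) by (simp add: smooth_plot_def)
    show "(fst \<circ> \<gamma>) ` D \<subseteq> points A" using inP by (fastforce simp: coframe_bundle_def)
    fix \<kappa> assume k: "\<kappa> \<in> A"
    have sm: "smooth_on {t \<in> D. \<gamma> t \<in> fst (Bch \<kappa>)} (snd (Bch \<kappa>) \<circ> \<gamma>)"
      using smooth_plot_chart[OF D(1), of "Bch \<kappa>"] k by (simp add: coframe_atlas_eq)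
    have eq: "{t \<in> D. (fst \<circ> \<gamma>) t \<in> fst \<kappa>} = {t \<in> D. \<gamma> t \<in> fst (Bch \<kappa>)}"
      using inP by (auto simp: Bch_dom)
    show "smooth_on {t \<in> D. (fst \<circ> \<gamma>) t \<in> fst \<kappa>} (snd \<kappa> \<circ> (fst \<circ> \<gamma>))"
      unfolding eq using smooth_on_fst[OF sm] by (simp add: o_def Bch_fst)
  qed
  then show c': "curve_at A (fst p) (fst \<circ> \<gamma>)"
    unfolding curve_at_def using D by (intro exI[of _ D]) auto
  assume k: "\<kappa> \<in> A" "fst p \<in> fst \<kappa>"
  have "p \<in> fst (Bch \<kappa>)" using inP[OF D(2)] D(3) k by (simp add: Bch_dom)
  moreover have "Bch \<kappa> \<in> coframe_atlas A g" using k by (simp add: coframe_atlas_eq)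
  ultimately have "((snd (Bch \<kappa>) \<circ> \<gamma>) has_vector_derivative velocity (coframe_atlas A g) \<gamma> 0 (Bch \<kappa>)) (at 0)"
    using curve_at_chart(1)[OF c] by blast
  from bounded_linear.has_vector_derivative[OF bounded_linear_fst this]
  have "((snd \<kappa> \<circ> (fst \<circ> \<gamma>)) has_vector_derivative fst (velocity (coframe_atlas A g) \<gamma> 0 (Bch \<kappa>))) (at 0)"
    by (simp add: o_def Bch_fst)
  then show "velocity A (fst \<circ> \<gamma>) 0 \<kappa> = fst (velocity (coframe_atlas A g) \<gamma> 0 (Bch \<kappa>))"
    using curve_at_chart(1)[OF c' k] vector_derivative_unique_at by blast
qed

text \<open>The definite description in \<open>pushforward\<close> ranges over all curves with the
  given velocity. It has a unique solution because the base component of this velocity in a bundle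
  chart is the velocity of the projected curve.\<close>

lemma tautological_form_velocity:
  assumes c: "curve_at (coframe_atlas A g) p \<gamma>"
  shows "tautological_form A g p (velocity (coframe_atlas A g) \<gamma> 0) = snd p (velocity A (fst \<circ> \<gamma>) 0)"
proof -
  let ?B = "coframe_atlas A g"
  have "pushforward ?B A fst p (velocity ?B \<gamma> 0) = velocity A (fst \<circ> \<gamma>) 0"
    unfolding pushforward_def
  proof (rule the_equality)
    show "\<exists>\<gamma>'. curve_at ?B p \<gamma>' \<and> velocity ?B \<gamma>' 0 = velocity ?B \<gamma> 0 \<and> velocity A (fst \<circ> \<gamma>) 0 = velocity A (fst \<circ> \<gamma>') 0"
      using c by blast
    fix w assume "\<exists>\<gamma>'. curve_at ?B p \<gamma>' \<and> velocity ?B \<gamma>' 0 = velocity ?B \<gamma> 0 \<and> w = velocity A (fst \<circ> \<gamma>') 0"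
    then obtain \<gamma>' where g': "curve_at ?B p \<gamma>'" "velocity ?B \<gamma>' 0 = velocity ?B \<gamma> 0" "w = velocity A (fst \<circ> \<gamma>') 0" by blast
    show "w = velocity A (fst \<circ> \<gamma>) 0"
    proof
      fix \<kappa>
      show "w \<kappa> = velocity A (fst \<circ> \<gamma>) 0 \<kappa>"
      proof (cases "\<kappa> \<in> A \<and> fst p \<in> fst \<kappa>")
        case True
        then show ?thesis
          unfolding g'(3) using bundle_curve_projection(2)[OF c] bundle_curve_projection(2)[OF g'(1)] g'(2) by simp
      next
        case False
        then show ?thesis
          unfolding g'(3) using curve_at_0[OF c] curve_at_0[OF g'(1)] by (auto simp: velocity_def)
      qed
    qed
  qed
  then show ?thesis by (simp add: tautological_form_def)
qed

end

subsection \<open>The structure equations\<close>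

lemma has_vector_derivative_0_imp_const:
  fixes f :: "real \<Rightarrow> 'b::real_normed_vector"
  assumes "\<And>r. (f has_vector_derivative 0) (at r)"
  shows "f r = f s"
proof -
  have "(f has_vector_derivative 0) (at r within UNIV)" for r using assms by simp
  then obtain c where "\<And>r. f r = c" using has_vector_derivative_zero_constant[of UNIV f] by auto
  then show ?thesis by simp
qed

text \<open>The trace in Jacobi's formula is that of R (SK - KS), which vanishes since the resolvent
  R commutes with K.\<close>

lemma det_has_vector_derivative_commutator:
  fixes K :: "real \<Rightarrow> complex^'n^'n"
  assumes K: "(K has_vector_derivative - (S ** K r) + K r ** S) (at r)" and nz: "det (mat t - K r) \<noteq> 0"
  shows "((\<lambda>r. det (mat t - K r)) has_vector_derivative 0) (at r)"
proof -
  obtain R where R: "R ** (mat t - K r) = mat 1" "(mat t - K r) ** R = mat 1"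
    using nz invertible_det_nz[of "mat t - K r"] unfolding invertible_def by blast
  have RK: "R ** K r = K r ** R"
  proof -
    have "R ** (mat t - K r) = (mat t - K r) ** R" using R by simp
    then show ?thesis by (simp add: matrix_add_simps mat_mult_commute[of t R])
  qed
  have "((\<lambda>r. mat t - K r) has_derivative (\<lambda>h. - (h *\<^sub>R (- (S ** K r) + K r ** S)))) (at r)"
    using has_derivative_diff[OF has_derivative_const K[unfolded has_vector_derivative_def], of "mat t"] by simp
  from det_has_derivative[OF this R(1)]
  have D: "((\<lambda>r. det (mat t - K r)) has_derivative
      (\<lambda>h. det (mat t - K r) * trace (R ** - (h *\<^sub>R (- (S ** K r) + K r ** S))))) (at r)" .
  have sc: "R ** (h *\<^sub>R M) = h *\<^sub>R (R ** M)" for h and M :: "complex^'n^'n"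
    using bounded_bilinear.scaleR_right[OF bounded_bilinear_matrix_mult] .
  have tr: "trace (R ** (S ** K r)) = trace (R ** (K r ** S))"
  proof -
    have "trace (R ** (S ** K r)) = trace ((S ** K r) ** R)" by (rule trace_mul_sym)
    also have "\<dots> = trace (S ** (R ** K r))" by (simp add: matrix_mul_assoc[symmetric] RK)
    also have "\<dots> = trace ((R ** K r) ** S)" by (rule trace_mul_sym)
    finally show ?thesis by (simp add: matrix_mul_assoc)
  qed
  have "trace (R ** - (h *\<^sub>R (- (S ** K r) + K r ** S))) = 0" for h
  proof -
    have "R ** - (h *\<^sub>R (- (S ** K r) + K r ** S)) = h *\<^sub>R (R ** (S ** K r) - R ** (K r ** S))"
      by (simp add: sc matrix_add_simps algebra_simps scaleR_right.minus flip: scaleR_minus_right)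
    then show ?thesis
      by (simp add: linear_scale[OF bounded_linear.linear[OF bounded_linear_trace]]
        linear_diff[OF bounded_linear.linear[OF bounded_linear_trace]] tr)
  qed
  then show ?thesis using D by (simp add: has_vector_derivative_def)
qed

text \<open>Non-real t keeps t - K invertible for every Hermitian K, however the eigenvalues move
  along a curve.\<close>

lemma det_nonreal_nz:
  assumes "ctranspose (K :: complex^'n^'n) = K" "t \<notin> \<real>" shows "det (mat t - K) \<noteq> 0"
  using det_eq_0_imp_eigenvector[of t K] hermitian_eigenvalue_real[OF assms(1)] assms(2) by blast

lemma infinite_nonreal: "infinite (- \<real> :: complex set)"
proof
  assume "finite (- \<real> :: complex set)"
  moreover have "range (\<lambda>n. of_nat n + \<i>) \<subseteq> (- \<real> :: complex set)" by (auto simp: complex_is_Real_iff)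
  ultimately have "finite (range (\<lambda>n. of_nat n + \<i>))" by (rule finite_subset[rotated])
  then show False using finite_imageD[of "\<lambda>n. of_nat n + \<i>" UNIV] by (auto simp: inj_on_def)
qed

locale bk_mfd = herm_mfd X A g for X :: "'a topology" and A :: "('a, complex^'n) chart set" and g +
  fixes H :: "('a, 'n) coframe \<Rightarrow> complex ^ 'n ^ 'n"
    and T :: "('a, 'n) coframe \<Rightarrow> complex ^ 'n"
    and V :: "('a, 'n) coframe \<Rightarrow> real"
    and \<phi> :: "('a, 'n) coframe \<Rightarrow> ('a, 'n) coframe_tvec \<Rightarrow> complex ^ 'n ^ 'n"
  assumes uc: "unitary_connection A g \<phi>"
    and herm_H: "p \<in> coframe_bundle A g \<Longrightarrow> ctranspose (H p) = H p"
    and dH: "p \<in> coframe_bundle A g \<Longrightarrow> has_differential_at (coframe_atlas A g) H p (\<lambda>\<xi>.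
          - (\<phi> p \<xi> ** H p) + H p ** \<phi> p \<xi> + outer (T p) (tautological_form A g p \<xi>) + outer (tautological_form A g p \<xi>) (T p))"
    and dT: "p \<in> coframe_bundle A g \<Longrightarrow> has_differential_at (coframe_atlas A g) T p (\<lambda>\<xi>.
          - (\<phi> p \<xi> *v T p)
          + (H p ** H p + mat (trace (H p)) ** H p + mat (complex_of_real (V p))) *v tautological_form A g p \<xi>)"
    and dV: "p \<in> coframe_bundle A g \<Longrightarrow> has_differential_at (coframe_atlas A g) (\<lambda>q. complex_of_real (V q)) p (\<lambda>\<xi>.
          trace (H p) * (herm (T p) (tautological_form A g p \<xi>) + herm (tautological_form A g p \<xi>) (T p))
          + (herm (T p) (H p *v tautological_form A g p \<xi>) + herm (tautological_form A g p \<xi>) (H p *v T p)))"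
    and metric_analytic: "\<kappa> \<in> A \<Longrightarrow> real_analytic_on (snd \<kappa> ` fst \<kappa>) (metric_coeff A g \<kappa> e e')"
    and connected_X: "connected_space X" and X_ne: "topspace X \<noteq> {}"
begin

lemma cof_curve:
  assumes k: "\<kappa> \<in> A" and b: "b ` D \<subseteq> fst \<kappa>" "smooth_on D (\<lambda>t. snd \<kappa> (b t))" and M: "smooth_on D M"
    and iso: "\<And>t. t \<in> D \<Longrightarrow> isom \<kappa> (b t) (M t)" and D: "(0::real) \<in> D"
  shows "curve_at (coframe_atlas A g) (cof \<kappa> (b 0) (M 0)) (\<lambda>t. cof \<kappa> (b t) (M t))"
    and "tautological_form A g (cof \<kappa> (b 0) (M 0)) (velocity (coframe_atlas A g) (\<lambda>t. cof \<kappa> (b t) (M t)) 0) =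
      M 0 *v vector_derivative (\<lambda>t. snd \<kappa> (b t)) (at 0)"
proof -
  show c: "curve_at (coframe_atlas A g) (cof \<kappa> (b 0) (M 0)) (\<lambda>t. cof \<kappa> (b t) (M t))"
    unfolding curve_at_def using plot_in_bundle[OF k b M iso] D by blast
  have b0: "b 0 \<in> fst \<kappa>" using b(1) D by auto
  have cb: "curve_at A (b 0) b" using bundle_curve_projection(1)[OF c] by (simp add: o_def)
  have "velocity A b 0 \<in> tangent_space A (b 0)" using cb by (auto simp: tangent_space_def)
  then have "snd (cof \<kappa> (b 0) (M 0)) (velocity A b 0) = M 0 *v velocity A b 0 \<kappa>" by (rule cof_apply)
  also have "velocity A b 0 \<kappa> = vector_derivative (\<lambda>t. snd \<kappa> (b t)) (at 0)"
    using k b0 by (simp add: velocity_def o_def)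
  finally show "tautological_form A g (cof \<kappa> (b 0) (M 0)) (velocity (coframe_atlas A g) (\<lambda>t. cof \<kappa> (b t) (M t)) 0) =
      M 0 *v vector_derivative (\<lambda>t. snd \<kappa> (b t)) (at 0)"
    using tautological_form_velocity[OF c] by (simp add: o_def)
qed

section \<open>Local sections and the pulled-back equations\<close>

definition fr :: "('a, complex^'n) chart \<Rightarrow> (complex^'n \<Rightarrow> complex^'n^'n) \<times> (complex^'n \<Rightarrow> complex^'n^'n)" where
  "fr \<kappa> = (SOME p. smooth_on (im \<kappa>) (fst p) \<and> (\<forall>y\<in>im \<kappa>. snd p y ** fst p y = (mat 1 :: complex^'n^'n) \<and>
     (\<forall>e e'. (fst p y *v e) \<bullet> (fst p y *v e') = \<beta> \<kappa> y e e')))"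

definition fa where "fa \<kappa> = fst (fr \<kappa>)"
definition fE where "fE \<kappa> = snd (fr \<kappa>)"

lemma frame:
  assumes "\<kappa> \<in> A"
  shows "smooth_on (im \<kappa>) (fa \<kappa>)" "y \<in> im \<kappa> \<Longrightarrow> fE \<kappa> y ** fa \<kappa> y = mat 1"
    "y \<in> im \<kappa> \<Longrightarrow> (fa \<kappa> y *v e) \<bullet> (fa \<kappa> y *v e') = \<beta> \<kappa> y e e'"
proof -
  obtain a E where aE: "smooth_on (im \<kappa>) (a :: complex^'n \<Rightarrow> complex^'n^'n)" "\<forall>y\<in>im \<kappa>. E y ** a y = (mat 1 :: complex^'n^'n) \<and>
     (\<forall>e e'. (a y *v e) \<bullet> (a y *v e') = \<beta> \<kappa> y e e')"
    using unitary_frame_exists[OF assms] by blast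
  have "smooth_on (im \<kappa>) (fa \<kappa>) \<and> (\<forall>y\<in>im \<kappa>. fE \<kappa> y ** fa \<kappa> y = (mat 1 :: complex^'n^'n) \<and>
     (\<forall>e e'. (fa \<kappa> y *v e) \<bullet> (fa \<kappa> y *v e') = \<beta> \<kappa> y e e'))"
    unfolding fa_def fE_def fr_def by (rule someI[of _ "(a, E)"]) (use aE in simp)
  then show "smooth_on (im \<kappa>) (fa \<kappa>)" "y \<in> im \<kappa> \<Longrightarrow> fE \<kappa> y ** fa \<kappa> y = mat 1"
    "y \<in> im \<kappa> \<Longrightarrow> (fa \<kappa> y *v e) \<bullet> (fa \<kappa> y *v e') = \<beta> \<kappa> y e e'" by blast+
qed

definition \<sigma> where "\<sigma> \<kappa> y = cof \<kappa> (ic \<kappa> y) (fa \<kappa> y)"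

lemma isom_fa: "\<kappa> \<in> A \<Longrightarrow> y \<in> im \<kappa> \<Longrightarrow> isom \<kappa> (ic \<kappa> y) (fa \<kappa> y)"
  by (simp add: isom_def frame)

lemma \<sigma>_in: "\<kappa> \<in> A \<Longrightarrow> y \<in> im \<kappa> \<Longrightarrow> \<sigma> \<kappa> y \<in> coframe_bundle A g"
  unfolding \<sigma>_def by (rule cof_in_bundle[OF _ _ isom_fa]) auto

lemma \<sigma>_plot:
  fixes z :: "'d::real_normed_vector \<Rightarrow> complex^'n"
  assumes k: "\<kappa> \<in> A" and z: "smooth_on D z" "z ` D \<subseteq> im \<kappa>"
  shows "smooth_plot (coframe_atlas A g) D (\<lambda>t. \<sigma> \<kappa> (z t))"
  unfolding \<sigma>_def
proof (rule plot_in_bundle[OF k])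
  show "(\<lambda>t. ic \<kappa> (z t)) ` D \<subseteq> fst \<kappa>" using z(2) by auto
  show "smooth_on D (\<lambda>t. snd \<kappa> (ic \<kappa> (z t)))" by (rule smooth_on_cong[OF z(1)]) (use z(2) in auto)
  show "smooth_on D (\<lambda>t. fa \<kappa> (z t))" by (rule smooth_on_compose[OF z(1) frame(1)[OF k] z(2)])
  show "isom \<kappa> (ic \<kappa> (z t)) (fa \<kappa> (z t))" if "t \<in> D" for t using isom_fa[OF k] z(2) that by auto
qed

lemma \<sigma>_line:
  assumes k: "\<kappa> \<in> A" and y: "y \<in> im \<kappa>"
  shows "curve_at (coframe_atlas A g) (\<sigma> \<kappa> y) (\<lambda>r. \<sigma> \<kappa> (y + r *\<^sub>R v))"
    "tautological_form A g (\<sigma> \<kappa> y) (velocity (coframe_atlas A g) (\<lambda>r. \<sigma> \<kappa> (y + r *\<^sub>R v)) 0) = fa \<kappa> y *v v"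
proof -
  let ?D = "{r::real. y + r *\<^sub>R v \<in> im \<kappa>}"
  have o: "open ?D" by (rule open_line_vimage[OF chart(2)[OF k]])
  have z: "smooth_on ?D (\<lambda>r. y + r *\<^sub>R v)" by (rule smooth_on_line[OF o])
  have 1: "(\<lambda>r. ic \<kappa> (y + r *\<^sub>R v)) ` ?D \<subseteq> fst \<kappa>" by auto
  have 2: "smooth_on ?D (\<lambda>r. snd \<kappa> (ic \<kappa> (y + r *\<^sub>R v)))" by (rule smooth_on_cong[OF z]) auto
  have 3: "smooth_on ?D (\<lambda>r. fa \<kappa> (y + r *\<^sub>R v))" by (rule smooth_on_compose[OF z frame(1)[OF k]]) auto
  have 4: "isom \<kappa> (ic \<kappa> (y + r *\<^sub>R v)) (fa \<kappa> (y + r *\<^sub>R v))" if "r \<in> ?D" for r using isom_fa[OF k] that by auto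
  have 5: "(0::real) \<in> ?D" using y by simp
  note c = cof_curve[OF k 1 2 3 4 5]
  show "curve_at (coframe_atlas A g) (\<sigma> \<kappa> y) (\<lambda>r. \<sigma> \<kappa> (y + r *\<^sub>R v))"
    using c(1) by (simp add: \<sigma>_def)
  have "((\<lambda>r. y + r *\<^sub>R v) has_vector_derivative v) (at 0)" by (auto intro!: derivative_eq_intros)
  then have "((\<lambda>r. snd \<kappa> (ic \<kappa> (y + r *\<^sub>R v))) has_vector_derivative v) (at 0)"
    by (rule vector_derivative_transform[OF _ o]) (use y in auto)
  then have "vector_derivative (\<lambda>r. snd \<kappa> (ic \<kappa> (y + r *\<^sub>R v))) (at 0) = v" by (rule vector_derivative_at)
  then show "tautological_form A g (\<sigma> \<kappa> y) (velocity (coframe_atlas A g) (\<lambda>r. \<sigma> \<kappa> (y + r *\<^sub>R v)) 0) = fa \<kappa> y *v v"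
    using c(2) by (simp add: \<sigma>_def)
qed

text \<open>The pullback of \<phi> along the section \<open>\<sigma> \<kappa>\<close>, evaluated on
  the coordinate direction v.\<close>

definition \<phi>\<kappa> where "\<phi>\<kappa> \<kappa> y v = \<phi> (\<sigma> \<kappa> y) (velocity (coframe_atlas A g) (\<lambda>r. \<sigma> \<kappa> (y + r *\<^sub>R v)) 0)"

text \<open>The exterior derivative is accessible through two-parameter plots. On the plane y + r v
  + s w, lifted by \<open>\<sigma> \<kappa>\<close>, the tautological form has the components
  \<open>fa \<kappa> *v v\<close> and \<open>fa \<kappa> *v w\<close>, whose derivatives at the
  origin give the left-hand side.\<close>

lemma torsion_local:
  assumes k: "\<kappa> \<in> A" and y: "y \<in> im \<kappa>"
  shows "frechet_derivative (fa \<kappa>) (at y) v *v w - frechet_derivative (fa \<kappa>) (at y) w *v v =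
       - (\<phi>\<kappa> \<kappa> y v *v (fa \<kappa> y *v w) - \<phi>\<kappa> \<kappa> y w *v (fa \<kappa> y *v v))"
proof -
  let ?B = "coframe_atlas A g"
  define z where "z t = y + fst t *\<^sub>R v + snd t *\<^sub>R w" for t :: "real \<times> real"
  define D where "D = {t. z t \<in> im \<kappa>}"
  define s where "s t = \<sigma> \<kappa> (z t)" for t
  have zc: "continuous_on UNIV z" unfolding z_def by (intro continuous_intros)
  have oD: "open D" using open_vimage[OF chart(2)[OF k] zc] by (simp add: D_def vimage_def)
  have zs: "smooth_on D z"
    unfolding z_def by (intro smooth_on_add smooth_on_const oD smooth_on_scaleR smooth_on_fst smooth_on_snd smooth_on_id)
  have pl: "smooth_plot ?B D s" unfolding s_def by (rule \<sigma>_plot[OF k zs]) (auto simp: D_def)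
  have 0: "(0, 0) \<in> D" using y by (simp add: D_def z_def)
  have ed: "has_exterior_derivative ?B (tautological_form A g) (\<lambda>p \<xi> \<eta>. - wedge (*v) (\<phi> p) (tautological_form A g p) \<xi> \<eta>)"
    using uc by (simp add: unitary_connection_def Let_def)
  let ?\<omega> = "tautological_form A g"
  have pv1: "partial_velocity ?B s t (1, 0) = velocity ?B (\<lambda>r. \<sigma> \<kappa> (z t + r *\<^sub>R v)) 0" for t
    by (simp add: partial_velocity_def s_def z_def algebra_simps)
  have pv2: "partial_velocity ?B s t (0, 1) = velocity ?B (\<lambda>r. \<sigma> \<kappa> (z t + r *\<^sub>R w)) 0" for t
    by (simp add: partial_velocity_def s_def z_def algebra_simps)
  have om1: "?\<omega> (s t) (partial_velocity ?B s t (1, 0)) = fa \<kappa> (z t) *v v" if "t \<in> D" for t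
    unfolding pv1 unfolding s_def by (rule \<sigma>_line(2)[OF k]) (use that D_def in auto)
  have om2: "?\<omega> (s t) (partial_velocity ?B s t (0, 1)) = fa \<kappa> (z t) *v w" if "t \<in> D" for t
    unfolding pv2 unfolding s_def by (rule \<sigma>_line(2)[OF k]) (use that D_def in auto)
  have z0: "z (0, 0) = y" by (simp add: z_def)
  have zd: "(z has_derivative (\<lambda>t. fst t *\<^sub>R v + snd t *\<^sub>R w)) (at (0, 0))"
    unfolding z_def by (auto intro!: derivative_eq_intros)
  have ad: "(fa \<kappa> has_derivative frechet_derivative (fa \<kappa>) (at y)) (at (z (0, 0)))"
    unfolding z0 by (rule smooth_on_has_derivative[OF frame(1)[OF k] y])
  have fd: "frechet_derivative F (at (0, 0)) e =
      frechet_derivative (fa \<kappa>) (at y) (fst e *\<^sub>R v + snd e *\<^sub>R w) *v q"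
    if "\<And>t. t \<in> D \<Longrightarrow> F t = fa \<kappa> (z t) *v q" for F q e
  proof -
    have "((\<lambda>t. fa \<kappa> (z t)) has_derivative (\<lambda>e. frechet_derivative (fa \<kappa>) (at y) (fst e *\<^sub>R v + snd e *\<^sub>R w))) (at (0, 0))"
      using has_derivative_compose[OF zd ad] .
    from bounded_linear.has_derivative[OF bounded_bilinear.bounded_linear_left[OF bounded_bilinear_matrix_vector_mult] this, of q]
    have "((\<lambda>t. fa \<kappa> (z t) *v q) has_derivative (\<lambda>e. frechet_derivative (fa \<kappa>) (at y) (fst e *\<^sub>R v + snd e *\<^sub>R w) *v q)) (at (0, 0))" .
    then have "(F has_derivative (\<lambda>e. frechet_derivative (fa \<kappa>) (at y) (fst e *\<^sub>R v + snd e *\<^sub>R w) *v q)) (at (0, 0))"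
      by (rule has_derivative_transform_within_open[OF _ oD 0]) (simp add: that)
    from frechet_derivative_at[OF this, symmetric] show ?thesis by simp
  qed
  have fe: "frechet_derivative (\<lambda>r. ?\<omega> (s r) (partial_velocity ?B s r (0, 1))) (at (0, 0)) (1, 0) = frechet_derivative (fa \<kappa>) (at y) v *v w"
    "frechet_derivative (\<lambda>r. ?\<omega> (s r) (partial_velocity ?B s r (1, 0))) (at (0, 0)) (0, 1) = frechet_derivative (fa \<kappa>) (at y) w *v v"
    by (simp_all add: fd om1 om2)
  have "frechet_derivative (\<lambda>r. ?\<omega> (s r) (partial_velocity ?B s r (0, 1))) (at (0, 0)) (1, 0)
        - frechet_derivative (\<lambda>r. ?\<omega> (s r) (partial_velocity ?B s r (1, 0))) (at (0, 0)) (0, 1)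
        = - wedge (*v) (\<phi> (s (0, 0))) (?\<omega> (s (0, 0))) (partial_velocity ?B s (0, 0) (1, 0)) (partial_velocity ?B s (0, 0) (0, 1))"
    using ed pl 0 unfolding has_exterior_derivative_def by blast
  then show ?thesis
    unfolding fe wedge_def om1[OF 0] om2[OF 0]
    by (simp add: \<phi>\<kappa>_def s_def z0 pv1 pv2)
qed

lemma bk_local:
  assumes k: "\<kappa> \<in> A"
  shows "bk_local (im \<kappa>) (fa \<kappa>) (fE \<kappa>) (\<lambda>y. H (\<sigma> \<kappa> y)) (\<lambda>y. T (\<sigma> \<kappa> y)) (\<lambda>y. of_real (V (\<sigma> \<kappa> y))) (\<phi>\<kappa> \<kappa>)"
proof
  fix y v w assume y: "y \<in> im \<kappa>"
  show "fE \<kappa> y ** fa \<kappa> y = mat 1" by (rule frame(2)[OF k y])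
  show "ctranspose (H (\<sigma> \<kappa> y)) = H (\<sigma> \<kappa> y)" by (rule herm_H[OF \<sigma>_in[OF k y]])
  show "frechet_derivative (fa \<kappa>) (at y) v *v w - frechet_derivative (fa \<kappa>) (at y) w *v v =
       - (\<phi>\<kappa> \<kappa> y v *v (fa \<kappa> y *v w) - \<phi>\<kappa> \<kappa> y w *v (fa \<kappa> y *v v))" by (rule torsion_local[OF k y])
  note c = \<sigma>_line[OF k y, of v]
  have "velocity (coframe_atlas A g) (\<lambda>r. \<sigma> \<kappa> (y + r *\<^sub>R v)) 0 \<in> tangent_space (coframe_atlas A g) (\<sigma> \<kappa> y)"
    unfolding tangent_space_def using c(1) by blast
  then show "ctranspose (\<phi>\<kappa> \<kappa> y v) = - \<phi>\<kappa> \<kappa> y v"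
    using uc \<sigma>_in[OF k y] by (simp add: unitary_connection_def Let_def \<phi>\<kappa>_def)
  note d = dH[OF \<sigma>_in[OF k y]] dT[OF \<sigma>_in[OF k y]] dV[OF \<sigma>_in[OF k y]]
  note e = d[unfolded has_differential_at_def, rule_format, OF c(1), unfolded c(2) \<phi>\<kappa>_def[symmetric] o_def]
  show "((\<lambda>r. H (\<sigma> \<kappa> (y + r *\<^sub>R v))) has_vector_derivative
       - (\<phi>\<kappa> \<kappa> y v ** H (\<sigma> \<kappa> y)) + H (\<sigma> \<kappa> y) ** \<phi>\<kappa> \<kappa> y v + outer (T (\<sigma> \<kappa> y)) (fa \<kappa> y *v v) + outer (fa \<kappa> y *v v) (T (\<sigma> \<kappa> y))) (at 0)"
    by (rule e(1))
  show "((\<lambda>r. T (\<sigma> \<kappa> (y + r *\<^sub>R v))) has_vector_derivative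
       - (\<phi>\<kappa> \<kappa> y v *v T (\<sigma> \<kappa> y)) + (H (\<sigma> \<kappa> y) ** H (\<sigma> \<kappa> y) + mat (trace (H (\<sigma> \<kappa> y))) ** H (\<sigma> \<kappa> y) + mat (of_real (V (\<sigma> \<kappa> y)))) *v (fa \<kappa> y *v v)) (at 0)"
    by (rule e(2))
  show "((\<lambda>r. of_real (V (\<sigma> \<kappa> (y + r *\<^sub>R v)))) has_vector_derivative
       trace (H (\<sigma> \<kappa> y)) * (herm (T (\<sigma> \<kappa> y)) (fa \<kappa> y *v v) + herm (fa \<kappa> y *v v) (T (\<sigma> \<kappa> y))) +
       (herm (T (\<sigma> \<kappa> y)) (H (\<sigma> \<kappa> y) *v (fa \<kappa> y *v v)) + herm (fa \<kappa> y *v v) (H (\<sigma> \<kappa> y) *v T (\<sigma> \<kappa> y)))) (at 0)"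
    by (rule e(3))
qed (rule frame(1)[OF k])

subsection \<open>The characteristic polynomial on the fibres\<close>

lemma isom_unitary:
  assumes "isom \<kappa> x M" "ctranspose c ** c = mat 1"
  shows "isom \<kappa> x (c ** M)"
proof -
  have "(c *v u) \<bullet> (c *v v) = u \<bullet> v" for u v
    by (simp add: inner_eq_Re_herm herm_matrix matrix_vector_mul_assoc assms(2))
  then show ?thesis using assms(1) by (simp add: isom_def matrix_vector_mul_assoc[symmetric])
qed

text \<open>The tautological form vanishes on velocities in a fibre, so dH reduces to a commutator
  there.\<close>

lemma det_H_fibre_curve:
  assumes k: "\<kappa> \<in> A" "x \<in> fst \<kappa>" and M: "isom \<kappa> x M" and c: "smooth_on UNIV c" "\<And>r. ctranspose (c r) ** c r = mat 1"
    and t: "t \<notin> \<real>"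
  shows "det (mat t - H (cof \<kappa> x (c (r::real) ** M))) = det (mat t - H (cof \<kappa> x (c s ** M)))"
proof (rule has_vector_derivative_0_imp_const[of "\<lambda>r. det (mat t - H (cof \<kappa> x (c r ** M)))"])
  fix r :: real
  let ?p = "cof \<kappa> x (c r ** M)" and ?B = "coframe_atlas A g"
  have iso: "isom \<kappa> x (c s ** M)" for s by (rule isom_unitary[OF M c(2)])
  have p: "?p \<in> coframe_bundle A g" by (rule cof_in_bundle[OF k iso])
  have sm: "smooth_on UNIV (\<lambda>s. c (r + s) ** M)"
    by (intro smooth_on_matrix_mult smooth_on_compose[OF _ c(1)] smooth_on_add smooth_on_const smooth_on_id) auto
  have x: "(\<lambda>_. x) ` (UNIV :: real set) \<subseteq> fst \<kappa>" using k by auto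
  have cx: "smooth_on (UNIV :: real set) (\<lambda>_. snd \<kappa> x)" by (rule smooth_on_const) simp
  note cu = cof_curve[OF k(1) x cx sm iso UNIV_I, simplified]
  define \<xi> where "\<xi> = velocity ?B (\<lambda>t. cof \<kappa> x (c (r + t) ** M)) 0"
  have om: "tautological_form A g ?p \<xi> = 0" using cu(2) by (simp add: \<xi>_def)
  have "((H \<circ> (\<lambda>t. cof \<kappa> x (c (r + t) ** M))) has_vector_derivative - (\<phi> ?p \<xi> ** H ?p) + H ?p ** \<phi> ?p \<xi> + outer (T ?p) (tautological_form A g ?p \<xi>) + outer (tautological_form A g ?p \<xi>) (T ?p)) (at 0)"
    using dH[OF p] cu(1) unfolding has_differential_at_def \<xi>_def by blast
  then have "((\<lambda>s. H (cof \<kappa> x (c (r + s) ** M))) has_vector_derivative - (\<phi> ?p \<xi> ** H ?p) + H ?p ** \<phi> ?p \<xi>) (at 0)"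
    unfolding om by (simp add: o_def outer_def zero_vec_def[symmetric])
  then have "((\<lambda>s. H (cof \<kappa> x (c s ** M))) has_vector_derivative - (\<phi> ?p \<xi> ** H ?p) + H ?p ** \<phi> ?p \<xi>) (at r)"
    using has_vector_derivative_at_shift[of "\<lambda>s. H (cof \<kappa> x (c s ** M))" r] by (simp add: o_def add.commute)
  then show "((\<lambda>r. det (mat t - H (cof \<kappa> x (c r ** M)))) has_vector_derivative 0) (at r)"
    by (rule det_has_vector_derivative_commutator) (rule det_nonreal_nz[OF herm_H[OF p] t])
qed

lemma isom_unitary_transition:
  assumes k: "\<kappa> \<in> A" "x \<in> fst \<kappa>" and M: "isom \<kappa> x M" and M': "isom \<kappa> x M'"
  obtains c where "ctranspose c ** c = mat 1" "M' = c ** M"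
proof -
  have y: "snd \<kappa> x \<in> im \<kappa>" using k by simp
  have "\<exists>N. N ** M = mat 1"
    unfolding matrix_left_invertible_ker
  proof (intro allI impI)
    fix e assume "M *v e = 0"
    then have "\<beta> \<kappa> (snd \<kappa> x) e e = 0" using M unfolding isom_def by (metis inner_zero_left)
    then show "e = 0" using \<beta>_pos[OF k(1) y, of e] by force
  qed
  then obtain N where N: "N ** M = mat 1" by blast
  then have MN: "M ** N = mat 1" using matrix_left_right_inverse by blast
  define c where "c = M' ** N"
  have cM: "M' = c ** M" by (simp add: c_def matrix_mul_assoc[symmetric] N)
  have inn: "(c *v u) \<bullet> (c *v v) = u \<bullet> v" for u v
  proof -
    have "u \<bullet> v = (M *v (N *v u)) \<bullet> (M *v (N *v v))" by (simp add: matrix_vector_mul_assoc MN)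
    also have "\<dots> = (M' *v (N *v u)) \<bullet> (M' *v (N *v v))" using M M' by (simp add: isom_def)
    finally show ?thesis by (simp add: c_def matrix_vector_mul_assoc)
  qed
  have "(ctranspose c ** c) *v v = v" for v
  proof -
    have "u \<bullet> ((ctranspose c ** c) *v v - v) = 0" for u
      using inn[of u v] by (simp add: inner_diff_right inner_eq_Re_herm[of u "_ *v _"] inner_eq_Re_herm[of "c *v u"] herm_matrix matrix_vector_mul_assoc)
    then have "(ctranspose c ** c) *v v - v = 0" using inner_eq_zero_iff by blast
    then show ?thesis by simp
  qed
  then have "ctranspose c ** c = mat 1" by (simp add: matrix_eq)
  then show ?thesis using cM that by blast
qed

text \<open>Two unitary coframes at x differ by a unitary matrix, which the two smooth arcs of
  \<open>unitary_connected\<close>, meeting at time 1, join to the identity.\<close>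

lemma charpoly_H_fibre:
  assumes k: "\<kappa> \<in> A" "x \<in> fst \<kappa>" and M: "isom \<kappa> x M" and M': "isom \<kappa> x M'"
  shows "charpoly (H (cof \<kappa> x M)) = charpoly (H (cof \<kappa> x M'))"
proof (rule poly_eqI_infinite[OF infinite_nonreal])
  fix t :: complex assume "t \<in> - \<real>"
  then have t: "t \<notin> \<real>" by simp
  obtain a where a: "ctranspose a ** a = mat 1" "M' = a ** M" using isom_unitary_transition[OF assms] .
  obtain c1 c2 :: "real \<Rightarrow> complex^'n^'n" where c: "smooth_on UNIV c1" "smooth_on UNIV c2"
    "\<And>r. ctranspose (c1 r) ** c1 r = mat 1" "\<And>r. ctranspose (c2 r) ** c2 r = mat 1" "c1 0 = a" "c1 1 = c2 1" "c2 0 = mat 1"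
    using unitary_connected[OF a(1)] by blast
  have "det (mat t - H (cof \<kappa> x (c1 0 ** M))) = det (mat t - H (cof \<kappa> x (c1 1 ** M)))"
    by (rule det_H_fibre_curve[OF k M c(1,3) t])
  also have "\<dots> = det (mat t - H (cof \<kappa> x (c2 0 ** M)))"
    unfolding c(6) by (rule det_H_fibre_curve[OF k M c(2,4) t])
  finally show "poly (charpoly (H (cof \<kappa> x M))) t = poly (charpoly (H (cof \<kappa> x M'))) t"
    by (simp add: poly_charpoly c a(2))
qed

text \<open>The characteristic polynomial is the same for all coframes over x and determines the
  elementary symmetric functions of its roots, so the description in \<open>h_fun\<close> has a
  unique solution.\<close>

lemma h_fun_eq:
  assumes k: "\<kappa> \<in> A" "x \<in> fst \<kappa>" and M: "isom \<kappa> x M" and ev: "eigenvalue_list (H (cof \<kappa> x M)) ev"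
    and l: "l \<in> {1..CARD('n)}"
  shows "h_fun A g H l x = elem_sym l ev"
  unfolding h_fun_def
proof (rule the_equality)
  show "\<exists>u ev'. (x, u) \<in> coframe_bundle A g \<and> eigenvalue_list (H (x, u)) ev' \<and> elem_sym l ev = elem_sym l ev'"
    using cof_in_bundle[OF k M] ev by (intro exI[of _ "snd (cof \<kappa> x M)"] exI[of _ ev]) (simp add: cof_def)
  fix s assume "\<exists>u ev'. (x, u) \<in> coframe_bundle A g \<and> eigenvalue_list (H (x, u)) ev' \<and> s = elem_sym l ev'"
  then obtain u ev' where u: "(x, u) \<in> coframe_bundle A g" "eigenvalue_list (H (x, u)) ev'" "s = elem_sym l ev'" by (elim exE conjE)
  define M' where "M' = matrix (\<lambda>e. u (coord_vec A \<kappa> x e))"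
  have M': "(x, u) = cof \<kappa> x M'" "isom \<kappa> x M'" unfolding M'_def by (rule bundle_eq_cof[OF u(1) k])+
  have "(\<Prod>i\<in>UNIV. [:- ev' i, 1:]) = (\<Prod>i\<in>UNIV. [:- ev i, 1:])"
  proof (rule poly_eqI_infinite[OF infinite_UNIV_char_0])
    fix t :: real
    have "det (mat (of_real t) - H (x, u)) = det (mat (of_real t) - H (cof \<kappa> x M))"
      using charpoly_H_fibre[OF k M M'(2)] unfolding M'(1) poly_charpoly[symmetric] by simp
    then show "poly (\<Prod>i\<in>UNIV. [:- ev' i, 1:]) t = poly (\<Prod>i\<in>UNIV. [:- ev i, 1:]) t"
      unfolding eigenvalue_list_eval[OF ev] eigenvalue_list_eval[OF u(2)] by (simp only: of_real_eq_iff)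
  qed
  then have "coeff (\<Prod>i\<in>UNIV. [:- ev' i, 1:]) (CARD('n) - l) = coeff (\<Prod>i\<in>UNIV. [:- ev i, 1:]) (CARD('n) - l)" by simp
  moreover have "coeff (\<Prod>i\<in>UNIV. [:- e i, 1:]) (CARD('n) - l) = (-1)^l * elem_sym l e" for e :: "'n \<Rightarrow> real"
  proof -
    have "(\<Sum>k=1..CARD('n). coeff (monom ((-1) ^ k * elem_sym k e) (CARD('n) - k)) (CARD('n) - l)) =
      (\<Sum>k=1..CARD('n). if k = l then (-1) ^ k * elem_sym k e else 0)"
      using l by (intro sum.cong) auto
    also have "\<dots> = (-1)^l * elem_sym l e" using l by simp
    finally show ?thesis using l unfolding elem_sym_eval coeff_add coeff_sum coeff_monom by auto
  qed
  ultimately show "s = elem_sym l ev" by (simp add: u(3))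
qed

lemma momentum_polynomial_eq:
  assumes k: "\<kappa> \<in> A" "x \<in> fst \<kappa>" and M: "isom \<kappa> x M" and ev: "eigenvalue_list (H (cof \<kappa> x M)) ev"
  shows "momentum_polynomial A g H x = (\<Prod>i\<in>UNIV. [:- ev i, 1:])"
  unfolding elem_sym_eval momentum_polynomial_def using h_fun_eq[OF assms] by simp

lemma momentum_polynomial_det:
  assumes k: "\<kappa> \<in> A" "x \<in> fst \<kappa>" and M: "isom \<kappa> x M"
  shows "complex_of_real (poly (momentum_polynomial A g H x) t) = det (mat (of_real t) - H (cof \<kappa> x M))"
proof -
  obtain ev where ev: "eigenvalue_list (H (cof \<kappa> x M)) ev"
    using hermitian_has_eigenvalue_list[OF herm_H[OF cof_in_bundle[OF assms]]] by blast
  show ?thesis unfolding momentum_polynomial_eq[OF assms ev] eigenvalue_list_eval[OF ev] ..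
qed

end

subsection \<open>Hamiltonian vector fields\<close>

context herm_mfd
begin

lemma \<beta>_nondegenerate:
  assumes "\<kappa> \<in> A" "y \<in> im \<kappa>" "\<And>v. \<beta> \<kappa> y e v = \<beta> \<kappa> y e' v"
  shows "e = e'"
proof (rule ccontr)
  assume "e \<noteq> e'"
  then have "\<beta> \<kappa> y (e - e') (e - e') > 0" using \<beta>_pos[OF assms(1,2), of "e - e'"] by simp
  moreover have "\<beta> \<kappa> y (e - e') (e - e') = 0"
    using linear_diff[OF \<beta>_linear[OF assms(1,2)]] assms(3) by simp
  ultimately show False by simp
qed

lemma ii_smult: "\<i> *s (\<i> *s e) = - (e :: complex^'n)"
  by (simp add: vec_eq_iff)

lemma kaehler_form_coord:
  assumes k: "\<kappa> \<in> A" "x \<in> fst \<kappa>" and v: "v \<in> tangent_space A x" "w \<in> tangent_space A x"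
  shows "kaehler_form g x v w = \<beta> \<kappa> (snd \<kappa> x) (\<i> *s v \<kappa>) (w \<kappa>)"
proof -
  have "cscale \<i> v = coord_vec A \<kappa> x (\<i> *s v \<kappa>)"
    using tangent_eq_coord_vec[OF v(1) k] coord_vec_linear(3)[OF k, of \<i> "v \<kappa>"] by simp
  then show ?thesis
    using tangent_eq_coord_vec[OF v(2) k] by (simp add: kaehler_form_def \<beta>_co[OF k])
qed

lemma curve_has_vector_derivative:
  assumes k: "\<kappa> \<in> A" "x \<in> fst \<kappa>" and c: "curve_at A x \<gamma>"
    and F: "((\<lambda>y. F (ic \<kappa> y)) has_derivative F') (at (snd \<kappa> x))"
  shows "((F \<circ> \<gamma>) has_vector_derivative F' (velocity A \<gamma> 0 \<kappa>)) (at 0)"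
proof -
  note cc = curve_at_chart[OF c k]
  obtain N where N: "open N" "0 \<in> N" "\<forall>t\<in>N. \<gamma> t \<in> fst \<kappa>" using cc(2) by blast
  have "((\<lambda>t. F (ic \<kappa> ((snd \<kappa> \<circ> \<gamma>) t))) has_vector_derivative F' (velocity A \<gamma> 0 \<kappa>)) (at 0)"
    by (rule has_vector_derivative_compose_derivative[OF cc(1)]) (use F curve_at_0[OF c] in simp)
  then show ?thesis
    by (rule vector_derivative_transform[OF _ N(1,2)]) (use N(3) k in auto)
qed

text \<open>In a chart the field is i times the gradient \<open>G\<close>: since \<Omega>(Z, .) =
  g(iZ, .), the choice Z = iG gives -dF. Nondegeneracy of g makes the solution unique, as the
  definite description in \<open>hamiltonian_field\<close> needs.\<close>

lemma hamiltonian_field_props: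
  assumes G: "\<And>\<kappa> y. \<kappa> \<in> A \<Longrightarrow> y \<in> im \<kappa> \<Longrightarrow> ((\<lambda>y. F (ic \<kappa> y)) has_derivative \<beta> \<kappa> y (G \<kappa> y)) (at y)"
  shows "x \<in> topspace X \<Longrightarrow> hamiltonian_field A g F x \<in> tangent_space A x"
    and "x \<notin> topspace X \<Longrightarrow> hamiltonian_field A g F x = 0"
    and "x \<in> topspace X \<Longrightarrow> has_differential_at A F x (\<lambda>v. - kaehler_form g x (hamiltonian_field A g F x) v)"
    and "\<kappa> \<in> A \<Longrightarrow> y \<in> im \<kappa> \<Longrightarrow> hamiltonian_field A g F (ic \<kappa> y) \<kappa> = \<i> *s G \<kappa> y"
proof -
  define K where "K x = (SOME \<kappa>. \<kappa> \<in> A \<and> x \<in> fst \<kappa>)" for x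
  have K: "K x \<in> A" "x \<in> fst (K x)" if "x \<in> topspace X" for x
    using someI_ex[of "\<lambda>\<kappa>. \<kappa> \<in> A \<and> x \<in> fst \<kappa>"] chart_ex[OF that] unfolding K_def by blast+
  define Q where "Q Z \<longleftrightarrow> (\<forall>x\<in>points A. Z x \<in> tangent_space A x \<and>
                has_differential_at A F x (\<lambda>v. - kaehler_form g x (Z x) v)) \<and>
             (\<forall>x. x \<notin> points A \<longrightarrow> Z x = 0)" for Z
  define Z0 where "Z0 x = (if x \<in> points A then coord_vec A (K x) x (\<i> *s G (K x) (snd (K x) x)) else 0)" for x
  have Q0: "Q Z0"
    unfolding Q_def points_A
  proof (intro conjI ballI allI impI)
    fix x assume x: "x \<in> topspace X"
    note k = K[OF x]
    have Zx: "Z0 x = coord_vec A (K x) x (\<i> *s G (K x) (snd (K x) x))" using x by (simp add: Z0_def points_A)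
    show t: "Z0 x \<in> tangent_space A x" unfolding Zx by (rule coord_vec_tangent[OF k])
    show "has_differential_at A F x (\<lambda>v. - kaehler_form g x (Z0 x) v)"
      unfolding has_differential_at_def
    proof (intro allI impI)
      fix \<gamma> assume c: "curve_at A x \<gamma>"
      have vt: "velocity A \<gamma> 0 \<in> tangent_space A x" using c by (auto simp: tangent_space_def)
      have "- kaehler_form g x (Z0 x) (velocity A \<gamma> 0) = \<beta> (K x) (snd (K x) x) (G (K x) (snd (K x) x)) (velocity A \<gamma> 0 (K x))"
        unfolding kaehler_form_coord[OF k t vt] unfolding Zx coord_vec_comp[OF k] ii_smult
        using linear_neg[OF \<beta>_linear[OF k(1)]] k by simp
      then show "((F \<circ> \<gamma>) has_vector_derivative - kaehler_form g x (Z0 x) (velocity A \<gamma> 0)) (at 0)"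
        using curve_has_vector_derivative[OF k c G[OF k(1)]] k by simp
    qed
  qed (simp add: Z0_def points_A)
  have comp: "Z (ic \<kappa> y) \<kappa> = \<i> *s G \<kappa> y" if "Q Z" and k: "\<kappa> \<in> A" "y \<in> im \<kappa>" for Z \<kappa> y
  proof -
    let ?x = "ic \<kappa> y"
    have x: "?x \<in> fst \<kappa>" "?x \<in> points A" using k chart_subset[OF k(1)] by (auto simp: points_A)
    then have Z: "Z ?x \<in> tangent_space A ?x" "has_differential_at A F ?x (\<lambda>v. - kaehler_form g ?x (Z ?x) v)"
      using \<open>Q Z\<close> unfolding Q_def by blast+
    have "\<beta> \<kappa> y (G \<kappa> y) v = \<beta> \<kappa> y (- (\<i> *s Z ?x \<kappa>)) v" for v
    proof -
      note l = line_in_chart[OF k, of v]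
      have vt: "velocity A (\<lambda>r. ic \<kappa> (y + r *\<^sub>R v)) 0 \<in> tangent_space A ?x" using l(1) by (auto simp: tangent_space_def)
      have "((F \<circ> (\<lambda>r. ic \<kappa> (y + r *\<^sub>R v))) has_vector_derivative - kaehler_form g ?x (Z ?x) (velocity A (\<lambda>r. ic \<kappa> (y + r *\<^sub>R v)) 0)) (at 0)"
        using Z(2) l(1) unfolding has_differential_at_def by blast
      moreover have "((F \<circ> (\<lambda>r. ic \<kappa> (y + r *\<^sub>R v))) has_vector_derivative \<beta> \<kappa> y (G \<kappa> y) (velocity A (\<lambda>r. ic \<kappa> (y + r *\<^sub>R v)) 0 \<kappa>)) (at 0)"
        by (rule curve_has_vector_derivative[OF k(1) x(1) l(1)]) (use G[OF k] k in simp)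
      ultimately have "\<beta> \<kappa> y (G \<kappa> y) (velocity A (\<lambda>r. ic \<kappa> (y + r *\<^sub>R v)) 0 \<kappa>) = - kaehler_form g ?x (Z ?x) (velocity A (\<lambda>r. ic \<kappa> (y + r *\<^sub>R v)) 0)"
        using vector_derivative_unique_at by blast
      then show ?thesis
        unfolding kaehler_form_coord[OF k(1) x(1) Z(1) vt] l(2)
        using linear_neg[OF \<beta>_linear[OF k]] k by simp
    qed
    from \<beta>_nondegenerate[OF k this] have "\<i> *s G \<kappa> y = \<i> *s (- (\<i> *s Z ?x \<kappa>))" by simp
    then show ?thesis by (simp add: vec_eq_iff)
  qed
  have uniq: "Z = Z0" if "Q Z" for Z
  proof
    fix x
    show "Z x = Z0 x"
    proof (cases "x \<in> points A")
      case True
      then have x: "x \<in> topspace X" by (simp add: points_A)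
      note k = K[OF x]
      have "Z x (K x) = Z0 x (K x)"
        using comp[OF that k(1) co_im[OF k(2)]] comp[OF Q0 k(1) co_im[OF k(2)]] k by simp
      then show ?thesis using that Q0 True unfolding Q_def by (intro tangent_eqI[OF _ _ k]) auto
    next
      case False
      then show ?thesis using that Q0 unfolding Q_def by simp
    qed
  qed
  have "hamiltonian_field A g F = Z0"
    unfolding hamiltonian_field_def Q_def[symmetric] by (rule the_equality) (fact Q0, erule uniq)
  then have Q: "Q (hamiltonian_field A g F)" using Q0 by simp
  show "x \<in> topspace X \<Longrightarrow> hamiltonian_field A g F x \<in> tangent_space A x"
    "x \<notin> topspace X \<Longrightarrow> hamiltonian_field A g F x = 0"
    "x \<in> topspace X \<Longrightarrow> has_differential_at A F x (\<lambda>v. - kaehler_form g x (hamiltonian_field A g F x) v)"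
    using Q unfolding Q_def points_A by blast+
  show "\<kappa> \<in> A \<Longrightarrow> y \<in> im \<kappa> \<Longrightarrow> hamiltonian_field A g F (ic \<kappa> y) \<kappa> = \<i> *s G \<kappa> y"
    by (rule comp[OF Q])
qed

end

section \<open>Holomorphic gradients of the coefficients\<close>

context bk_mfd
begin

abbreviation mom where "mom \<equiv> momentum_polynomial A g H"
abbreviation hh where "hh \<equiv> h_fun A g H"

text \<open>The vector \<open>wt\<close> carried from the frame to the coordinates of the chart; up
  to the factor -2 it is the gradient of p_h(t).\<close>

definition Wt where "Wt \<kappa> t y = fE \<kappa> y *v bk_local.wt (\<lambda>y. H (\<sigma> \<kappa> y)) (\<lambda>y. T (\<sigma> \<kappa> y)) t y"

lemma mom_det:
  assumes "\<kappa> \<in> A" "y \<in> im \<kappa>"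
  shows "complex_of_real (poly (mom (ic \<kappa> y)) t) = det (mat (of_real t) - H (\<sigma> \<kappa> y))"
  using momentum_polynomial_det[OF assms(1) ic_dom[OF assms(2)] isom_fa[OF assms]] by (simp add: \<sigma>_def)

lemma mom_ev: "x \<in> topspace X \<Longrightarrow> \<exists>ev. mom x = (\<Prod>i\<in>(UNIV :: 'n set). [:- ev i, 1:])"
proof -
  assume "x \<in> topspace X"
  then obtain \<kappa> where k: "\<kappa> \<in> A" "x \<in> fst \<kappa>" using chart_ex by blast
  have iso: "isom \<kappa> x (fa \<kappa> (snd \<kappa> x))" using isom_fa[OF k(1) co_im[OF k(2)]] k by simp
  obtain ev where "eigenvalue_list (H (cof \<kappa> x (fa \<kappa> (snd \<kappa> x)))) ev"
    using hermitian_has_eigenvalue_list[OF herm_H[OF cof_in_bundle[OF k iso]]] by blast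
  from momentum_polynomial_eq[OF k iso this] show ?thesis by blast
qed

lemma mom_nz: "x \<in> topspace X \<Longrightarrow> mom x \<noteq> 0"
  using mom_ev[of x] by auto

lemma coeff_mom:
  shows "l \<in> {1..CARD('n)} \<Longrightarrow> coeff (mom x) (CARD('n) - l) = (-1)^l * hh l x"
    and "degree (mom x - monom 1 CARD('n)) < CARD('n)" 
proof -
  assume l: "l \<in> {1..CARD('n)}"
  have "(\<Sum>k=1..CARD('n). coeff (monom ((-1) ^ k * hh k x) (CARD('n) - k)) (CARD('n) - l)) =
    (\<Sum>k=1..CARD('n). if k = l then (-1) ^ k * hh k x else 0)"
    using l by (intro sum.cong) auto
  also have "\<dots> = (-1)^l * hh l x" using l by simp
  finally show "coeff (mom x) (CARD('n) - l) = (-1)^l * hh l x"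
    using l unfolding momentum_polynomial_def coeff_add coeff_sum coeff_monom by auto
next
  have c: "CARD('n) > 0" by simp
  have "mom x - monom 1 CARD('n) = (\<Sum>k=1..CARD('n). monom ((-1) ^ k * hh k x) (CARD('n) - k))"
    by (simp add: momentum_polynomial_def)
  also have "degree \<dots> \<le> CARD('n) - 1"
    by (rule degree_sum_le) (auto intro: order.trans[OF degree_monom_le])
  finally show "degree (mom x - monom 1 CARD('n)) < CARD('n)" using c by linarith
qed

lemma poly_mom_has_derivative:
  assumes k: "\<kappa> \<in> A" and y: "y \<in> im \<kappa>" and nz: "poly (mom (ic \<kappa> y)) t \<noteq> 0"
  shows "((\<lambda>y. poly (mom (ic \<kappa> y)) t) has_derivative (\<lambda>v. - 2 * \<beta> \<kappa> y (Wt \<kappa> t y) v)) (at y)"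
    and "\<exists>D. (Wt \<kappa> t has_derivative D) (at y) \<and> (\<forall>c v. D (c *s v) = c *s D v)"
proof -
  interpret L: bk_local "im \<kappa>" "fa \<kappa>" "fE \<kappa>" "\<lambda>y. H (\<sigma> \<kappa> y)" "\<lambda>y. T (\<sigma> \<kappa> y)" "\<lambda>y. of_real (V (\<sigma> \<kappa> y))" "\<phi>\<kappa> \<kappa>"
    by (rule bk_local[OF k])
  have Pt: "L.Pt t y = of_real (poly (mom (ic \<kappa> y)) t)" if "y \<in> im \<kappa>" for y
    by (simp add: L.Pt_def mom_det[OF k that])
  have Ptnz: "L.Pt t y \<noteq> 0" using nz by (simp add: Pt[OF y])
  have eq: "herm (L.wt t y) (fa \<kappa> y *v v) + herm (fa \<kappa> y *v v) (L.wt t y) = of_real (2 * \<beta> \<kappa> y (Wt \<kappa> t y) v)" for v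
  proof -
    have "L.wt t y = fa \<kappa> y *v Wt \<kappa> t y" by (simp add: Wt_def matrix_vector_mul_assoc L.aE[OF y])
    then have "\<beta> \<kappa> y (Wt \<kappa> t y) v = L.wt t y \<bullet> (fa \<kappa> y *v v)" by (simp add: frame(3)[OF k y])
    then show ?thesis
      unfolding inner_eq_Re_herm herm_commute[of "L.wt t y" "fa \<kappa> y *v v", symmetric] by (simp add: complex_eq_iff)
  qed
  have "((\<lambda>y. Re (L.Pt t y)) has_derivative (\<lambda>v. Re (- (of_real (2 * \<beta> \<kappa> y (Wt \<kappa> t y) v))))) (at y)"
    using bounded_linear.has_derivative[OF bounded_linear_Re L.Pt_has_derivative[OF y Ptnz]] unfolding eq .
  then have "((\<lambda>y. Re (L.Pt t y)) has_derivative (\<lambda>v. - 2 * \<beta> \<kappa> y (Wt \<kappa> t y) v)) (at y)" by simp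
  then show "((\<lambda>y. poly (mom (ic \<kappa> y)) t) has_derivative (\<lambda>v. - 2 * \<beta> \<kappa> y (Wt \<kappa> t y) v)) (at y)"
    by (rule has_derivative_transform_within_open[OF _ L.open_S y]) (simp add: Pt)
  show "\<exists>D. (Wt \<kappa> t has_derivative D) (at y) \<and> (\<forall>c v. D (c *s v) = c *s D v)"
    using L.EW_has_derivative[OF y Ptnz] unfolding Wt_def[abs_def] .
qed

lemma good_points:
  assumes "x \<in> topspace X"
  obtains S where "finite S" "card S = CARD('n)" "\<And>t. t \<in> S \<Longrightarrow> poly (mom x) t \<noteq> 0"
proof -
  have "infinite (UNIV - {t. poly (mom x) t = 0})"
    using poly_roots_finite[OF mom_nz[OF assms]] by (simp add: Diff_infinite_finite infinite_UNIV_char_0)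
  then obtain S where "S \<subseteq> UNIV - {t. poly (mom x) t = 0}" "finite S" "card S = CARD('n)"
    using infinite_arbitrarily_large by blast
  then show ?thesis using that by blast
qed

text \<open>n real numbers that are not roots of p_h at one point stay so nearby. There the
  gradients of the values p_h(t) are known, and interpolation at these nodes gives the gradients of
  all h_l at once.\<close>

lemma h_fun_local:
  assumes k: "\<kappa> \<in> A" and y: "y \<in> im \<kappa>"
  shows "\<exists>U S \<nu>. open U \<and> y \<in> U \<and> U \<subseteq> im \<kappa> \<and> finite S \<and> card S = CARD('n) \<and> (\<forall>t\<in>S. \<forall>z\<in>U. poly (mom (ic \<kappa> z)) t \<noteq> 0) \<and>
    (\<forall>l\<in>{1..CARD('n)}. \<forall>z\<in>U. ((\<lambda>y. hh l (ic \<kappa> y)) has_derivative \<beta> \<kappa> z (\<Sum>t\<in>S. \<nu> l t *\<^sub>R Wt \<kappa> t z)) (at z))"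
proof -
  have x: "ic \<kappa> y \<in> topspace X" using chart_subset[OF k] ic_dom[OF y] by blast
  obtain S where S: "finite S" "card S = CARD('n)" "\<And>t. t \<in> S \<Longrightarrow> poly (mom (ic \<kappa> y)) t \<noteq> 0"
    using good_points[OF x] by blast
  obtain \<mu> :: "nat \<Rightarrow> real \<Rightarrow> real" where mu: "\<And>p k. degree p < CARD('n) \<Longrightarrow> coeff p k = (\<Sum>t\<in>S. \<mu> k t * poly p t)"
    using lagrange_coefficients[OF S(1,2)] by blast
  interpret L: bk_local "im \<kappa>" "fa \<kappa>" "fE \<kappa>" "\<lambda>y. H (\<sigma> \<kappa> y)" "\<lambda>y. T (\<sigma> \<kappa> y)" "\<lambda>y. of_real (V (\<sigma> \<kappa> y))" "\<phi>\<kappa> \<kappa>"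
    by (rule bk_local[OF k])
  have Pt: "L.Pt t y = of_real (poly (mom (ic \<kappa> y)) t)" if "y \<in> im \<kappa>" for y t
    by (simp add: L.Pt_def mom_det[OF k that])
  have "continuous_on (im \<kappa>) (\<lambda>z. \<Prod>t\<in>S. L.Pt t z)"
  proof (intro continuous_on_prod continuous_at_imp_continuous_on ballI)
    fix t z assume "t \<in> S" "z \<in> im \<kappa>"
    have "(\<lambda>z. (mat (of_real t) - H (\<sigma> \<kappa> z)) $ i $ j) differentiable (at z)" for i j
    proof -
      have "(\<lambda>z. (mat (of_real t) - H (\<sigma> \<kappa> z)) $ i $ j) = (\<lambda>z. mat (of_real t) $ i $ j - H (\<sigma> \<kappa> z) $ i $ j)" by simp
      moreover have "(\<lambda>z. H (\<sigma> \<kappa> z) $ i $ j) differentiable (at z)"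
        using bounded_linear.has_derivative[OF bounded_linear_compose[OF bounded_linear_vec_nth bounded_linear_vec_nth] L.has_derivatives(1)[OF \<open>z \<in> im \<kappa>\<close>]]
        unfolding differentiable_def by blast
      ultimately show ?thesis by (simp add: differentiable_diff)
    qed
    then have "L.Pt t differentiable (at z)"
      unfolding L.Pt_def[abs_def] by (rule det_differentiable)
    then show "isCont (L.Pt t) z" by (rule differentiable_imp_continuous_within)
  qed
  from continuous_open_preimage[OF this L.open_S, of "- {0}"] have oU: "open {z \<in> im \<kappa>. (\<Prod>t\<in>S. L.Pt t z) \<noteq> 0}"
    by (simp add: vimage_def Int_def open_Compl)
  define U where "U = {z \<in> im \<kappa>. (\<Prod>t\<in>S. L.Pt t z) \<noteq> 0}"
  have U: "open U" "y \<in> U" "U \<subseteq> im \<kappa>" using oU y S(1,3) Pt[OF y] by (auto simp: U_def)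
  have nz: "poly (mom (ic \<kappa> z)) t \<noteq> 0" if "t \<in> S" "z \<in> U" for t z
    using that S(1) Pt[of z t] by (auto simp: U_def)
  \<comment> \<open>The sign is that of h_l in the polynomial, \<mu> is the interpolation
    coefficient, and -2 comes from the derivative of p_h(t).\<close>
  define \<nu> where "\<nu> l t = (-1)^l * \<mu> (CARD('n) - l) t * (- 2)" for l t
  have "((\<lambda>y. hh l (ic \<kappa> y)) has_derivative \<beta> \<kappa> z (\<Sum>t\<in>S. \<nu> l t *\<^sub>R Wt \<kappa> t z)) (at z)"
    if l: "l \<in> {1..CARD('n)}" and z: "z \<in> U" for l z
  proof -
    have zi: "z \<in> im \<kappa>" using z U by auto
    \<comment> \<open>Interpolation at n nodes requires degree below n, so the leading term t^n is
      subtracted.\<close>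
    have h: "hh l x = (\<Sum>t\<in>S. ((-1)^l * \<mu> (CARD('n) - l) t) * (poly (mom x) t - t ^ CARD('n)))" for x
    proof -
      have "(-1)^l * hh l x = coeff (mom x - monom 1 CARD('n)) (CARD('n) - l)"
        using coeff_mom(1)[OF l, of x] l by auto
      also have "\<dots> = (\<Sum>t\<in>S. \<mu> (CARD('n) - l) t * (poly (mom x) t - t ^ CARD('n)))"
        unfolding mu[OF coeff_mom(2)] by (simp add: poly_monom)
      finally have "(-1)^l * ((-1)^l * hh l x) = (-1)^l * (\<Sum>t\<in>S. \<mu> (CARD('n) - l) t * (poly (mom x) t - t ^ CARD('n)))" by simp
      then show ?thesis by (simp add: sum_distrib_left mult.assoc flip: power_add mult.assoc[of "(-1)^l" "(-1)^l"])
    qed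
    have "((\<lambda>y. \<Sum>t\<in>S. ((-1)^l * \<mu> (CARD('n) - l) t) * (poly (mom (ic \<kappa> y)) t - t ^ CARD('n))) has_derivative
       (\<lambda>v. \<Sum>t\<in>S. ((-1)^l * \<mu> (CARD('n) - l) t) * (- 2 * \<beta> \<kappa> z (Wt \<kappa> t z) v - 0))) (at z)"
      by (intro has_derivative_sum has_derivative_mult_right has_derivative_diff has_derivative_const
          poly_mom_has_derivative(1)[OF k zi nz[OF _ z]])
    moreover have "(\<lambda>v. \<Sum>t\<in>S. ((-1)^l * \<mu> (CARD('n) - l) t) * (- 2 * \<beta> \<kappa> z (Wt \<kappa> t z) v - 0)) = \<beta> \<kappa> z (\<Sum>t\<in>S. \<nu> l t *\<^sub>R Wt \<kappa> t z)"
      unfolding linear_sum[OF \<beta>_linear[OF k zi]] linear_scale[OF \<beta>_linear[OF k zi]] by (simp add: fun_eq_iff \<nu>_def mult.assoc)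
    ultimately show ?thesis unfolding h[symmetric] by (simp only:)
  qed
  then show ?thesis using U S(1,2) nz by blast
qed

text \<open>The gradient of h_l in coordinates, made independent of the interpolation nodes;
  nondegeneracy of the metric makes it unique.\<close>

definition GR :: "('a, complex^'n) chart \<Rightarrow> nat \<Rightarrow> complex^'n \<Rightarrow> complex^'n" where
  "GR \<kappa> l y = (SOME e. ((\<lambda>y. hh l (ic \<kappa> y)) has_derivative \<beta> \<kappa> y e) (at y))"

lemma GR:
  assumes "\<kappa> \<in> A" "y \<in> im \<kappa>" "l \<in> {1..CARD('n)}"
  shows "((\<lambda>y. hh l (ic \<kappa> y)) has_derivative \<beta> \<kappa> y (GR \<kappa> l y)) (at y)"
proof -
  obtain U S \<nu> where "y \<in> U"
    "\<forall>l\<in>{1..CARD('n)}. \<forall>z\<in>U. ((\<lambda>y. hh l (ic \<kappa> y)) has_derivative \<beta> \<kappa> z (\<Sum>t\<in>S. \<nu> l t *\<^sub>R Wt \<kappa> t z)) (at z)"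
    using h_fun_local[OF assms(1,2)] by (elim exE conjE) (rule that)
  then have "((\<lambda>y. hh l (ic \<kappa> y)) has_derivative \<beta> \<kappa> y (\<Sum>t\<in>S. \<nu> l t *\<^sub>R Wt \<kappa> t y)) (at y)"
    using assms(3) by (elim ballE) auto
  then show ?thesis unfolding GR_def by (rule someI)
qed

lemma GR_eq:
  assumes "\<kappa> \<in> A" "y \<in> im \<kappa>" "l \<in> {1..CARD('n)}" "((\<lambda>y. hh l (ic \<kappa> y)) has_derivative \<beta> \<kappa> y e) (at y)"
  shows "GR \<kappa> l y = e"
  by (rule \<beta>_nondegenerate[OF assms(1,2)]) (rule fun_cong[OF has_derivative_unique[OF GR[OF assms(1-3)] assms(4)]])

text \<open>Near each point the gradient is a combination, with constant real coefficients, of the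
  holomorphic fields \<open>Wt\<close>.\<close>

lemma GR_holomorphic:
  assumes k: "\<kappa> \<in> A" and l: "l \<in> {1..CARD('n)}"
  shows "cdiff ((*s) \<i>) (im \<kappa>) (\<lambda>y. GR \<kappa> l y $ i)"
proof (rule cdiff_local)
  fix y assume y: "y \<in> im \<kappa>"
  obtain U S \<nu> where U: "open U" "y \<in> U" "U \<subseteq> im \<kappa>" "finite S" "\<And>t z. t\<in>S \<Longrightarrow> z\<in>U \<Longrightarrow> poly (mom (ic \<kappa> z)) t \<noteq> 0"
    "\<And>l z. l\<in>{1..CARD('n)} \<Longrightarrow> z\<in>U \<Longrightarrow> ((\<lambda>y. hh l (ic \<kappa> y)) has_derivative \<beta> \<kappa> z (\<Sum>t\<in>S. \<nu> l t *\<^sub>R Wt \<kappa> t z)) (at z)"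
    using h_fun_local[OF k y] by blast
  have W: "cdiff ((*s) \<i>) U (\<lambda>z. Wt \<kappa> t z $ i)" if t: "t \<in> S" for t
    unfolding cdiff_def
  proof (intro conjI U(1) ballI)
    fix z assume z: "z \<in> U"
    obtain D where D: "(Wt \<kappa> t has_derivative D) (at z)" "\<And>c v. D (c *s v) = c *s D v"
      using poly_mom_has_derivative(2)[OF k _ U(5)[OF t z]] U(3) z by blast
    from bounded_linear.has_derivative[OF bounded_linear_vec_nth D(1), of i]
    show "\<exists>F'. ((\<lambda>z. Wt \<kappa> t z $ i) has_derivative F') (at z) \<and> (\<forall>v. F' (\<i> *s v) = \<i> * F' v)"
      by (intro exI[of _ "\<lambda>v. D v $ i"]) (simp add: D(2))
  qed
  have "cdiff ((*s) \<i>) U (\<lambda>z. \<Sum>t\<in>S. of_real (\<nu> l t) * (Wt \<kappa> t z $ i))"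
    by (intro cdiff_sum U(1) cdiff_mult cdiff_const W)
  then have "cdiff ((*s) \<i>) U (\<lambda>y. GR \<kappa> l y $ i)"
  proof (rule cdiff_cong)
    fix z assume z: "z \<in> U"
    show "(\<Sum>t\<in>S. of_real (\<nu> l t) * (Wt \<kappa> t z $ i)) = GR \<kappa> l z $ i"
    proof -
      have "GR \<kappa> l z = (\<Sum>t\<in>S. \<nu> l t *\<^sub>R Wt \<kappa> t z)" using GR_eq[OF k _ l U(6)[OF l z]] U(3) z by auto
      then show ?thesis by (simp add: scaleR_conv_of_real[of _ "_ :: complex"])
    qed
  qed
  then show "\<exists>U. y \<in> U \<and> U \<subseteq> im \<kappa> \<and> cdiff ((*s) \<i>) U (\<lambda>y. GR \<kappa> l y $ i)" using U by blast
qed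

abbreviation ZZ where "ZZ l \<equiv> hamiltonian_field A g (hh l)"

lemmas ZZ = hamiltonian_field_props[where F = "hh l" for l, OF GR]

definition WW :: "('a, complex^'n) chart \<Rightarrow> nat \<Rightarrow> complex^'n \<Rightarrow> complex^'n" where
  "WW \<kappa> l y = ZZ l (ic \<kappa> y) \<kappa>"

lemma WW_eq: "\<kappa> \<in> A \<Longrightarrow> y \<in> im \<kappa> \<Longrightarrow> l \<in> {1..CARD('n)} \<Longrightarrow> WW \<kappa> l y = \<i> *s GR \<kappa> l y"
  unfolding WW_def by (rule ZZ(4))

lemma WW_holomorphic:
  assumes "\<kappa> \<in> A" "l \<in> {1..CARD('n)}"
  shows "cdiff ((*s) \<i>) (im \<kappa>) (\<lambda>y. WW \<kappa> l y $ i)"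
  by (rule cdiff_cong[OF cdiff_mult[OF cdiff_const[OF chart(2)[OF assms(1)], of _ \<i>] GR_holomorphic[OF assms, of i]]])
    (simp add: WW_eq[OF assms(1) _ assms(2)])

end

text \<open>A holomorphic function is its own extension: compose it with the complex linear map of
  the complexification that sends (x, x') to x + i x'.\<close>

lemma cdiff_imp_canal:
  fixes f :: "complex^'n \<Rightarrow> complex"
  assumes f: "cdiff ((*s) \<i>) S f" and y: "y \<in> S"
  shows "canal f y"
proof -
  define L :: "(complex^'n) \<times> (complex^'n) \<Rightarrow> complex^'n" where "L p = fst p + \<i> *s snd p" for p
  have "linear L" by (auto simp: linear_iff L_def vec_eq_iff algebra_simps)
  then have L: "bounded_linear L" by (rule linear_conv_bounded_linear[THEN iffD1])
  have LJ: "L (cJ v) = \<i> *s L v" for v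
    by (simp add: L_def cJ_def vec_eq_iff algebra_simps)
  note c = cdiff_linear_compose[OF f L LJ, of y]
  have "0 \<in> (\<lambda>z. L z + y) -` S" using y by (simp add: L_def)
  then obtain r where r: "r > 0" "ball 0 r \<subseteq> (\<lambda>z. L z + y) -` S" using cdiff_open[OF c] open_contains_ball by blast
  show ?thesis
    by (rule canalI[OF r(1) cdiff_subset[OF c open_ball r(2)]]) (simp add: L_def add.commute)
qed

context bk_mfd
begin

text \<open>The differential of h_l is the metric paired with the holomorphic gradient, hence
  analytic since the metric is; h_l itself is recovered by integration.\<close>

lemma canal_h_fun:
  assumes k: "\<kappa> \<in> A" and y: "y \<in> im \<kappa>" and l: "l \<in> {1..CARD('n)}"
  shows "canal (\<lambda>y. of_real (hh l (ic \<kappa> y))) y"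
proof (rule canal_antiderivative[OF chart(2)[OF k] y])
  fix z assume z: "z \<in> im \<kappa>"
  show "((\<lambda>y. complex_of_real (hh l (ic \<kappa> y))) has_derivative (\<lambda>v. of_real (\<beta> \<kappa> z (GR \<kappa> l z) v))) (at z)"
    using bounded_linear.has_derivative[OF bounded_linear_of_real GR[OF k z l]] .
next
  fix b :: "complex^'n" assume "b \<in> Basis"
  have b1: "canal (\<lambda>y. of_real (\<beta> \<kappa> y b' b)) y" for b'
    unfolding \<beta>_def using real_analytic_on_imp_canal[OF metric_analytic[OF k]] y by (simp add: im_def)
  have b2: "canal (\<lambda>y. of_real (GR \<kappa> l y \<bullet> b')) y" for b'
  proof -
    have eq: "(\<lambda>y. complex_of_real (GR \<kappa> l y \<bullet> b')) = (\<lambda>y. of_real (Re (\<Sum>i\<in>UNIV. (GR \<kappa> l y $ i) * cnj (b' $ i))))"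
      by (simp add: inner_vec_def inner_complex_def)
    show ?thesis
      unfolding eq
      by (rule canal_Re, rule canal_sum, rule canal_mult[OF cdiff_imp_canal[OF GR_holomorphic[OF k l] y] canal_const])
  qed
  have "canal (\<lambda>y. \<Sum>b'\<in>Basis. of_real (GR \<kappa> l y \<bullet> b') * of_real (\<beta> \<kappa> y b' b)) y"
    by (intro canal_sum canal_mult b1 b2)
  then show "canal (\<lambda>y. of_real (\<beta> \<kappa> y (GR \<kappa> l y) b)) y"
  proof (rule canal_cong[OF _ chart(2)[OF k] y])
    fix z assume z: "z \<in> im \<kappa>"
    have "\<beta> \<kappa> z (GR \<kappa> l z) b = \<beta> \<kappa> z (\<Sum>b'\<in>Basis. (GR \<kappa> l z \<bullet> b') *\<^sub>R b') b" by (simp add: euclidean_representation)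
    also have "\<dots> = (\<Sum>b'\<in>Basis. (GR \<kappa> l z \<bullet> b') * \<beta> \<kappa> z b' b)"
      by (simp only: linear_sum[OF \<beta>_linear[OF k z]] linear_scale[OF \<beta>_linear[OF k z]] real_scaleR_def)
    finally show "(\<Sum>b'\<in>Basis. of_real (GR \<kappa> l z \<bullet> b') * of_real (\<beta> \<kappa> z b' b)) = complex_of_real (\<beta> \<kappa> z (GR \<kappa> l z) b)"
      by simp
  qed
qed

end

subsection \<open>Completing independent columns\<close>

text \<open>Families rather than sets: a repeated vector makes the family dependent.\<close>

definition indepR :: "'n set \<Rightarrow> ('n \<Rightarrow> 'v::real_vector) \<Rightarrow> bool" where
  "indepR K v \<longleftrightarrow> (\<forall>c. (\<Sum>i\<in>K. c i *\<^sub>R v i) = 0 \<longrightarrow> (\<forall>i\<in>K. c i = 0))"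

definition indepC :: "'n set \<Rightarrow> ('n \<Rightarrow> complex^'n) \<Rightarrow> bool" where
  "indepC K v \<longleftrightarrow> (\<forall>c. (\<Sum>i\<in>K. c i *s v i) = 0 \<longrightarrow> (\<forall>i\<in>K. c i = 0))"

text \<open>Completes the columns indexed by \<open>K\<close> to a square matrix by unit vectors, so
  that a rank condition becomes the non-vanishing of an ordinary determinant.\<close>

definition cols :: "'n set \<Rightarrow> ('n \<Rightarrow> 'n) \<Rightarrow> ('n \<Rightarrow> complex^'n) \<Rightarrow> complex^'n^'n" where
  "cols K \<tau> v = (\<chi> a b. (if b \<in> K then v b else axis (\<tau> b) 1) $ a)"

lemma matrix_mult_columns: "(\<chi> a b. v b $ a) *v c = (\<Sum>b\<in>UNIV. c $ b *s (v b :: complex^'n))"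
  by (simp add: vec_eq_iff matrix_vector_mult_def mult.commute)

lemma cols_mult: "cols K \<tau> v *v c = (\<Sum>b\<in>UNIV. c $ b *s (if b \<in> K then v b else axis (\<tau> b) 1))"
  unfolding cols_def by (rule matrix_mult_columns)

text \<open>If no unit vector could be added, all of them would be combinations of the vectors in
  \<open>K\<close>. The matrix \<open>M\<close> with these columns and zeros elsewhere would then be
  surjective, hence injective, although it kills the unit vector of index i.\<close>

lemma indepC_exchange:
  fixes K :: "'n::finite set"
  assumes v: "indepC K v" and i: "i \<notin> K"
  shows "\<exists>a. indepC (insert i K) (v(i := axis a 1))"
proof (rule ccontr)
  assume "\<not> ?thesis"
  note nex = this
  have dep: "\<exists>c. axis a 1 = (\<Sum>b\<in>K. c b *s v b)" for a
  proof -
    have fin: "finite K" by simp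
    obtain c where c: "(\<Sum>b\<in>insert i K. c b *s (v(i := axis a 1)) b) = 0" "\<not> (\<forall>b\<in>insert i K. c b = 0)"
      using nex unfolding indepC_def by blast
    have "(\<Sum>b\<in>K. c b *s (v(i := axis a 1)) b) = (\<Sum>b\<in>K. c b *s v b)"
      using i by (intro sum.cong) auto
    then have eq: "c i *s axis a 1 + (\<Sum>b\<in>K. c b *s v b) = 0"
      using c(1) i fin by simp
    have ci: "c i \<noteq> 0"
    proof
      assume "c i = 0"
      with eq have "\<forall>b\<in>K. c b = 0" using v unfolding indepC_def by simp
      with \<open>c i = 0\<close> c(2) show False by auto
    qed
    have "c i *s axis a 1 = - (\<Sum>b\<in>K. c b *s v b)" using eq by (simp add: eq_neg_iff_add_eq_0)
    then have "inverse (c i) *s (c i *s axis a 1) = inverse (c i) *s (- (\<Sum>b\<in>K. c b *s v b))" by simp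
    then have "axis a 1 = inverse (c i) *s (- (\<Sum>b\<in>K. c b *s v b))" using ci by (simp add: vec_eq_iff)
    also have "\<dots> = (\<Sum>b\<in>K. (- (inverse (c i) * c b)) *s v b)"
      by (simp add: vec_eq_iff sum_distrib_left mult.assoc flip: sum_negf)
    finally show ?thesis by (rule exI[of _ "\<lambda>b. - (inverse (c i) * c b)"])
  qed
  from dep obtain C where C: "\<And>a. axis a 1 = (\<Sum>b\<in>K. C a b *s v b)" by metis
  define M :: "complex^'n^'n" where "M = (\<chi> a b. (if b \<in> K then v b else 0) $ a)"
  have M: "M *v c = (\<Sum>b\<in>K. c $ b *s v b)" for c
    unfolding M_def matrix_mult_columns
    by (rule sum.mono_neutral_cong_right) auto
  have "\<exists>c. M *v c = x" for x
  proof
    show "M *v (\<Sum>a\<in>UNIV. x $ a *s (\<chi> b. C a b)) = x"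
    proof -
      have "M *v (\<Sum>a\<in>UNIV. x $ a *s (\<chi> b. C a b)) = (\<Sum>a\<in>UNIV. x $ a *s (M *v (\<chi> b. C a b)))"
        by (simp add: vec.linear_sum[OF matrix_vector_mul_linear_gen] matrix_vector_smult)
      also have "\<dots> = (\<Sum>a\<in>UNIV. x $ a *s axis a 1)" unfolding M using C by simp
      also have "\<dots> = x" by (rule basis_expansion)
      finally show ?thesis .
    qed
  qed
  then have "\<exists>R. M ** R = mat 1" unfolding matrix_right_invertible_surjective surj_def by metis
  then obtain R where "R ** M = mat 1" using matrix_left_right_inverse by blast
  then have "axis i 1 = R *v (M *v axis i 1)" by (simp add: matrix_vector_mul_assoc)
  also have "M *v axis i (1::complex) = 0" unfolding M using i by (intro sum.neutral) (auto simp: axis_def)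
  finally have "axis i (1::complex) = 0" by simp
  then show False by (simp add: axis_eq_0_iff)
qed

lemma indepC_complete:
  "indepC K v \<Longrightarrow> \<exists>\<tau>. indepC UNIV (\<lambda>b. if b \<in> K then v b else axis (\<tau> b) 1)"
proof (induction "card (- K)" arbitrary: K v)
  case 0
  then have "K = UNIV" by auto
  then show ?case using 0 by simp
next
  case (Suc r)
  then obtain i where i: "i \<notin> K" by (metis Compl_iff card.empty ex_in_conv nat.distinct(1))
  obtain a where a: "indepC (insert i K) (v(i := axis a 1))" using indepC_exchange[OF Suc.prems i] by blast
  have "r = card (- insert i K)" using Suc.hyps(2) i by (simp add: card_Diff_singleton Compl_insert)
  from Suc.hyps(1)[OF this a] obtain \<tau> where t: "indepC UNIV (\<lambda>b. if b \<in> insert i K then (v(i := axis a 1)) b else axis (\<tau> b) 1)" by blast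
  have "(\<lambda>b. if b \<in> insert i K then (v(i := axis a 1)) b else axis (\<tau> b) 1) = (\<lambda>b. if b \<in> K then v b else axis ((\<tau>(i := a)) b) 1)"
    using i by (auto simp: fun_eq_iff)
  then show ?case using t by metis
qed

lemma indepC_iff_det:
  fixes K :: "'n::finite set"
  shows "indepC K v \<longleftrightarrow> (\<exists>\<tau>. det (cols K \<tau> v) \<noteq> 0)"
proof
  assume "indepC K v"
  then obtain \<tau> where t: "indepC UNIV (\<lambda>b. if b \<in> K then v b else axis (\<tau> b) 1)" using indepC_complete by blast
  have "\<exists>R. R ** cols K \<tau> v = mat 1"
    unfolding matrix_left_invertible_ker cols_mult using t unfolding indepC_def by (simp add: vec_eq_iff)
  then have "det (cols K \<tau> v) \<noteq> 0" using invertible_det_nz invertible_left_inverse by blast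
  then show "\<exists>\<tau>. det (cols K \<tau> v) \<noteq> 0" by blast
next
  assume "\<exists>\<tau>. det (cols K \<tau> v) \<noteq> 0"
  then obtain \<tau> R where R: "R ** cols K \<tau> v = mat 1" using invertible_det_nz invertible_left_inverse by blast
  show "indepC K v"
    unfolding indepC_def
  proof (intro allI impI ballI)
    fix c i assume c: "(\<Sum>i\<in>K. c i *s v i) = 0" and i: "i \<in> K"
    define w :: "complex^'n" where "w = (\<chi> b. if b \<in> K then c b else 0)"
    have "cols K \<tau> v *v w = (\<Sum>i\<in>K. c i *s v i)"
      unfolding cols_mult w_def by (rule sum.mono_neutral_cong_right) auto
    then have "w = 0" using R c by (metis matrix_left_invertible_ker)
    then have "w $ i = 0" by simp
    then show "c i = 0" using i by (simp add: w_def)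
  qed
qed

text \<open>Writes the coefficients of a combination as quotients of determinants, so that they are
  holomorphic when the vectors are.\<close>

lemma cramer_cols:
  fixes K :: "'n::finite set"
  assumes "det (cols K \<tau> v) \<noteq> 0" "w = (\<Sum>i\<in>K. f i *s v i)" "i \<in> K"
  shows "f i = det (cols K \<tau> (v(i := w))) / det (cols K \<tau> v)"
proof -
  define x :: "complex^'n" where "x = (\<chi> b. if b \<in> K then f b else 0)"
  have "cols K \<tau> v *v x = w"
    unfolding cols_mult x_def assms(2) by (rule sum.mono_neutral_cong_right) auto
  then have "x = (\<chi> k. det (\<chi> i j. if j = k then w $ i else cols K \<tau> v $ i $ j) / det (cols K \<tau> v))"
    using cramer[OF assms(1)] by blast
  then have "x $ i = det (\<chi> a j. if j = i then w $ a else cols K \<tau> v $ a $ j) / det (cols K \<tau> v)" by simp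
  moreover have "(\<chi> a j. if j = i then w $ a else cols K \<tau> v $ a $ j) = cols K \<tau> (v(i := w))"
    using assms(3) by (simp add: vec_eq_iff cols_def)
  ultimately show ?thesis using assms(3) by (simp add: x_def)
qed

lemma cdiff_det:
  assumes "open S" "\<And>i j. cdiff J S (\<lambda>y. M y $ i $ j)"
  shows "cdiff J S (\<lambda>y. det (M y :: complex^'n^'n))"
  unfolding det_def by (intro cdiff_sum cdiff_mult cdiff_const cdiff_prod assms)

lemma cdiff_det_cols:
  assumes S: "open S" and v: "\<And>i a. i \<in> K \<Longrightarrow> cdiff J S (\<lambda>y. v y i $ a)"
  shows "cdiff J S (\<lambda>y. det (cols K \<tau> (v y)))"
proof (rule cdiff_det[OF S])
  fix a b
  show "cdiff J S (\<lambda>y. cols K \<tau> (v y) $ a $ b)"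
    using v by (cases "b \<in> K") (simp_all add: cols_def cdiff_const[OF S])
qed

text \<open>The derivative takes real values on v and on iv, and these two values differ by the
  factor i; so it vanishes.\<close>

lemma real_cdiff_constant:
  fixes F :: "complex^'n \<Rightarrow> complex"
  assumes F: "cdiff ((*s) \<i>) (ball y0 r) F" and real: "\<And>y. y \<in> ball y0 r \<Longrightarrow> F y \<in> \<real>" and y: "y \<in> ball y0 r"
  shows "F y = F y0"
proof -
  have "(F has_derivative (\<lambda>h. 0)) (at z within ball y0 r)" if z: "z \<in> ball y0 r" for z
  proof -
    note d = cdiffD[OF F z]
    have "((\<lambda>y. Im (F y)) has_derivative (\<lambda>v. Im (frechet_derivative F (at z) v))) (at z)"
      using bounded_linear.has_derivative[OF bounded_linear_Im d(1)] .
    moreover have "((\<lambda>y. Im (F y)) has_derivative (\<lambda>v. 0)) (at z)"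
      by (rule has_derivative_transform_within_open[OF has_derivative_const[of 0] open_ball z])
        (use real in \<open>simp add: complex_is_Real_iff\<close>)
    ultimately have Im0: "Im (frechet_derivative F (at z) v) = 0" for v
      using has_derivative_unique by metis
    have "frechet_derivative F (at z) v = 0" for v
      using Im0[of v] Im0[of "\<i> *s v"] d(2)[of v] by (simp add: complex_eq_iff)
    then have "frechet_derivative F (at z) = (\<lambda>h. 0)" by (rule ext)
    then show ?thesis using has_derivative_at_withinI[OF d(1)] by simp
  qed
  then obtain c where "\<And>y. y \<in> ball y0 r \<Longrightarrow> F y = c"
    using has_derivative_zero_constant[of "ball y0 r" F] by auto
  moreover have "y0 \<in> ball y0 r" using y by (metis ball_eq_empty centre_in_ball ex_in_conv not_le)
  ultimately show ?thesis using y by simp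
qed

lemma cdiff_compose_holomorphic:
  fixes F :: "complex^'n \<Rightarrow> complex" and G :: "complex^'n \<Rightarrow> complex^'n"
  assumes F: "cdiff ((*s) \<i>) T F" and S: "open S" "G ` S \<subseteq> T"
    and G: "\<And>y. y \<in> S \<Longrightarrow> (G has_derivative G' y) (at y)" "\<And>y v. y \<in> S \<Longrightarrow> G' y (\<i> *s v) = \<i> *s G' y v"
  shows "cdiff ((*s) \<i>) S (\<lambda>y. F (G y))"
proof (rule cdiffI[OF S(1)])
  fix y assume y: "y \<in> S"
  then have Gy: "G y \<in> T" using S(2) by auto
  show "((\<lambda>y. F (G y)) has_derivative (\<lambda>v. frechet_derivative F (at (G y)) (G' y v))) (at y)"
    by (rule has_derivative_compose[OF G(1)[OF y] cdiffD(1)[OF F Gy]])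
  show "frechet_derivative F (at (G y)) (G' y (\<i> *s v)) = \<i> * frechet_derivative F (at (G y)) (G' y v)" for v
    by (simp add: G(2)[OF y] cdiffD(2)[OF F Gy])
qed


subsection \<open>Linear relations among the Hamiltonian fields\<close>

lemma sum_fun_apply: "(\<Sum>i\<in>K. c i *\<^sub>R (v i :: 'b \<Rightarrow> 'v::real_vector)) x = (\<Sum>i\<in>K. c i *\<^sub>R v i x)"
  by (induction K rule: infinite_finite_induct) (auto simp: scaleR_fun_def)

context bk_mfd
begin

text \<open>This says that the functions h_l Poisson commute; it rests on the reality of the
  Hermitian products of the vectors w_t.\<close>

lemma \<beta>_GR_orthogonal:
  assumes k: "\<kappa> \<in> A" and y: "y \<in> im \<kappa>" and l: "l \<in> {1..CARD('n)}" "l' \<in> {1..CARD('n)}"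
  shows "\<beta> \<kappa> y (\<i> *s GR \<kappa> l y) (GR \<kappa> l' y) = 0"
proof -
  obtain U S \<nu> where U': "open U" "y \<in> U" "U \<subseteq> im \<kappa>" "finite S" "\<And>t z. t\<in>S \<Longrightarrow> z\<in>U \<Longrightarrow> poly (mom (ic \<kappa> z)) t \<noteq> 0"
    "\<And>l z. l\<in>{1..CARD('n)} \<Longrightarrow> z\<in>U \<Longrightarrow> ((\<lambda>y. hh l (ic \<kappa> y)) has_derivative \<beta> \<kappa> z (\<Sum>t\<in>S. \<nu> l t *\<^sub>R Wt \<kappa> t z)) (at z)"
    using h_fun_local[OF k y] by blast
  note U = U'(2,3,5,6)
  interpret L: bk_local "im \<kappa>" "fa \<kappa>" "fE \<kappa>" "\<lambda>y. H (\<sigma> \<kappa> y)" "\<lambda>y. T (\<sigma> \<kappa> y)" "\<lambda>y. of_real (V (\<sigma> \<kappa> y))" "\<phi>\<kappa> \<kappa>"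
    by (rule bk_local[OF k])
  have Pt: "L.Pt t y \<noteq> 0" if "t \<in> S" for t
    using U(3)[OF that U(1)] by (simp add: L.Pt_def mom_det[OF k y, symmetric])
  have W: "\<beta> \<kappa> y (\<i> *s Wt \<kappa> s y) (Wt \<kappa> t y) = 0" if "s \<in> S" "t \<in> S" for s t
  proof -
    have w: "fa \<kappa> y *v Wt \<kappa> t y = L.wt t y" for t by (simp add: Wt_def matrix_vector_mul_assoc L.aE[OF y])
    have "\<beta> \<kappa> y (\<i> *s Wt \<kappa> s y) (Wt \<kappa> t y) = (\<i> *s L.wt s y) \<bullet> L.wt t y"
      by (simp add: frame(3)[OF k y, symmetric] matrix_vector_smult w)
    also have "\<dots> = Im (herm (L.wt s y) (L.wt t y))" by (simp add: inner_eq_Re_herm herm_smult)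
    also have "\<dots> = 0"
      using L.herm_wt_real[OF y Pt[OF that(1)] Pt[OF that(2)]] by (simp add: complex_eq_iff)
    finally show ?thesis .
  qed
  have GR: "GR \<kappa> l y = (\<Sum>t\<in>S. \<nu> l t *\<^sub>R Wt \<kappa> t y)" if "l \<in> {1..CARD('n)}" for l
    by (rule GR_eq[OF k y that U(4)[OF that U(1)]])
  note lin = linear_compose[OF vecJ.lin \<beta>_linear[OF k y], unfolded o_def]
  show ?thesis
    unfolding GR[OF l(1)] GR[OF l(2)] linear_sum[OF lin] linear_scale[OF lin] linear_sum[OF \<beta>_linear2[OF k y]] linear_scale[OF \<beta>_linear2[OF k y]]
    by (simp add: W)
qed

text \<open>Indexes the fields by \<open>'n\<close> instead of 1, ..., n, so that coefficient
  vectors live in \<open>real ^ 'n\<close> and the matrices of \<open>cols\<close> are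
  square.\<close>

definition dx :: "'n \<Rightarrow> nat" where "dx = (SOME d. bij_betw d UNIV {1..CARD('n)})"

lemma dx: "bij_betw dx (UNIV :: 'n set) {1..CARD('n)}"
proof -
  have "\<exists>d. bij_betw d (UNIV :: 'n set) {1..CARD('n)}" by (rule finite_same_card_bij) auto
  then show ?thesis unfolding dx_def by (rule someI_ex)
qed

lemma dx_in: "dx i \<in> {1..CARD('n)}"
  using dx bij_betwE by blast

abbreviation Zn :: "'n \<Rightarrow> 'a \<Rightarrow> ('a, complex^'n) tvec" where "Zn i \<equiv> ZZ (dx i)"
abbreviation Wn where "Wn \<kappa> i y \<equiv> WW \<kappa> (dx i) y"

text \<open>A complex relation reads P + iQ = 0 with real combinations P and Q of gradients. As iQ
  is orthogonal to P, this forces |P|^2 = 0.\<close>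

lemma real_relation:
  assumes k: "\<kappa> \<in> A" and y: "y \<in> im \<kappa>" and rel: "(\<Sum>i\<in>K. c i *s Wn \<kappa> i y) = 0"
  shows "(\<Sum>i\<in>K. Re (c i) *\<^sub>R Wn \<kappa> i y) = 0" "(\<Sum>i\<in>K. Im (c i) *\<^sub>R Wn \<kappa> i y) = 0"
proof -
  define P where "P = (\<Sum>i\<in>K. Re (c i) *\<^sub>R GR \<kappa> (dx i) y)"
  define Q where "Q = (\<Sum>i\<in>K. Im (c i) *\<^sub>R GR \<kappa> (dx i) y)"
  have W: "Wn \<kappa> i y = \<i> *s GR \<kappa> (dx i) y" for i by (rule WW_eq[OF k y dx_in])
  have sums: "(\<Sum>i\<in>K. r i *\<^sub>R Wn \<kappa> i y) = \<i> *s (\<Sum>i\<in>K. r i *\<^sub>R GR \<kappa> (dx i) y)" for r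
    unfolding W by (simp add: linear_sum[OF vecJ.lin] linear_scale[OF vecJ.lin])
  have "(\<Sum>i\<in>K. c i *s Wn \<kappa> i y) = \<i> *s (P + \<i> *s Q)"
  proof -
    have "(\<Sum>i\<in>K. c i *s Wn \<kappa> i y) = (\<Sum>i\<in>K. Re (c i) *\<^sub>R Wn \<kappa> i y) + \<i> *s (\<Sum>i\<in>K. Im (c i) *\<^sub>R Wn \<kappa> i y)"
      by (simp add: smult_eq_real_combination[of "c _"] sum.distrib linear_sum[OF vecJ.lin] linear_scale[OF vecJ.lin])
    also have "\<dots> = \<i> *s (P + \<i> *s Q)" by (simp add: sums P_def Q_def linear_add[OF vecJ.lin])
    finally show ?thesis .
  qed
  then have "\<i> *s (P + \<i> *s Q) = 0" using rel by (simp only:)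
  then have "P + \<i> *s Q = 0" unfolding vector_mul_eq_0 by simp
  then have PQ: "P = - (\<i> *s Q)" by (simp only: eq_neg_iff_add_eq_0)
  note lin = linear_compose[OF vecJ.lin \<beta>_linear[OF k y], unfolded o_def]
  have "\<beta> \<kappa> y (\<i> *s Q) P = 0"
    unfolding P_def Q_def linear_sum[OF lin] linear_scale[OF lin] linear_sum[OF \<beta>_linear2[OF k y]] linear_scale[OF \<beta>_linear2[OF k y]]
    by (simp add: \<beta>_GR_orthogonal[OF k y dx_in dx_in])
  then have "\<beta> \<kappa> y P P = 0" using linear_neg[OF \<beta>_linear[OF k y], of "\<i> *s Q" P] PQ by simp
  then have P0: "P = 0" using \<beta>_pos[OF k y, of P] by force
  then have Q0: "Q = 0" using PQ by (simp add: vec_eq_iff)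
  show "(\<Sum>i\<in>K. Re (c i) *\<^sub>R Wn \<kappa> i y) = 0" "(\<Sum>i\<in>K. Im (c i) *\<^sub>R Wn \<kappa> i y) = 0"
    unfolding sums using P0 Q0 by (simp_all add: P_def Q_def vec_eq_iff)
qed

lemma sum_tangent: "x \<in> topspace X \<Longrightarrow> (\<Sum>i\<in>K. c i *\<^sub>R Zn i x) \<in> tangent_space A x"
proof (induction K rule: infinite_finite_induct)
  case (insert i K)
  note t = ZZ(1)[OF _ _ dx_in insert.prems]
  have z: "Zn i x \<in> tangent_space A x" for i using t by blast
  have "c i *\<^sub>R Zn i x \<in> tangent_space A x" by (rule tangent_ops(2)[OF insert.prems z z])
  then show ?case
    unfolding sum.insert[OF insert.hyps] by (rule tangent_ops(1)[OF insert.prems _ insert.IH[OF insert.prems]])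
next
  case empty
  have z: "Zn i x \<in> tangent_space A x" for i using ZZ(1)[OF _ _ dx_in empty.prems] by blast
  show ?case unfolding sum.empty by (rule tangent_ops(4)[OF empty.prems z z])
next
  case (infinite K)
  then show ?case by simp
qed

lemma relation_chart:
  assumes k: "\<kappa> \<in> A" and x: "x \<in> fst \<kappa>"
  shows "(\<Sum>i\<in>K. c i *\<^sub>R Zn i x) = 0 \<longleftrightarrow> (\<Sum>i\<in>K. c i *\<^sub>R Wn \<kappa> i (snd \<kappa> x)) = 0"
proof -
  have X: "x \<in> topspace X" using chart_subset[OF k] x by blast
  have z: "Zn i x \<in> tangent_space A x" for i using ZZ(1)[OF _ _ dx_in X] by blast
  have app: "(\<Sum>i\<in>K. c i *\<^sub>R Zn i x) \<kappa> = (\<Sum>i\<in>K. c i *\<^sub>R Wn \<kappa> i (snd \<kappa> x))"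
    unfolding sum_fun_apply using k x by (simp add: WW_def)
  show ?thesis
  proof
    assume "(\<Sum>i\<in>K. c i *\<^sub>R Wn \<kappa> i (snd \<kappa> x)) = 0"
    then show "(\<Sum>i\<in>K. c i *\<^sub>R Zn i x) = 0"
      using app by (intro tangent_eqI[OF sum_tangent[OF X] tangent_ops(4)[OF X z z] k x]) simp
  qed (simp add: app[symmetric])
qed

lemma indepR_iff_indepC:
  assumes k: "\<kappa> \<in> A" and x: "x \<in> fst \<kappa>"
  shows "indepR K (\<lambda>i. Zn i x) \<longleftrightarrow> indepC K (\<lambda>i. Wn \<kappa> i (snd \<kappa> x))"
proof
  assume R: "indepR K (\<lambda>i. Zn i x)"
  show "indepC K (\<lambda>i. Wn \<kappa> i (snd \<kappa> x))"
    unfolding indepC_def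
  proof (intro allI impI ballI)
    fix c i assume c: "(\<Sum>i\<in>K. c i *s Wn \<kappa> i (snd \<kappa> x)) = 0" and i: "i \<in> K"
    from real_relation[OF k co_im[OF x] c] have "(\<Sum>i\<in>K. Re (c i) *\<^sub>R Zn i x) = 0" "(\<Sum>i\<in>K. Im (c i) *\<^sub>R Zn i x) = 0"
      unfolding relation_chart[OF k x] by auto
    then have "Re (c i) = 0" "Im (c i) = 0"
      using R[unfolded indepR_def, THEN spec, of "\<lambda>i. Re (c i)"] R[unfolded indepR_def, THEN spec, of "\<lambda>i. Im (c i)"] i by auto
    then show "c i = 0" by (simp add: complex_eq_iff)
  qed
next
  assume C: "indepC K (\<lambda>i. Wn \<kappa> i (snd \<kappa> x))"
  show "indepR K (\<lambda>i. Zn i x)"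
    unfolding indepR_def
  proof (intro allI impI ballI)
    fix c i assume c: "(\<Sum>i\<in>K. c i *\<^sub>R Zn i x) = 0" and i: "i \<in> K"
    then have "(\<Sum>i\<in>K. complex_of_real (c i) *s Wn \<kappa> i (snd \<kappa> x)) = 0"
      unfolding relation_chart[OF k x] by (simp add: smult_eq_real_combination[of "of_real _"])
    then have "complex_of_real (c i) = 0"
      using C[unfolded indepC_def, THEN spec, of "\<lambda>i. complex_of_real (c i)"] i by auto
    then show "c i = 0" by simp
  qed
qed

lemma dependent_insert:
  assumes K: "indepR K v" and k: "k \<notin> K" and dep: "\<not> indepR (insert k K) v" and "finite K"
  shows "\<exists>f. v k = (\<Sum>i\<in>K. f i *\<^sub>R v i)"
proof -
  obtain c where c: "(\<Sum>i\<in>insert k K. c i *\<^sub>R v i) = 0" "\<not> (\<forall>i\<in>insert k K. c i = 0)"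
    using dep unfolding indepR_def by blast
  have eq: "c k *\<^sub>R v k + (\<Sum>i\<in>K. c i *\<^sub>R v i) = 0" using c(1) k \<open>finite K\<close> by simp
  have ck: "c k \<noteq> 0"
  proof
    assume "c k = 0"
    with eq have "\<forall>i\<in>K. c i = 0" using K unfolding indepR_def by simp
    with \<open>c k = 0\<close> c(2) show False by auto
  qed
  have "c k *\<^sub>R v k = - (\<Sum>i\<in>K. c i *\<^sub>R v i)" using eq by (simp add: eq_neg_iff_add_eq_0)
  then have "inverse (c k) *\<^sub>R (c k *\<^sub>R v k) = inverse (c k) *\<^sub>R (- (\<Sum>i\<in>K. c i *\<^sub>R v i))" by simp
  then have "v k = (\<Sum>i\<in>K. (- (inverse (c k) * c i)) *\<^sub>R v i)"
    using ck by (simp add: scaleR_sum_right sum_negf)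
  then show ?thesis by (rule exI[of _ "\<lambda>i. - (inverse (c k) * c i)"])
qed

lemma nearby_independent:
  assumes k: "\<kappa> \<in> A" and y: "y \<in> im \<kappa>" and K: "indepR K (\<lambda>i. Zn i (ic \<kappa> y))"
  shows "\<exists>\<tau> r. r > 0 \<and> ball y r \<subseteq> im \<kappa> \<and> (\<forall>z\<in>ball y r. det (cols K \<tau> (\<lambda>i. Wn \<kappa> i z)) \<noteq> 0)"
proof -
  have "indepC K (\<lambda>i. Wn \<kappa> i y)" using indepR_iff_indepC[OF k ic_dom[OF y]] K y by simp
  then obtain \<tau> where t: "det (cols K \<tau> (\<lambda>i. Wn \<kappa> i y)) \<noteq> 0" unfolding indepC_iff_det by blast
  note o = chart(2)[OF k]
  have "cdiff ((*s) \<i>) (im \<kappa>) (\<lambda>z. det (cols K \<tau> (\<lambda>i. Wn \<kappa> i z)))"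
    by (rule cdiff_det_cols[OF o WW_holomorphic[OF k dx_in]])
  from continuous_open_preimage[OF cdiff_continuous_on[OF this] o, of "- {0}"]
  have "open (im \<kappa> \<inter> (\<lambda>z. det (cols K \<tau> (\<lambda>i. Wn \<kappa> i z))) -` (- {0}))" by (simp add: open_Compl)
  moreover have "y \<in> im \<kappa> \<inter> (\<lambda>z. det (cols K \<tau> (\<lambda>i. Wn \<kappa> i z))) -` (- {0})" using t y by simp
  ultimately obtain r where "r > 0" "ball y r \<subseteq> im \<kappa> \<inter> (\<lambda>z. det (cols K \<tau> (\<lambda>i. Wn \<kappa> i z))) -` (- {0})"
    using open_contains_ball by metis
  then show ?thesis by (intro exI[of _ \<tau>] exI[of _ r]) auto
qed

text \<open>The points near which the relation holds, rather than those at which it holds, form an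
  open set; its complement is open by the identity theorem on coordinate balls.\<close>

lemma relation_global:
  assumes k: "\<kappa> \<in> A" and y: "y \<in> im \<kappa>" and r: "r > 0" "ball y r \<subseteq> im \<kappa>"
    and rel: "\<And>z. z \<in> ball y r \<Longrightarrow> (\<Sum>i\<in>K. c i *\<^sub>R Zn i (ic \<kappa> z)) = 0" and x: "x \<in> topspace X"
  shows "(\<Sum>i\<in>K. c i *\<^sub>R Zn i x) = 0"
proof -
  define D where "D x = (\<Sum>i\<in>K. c i *\<^sub>R Zn i x)" for x
  define \<Omega> where "\<Omega> = {x. \<exists>W. openin X W \<and> x \<in> W \<and> (\<forall>z\<in>W. D z = 0)}"
  have o: "openin X \<Omega>"
  proof (subst openin_subopen, intro ballI)
    fix x assume "x \<in> \<Omega>"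
    then obtain W where "openin X W" "x \<in> W" "\<forall>z\<in>W. D z = 0" by (auto simp: \<Omega>_def)
    then show "\<exists>W. openin X W \<and> x \<in> W \<and> W \<subseteq> \<Omega>" unfolding \<Omega>_def by (intro exI[of _ W]) blast
  qed
  have ball_open: "openin X {x \<in> fst \<kappa>. snd \<kappa> x \<in> ball y r}" if "\<kappa> \<in> A" for \<kappa> y r
    by (rule chart_open_preimage[OF that open_ball])
  have "openin X (topspace X - \<Omega>)"
  proof (subst openin_subopen, intro ballI)
    fix x assume x: "x \<in> topspace X - \<Omega>"
    then obtain \<kappa> where k: "\<kappa> \<in> A" "x \<in> fst \<kappa>" using chart_ex by blast
    obtain r where r: "r > 0" "ball (snd \<kappa> x) r \<subseteq> im \<kappa>"
      using open_contains_ball chart(2)[OF k(1)] co_im[OF k(2)] by blast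
    define W where "W = {z \<in> fst \<kappa>. snd \<kappa> z \<in> ball (snd \<kappa> x) r}"
    have W: "openin X W" "x \<in> W" using ball_open[OF k(1)] k r by (auto simp: W_def)
    have "W \<inter> \<Omega> = {}"
    proof (rule ccontr)
      assume "W \<inter> \<Omega> \<noteq> {}"
      then obtain z W' where z: "z \<in> W" "openin X W'" "z \<in> W'" "\<forall>z\<in>W'. D z = 0" by (auto simp: \<Omega>_def)
      define U where "U = snd \<kappa> ` (fst \<kappa> \<inter> (W \<inter> W'))"
      have U: "open U" "U \<subseteq> ball (snd \<kappa> x) r" "U \<noteq> {}"
        unfolding U_def using chart_open_image[OF k(1) openin_Int[OF W(1) z(2)]] z by (auto simp: W_def)
      have hol: "cdiff ((*s) \<i>) (ball (snd \<kappa> x) r) (\<lambda>q. (\<Sum>i\<in>K. of_real (c i) * (Wn \<kappa> i q $ a)))" for a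
        by (intro cdiff_sum open_ball cdiff_mult cdiff_const cdiff_subset[OF WW_holomorphic[OF k(1) dx_in] open_ball r(2)])
      have comp: "(\<Sum>i\<in>K. of_real (c i) * (Wn \<kappa> i q $ a)) = (\<Sum>i\<in>K. c i *\<^sub>R Wn \<kappa> i q) $ a" for q a
        by (simp add: scaleR_conv_of_real[of _ "_ :: complex"])
      have z0: "(\<Sum>i\<in>K. of_real (c i) * (Wn \<kappa> i q $ a)) = 0" if q: "q \<in> U" for q a
      proof -
        obtain z' where z': "z' \<in> fst \<kappa>" "z' \<in> W'" "q = snd \<kappa> z'" using q by (auto simp: U_def)
        have "(\<Sum>i\<in>K. c i *\<^sub>R Wn \<kappa> i q) = 0" using z(4) z' relation_chart[OF k(1) z'(1), of c K] by (simp add: D_def)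
        then show ?thesis unfolding comp by simp
      qed
      have "D z' = 0" if z': "z' \<in> W" for z'
      proof -
        have z'': "z' \<in> fst \<kappa>" "snd \<kappa> z' \<in> ball (snd \<kappa> x) r" using z' by (auto simp: W_def)
        have "(\<Sum>i\<in>K. c i *\<^sub>R Wn \<kappa> i (snd \<kappa> z')) $ a = 0" for a
          unfolding comp[symmetric] by (rule vecJ.cdiff_eq_0_on_ball[OF hol U z0 z''(2)])
        then show ?thesis unfolding D_def relation_chart[OF k(1) z''(1)] by (simp add: vec_eq_iff)
      qed
      then have "x \<in> \<Omega>" unfolding \<Omega>_def using W by blast
      then show False using x by simp
    qed
    then show "\<exists>W. openin X W \<and> x \<in> W \<and> W \<subseteq> topspace X - \<Omega>"
      using W openin_subset[OF W(1)] by (intro exI[of _ W]) blast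
  qed
  then have "closedin X \<Omega>" using openin_subset[OF o] by (simp add: closedin_def)
  then have "\<Omega> = {} \<or> \<Omega> = topspace X" using connected_X o unfolding connected_space_clopen_in by blast
  moreover have "ic \<kappa> y \<in> \<Omega>"
    unfolding \<Omega>_def
  proof (intro CollectI exI conjI ballI)
    show "openin X {x \<in> fst \<kappa>. snd \<kappa> x \<in> ball y r}" by (rule ball_open[OF k])
    show "ic \<kappa> y \<in> {x \<in> fst \<kappa>. snd \<kappa> x \<in> ball y r}" using y r by simp
    fix z assume "z \<in> {x \<in> fst \<kappa>. snd \<kappa> x \<in> ball y r}"
    then show "D z = 0" using rel[of "snd \<kappa> z"] k by (simp add: D_def)
  qed
  ultimately have "x \<in> \<Omega>" using x by auto
  then show ?thesis by (auto simp: \<Omega>_def D_def)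
qed

lemma maximal_independent:
  "\<exists>K f x0. x0 \<in> topspace X \<and> indepR K (\<lambda>i. Zn i x0) \<and>
    (\<forall>k. k \<notin> K \<longrightarrow> (\<forall>x. Zn k x = (\<Sum>i\<in>K. f k i *\<^sub>R Zn i x)))"
proof -
  define Q where "Q K \<longleftrightarrow> (\<exists>x\<in>topspace X. indepR K (\<lambda>i. Zn i x))" for K
  have "\<exists>x. x \<in> topspace X" using X_ne by blast
  then have "Q {}" by (auto simp: Q_def indepR_def)
  moreover have "\<forall>K. Q K \<longrightarrow> card K < CARD('n) + 1" by (simp add: card_mono le_imp_less_Suc)
  ultimately obtain K where K: "Q K" "\<And>K'. Q K' \<Longrightarrow> card K' \<le> card K"
    using ex_has_greatest_nat[of Q "{}" card "CARD('n) + 1"] by (metis less_imp_le_nat)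
  obtain x0 where x0: "x0 \<in> topspace X" "indepR K (\<lambda>i. Zn i x0)" using K(1) by (auto simp: Q_def)
  obtain \<kappa> where k: "\<kappa> \<in> A" "x0 \<in> fst \<kappa>" using chart_ex[OF x0(1)] by blast
  define y0 where "y0 = snd \<kappa> x0"
  have y0: "y0 \<in> im \<kappa>" "ic \<kappa> y0 = x0" using k by (auto simp: y0_def)
  obtain \<tau> r where r: "r > 0" "ball y0 r \<subseteq> im \<kappa>" and det: "\<And>z. z \<in> ball y0 r \<Longrightarrow> det (cols K \<tau> (\<lambda>i. Wn \<kappa> i z)) \<noteq> 0"
    using nearby_independent[OF k(1) y0(1), of K, unfolded y0(2), OF x0(2)] by blast
  have "\<exists>f. \<forall>x. Zn l x = (\<Sum>i\<in>K. f i *\<^sub>R Zn i x)" if l: "l \<notin> K" for l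
  proof -
    have near: "\<exists>f. Zn l (ic \<kappa> z) = (\<Sum>i\<in>K. f i *\<^sub>R Zn i (ic \<kappa> z))" if z: "z \<in> ball y0 r" for z
    proof (rule dependent_insert[OF _ l])
      have zi: "z \<in> im \<kappa>" using z r by auto
      show "indepR K (\<lambda>i. Zn i (ic \<kappa> z))"
        unfolding indepR_iff_indepC[OF k(1) ic_dom[OF zi]] indepC_iff_det using det[OF z] zi by auto
      show "\<not> indepR (insert l K) (\<lambda>i. Zn i (ic \<kappa> z))"
      proof
        assume "indepR (insert l K) (\<lambda>i. Zn i (ic \<kappa> z))"
        then have "Q (insert l K)" unfolding Q_def using chart_subset[OF k(1)] ic_dom[OF zi] by blast
        from K(2)[OF this] l show False by simp
      qed
    qed simp
    \<comment> \<open>Cramer's rule makes the coefficients holomorphic, and by their uniqueness they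
      equal the real ones; so they are constant.\<close>
    define F where "F i z = det (cols K \<tau> ((\<lambda>i. Wn \<kappa> i z)(i := Wn \<kappa> l z))) / det (cols K \<tau> (\<lambda>i. Wn \<kappa> i z))" for i z
    have Fval: "\<exists>f. Zn l (ic \<kappa> z) = (\<Sum>i\<in>K. f i *\<^sub>R Zn i (ic \<kappa> z)) \<and> (\<forall>i\<in>K. F i z = of_real (f i))" if z: "z \<in> ball y0 r" for z
    proof -
      have zi: "z \<in> im \<kappa>" using z r by auto
      obtain f where f: "Zn l (ic \<kappa> z) = (\<Sum>i\<in>K. f i *\<^sub>R Zn i (ic \<kappa> z))" using near[OF z] by blast
      have "Zn l (ic \<kappa> z) \<kappa> = (\<Sum>i\<in>K. f i *\<^sub>R Zn i (ic \<kappa> z)) \<kappa>" using f by simp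
      then have "Wn \<kappa> l z = (\<Sum>i\<in>K. complex_of_real (f i) *s Wn \<kappa> i z)"
        unfolding sum_fun_apply by (simp add: WW_def smult_eq_real_combination[of "of_real _"])
      from cramer_cols[OF det[OF z] this] have "\<forall>i\<in>K. F i z = of_real (f i)" unfolding F_def by simp
      then show ?thesis using f by blast
    qed
    have Fc: "F i z = F i y0" if i: "i \<in> K" and z: "z \<in> ball y0 r" for i z
    proof (rule real_cdiff_constant[OF _ _ z])
      have sub: "cdiff ((*s) \<i>) (ball y0 r) (\<lambda>z. Wn \<kappa> j z $ a)" for j a
        by (rule cdiff_subset[OF WW_holomorphic[OF k(1) dx_in] open_ball r(2)])
      have up: "((\<lambda>i. Wn \<kappa> i z)(i := Wn \<kappa> l z)) j = Wn \<kappa> (if j = i then l else j) z" for z j by simp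
      show "cdiff ((*s) \<i>) (ball y0 r) (F i)"
        unfolding F_def
      proof (intro cdiff_divide cdiff_det_cols open_ball sub det)
        show "cdiff ((*s) \<i>) (ball y0 r) (\<lambda>y. ((\<lambda>i. Wn \<kappa> i y)(i := Wn \<kappa> l y)) j $ a)" for j a
          unfolding up by (rule sub)
      qed
      show "F i z \<in> \<real>" if "z \<in> ball y0 r" for z using Fval[OF that] i by auto
    qed
    define f where "f i = Re (F i y0)" for i
    define c where "c i = (if i = l then 1 else - f i)" for i
    have rel: "(\<Sum>i\<in>insert l K. c i *\<^sub>R Zn i (ic \<kappa> z)) = 0" if z: "z \<in> ball y0 r" for z
    proof -
      obtain f' where f': "Zn l (ic \<kappa> z) = (\<Sum>i\<in>K. f' i *\<^sub>R Zn i (ic \<kappa> z))" "\<And>i. i\<in>K \<Longrightarrow> F i z = of_real (f' i)"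
        using Fval[OF z] by blast
      have "f' i = f i" if "i \<in> K" for i
        using arg_cong[OF f'(2)[OF that], of Re] unfolding f_def Fc[OF that z] by simp
      then have "Zn l (ic \<kappa> z) = (\<Sum>i\<in>K. f i *\<^sub>R Zn i (ic \<kappa> z))" unfolding f'(1) by (intro sum.cong) auto
      moreover have "(\<Sum>i\<in>K. c i *\<^sub>R Zn i (ic \<kappa> z)) = - (\<Sum>i\<in>K. f i *\<^sub>R Zn i (ic \<kappa> z))"
        unfolding sum_negf[symmetric] using l by (intro sum.cong) (auto simp: c_def)
      ultimately show ?thesis using l by (simp add: c_def)
    qed
    have glob: "(\<Sum>i\<in>insert l K. c i *\<^sub>R Zn i x) = 0" if "x \<in> topspace X" for x
      by (rule relation_global[OF k(1) y0(1) r rel that])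
    have "Zn l x = (\<Sum>i\<in>K. f i *\<^sub>R Zn i x)" for x
    proof (cases "x \<in> topspace X")
      case True
      have "(\<Sum>i\<in>K. c i *\<^sub>R Zn i x) = - (\<Sum>i\<in>K. f i *\<^sub>R Zn i x)"
        unfolding sum_negf[symmetric] using l by (intro sum.cong) (auto simp: c_def)
      then show ?thesis using glob[OF True] l by (simp add: c_def)
    next
      case False
      \<comment> \<open>Outside the manifold the fields are 0 by definition, so that the relation
        holds for every x of the type.\<close>
      then have "Zn i x = 0" for i using ZZ(2)[OF _ _ dx_in False] by blast
      then show ?thesis by simp
    qed
    then show ?thesis by blast
  qed
  note ex = this
  define f where "f l = (SOME f. \<forall>x. Zn l x = (\<Sum>i\<in>K. f i *\<^sub>R Zn i x))" for l
  have "\<forall>x. Zn l x = (\<Sum>i\<in>K. f l i *\<^sub>R Zn i x)" if "l \<notin> K" for l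
    using someI_ex[OF ex[OF that]] unfolding f_def .
  then have "\<forall>k. k \<notin> K \<longrightarrow> (\<forall>x. Zn k x = (\<Sum>i\<in>K. f k i *\<^sub>R Zn i x))" by simp
  then show ?thesis using x0 by - (rule exI[of _ K], rule exI[of _ f], rule exI[of _ x0], simp)
qed

end

subsection \<open>Ideals modulo a monic polynomial\<close>

text \<open>\<open>I\<close> consists of residues of degree below that of p and is stable under
  multiplication by t modulo p. A monic element s of least degree generates it by division with
  remainder.\<close>

lemma ideal_generator:
  fixes p :: "'f::field poly"
  assumes p: "lead_coeff p = 1" "0 < degree p"
    and zero: "0 \<in> I" and add: "\<And>f h. f \<in> I \<Longrightarrow> h \<in> I \<Longrightarrow> f + h \<in> I"
    and smult: "\<And>c f. f \<in> I \<Longrightarrow> smult c f \<in> I"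
    and deg: "\<And>f. f \<in> I \<Longrightarrow> degree f < degree p"
    and mult: "\<And>f. f \<in> I \<Longrightarrow> \<exists>c. pCons 0 f - smult c p \<in> I"
  shows "\<exists>s. lead_coeff s = 1 \<and> s dvd p \<and> I = {f. degree f < degree p \<and> s dvd f}"
proof (cases "I = {0}")
  case True
  have "f = 0" if "degree f < degree p" "p dvd f" for f
    using that dvd_imp_degree_le[of p f] by (cases "f = 0") auto
  \<comment> \<open>For the zero ideal the generator is p itself: 0 is its only multiple of smaller
    degree.\<close>
  then show ?thesis using True p by (intro exI[of _ p]) auto
next
  case False
  then obtain f0 where f0: "f0 \<in> I" "f0 \<noteq> 0" using zero by blast
  define s0 where "s0 = arg_min degree (\<lambda>f. f \<in> I \<and> f \<noteq> 0)"
  have s0: "s0 \<in> I" "s0 \<noteq> 0" and min: "\<And>f. f \<in> I \<Longrightarrow> f \<noteq> 0 \<Longrightarrow> degree s0 \<le> degree f"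
    using arg_min_natI[of "\<lambda>f. f \<in> I \<and> f \<noteq> 0" f0 degree] arg_min_nat_le[of "\<lambda>f. f \<in> I \<and> f \<noteq> 0" _ degree] f0
    unfolding s0_def by blast+
  define s where "s = smult (inverse (lead_coeff s0)) s0"
  have s: "s \<in> I" "lead_coeff s = 1" "degree s = degree s0"
    unfolding s_def using smult[OF s0(1)] s0(2) by auto
  have s_nz: "s \<noteq> 0" using s(2) by auto
  \<comment> \<open>As long as the degree stays below that of p, multiplication by t needs no
    reduction.\<close>
  have shift: "pCons 0 f \<in> I" if "f \<in> I" "degree (pCons 0 f) < degree p" for f
  proof -
    obtain c where c: "pCons 0 f - smult c p \<in> I" using mult[OF \<open>f \<in> I\<close>] by blast
    have "c = 0"
    proof (rule ccontr)
      assume "c \<noteq> 0"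
      then have "coeff (pCons 0 f - smult c p) (degree p) \<noteq> 0" using p(1) that(2) by (simp add: coeff_eq_0)
      then have "degree p \<le> degree (pCons 0 f - smult c p)" by (rule le_degree)
      then show False using deg[OF c] by simp
    qed
    then show ?thesis using c by simp
  qed
  have mul: "degree (q * s) < degree p \<Longrightarrow> q * s \<in> I" for q
  proof (induction q rule: pCons_induct)
    case 0
    then show ?case by (simp add: zero)
  next
    case (pCons a q)
    have eq: "pCons a q * s = smult a s + pCons 0 (q * s)" by simp
    show ?case
    proof (cases "q = 0")
      case True
      then show ?thesis using smult[OF s(1)] by simp
    next
      case False
      then have d: "degree (pCons a q * s) = Suc (degree (q * s))" "degree (pCons 0 (q * s)) = Suc (degree (q * s))"
        using s_nz by (auto simp: degree_mult_eq simp del: mult_pCons_left)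
      then show ?thesis
        unfolding eq using pCons.prems pCons.IH by (intro add smult s(1) shift) auto
    qed
  qed
  have I: "I = {f. degree f < degree p \<and> s dvd f}"
  proof (intro equalityI subsetI CollectI conjI)
    fix f assume f: "f \<in> I"
    show d: "degree f < degree p" by (rule deg[OF f])
    have "(f div s) * s \<in> I"
    proof (rule mul)
      have "degree (f div s * s) \<le> degree f"
      proof (cases "f div s = 0 \<or> f mod s = 0")
        case True
        then show ?thesis using div_mult_mod_eq[of f s] by auto
      next
        case False
        then have "degree (f mod s) < degree s" using degree_mod_less[OF s_nz, of f] by auto
        also have "degree s \<le> degree (f div s * s)" using False s_nz by (simp add: degree_mult_eq)
        finally have "degree (f div s * s + f mod s) = degree (f div s * s)" by (rule degree_add_eq_left)
        then show ?thesis by simp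
      qed
      then show "degree (f div s * s) < degree p" using d by simp
    qed
    then have "f + smult (-1) ((f div s) * s) \<in> I" by (intro add f smult)
    moreover have "f + smult (-1) ((f div s) * s) = f mod s" by (simp add: minus_div_mult_eq_mod)
    ultimately have m: "f mod s \<in> I" by simp
    show "s dvd f"
    proof (rule ccontr)
      assume nd: "\<not> s dvd f"
      then have "f mod s \<noteq> 0" by (simp add: dvd_eq_mod_eq_0)
      then show False using min[OF m] degree_mod_less_degree[OF s_nz nd] s(3) by simp
    qed
  next
    fix f assume "f \<in> {f. degree f < degree p \<and> s dvd f}"
    then show "f \<in> I" using mul[of "f div s"] by auto
  qed
  have "s dvd p"
  proof -
    have ds: "degree s < degree p" by (rule deg[OF s(1)])
    \<comment> \<open>A multiple of s of the largest degree still allowed. Multiplying it by t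
      forces a reduction with c nonzero, and s then divides c p.\<close>
    define f where "f = monom 1 (degree p - 1 - degree s) * s"
    have df: "degree f = degree p - 1" 
    proof -
      have "degree (monom (1::'f) (degree p - 1 - degree s)) = degree p - 1 - degree s" by (rule degree_monom_eq) simp
      moreover have "monom (1::'f) (degree p - 1 - degree s) \<noteq> 0" by simp
      ultimately show ?thesis unfolding f_def using degree_mult_eq[OF _ s_nz] ds by fastforce
    qed
    have f: "f \<in> I" using df p(2) unfolding I by (simp add: f_def)
    obtain c where c: "pCons 0 f - smult c p \<in> I" using mult[OF f] by blast
    have lf: "lead_coeff f = 1" unfolding f_def lead_coeff_mult lead_coeff_monom using s(2) by simp
    have "c \<noteq> 0"
    proof
      assume "c = 0"
      then have "degree (pCons 0 f) < degree p" using deg[OF c] by simp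
      moreover have "f \<noteq> 0" using lf by auto
      ultimately show False using df p(2) by simp
    qed
    have "s dvd pCons 0 f - smult c p" using c I by blast
    moreover have "s dvd pCons 0 f"
    proof -
      have "s dvd f" using f I by blast
      then have "s dvd [:0, 1:] * f" by (rule dvd_mult)
      then show ?thesis by simp
    qed
    ultimately have "s dvd smult c p" by (metis dvd_diff_right_iff)
    then show ?thesis using \<open>c \<noteq> 0\<close> by (simp add: dvd_smult_iff)
  qed
  then show ?thesis using s(2) I by blast
qed

text \<open>Either the next linear factor divides f and is split off, or its root belongs to the
  cofactor and f divides the remaining product.\<close>

lemma split_divisor:
  fixes f :: "real poly"
  assumes "finite S" "f dvd (\<Prod>i\<in>S. [:- a i, 1:])" "lead_coeff f = 1"
  shows "\<exists>xs. f = (\<Prod>x\<leftarrow>xs. [:- x, 1:])"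
  using assms
proof (induction S arbitrary: f rule: finite_induct)
  case empty
  then have "f dvd 1" "f \<noteq> 0" by auto
  then have "degree f = 0" by (simp add: is_unit_iff_degree)
  then obtain c where "f = [:c:]" by (rule degree_eq_zeroE)
  then have "f = 1" using empty.prems(2) by (simp add: one_pCons)
  then show ?case by (intro exI[of _ "[]"]) simp
next
  case (insert j S)
  show ?case
  proof (cases "poly f (a j) = 0")
    case True
    then obtain f' where f': "f = [:- a j, 1:] * f'" by (auto simp: poly_eq_0_iff_dvd elim: dvdE)
    have "f' dvd (\<Prod>i\<in>S. [:- a i, 1:])"
      using insert.prems(1) insert.hyps unfolding f' by (simp del: mult_pCons_left)
    moreover have "lead_coeff f' = 1" using insert.prems(2) unfolding f' lead_coeff_mult by simp
    ultimately obtain xs where "f' = (\<Prod>x\<leftarrow>xs. [:- x, 1:])" using insert.IH by blast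
    then show ?thesis using f' by (intro exI[of _ "a j # xs"]) simp
  next
    case False
    obtain h where h: "[:- a j, 1:] * (\<Prod>i\<in>S. [:- a i, 1:]) = f * h"
      using insert.prems(1) insert.hyps by (auto simp del: mult_pCons_left elim: dvdE)
    have "poly f (a j) * poly h (a j) = 0" using arg_cong[OF h, of "\<lambda>p. poly p (a j)"] by simp
    then obtain h' where "h = [:- a j, 1:] * h'" using False by (auto simp: poly_eq_0_iff_dvd elim: dvdE)
    then have "[:- a j, 1:] * (\<Prod>i\<in>S. [:- a i, 1:]) = [:- a j, 1:] * (f * h')" using h by (simp only: mult.left_commute)
    then have "(\<Prod>i\<in>S. [:- a i, 1:]) = f * h'" by (subst (asm) mult_cancel_left) simp
    then have "f dvd (\<Prod>i\<in>S. [:- a i, 1:])" by simp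
    then show ?thesis using insert.IH insert.prems(2) by blast
  qed
qed

lemma split_divisor_sorted:
  fixes f :: "real poly"
  assumes "finite S" "f dvd (\<Prod>i\<in>S. [:- a i, 1:])" "lead_coeff f = 1"
  shows "\<exists>r. f = (\<Prod>j<degree f. [:- r j, 1:]) \<and> (\<forall>i j. i \<le> j \<longrightarrow> j < degree f \<longrightarrow> r i \<le> r j)"
proof -
  obtain xs where xs: "f = (\<Prod>x\<leftarrow>xs. [:- x, 1:])" using split_divisor[OF assms] by blast
  define ys where "ys = sort xs"
  have f: "f = (\<Prod>x\<leftarrow>ys. [:- x, 1:])"
    unfolding xs ys_def by (simp flip: prod_mset_prod_list)
  also have "\<dots> = (\<Prod>j<length ys. [:- (ys ! j), 1:])"
    by (simp add: prod.list_conv_set_nth atLeast0LessThan)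
  finally have f2: "f = (\<Prod>j<length ys. [:- (ys ! j), 1:])" .
  then have "degree f = length ys" by (simp add: degree_prod_linear)
  moreover have "ys ! i \<le> ys ! j" if "i \<le> j" "j < length ys" for i j
    using that by (simp add: ys_def sorted_nth_mono)
  ultimately show ?thesis using f2 by (intro exI[of _ "\<lambda>j. ys ! j"]) auto
qed

subsection \<open>Polynomials as coefficient vectors\<close>

lemma dim_coordinate_subspace: "dim {x :: real^'n. \<forall>i. i \<notin> M \<longrightarrow> x $ i = 0} = card M"
proof -
  have inj: "inj (\<lambda>i. axis i (1::real) :: real^'n)" by (rule injI) (simp add: axis_eq_axis)
  have eq: "{x :: real^'n. \<forall>i. i \<notin> M \<longrightarrow> x $ i = 0} = {x. \<forall>b\<in>Basis. b \<notin> (\<lambda>i. axis i 1) ` M \<longrightarrow> x \<bullet> b = 0}"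
  proof (intro Collect_cong iffI)
    fix x :: "real^'n" assume x: "\<forall>i. i \<notin> M \<longrightarrow> x $ i = 0"
    show "\<forall>b\<in>Basis. b \<notin> (\<lambda>i. axis i 1) ` M \<longrightarrow> x \<bullet> b = 0"
      using x by (auto simp: Basis_vec_def inner_axis)
  next
    fix x :: "real^'n" assume x: "\<forall>b\<in>Basis. b \<notin> (\<lambda>i. axis i 1) ` M \<longrightarrow> x \<bullet> b = 0"
    show "\<forall>i. i \<notin> M \<longrightarrow> x $ i = 0"
    proof (intro allI impI)
      fix i assume "i \<notin> M"
      then have "axis i (1::real) \<notin> (\<lambda>i. axis i 1) ` M" using inj by (auto dest: injD)
      moreover have "axis i (1::real) \<in> (Basis :: (real^'n) set)" by (auto simp: Basis_vec_def)
      ultimately have "x \<bullet> axis i 1 = 0" using x by blast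
      then show "x $ i = 0" by (simp add: inner_axis)
    qed
  qed
  have "(\<lambda>i. axis i (1::real)) ` M \<subseteq> (Basis :: (real^'n) set)" by (auto simp: Basis_vec_def)
  from dim_substandard[OF this] show ?thesis
    unfolding eq using card_image[OF inj_on_subset[OF inj subset_UNIV], of M] by simp
qed

locale coefficient_vectors =
  fixes d :: "'n::finite \<Rightarrow> nat"
  assumes d: "bij_betw d UNIV {1..CARD('n)}"
begin

lemma d_in: "d i \<in> {1..CARD('n)}" using d bij_betwE by blast

lemma d_inj: "d i = d j \<longleftrightarrow> i = j" using d by (auto simp: bij_betw_def dest: injD)

text \<open>The sign and exponent are those of h_k in p_h, so that the vector of differentials of
  the h_k becomes the differential of p_h.\<close>

definition PV :: "real^'n \<Rightarrow> real poly" where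
  "PV c = (\<Sum>i\<in>UNIV. monom ((-1) ^ d i * c $ i) (CARD('n) - d i))"

definition VP :: "real poly \<Rightarrow> real^'n" where
  "VP f = (\<chi> i. (-1) ^ d i * coeff f (CARD('n) - d i))"

lemma coeff_PV: "coeff (PV c) (CARD('n) - d i) = (-1) ^ d i * c $ i"
proof -
  have "coeff (PV c) (CARD('n) - d i) = (\<Sum>j\<in>UNIV. if j = i then (-1) ^ d j * c $ j else 0)"
    unfolding PV_def coeff_sum
  proof (intro sum.cong refl)
    fix j
    have "CARD('n) - d j = CARD('n) - d i \<longleftrightarrow> j = i"
      using d_in[of i] d_in[of j] d_inj[of j i] by auto
    then show "coeff (monom ((-1) ^ d j * c $ j) (CARD('n) - d j)) (CARD('n) - d i) = (if j = i then (-1) ^ d j * c $ j else 0)"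
      by (simp add: coeff_monom)
  qed
  then show ?thesis by simp
qed

lemma degree_PV: "degree (PV c) < CARD('n)"
proof -
  have "degree (PV c) \<le> CARD('n) - 1"
    unfolding PV_def
  proof (intro degree_sum_le finite_class.finite_UNIV)
    fix i
    show "degree (monom ((-1) ^ d i * c $ i) (CARD('n) - d i)) \<le> CARD('n) - 1"
      using degree_monom_le[of "(-1) ^ d i * c $ i" "CARD('n) - d i"] d_in[of i] by auto
  qed
  moreover have "CARD('n) > 0" by simp
  ultimately show ?thesis by linarith
qed

lemma sign_square: "(-1) ^ k * ((-1) ^ k * x) = (x :: real)"
  by (simp flip: mult.assoc power_add)

lemma VP_PV: "VP (PV c) = c"
  by (simp add: VP_def coeff_PV vec_eq_iff sign_square)

lemma PV_VP: assumes "degree f < CARD('n)" shows "PV (VP f) = f"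
proof (rule poly_eqI)
  fix k
  show "coeff (PV (VP f)) k = coeff f k"
  proof (cases "k < CARD('n)")
    case True
    then have "CARD('n) - k \<in> {1..CARD('n)}" by auto
    then obtain i where "d i = CARD('n) - k" using d by (metis bij_betw_imp_surj_on imageE)
    then have k: "k = CARD('n) - d i" using True by simp
    show ?thesis unfolding k coeff_PV by (simp add: VP_def sign_square)
  next
    case False
    then show ?thesis using assms degree_PV[of "VP f"] by (simp add: coeff_eq_0)
  qed
qed

lemma PV_linear: "PV (a + b) = PV a + PV b" "PV (r *\<^sub>R a) = smult r (PV a)"
proof -
  show "PV (a + b) = PV a + PV b"
    by (simp add: PV_def algebra_simps sum.distrib add_monom[symmetric])
  show "PV (r *\<^sub>R a) = smult r (PV a)"
    by (rule poly_eqI) (simp add: PV_def coeff_sum coeff_monom sum_distrib_left if_distrib mult.left_commute cong: if_cong)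
qed

lemma linear_VP: "VP (f + h) = VP f + VP h" "VP (smult r f) = r *\<^sub>R VP f"
  by (simp_all add: VP_def vec_eq_iff algebra_simps)

text \<open>Multiplication by s maps the polynomials of degree below n - deg s isomorphically onto
  the multiples of s of degree below n.\<close>

lemma dim_multiples:
  assumes s: "s \<noteq> 0" "degree s \<le> CARD('n)" and R: "\<And>c. c \<in> R \<longleftrightarrow> s dvd PV c"
  shows "dim R = CARD('n) - degree s"
proof -
  define r where "r = CARD('n) - degree s"
  define M where "M = {i. CARD('n) - d i < r}"
  define S where "S = {c :: real^'n. \<forall>i. i \<notin> M \<longrightarrow> c $ i = 0}"
  define \<Theta> where "\<Theta> c = VP (s * PV c)" for c
  have subS: "subspace S" by (auto simp: S_def subspace_def)
  have Sdeg: "c \<in> S \<longleftrightarrow> PV c = 0 \<or> degree (PV c) < r" for c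
  proof
    assume c: "c \<in> S"
    show "PV c = 0 \<or> degree (PV c) < r"
    proof (rule ccontr)
      assume "\<not> ?thesis"
      then have nz: "PV c \<noteq> 0" "degree (PV c) \<ge> r" by auto
      have "CARD('n) - degree (PV c) \<in> {1..CARD('n)}" using degree_PV[of c] by auto
      then obtain i where "d i = CARD('n) - degree (PV c)" using d by (metis bij_betw_imp_surj_on imageE)
      then have i: "degree (PV c) = CARD('n) - d i" using degree_PV[of c] by simp
      have "c $ i \<noteq> 0" using nz(1) coeff_PV[of c i] i by (metis leading_coeff_0_iff mult_zero_right)
      moreover have "i \<notin> M" using nz(2) i by (simp add: M_def)
      ultimately show False using c by (simp add: S_def)
    qed
  next
    assume c: "PV c = 0 \<or> degree (PV c) < r"
    show "c \<in> S"
      unfolding S_def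
    proof (intro CollectI allI impI)
      fix i assume "i \<notin> M"
      then have "coeff (PV c) (CARD('n) - d i) = 0" using c by (auto simp: M_def intro: coeff_eq_0)
      then show "c $ i = 0" by (simp add: coeff_PV)
    qed
  qed
  have sdeg: "degree (s * PV c) < CARD('n)" if "c \<in> S" for c
  proof (cases "PV c = 0")
    case False
    then show ?thesis using that s unfolding Sdeg by (auto simp: degree_mult_eq r_def)
  qed simp
  have lin: "linear \<Theta>"
    by (rule linearI) (simp_all add: \<Theta>_def PV_linear linear_VP distrib_left)
  have "inj_on \<Theta> S"
  proof (rule inj_onI)
    fix a b assume ab: "a \<in> S" "b \<in> S" "\<Theta> a = \<Theta> b"
    have "s * PV a = PV (\<Theta> a)" using PV_VP[OF sdeg[OF ab(1)]] by (simp only: \<Theta>_def)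
    also have "\<dots> = PV (\<Theta> b)" by (simp only: ab(3))
    also have "\<dots> = s * PV b" using PV_VP[OF sdeg[OF ab(2)]] by (simp only: \<Theta>_def)
    finally have "s * PV a = s * PV b" .
    then have "PV a = PV b" using s(1) by simp
    then have "VP (PV a) = VP (PV b)" by (rule arg_cong)
    then show "a = b" unfolding VP_PV .
  qed
  then have "dim (\<Theta> ` S) = dim S" using lin subS by (intro dim_image_eq) (simp_all only: span_eq_iff[THEN iffD2])
  moreover have "\<Theta> ` S = R"
  proof (intro equalityI subsetI)
    fix c assume "c \<in> \<Theta> ` S"
    then obtain a where "a \<in> S" "c = \<Theta> a" by blast
    then have "PV c = s * PV a" using PV_VP[OF sdeg] by (simp add: \<Theta>_def)
    then show "c \<in> R" by (simp add: R)
  next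
    fix c assume "c \<in> R"
    then obtain q where q: "PV c = s * q" using R by blast
    have dq: "q = 0 \<or> degree q < r"
      using degree_PV[of c] s unfolding q r_def by (cases "q = 0") (auto simp: degree_mult_eq)
    have cn: "degree q < CARD('n)" using dq by (auto simp: r_def)
    have "PV (VP q) = q" by (rule PV_VP[OF cn])
    then have "VP q \<in> S" "c = \<Theta> (VP q)"
      unfolding Sdeg \<Theta>_def using dq q VP_PV[of c] by auto
    then show "c \<in> \<Theta> ` S" by blast
  qed
  moreover have "dim S = r"
  proof -
    have "bij_betw (\<lambda>i. CARD('n) - d i) M {..<r}"
      unfolding bij_betw_def
    proof
      show "inj_on (\<lambda>i. CARD('n) - d i) M"
      proof (rule inj_onI)
        fix i j assume "CARD('n) - d i = CARD('n) - d j"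
        then have "d i = d j" using d_in[of i] d_in[of j] by auto
        then show "i = j" by (simp add: d_inj)
      qed
      show "(\<lambda>i. CARD('n) - d i) ` M = {..<r}"
      proof (intro equalityI subsetI)
        fix k assume k: "k \<in> {..<r}"
        then have "CARD('n) - k \<in> {1..CARD('n)}" by (auto simp: r_def)
        then obtain i where "d i = CARD('n) - k" using d by (metis bij_betw_imp_surj_on imageE)
        then have "k = CARD('n) - d i" using k by (auto simp: r_def)
        then show "k \<in> (\<lambda>i. CARD('n) - d i) ` M" using k by (auto simp: M_def)
      qed (auto simp: M_def)
    qed
    then have "card M = r" using bij_betw_same_card by fastforce
    then show ?thesis unfolding S_def dim_coordinate_subspace .
  qed
  ultimately show ?thesis by (simp add: r_def)
qed

end

subsection \<open>The singular locus\<close>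

locale bk_max = bk_mfd X A g H T V \<phi> for X :: "'a topology" and A :: "('a, complex^'n) chart set" and g H T V \<phi> +
  fixes K :: "'n set" and f :: "'n \<Rightarrow> 'n \<Rightarrow> real" and x0 :: 'a
  assumes x0: "x0 \<in> topspace X" and K0: "indepR K (\<lambda>i. Zn i x0)"
    and Kf: "k \<notin> K \<Longrightarrow> Zn k x = (\<Sum>i\<in>K. f k i *\<^sub>R Zn i x)"
begin

text \<open>The definition takes the span of the fields as functions on all of M. Independence at
  the single point \<open>x0\<close> already makes the fields in \<open>K\<close> independent as
  functions, and the relations \<open>Kf\<close> show that they span.\<close>

lemma cohomogeneity_eq: "cohomogeneity A g H = card K"
proof -
  have img: "(\<lambda>k. ZZ k) ` {1..CARD('n)} = range (\<lambda>i. Zn i)"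
    using bij_betw_imp_surj_on[OF dx] by (metis image_image)
  have inj: "inj_on (\<lambda>i. Zn i) K"
  proof (rule inj_onI, rule ccontr)
    fix i j assume ij: "i \<in> K" "j \<in> K" "Zn i = Zn j" "i \<noteq> j"
    define c :: "'n \<Rightarrow> real" where "c l = (if l = i then 1 else if l = j then - 1 else 0)" for l
    have "(\<Sum>l\<in>K. c l *\<^sub>R Zn l x0) = (\<Sum>l\<in>{i, j}. c l *\<^sub>R Zn l x0)"
      using ij by (intro sum.mono_neutral_right) (auto simp: c_def)
    also have "\<dots> = 0" using ij by (simp add: c_def)
    finally have "c i = 0" using K0 ij(1) unfolding indepR_def by blast
    then show False by (simp add: c_def)
  qed
  have indep: "independent ((\<lambda>i. Zn i) ` K)"
  proof (rule ccontr)
    assume "\<not> independent ((\<lambda>i. Zn i) ` K)"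
    then have "dependent ((\<lambda>i. Zn i) ` K)" by simp
    moreover have "finite ((\<lambda>i. Zn i) ` K)" by simp
    ultimately obtain u where u: "\<exists>v\<in>(\<lambda>i. Zn i) ` K. u v \<noteq> 0" "(\<Sum>v\<in>(\<lambda>i. Zn i) ` K. u v *\<^sub>R v) = 0"
      using real_vector.dependent_finite by blast
    have "(\<Sum>i\<in>K. u (Zn i) *\<^sub>R Zn i) = 0" using u(2) by (simp add: sum.reindex[OF inj])
    then have "(\<Sum>i\<in>K. u (Zn i) *\<^sub>R Zn i) x0 = 0" by simp
    then have "(\<Sum>i\<in>K. u (Zn i) *\<^sub>R Zn i x0) = 0" unfolding sum_fun_apply .
    then have "\<forall>i\<in>K. u (Zn i) = 0" using K0[unfolded indepR_def, THEN spec, of "\<lambda>i. u (Zn i)"] by blast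
    then show False using u(1) by blast
  qed
  have "Zn i \<in> span ((\<lambda>i. Zn i) ` K)" for i
  proof (cases "i \<in> K")
    case True
    then show ?thesis by (intro span_base) auto
  next
    case False
    have "Zn i = (\<Sum>j\<in>K. f i j *\<^sub>R Zn j)" by (rule ext) (simp only: sum_fun_apply Kf[OF False])
    then show ?thesis by (simp only:) (intro span_sum span_scale span_base imageI)
  qed
  then have "span ((\<lambda>i. Zn i) ` K) = span (range (\<lambda>i. Zn i))"
    by (intro equalityI span_mono span_minimal subspace_span) auto
  then have "dim (range (\<lambda>i. Zn i)) = card ((\<lambda>i. Zn i) ` K)"
    using indep by (rule dim_eq_card)
  then show ?thesis
    unfolding cohomogeneity_def img dim_span using card_image[OF inj] by simp
qed

definition NN where "NN = {x \<in> topspace X. \<not> indepR K (\<lambda>i. Zn i x)}"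

lemma NN_subset: "NN \<subset> topspace X"
  using x0 K0 by (auto simp: NN_def)

lemma NN_iff:
  assumes "x \<in> topspace X" shows "x \<notin> NN \<longleftrightarrow> indepR K (\<lambda>i. Zn i x)"
  using assms by (simp add: NN_def)

lemma open_regular: "openin X (topspace X - NN)"
proof (subst openin_subopen, intro ballI)
  fix x assume x: "x \<in> topspace X - NN"
  then obtain \<kappa> where k: "\<kappa> \<in> A" "x \<in> fst \<kappa>" using chart_ex by blast
  have "indepR K (\<lambda>i. Zn i (ic \<kappa> (snd \<kappa> x)))" using x k by (simp add: NN_def)
  from nearby_independent[OF k(1) co_im[OF k(2)] this]
  obtain \<tau> r where r: "r > 0" "\<And>z. z\<in>ball (snd \<kappa> x) r \<Longrightarrow> det (cols K \<tau> (\<lambda>i. Wn \<kappa> i z)) \<noteq> 0" by blast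
  have "{z \<in> fst \<kappa>. snd \<kappa> z \<in> ball (snd \<kappa> x) r} \<subseteq> topspace X - NN"
  proof
    fix z assume z: "z \<in> {z \<in> fst \<kappa>. snd \<kappa> z \<in> ball (snd \<kappa> x) r}"
    then have zk: "z \<in> fst \<kappa>" by simp
    have "indepR K (\<lambda>i. Zn i z)"
      unfolding indepR_iff_indepC[OF k(1) zk] indepC_iff_det using r(2)[of "snd \<kappa> z"] z by auto
    then show "z \<in> topspace X - NN" using zk chart_subset[OF k(1)] by (auto simp: NN_def)
  qed
  then show "\<exists>W. openin X W \<and> x \<in> W \<and> W \<subseteq> topspace X - NN"
    using chart_open_preimage[OF k(1) open_ball, of "snd \<kappa> x" r] k r(1)
    by (intro exI[of _ "{z \<in> fst \<kappa>. snd \<kappa> z \<in> ball (snd \<kappa> x) r}"]) auto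
qed

text \<open>The components of the fields are those in the fixed chart \<kappa>; read in another
  chart they are composed with a holomorphic transition map.\<close>

lemma holomorphic_det_cols:
  assumes k: "\<kappa> \<in> A"
  shows "holomorphic_fun_on A (fst \<kappa>) (\<lambda>x. det (cols K \<tau> (\<lambda>i. Zn i x \<kappa>)))"
  unfolding holomorphic_fun_on_def
proof (rule ballI)
  fix \<kappa>' assume k': "\<kappa>' \<in> A"
  define S where "S = snd \<kappa>' ` (fst \<kappa>' \<inter> fst \<kappa>)"
  have S: "open S" unfolding S_def by (rule chart_open_image[OF k' chart(1)[OF k]])
  have mem: "y \<in> im \<kappa>'" "ic \<kappa>' y \<in> fst \<kappa>" "tr \<kappa>' \<kappa> y \<in> im \<kappa>" "ic \<kappa> (tr \<kappa>' \<kappa> y) = ic \<kappa>' y" if "y \<in> S" for y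
    using that k k' by (auto simp: S_def tr_def)
  have der: "(tr \<kappa>' \<kappa> has_derivative Dtr \<kappa>' \<kappa> y) (at y)" "Dtr \<kappa>' \<kappa> y (\<i> *s v) = \<i> *s Dtr \<kappa>' \<kappa> y v" if yS: "y \<in> S" for y v
  proof -
    obtain x where x: "x \<in> fst \<kappa>'" "x \<in> fst \<kappa>" "y = snd \<kappa>' x" using yS by (auto simp: S_def)
    show "(tr \<kappa>' \<kappa> has_derivative Dtr \<kappa>' \<kappa> y) (at y)" unfolding x(3) by (rule tr_has_derivative[OF k' k x(1,2)])
    show "Dtr \<kappa>' \<kappa> y (\<i> *s v) = \<i> *s Dtr \<kappa>' \<kappa> y v" unfolding x(3) by (rule Dtr_linear(2)[OF k' k x(1,2)])
  qed
  have sub: "tr \<kappa>' \<kappa> ` S \<subseteq> im \<kappa>" using mem by blast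
  have c: "cdiff ((*s) \<i>) S (\<lambda>y. Wn \<kappa> i (tr \<kappa>' \<kappa> y) $ a)" for i a
    by (rule cdiff_compose_holomorphic[OF WW_holomorphic[OF k dx_in] S sub der])
  have "cdiff ((*s) \<i>) S (\<lambda>y. det (cols K \<tau> (\<lambda>i. Wn \<kappa> i (tr \<kappa>' \<kappa> y))))"
    by (rule cdiff_det_cols[OF S c])
  then have "cdiff ((*s) \<i>) S (\<lambda>y. det (cols K \<tau> (\<lambda>i. Zn i (ic \<kappa>' y) \<kappa>)))"
    by (rule cdiff_cong) (simp add: WW_def mem)
  then show "case \<kappa>' of (U, h) \<Rightarrow> complex_diff_on (h ` (U \<inter> fst \<kappa>)) (\<lambda>y. det (cols K \<tau> (\<lambda>i. Zn i (inv_into U h y) \<kappa>)))"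
    unfolding complex_diff_on_iff_cdiff S_def ic_def by (simp add: case_prod_unfold)
qed

text \<open>Over a chart the equations are the determinants of \<open>cols K \<tau>\<close> for all
  of the finitely many \<tau>; that complex determinants detect real dependence is
  \<open>indepR_iff_indepC\<close>.\<close>

lemma NN_analytic: "closed_analytic_subvariety X A NN"
  unfolding closed_analytic_subvariety_def
proof (intro conjI ballI)
  show "closedin X NN"
    using open_regular NN_subset by (auto simp: closedin_def)
  fix x assume "x \<in> topspace X"
  then obtain \<kappa> where k: "\<kappa> \<in> A" "x \<in> fst \<kappa>" using chart_ex by blast
  define \<F> where "\<F> = range (\<lambda>\<tau> x. det (cols K \<tau> (\<lambda>i. Zn i x \<kappa>)))"
  have fin: "finite \<F>" unfolding \<F>_def by (rule finite_imageI) simp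
  have hol: "\<forall>F\<in>\<F>. holomorphic_fun_on A (fst \<kappa>) F"
    unfolding \<F>_def using holomorphic_det_cols[OF k(1)] by blast
  have "NN \<inter> fst \<kappa> = {y \<in> fst \<kappa>. \<forall>F\<in>\<F>. F y = 0}"
  proof -
    have "z \<in> NN \<longleftrightarrow> (\<forall>F\<in>\<F>. F z = 0)" if z: "z \<in> fst \<kappa>" for z
    proof -
      have W: "Wn \<kappa> i (snd \<kappa> z) = Zn i z \<kappa>" for i using k(1) z by (simp add: WW_def)
      have zX: "z \<in> topspace X" using chart_subset[OF k(1)] z by blast
      have "z \<in> NN \<longleftrightarrow> \<not> indepC K (\<lambda>i. Wn \<kappa> i (snd \<kappa> z))"
        unfolding NN_def indepR_iff_indepC[OF k(1) z, symmetric] using zX by simp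
      also have "\<dots> \<longleftrightarrow> (\<forall>F\<in>\<F>. F z = 0)" unfolding W indepC_iff_det \<F>_def by simp
      finally show ?thesis .
    qed
    then show ?thesis by blast
  qed
  then show "\<exists>W \<F>. openin X W \<and> x \<in> W \<and> finite \<F> \<and> (\<forall>F\<in>\<F>. holomorphic_fun_on A W F) \<and> NN \<inter> W = {y\<in>W. \<forall>F\<in>\<F>. F y = 0}"
    using chart(1)[OF k(1)] k(2) fin hol by - (rule exI[of _ "fst \<kappa>"], rule exI[of _ \<F>], simp)
qed

subsection \<open>The ideal of differentials of the momentum polynomial\<close>

sublocale CV: coefficient_vectors "dx :: 'n \<Rightarrow> nat"
  by unfold_locales (rule dx)

definition CC :: "(real^'n) set" where "CC = {c. \<forall>x. (\<Sum>i\<in>UNIV. c $ i *\<^sub>R Zn i x) = 0}"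

text \<open>The annihilator of the relations that hold everywhere: a space independent of the point,
  which at every regular point is the set of values of the differentials of the h_k.\<close>

definition RR :: "(real^'n) set" where "RR = orthogonal_comp CC"

definition \<Psi> :: "('a, complex^'n) chart \<Rightarrow> complex^'n \<Rightarrow> complex^'n \<Rightarrow> real^'n" where
  "\<Psi> \<kappa> y v = (\<chi> i. \<beta> \<kappa> y (GR \<kappa> (dx i) y) v)"

text \<open>Rewriting the fields outside \<open>K\<close> by \<open>Kf\<close> turns a relation at x
  into one among the fields in \<open>K\<close>, which are independent there. The resulting
  conditions on the coefficients do not involve x.\<close>

lemma relation_iff_CC:
  assumes x: "x \<in> topspace X" "x \<notin> NN"
  shows "(\<Sum>i\<in>UNIV. c $ i *\<^sub>R Zn i x) = 0 \<longleftrightarrow> c \<in> CC"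
proof
  have red: "(\<Sum>i\<in>UNIV. c $ i *\<^sub>R Zn i x) = (\<Sum>i\<in>K. (c $ i + (\<Sum>k\<in>-K. c $ k * f k i)) *\<^sub>R Zn i x)" for x
  proof -
    have "(\<Sum>i\<in>UNIV. c $ i *\<^sub>R Zn i x) = (\<Sum>i\<in>K. c $ i *\<^sub>R Zn i x) + (\<Sum>k\<in>-K. c $ k *\<^sub>R Zn k x)"
      by (subst sum.union_disjoint[symmetric]) (auto intro!: sum.cong)
    also have "(\<Sum>k\<in>-K. c $ k *\<^sub>R Zn k x) = (\<Sum>k\<in>-K. \<Sum>i\<in>K. (c $ k * f k i) *\<^sub>R Zn i x)"
      by (intro sum.cong refl) (simp add: Kf[symmetric] scaleR_sum_right[symmetric] flip: scaleR_scaleR)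
    also have "\<dots> = (\<Sum>i\<in>K. (\<Sum>k\<in>-K. c $ k * f k i) *\<^sub>R Zn i x)"
      by (subst sum.swap) (simp only: scaleR_sum_left)
    finally show ?thesis by (simp only: scaleR_add_left sum.distrib)
  qed
  assume "(\<Sum>i\<in>UNIV. c $ i *\<^sub>R Zn i x) = 0"
  then have "\<forall>i\<in>K. c $ i + (\<Sum>k\<in>-K. c $ k * f k i) = 0"
    using x(2)[unfolded NN_iff[OF x(1)] indepR_def, THEN spec, of "\<lambda>i. c $ i + (\<Sum>k\<in>-K. c $ k * f k i)"] unfolding red by blast
  then show "c \<in> CC" unfolding CC_def mem_Collect_eq red by simp
qed (simp add: CC_def)

lemma relation_GR:
  assumes k: "\<kappa> \<in> A" and y: "y \<in> im \<kappa>"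
  shows "(\<Sum>i\<in>UNIV. c i *\<^sub>R GR \<kappa> (dx i) y) = 0 \<longleftrightarrow> (\<Sum>i\<in>UNIV. c i *\<^sub>R Zn i (ic \<kappa> y)) = 0"
proof -
  have "(\<Sum>i\<in>UNIV. c i *\<^sub>R Wn \<kappa> i y) = \<i> *s (\<Sum>i\<in>UNIV. c i *\<^sub>R GR \<kappa> (dx i) y)"
    unfolding WW_eq[OF k y dx_in] by (simp add: linear_sum[OF vecJ.lin] linear_scale[OF vecJ.lin])
  then show ?thesis
    unfolding relation_chart[OF k ic_dom[OF y]] co_ic[OF y] by (simp add: vector_mul_eq_0)
qed

lemma linear_\<Psi>: "\<kappa> \<in> A \<Longrightarrow> y \<in> im \<kappa> \<Longrightarrow> linear (\<Psi> \<kappa> y)"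
  by (rule linearI) (simp_all add: \<Psi>_def vec_eq_iff linear_add[OF \<beta>_linear2] linear_scale[OF \<beta>_linear2])

lemma inner_\<Psi>:
  assumes "\<kappa> \<in> A" "y \<in> im \<kappa>"
  shows "c \<bullet> \<Psi> \<kappa> y v = \<beta> \<kappa> y (\<Sum>i\<in>UNIV. c $ i *\<^sub>R GR \<kappa> (dx i) y) v"
  by (simp add: inner_vec_def \<Psi>_def linear_sum[OF \<beta>_linear[OF assms]] linear_scale[OF \<beta>_linear[OF assms]])

text \<open>The orthogonal complement of the range consists of the relations among the gradients at
  y, which at a regular point are the global ones.\<close>

lemma range_\<Psi>:
  assumes k: "\<kappa> \<in> A" and y: "y \<in> im \<kappa>" and reg: "ic \<kappa> y \<notin> NN"
  shows "range (\<Psi> \<kappa> y) = RR"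
proof -
  have X: "ic \<kappa> y \<in> topspace X" using chart_subset[OF k] ic_dom[OF y] by blast
  have "orthogonal_comp (range (\<Psi> \<kappa> y)) = CC"
  proof (intro equalityI subsetI)
    fix c assume "c \<in> orthogonal_comp (range (\<Psi> \<kappa> y))"
    then have "c \<bullet> \<Psi> \<kappa> y v = 0" for v by (auto simp: orthogonal_comp_def orthogonal_def inner_commute)
    then have "\<beta> \<kappa> y (\<Sum>i\<in>UNIV. c $ i *\<^sub>R GR \<kappa> (dx i) y) v = \<beta> \<kappa> y 0 v" for v
      unfolding inner_\<Psi>[OF k y] linear_0[OF \<beta>_linear[OF k y]] .
    then have "(\<Sum>i\<in>UNIV. c $ i *\<^sub>R GR \<kappa> (dx i) y) = 0" by (rule \<beta>_nondegenerate[OF k y])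
    then show "c \<in> CC" unfolding relation_GR[OF k y] relation_iff_CC[OF X reg] .
  next
    fix c assume "c \<in> CC"
    then have "(\<Sum>i\<in>UNIV. c $ i *\<^sub>R GR \<kappa> (dx i) y) = 0" unfolding relation_GR[OF k y] relation_iff_CC[OF X reg] .
    then have "c \<bullet> \<Psi> \<kappa> y v = 0" for v unfolding inner_\<Psi>[OF k y] by (simp add: linear_0[OF \<beta>_linear[OF k y]])
    then show "c \<in> orthogonal_comp (range (\<Psi> \<kappa> y))" by (auto simp: orthogonal_comp_def orthogonal_def inner_commute)
  qed
  moreover have "subspace (range (\<Psi> \<kappa> y))"
    using linear_subspace_image[OF linear_\<Psi>[OF k y] subspace_UNIV] .
  ultimately show ?thesis unfolding RR_def using orthogonal_comp_self by metis
qed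

lemma subspace_RR: "subspace RR"
  unfolding RR_def by (rule subspace_orthogonal_comp)

lemma regular_chart:
  obtains \<kappa> y where "\<kappa> \<in> A" "y \<in> im \<kappa>" "ic \<kappa> y = x0" "x0 \<notin> NN"
proof -
  obtain \<kappa> where k: "\<kappa> \<in> A" "x0 \<in> fst \<kappa>" using chart_ex[OF x0] by blast
  have "x0 \<notin> NN" using NN_iff[OF x0] K0 by simp
  then show ?thesis using k by (intro that[of \<kappa> "snd \<kappa> x0"]) auto
qed

text \<open>Lower bound: the inner product of a with its image \<Psi>(G a) is the squared length of
  \<open>G a\<close>, so the map is injective on vectors supported in \<open>K\<close>. Upper bound:
  orthogonality to the relations \<open>Kf\<close> determines a vector of \<open>RR\<close> by its
  components in \<open>K\<close>.\<close>

lemma dim_RR: "dim RR = card K"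
proof -
  obtain \<kappa> y where k: "\<kappa> \<in> A" and y: "y \<in> im \<kappa>" and x: "ic \<kappa> y = x0" "x0 \<notin> NN" using regular_chart by metis
  define S where "S = {c :: real^'n. \<forall>i. i \<notin> K \<longrightarrow> c $ i = 0}"
  have dS: "dim S = card K" unfolding S_def by (rule dim_coordinate_subspace)
  have subS: "subspace S" by (auto simp: S_def subspace_def)
  define G where "G a = (\<Sum>i\<in>UNIV. a $ i *\<^sub>R GR \<kappa> (dx i) y)" for a :: "real^'n"
  have linG: "linear G" by (rule linearI) (simp_all add: G_def scaleR_add_left sum.distrib scaleR_sum_right)
  have G0: "a = 0" if "a \<in> S" "G a = 0" for a
  proof -
    have "(\<Sum>i\<in>UNIV. a $ i *\<^sub>R Zn i x0) = 0" using that(2) relation_GR[OF k y, of "($) a"] by (simp add: G_def x(1))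
    also have "(\<Sum>i\<in>UNIV. a $ i *\<^sub>R Zn i x0) = (\<Sum>i\<in>K. a $ i *\<^sub>R Zn i x0)"
      using that(1) by (intro sum.mono_neutral_right) (auto simp: S_def)
    finally have "\<forall>i\<in>K. a $ i = 0" using K0 unfolding indepR_def by blast
    then show ?thesis using that(1) by (auto simp: vec_eq_iff S_def)
  qed
  have lin: "linear (\<lambda>a. \<Psi> \<kappa> y (G a))" using linear_compose[OF linG linear_\<Psi>[OF k y]] by (simp add: o_def)
  have key: "a \<bullet> \<Psi> \<kappa> y (G a) = \<beta> \<kappa> y (G a) (G a)" for a unfolding inner_\<Psi>[OF k y] G_def ..
  have inj: "inj_on (\<lambda>a. \<Psi> \<kappa> y (G a)) S"
    unfolding linear_inj_on_iff_eq_0[OF lin subS]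
  proof (intro ballI impI)
    fix a assume a: "a \<in> S" "\<Psi> \<kappa> y (G a) = 0"
    then have "\<beta> \<kappa> y (G a) (G a) = 0" using key[of a] by simp
    then have "G a = 0" using \<beta>_pos[OF k y, of "G a"] by force
    then show "a = 0" using G0 a by blast
  qed
  have R: "range (\<Psi> \<kappa> y) = RR" by (rule range_\<Psi>[OF k y]) (simp add: x)
  have "dim ((\<lambda>a. \<Psi> \<kappa> y (G a)) ` S) = dim S"
    by (rule dim_image_eq[OF lin]) (simp only: inj span_eq_iff[THEN iffD2, OF subS])
  moreover have "dim ((\<lambda>a. \<Psi> \<kappa> y (G a)) ` S) \<le> dim RR" using R by (intro dim_subset) auto
  ultimately have le: "card K \<le> dim RR" using dS by simp
  define Q where "Q c = (\<chi> i. if i \<in> K then c $ i else 0)" for c :: "real^'n"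
  have linQ: "linear Q" by (rule linearI) (auto simp: Q_def vec_eq_iff)
  have injQ: "inj_on Q RR"
    unfolding linear_inj_on_iff_eq_0[OF linQ subspace_RR]
  proof (intro ballI impI)
    fix c assume c: "c \<in> RR" "Q c = 0"
    have cK: "c $ i = 0" if "i \<in> K" for i using c(2) that by (auto simp: Q_def vec_eq_iff split: if_splits)
    have "c $ k = 0" if k: "k \<notin> K" for k
    proof -
      define e :: "real^'n" where "e = (\<chi> i. if i = k then 1 else if i \<in> K then - f k i else 0)"
      have "(\<Sum>i\<in>UNIV. e $ i *\<^sub>R Zn i x) = 0" for x
      proof -
        have "(\<Sum>i\<in>UNIV. e $ i *\<^sub>R Zn i x) = (\<Sum>i\<in>insert k K. e $ i *\<^sub>R Zn i x)"
          by (intro sum.mono_neutral_right) (auto simp: e_def)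
        also have "\<dots> = Zn k x + (\<Sum>i\<in>K. e $ i *\<^sub>R Zn i x)" using k by (simp add: e_def)
        also have "(\<Sum>i\<in>K. e $ i *\<^sub>R Zn i x) = (\<Sum>i\<in>K. - (f k i *\<^sub>R Zn i x))"
          using k by (intro sum.cong) (auto simp: e_def)
        finally show ?thesis by (simp only: sum_negf Kf[OF k, symmetric] add.right_inverse)
      qed
      then have "e \<in> CC" by (simp add: CC_def)
      then have "e \<bullet> c = 0" using c(1) by (simp add: RR_def orthogonal_comp_def orthogonal_def)
      moreover have "e \<bullet> c = (\<Sum>i\<in>UNIV. if i = k then c $ k else 0)"
        unfolding inner_vec_def using cK by (intro sum.cong) (auto simp: e_def)
      ultimately show ?thesis by simp
    qed
    then show "c = 0" using cK by (auto simp: vec_eq_iff)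
  qed
  have "dim (Q ` RR) = dim RR"
    by (rule dim_image_eq[OF linQ]) (simp only: injQ span_eq_iff[THEN iffD2, OF subspace_RR])
  moreover have "dim (Q ` RR) \<le> dim S" by (intro dim_subset) (auto simp: Q_def S_def)
  ultimately show ?thesis using dS le by simp
qed

lemma mom_PV: "mom x = monom 1 CARD('n) + CV.PV (\<chi> i. hh (dx i) x)"
  unfolding momentum_polynomial_def CV.PV_def using sum.reindex_bij_betw[OF dx, of "\<lambda>k. monom ((-1) ^ k * hh k x) (CARD('n) - k)"]
  by simp

lemma poly_PV: "poly (CV.PV c) t = (\<Sum>i\<in>UNIV. (-1) ^ dx i * c $ i * t ^ (CARD('n) - dx i))"
  by (simp add: CV.PV_def poly_sum poly_monom)

lemma poly_mom_has_derivative_PV: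
  assumes k: "\<kappa> \<in> A" and y: "y \<in> im \<kappa>"
  shows "((\<lambda>y. poly (mom (ic \<kappa> y)) t) has_derivative (\<lambda>v. poly (CV.PV (\<Psi> \<kappa> y v)) t)) (at y)"
proof -
  have "((\<lambda>y. t ^ CARD('n) + (\<Sum>i\<in>UNIV. ((-1) ^ dx i * t ^ (CARD('n) - dx i)) * hh (dx i) (ic \<kappa> y))) has_derivative
    (\<lambda>v. 0 + (\<Sum>i\<in>UNIV. ((-1) ^ dx i * t ^ (CARD('n) - dx i)) * \<beta> \<kappa> y (GR \<kappa> (dx i) y) v))) (at y)"
    by (intro has_derivative_add has_derivative_const has_derivative_sum has_derivative_mult_right GR[OF k y dx_in])
  moreover have "(\<lambda>y. t ^ CARD('n) + (\<Sum>i\<in>UNIV. ((-1) ^ dx i * t ^ (CARD('n) - dx i)) * hh (dx i) (ic \<kappa> y))) = (\<lambda>y. poly (mom (ic \<kappa> y)) t)"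
    by (rule ext) (simp add: mom_PV poly_PV poly_monom mult_ac)
  moreover have "(\<lambda>v. 0 + (\<Sum>i\<in>UNIV. ((-1) ^ dx i * t ^ (CARD('n) - dx i)) * \<beta> \<kappa> y (GR \<kappa> (dx i) y) v)) = (\<lambda>v. poly (CV.PV (\<Psi> \<kappa> y v)) t)"
    by (rule ext) (simp add: poly_PV \<Psi>_def mult_ac)
  ultimately show ?thesis by (simp only:)
qed

lemma degree_mom: "degree (mom x) = CARD('n)" "lead_coeff (mom x) = 1"
proof -
  have "degree (CV.PV (\<chi> i. hh (dx i) x)) < degree (monom (1::real) CARD('n))"
    using CV.degree_PV by (simp add: degree_monom_eq)
  then have "degree (mom x) = degree (monom (1::real) CARD('n))" unfolding mom_PV by (rule degree_add_eq_left)
  then show d: "degree (mom x) = CARD('n)" by (simp add: degree_monom_eq)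
  have "coeff (CV.PV (\<chi> i. hh (dx i) x)) CARD('n) = 0" using CV.degree_PV by (intro coeff_eq_0)
  then show "lead_coeff (mom x) = 1" unfolding d unfolding mom_PV by (simp add: coeff_monom)
qed

text \<open>H applied to the direction is moved onto w_t by self-adjointness, where
  \<open>Hs_wt\<close> evaluates it. It suffices to compare values at the infinitely many t that are
  not roots of p_h.\<close>

lemma PV_\<Psi>_shift:
  assumes k: "\<kappa> \<in> A" and y: "y \<in> im \<kappa>"
  shows "pCons 0 (CV.PV (\<Psi> \<kappa> y v)) - smult (- 2 * (T (\<sigma> \<kappa> y) \<bullet> (fa \<kappa> y *v v))) (mom (ic \<kappa> y)) =
    CV.PV (\<Psi> \<kappa> y (fE \<kappa> y *v (H (\<sigma> \<kappa> y) *v (fa \<kappa> y *v v))))"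
proof -
  interpret L: bk_local "im \<kappa>" "fa \<kappa>" "fE \<kappa>" "\<lambda>y. H (\<sigma> \<kappa> y)" "\<lambda>y. T (\<sigma> \<kappa> y)" "\<lambda>y. of_real (V (\<sigma> \<kappa> y))" "\<phi>\<kappa> \<kappa>"
    by (rule bk_local[OF k])
  let ?H = "H (\<sigma> \<kappa> y)" and ?T = "T (\<sigma> \<kappa> y)"
  have X: "ic \<kappa> y \<in> topspace X" using chart_subset[OF k] ic_dom[OF y] by blast
  have inf: "infinite (- {t. poly (mom (ic \<kappa> y)) t = 0})"
    using poly_roots_finite[OF mom_nz[OF X]] infinite_UNIV_char_0 by (metis finite_compl)
  show ?thesis
  proof (rule poly_eqI_infinite[OF inf])
    fix t assume "t \<in> - {t. poly (mom (ic \<kappa> y)) t = 0}"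
    then have nz: "poly (mom (ic \<kappa> y)) t \<noteq> 0" by simp
    have Pt: "L.Pt t y = of_real (poly (mom (ic \<kappa> y)) t)" by (simp add: L.Pt_def mom_det[OF k y])
    have Ptnz: "L.Pt t y \<noteq> 0" using nz by (simp add: Pt)
    have w: "fa \<kappa> y *v Wt \<kappa> t y = L.wt t y" by (simp add: Wt_def matrix_vector_mul_assoc L.aE[OF y])
    have ev: "poly (CV.PV (\<Psi> \<kappa> y v)) t = - 2 * (L.wt t y \<bullet> (fa \<kappa> y *v v))" for v
    proof -
      have "(\<lambda>v. poly (CV.PV (\<Psi> \<kappa> y v)) t) = (\<lambda>v. - 2 * \<beta> \<kappa> y (Wt \<kappa> t y) v)"
        by (rule has_derivative_unique[OF poly_mom_has_derivative_PV[OF k y] poly_mom_has_derivative(1)[OF k y nz]])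
      from fun_cong[OF this, of v] show ?thesis by (simp add: frame(3)[OF k y, symmetric] w)
    qed
    let ?u = "fa \<kappa> y *v v"
    have "L.wt t y \<bullet> (?H *v ?u) = (?H *v L.wt t y) \<bullet> ?u"
      by (simp add: inner_eq_Re_herm herm_matrix L.Hs[OF y])
    also have "\<dots> = Re (herm (of_real t *s L.wt t y - of_real (poly (mom (ic \<kappa> y)) t) *s ?T) ?u)"
      unfolding inner_eq_Re_herm L.Hs_wt[OF Ptnz] Pt ..
    also have "\<dots> = t * (L.wt t y \<bullet> ?u) - poly (mom (ic \<kappa> y)) t * (?T \<bullet> ?u)"
    proof -
      have "herm (a - b) c = herm a c - herm b c" for a b c :: "complex^'n"
        by (simp add: herm_def algebra_simps sum_subtractf)
      then show ?thesis by (simp add: inner_eq_Re_herm herm_smult)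
    qed
    finally have eq: "L.wt t y \<bullet> (?H *v ?u) = t * (L.wt t y \<bullet> ?u) - poly (mom (ic \<kappa> y)) t * (?T \<bullet> ?u)" .
    have aEu: "fa \<kappa> y *v (fE \<kappa> y *v (?H *v ?u)) = ?H *v ?u" by (simp add: matrix_vector_mul_assoc[of "fa \<kappa> y" "fE \<kappa> y"] L.aE[OF y])
    show "poly (pCons 0 (CV.PV (\<Psi> \<kappa> y v)) - smult (- 2 * (?T \<bullet> ?u)) (mom (ic \<kappa> y))) t =
      poly (CV.PV (\<Psi> \<kappa> y (fE \<kappa> y *v (?H *v ?u)))) t"
      unfolding ev aEu eq poly_diff poly_pCons poly_smult ev by (simp add: algebra_simps)
  qed
qed

lemma divisor_exists:
  "\<exists>s. lead_coeff s = 1 \<and> s dvd mom x0 \<and> (\<forall>c. c \<in> RR \<longleftrightarrow> s dvd CV.PV c)"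
proof -
  obtain \<kappa> y where k: "\<kappa> \<in> A" and y: "y \<in> im \<kappa>" and x: "ic \<kappa> y = x0" "x0 \<notin> NN" using regular_chart by metis
  have R: "range (\<Psi> \<kappa> y) = RR" by (rule range_\<Psi>[OF k y]) (simp add: x)
  have "\<exists>s. lead_coeff s = 1 \<and> s dvd mom x0 \<and> CV.PV ` RR = {f. degree f < degree (mom x0) \<and> s dvd f}"
  proof (rule ideal_generator)
    show "lead_coeff (mom x0) = 1" by (rule degree_mom)
    show "0 < degree (mom x0)" by (simp add: degree_mom(1))
    have "CV.PV 0 = 0" by (simp add: CV.PV_def)
    then show "0 \<in> CV.PV ` RR" using subspace_0[OF subspace_RR] by (metis imageI)
    fix p assume "p \<in> CV.PV ` RR"
    then obtain a where a: "p = CV.PV a" "a \<in> RR" by blast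
    show "degree p < degree (mom x0)" unfolding a(1) degree_mom by (rule CV.degree_PV)
    show "smult c p \<in> CV.PV ` RR" for c
      unfolding a(1) CV.PV_linear(2)[symmetric] using subspace_mul[OF subspace_RR a(2)] by blast
    show "p + q \<in> CV.PV ` RR" if q: "q \<in> CV.PV ` RR" for q
    proof -
      obtain b where "q = CV.PV b" "b \<in> RR" using q by blast
      then have "p + q = CV.PV (a + b)" "a + b \<in> RR" using a subspace_add[OF subspace_RR] by (auto simp: CV.PV_linear)
      then show ?thesis by blast
    qed
    obtain v where v: "a = \<Psi> \<kappa> y v" using a(2) R by blast
    show "\<exists>c. pCons 0 p - smult c (mom x0) \<in> CV.PV ` RR"
      unfolding a(1) v x(1)[symmetric] by (rule exI, subst PV_\<Psi>_shift[OF k y]) (use R in blast)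
  qed
  then obtain s where s: "lead_coeff s = 1" "s dvd mom x0" "CV.PV ` RR = {f. degree f < CARD('n) \<and> s dvd f}"
    unfolding degree_mom by blast
  have "c \<in> RR \<longleftrightarrow> s dvd CV.PV c" for c
  proof
    show "c \<in> RR \<Longrightarrow> s dvd CV.PV c" using s(3) by blast
    assume "s dvd CV.PV c"
    then have "CV.PV c \<in> CV.PV ` RR" unfolding s(3) using CV.degree_PV by simp
    then obtain c' where "CV.PV c = CV.PV c'" "c' \<in> RR" by blast
    then show "c \<in> RR" using CV.VP_PV by metis
  qed
  then show ?thesis using s by blast
qed

lemma derivative_0_imp_constant:
  assumes F: "\<And>\<kappa> y. \<kappa> \<in> A \<Longrightarrow> y \<in> im \<kappa> \<Longrightarrow> ((\<lambda>y. F (ic \<kappa> y) :: real) has_derivative (\<lambda>v. 0)) (at y)"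
    and x: "x \<in> topspace X"
  shows "F x = F x0"
proof -
  have loc: "\<exists>W. openin X W \<and> x \<in> W \<and> (\<forall>z\<in>W. F z = F x)" if xX: "x \<in> topspace X" for x
  proof -
    obtain \<kappa> where k: "\<kappa> \<in> A" "x \<in> fst \<kappa>" using chart_ex[OF xX] by blast
    obtain r where r: "r > 0" "ball (snd \<kappa> x) r \<subseteq> im \<kappa>"
      using open_contains_ball chart(2)[OF k(1)] co_im[OF k(2)] by blast
    have "((\<lambda>y. F (ic \<kappa> y)) has_derivative (\<lambda>v. 0)) (at y within ball (snd \<kappa> x) r)" if "y \<in> ball (snd \<kappa> x) r" for y
      using has_derivative_at_withinI[OF F[OF k(1)]] r(2) that by blast
    then obtain c where c: "\<And>y. y \<in> ball (snd \<kappa> x) r \<Longrightarrow> F (ic \<kappa> y) = c"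
      using has_derivative_zero_constant[of "ball (snd \<kappa> x) r" "\<lambda>y. F (ic \<kappa> y)"] by auto
    have "F z = c" if "z \<in> fst \<kappa>" "snd \<kappa> z \<in> ball (snd \<kappa> x) r" for z
      using c[OF that(2)] k(1) that(1) by simp
    then show ?thesis
      using chart_open_preimage[OF k(1) open_ball, of "snd \<kappa> x" r] k r(1)
      by (intro exI[of _ "{z \<in> fst \<kappa>. snd \<kappa> z \<in> ball (snd \<kappa> x) r}"]) auto
  qed
  define \<Omega> where "\<Omega> = {x \<in> topspace X. F x = F x0}"
  have "openin X \<Omega>"
  proof (subst openin_subopen, intro ballI)
    fix x assume "x \<in> \<Omega>"
    then have x: "x \<in> topspace X" "F x = F x0" by (auto simp: \<Omega>_def)
    obtain W where W: "openin X W" "x \<in> W" "\<forall>z\<in>W. F z = F x" using loc[OF x(1)] by blast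
    have "W \<subseteq> \<Omega>"
    proof
      fix z assume "z \<in> W"
      then have "z \<in> topspace X" "F z = F x" using openin_subset[OF W(1)] W(3) by blast+
      then show "z \<in> \<Omega>" unfolding \<Omega>_def by (simp only: x(2) mem_Collect_eq simp_thms)
    qed
    then show "\<exists>W. openin X W \<and> x \<in> W \<and> W \<subseteq> \<Omega>" using W(1,2) by blast
  qed
  moreover have "openin X (topspace X - \<Omega>)"
  proof (subst openin_subopen, intro ballI)
    fix x assume "x \<in> topspace X - \<Omega>"
    then have x: "x \<in> topspace X" "F x \<noteq> F x0" by (auto simp: \<Omega>_def)
    obtain W where W: "openin X W" "x \<in> W" "\<forall>z\<in>W. F z = F x" using loc[OF x(1)] by blast
    have "W \<subseteq> topspace X - \<Omega>"
    proof
      fix z assume "z \<in> W"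
      then have "z \<in> topspace X" "F z = F x" using openin_subset[OF W(1)] W(3) by blast+
      then show "z \<in> topspace X - \<Omega>" using x(2) unfolding \<Omega>_def by simp
    qed
    then show "\<exists>W. openin X W \<and> x \<in> W \<and> W \<subseteq> topspace X - \<Omega>" using W(1,2) by blast
  qed
  then have "closedin X \<Omega>" by (auto simp: closedin_def \<Omega>_def)
  ultimately have "\<Omega> = {} \<or> \<Omega> = topspace X" using connected_X unfolding connected_space_clopen_in by blast
  moreover have "x0 \<in> \<Omega>" using x0 by (simp add: \<Omega>_def)
  ultimately show ?thesis using x by (auto simp: \<Omega>_def)
qed

text \<open>For a global relation c the combination of the h_k with coefficients c has zero
  differential on all of M, hence is constant. This reaches the singular points as well.\<close>

lemma h_difference_RR:
  assumes x: "x \<in> topspace X"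
  shows "(\<chi> i. hh (dx i) x - hh (dx i) x0) \<in> RR"
  unfolding RR_def orthogonal_comp_def orthogonal_def
proof (intro CollectI ballI)
  fix c assume c: "c \<in> CC"
  define F where "F x = (\<Sum>i\<in>UNIV. c $ i * hh (dx i) x)" for x
  have "F x = F x0"
  proof (rule derivative_0_imp_constant[OF _ x])
    fix \<kappa> y assume k: "\<kappa> \<in> A" and y: "y \<in> im \<kappa>"
    have "((\<lambda>y. F (ic \<kappa> y)) has_derivative (\<lambda>v. \<Sum>i\<in>UNIV. c $ i * \<beta> \<kappa> y (GR \<kappa> (dx i) y) v)) (at y)"
      unfolding F_def by (intro has_derivative_sum has_derivative_mult_right GR[OF k y dx_in])
    moreover have "(\<Sum>i\<in>UNIV. c $ i * \<beta> \<kappa> y (GR \<kappa> (dx i) y) v) = 0" for v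
    proof -
      have "(\<Sum>i\<in>UNIV. c $ i *\<^sub>R GR \<kappa> (dx i) y) = 0" using c unfolding relation_GR[OF k y] by (simp add: CC_def)
      then have "\<beta> \<kappa> y (\<Sum>i\<in>UNIV. c $ i *\<^sub>R GR \<kappa> (dx i) y) v = 0" by (simp add: linear_0[OF \<beta>_linear[OF k y]])
      then show ?thesis by (simp add: linear_sum[OF \<beta>_linear[OF k y]] linear_scale[OF \<beta>_linear[OF k y]])
    qed
    ultimately show "((\<lambda>y. F (ic \<kappa> y)) has_derivative (\<lambda>v. 0)) (at y)" by simp
  qed
  then show "c \<bullet> (\<chi> i. hh (dx i) x - hh (dx i) x0) = 0"
    by (simp add: F_def inner_vec_def algebra_simps sum_subtractf)
qed

lemma mom_difference: "mom x - mom x0 = CV.PV (\<chi> i. hh (dx i) x - hh (dx i) x0)"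
proof -
  have "CV.PV ((\<chi> i. hh (dx i) x) + (-1) *\<^sub>R (\<chi> i. hh (dx i) x0)) = CV.PV (\<chi> i. hh (dx i) x) + smult (-1) (CV.PV (\<chi> i. hh (dx i) x0))"
    by (simp only: CV.PV_linear)
  moreover have "(\<chi> i. hh (dx i) x) + (-1) *\<^sub>R (\<chi> i. hh (dx i) x0) = (\<chi> i. hh (dx i) x - hh (dx i) x0)" by (simp add: vec_eq_iff)
  ultimately show ?thesis by (simp add: mom_PV)
qed

end

subsection \<open>The nonconstant roots\<close>

lemma sum_div_poly: "(\<Sum>i\<in>S. f i) div z = (\<Sum>i\<in>S. f i div (z :: 'f::field poly))"
  by (induction S rule: infinite_finite_induct) (auto simp: poly_div_add_left)

lemma smult_eq_0_if_small_degree: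
  fixes p :: "'f::field poly"
  assumes "degree f < degree p" "degree h < degree p" "f = h + smult c p"
  shows "c = 0"
proof (rule ccontr)
  assume c: "c \<noteq> 0"
  have "coeff f (degree p) = coeff h (degree p) + c * lead_coeff p" unfolding assms(3) by simp
  moreover have "p \<noteq> 0" using assms(1) by auto
  ultimately show False using c assms(1,2) by (simp add: coeff_eq_0)
qed

context bk_max
begin

text \<open>The monic generator found at \<open>x0\<close>; as \<open>RR\<close> does not depend on
  the point, it serves at all points, and its roots are the constant ones.\<close>

definition ss where "ss = (SOME s. lead_coeff s = 1 \<and> s dvd mom x0 \<and> (\<forall>c. c \<in> RR \<longleftrightarrow> s dvd CV.PV c))"

lemma ss: "lead_coeff ss = 1" "ss dvd mom x0" "c \<in> RR \<longleftrightarrow> ss dvd CV.PV c"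
  using someI_ex[OF divisor_exists, folded ss_def] by blast+

lemma ss_nz: "ss \<noteq> 0" using ss(1) by auto

lemma degree_ss: "degree ss = CARD('n) - card K" "degree ss + card K = CARD('n)"
proof -
  have le: "degree ss \<le> CARD('n)"
    using dvd_imp_degree_le[OF ss(2)] mom_nz[OF x0] degree_mom(1)[of x0] by simp
  have "card K = CARD('n) - degree ss" using CV.dim_multiples[OF ss_nz le ss(3)] dim_RR by simp
  then show "degree ss = CARD('n) - card K" "degree ss + card K = CARD('n)" using le by auto
qed

lemma ss_dvd_mom: assumes "x \<in> topspace X" shows "ss dvd mom x"
proof -
  have "ss dvd mom x - mom x0" unfolding mom_difference using h_difference_RR[OF assms] ss(3) by blast
  then have "ss dvd (mom x - mom x0) + mom x0" using ss(2) by (rule dvd_add)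
  then show ?thesis by simp
qed

definition qq where "qq x = mom x div ss"

lemma qq:
  assumes "x \<in> topspace X"
  shows "mom x = ss * qq x" "lead_coeff (qq x) = 1" "degree (qq x) = card K"
proof -
  show m: "mom x = ss * qq x" using ss_dvd_mom[OF assms] by (simp add: qq_def)
  have "lead_coeff (mom x) = lead_coeff ss * lead_coeff (qq x)" unfolding lead_coeff_mult[symmetric] m[symmetric] ..
  then show "lead_coeff (qq x) = 1" by (simp only: ss(1) degree_mom(2) mult_1)
  have "qq x \<noteq> 0" using m mom_nz[OF assms] by auto
  then have "degree (mom x) = degree ss + degree (qq x)" by (subst m) (rule degree_mult_eq[OF ss_nz])
  then show "degree (qq x) = card K" using degree_ss(2) degree_mom(1)[of x] by simp
qed

lemma constant_roots: "\<exists>c. ss = (\<Prod>i<CARD('n) - card K. [:- c i, 1:])"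
proof -
  obtain ev where ev: "mom x0 = (\<Prod>i\<in>(UNIV :: 'n set). [:- ev i, 1:])" using mom_ev[OF x0] by blast
  from split_divisor_sorted[OF finite_class.finite_UNIV ss(2)[unfolded ev] ss(1)]
  show ?thesis unfolding degree_ss(1) by blast
qed

definition rr where "rr x = (SOME r. qq x = (\<Prod>j<card K. [:- r j, 1:]) \<and> (\<forall>i j. i \<le> j \<longrightarrow> j < card K \<longrightarrow> r i \<le> (r j :: real)))"

lemma rr:
  assumes "x \<in> topspace X"
  shows "qq x = (\<Prod>j<card K. [:- rr x j, 1:])" "i \<le> j \<Longrightarrow> j < card K \<Longrightarrow> rr x i \<le> rr x j"
proof -
  obtain ev where ev: "mom x = (\<Prod>i\<in>(UNIV :: 'n set). [:- ev i, 1:])" using mom_ev[OF assms] by blast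
  have "qq x dvd mom x" using qq(1)[OF assms] by (metis dvd_triv_right)
  from split_divisor_sorted[OF finite_class.finite_UNIV this[unfolded ev] qq(2)[OF assms]]
  have "\<exists>r. qq x = (\<Prod>j<card K. [:- r j, 1:]) \<and> (\<forall>i j. i \<le> j \<longrightarrow> j < card K \<longrightarrow> r i \<le> (r j :: real))"
    unfolding qq(3)[OF assms] .
  from someI_ex[OF this, folded rr_def]
  show "qq x = (\<Prod>j<card K. [:- rr x j, 1:])" "i \<le> j \<Longrightarrow> j < card K \<Longrightarrow> rr x i \<le> rr x j" by blast+
qed

text \<open>At a regular point every multiple of \<open>ss\<close> of degree below n is the
  derivative of p_h in some direction.\<close>

lemma ideal_element:
  assumes k: "\<kappa> \<in> A" and y: "y \<in> im \<kappa>" and reg: "ic \<kappa> y \<notin> NN" and q: "degree (ss * q) < CARD('n)"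
  shows "\<exists>v. CV.PV (\<Psi> \<kappa> y v) = ss * q"
proof -
  have PV: "CV.PV (CV.VP (ss * q)) = ss * q" by (rule CV.PV_VP[OF q])
  then have "CV.VP (ss * q) \<in> RR" using ss(3)[of "CV.VP (ss * q)"] by simp
  then obtain v where "CV.VP (ss * q) = \<Psi> \<kappa> y v" using range_\<Psi>[OF k y reg] by blast
  then show ?thesis using PV by metis
qed

lemma degree_ss_mult:
  assumes "q \<noteq> 0" shows "degree (ss * q) = CARD('n) - card K + degree q"
  using degree_mult_eq[OF ss_nz assms] degree_ss by simp

text \<open>A multiple root of the quotient would make \<open>(H - \<mu>)\<^sup>2\<close> but not \<open>H - \<mu>\<close> vanish on a vector
  modulo the kernel of the differential, which is impossible because \<open>H\<close> is self-adjoint.\<close>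

lemma no_multiple_root:
  assumes k: "\<kappa> \<in> A" and y: "y \<in> im \<kappa>" and reg: "ic \<kappa> y \<notin> NN"
    and q: "qq (ic \<kappa> y) = [:- \<mu>, 1:] * ([:- \<mu>, 1:] * q2)"
  shows False
proof -
  let ?x = "ic \<kappa> y" let ?H = "H (\<sigma> \<kappa> y)" let ?T = "T (\<sigma> \<kappa> y)" let ?p = "mom ?x"
  have X: "?x \<in> topspace X" using chart_subset[OF k] ic_dom[OF y] by blast
  interpret L: bk_local "im \<kappa>" "fa \<kappa>" "fE \<kappa>" "\<lambda>y. H (\<sigma> \<kappa> y)" "\<lambda>y. T (\<sigma> \<kappa> y)" "\<lambda>y. of_real (V (\<sigma> \<kappa> y))" "\<phi>\<kappa> \<kappa>"
    by (rule bk_local[OF k])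
  \<comment> \<open>The derivative of p_h in the direction with components u in the unitary
    frame.\<close>
  define \<Lambda> where "\<Lambda> u = CV.PV (\<Psi> \<kappa> y (fE \<kappa> y *v u))" for u
  have lin: "\<Lambda> (u + w) = \<Lambda> u + \<Lambda> w" "\<Lambda> (r *\<^sub>R u) = smult r (\<Lambda> u)" for u w r
  proof -
    have "linear (\<lambda>u. fE \<kappa> y *v u)" 
      using bounded_linear.linear[OF bounded_bilinear.bounded_linear_right[OF bounded_bilinear_matrix_vector_mult]] .
    from linear_compose[OF this linear_\<Psi>[OF k y]] have l: "linear (\<lambda>u. \<Psi> \<kappa> y (fE \<kappa> y *v u))" by (simp add: o_def)
    show "\<Lambda> (u + w) = \<Lambda> u + \<Lambda> w" "\<Lambda> (r *\<^sub>R u) = smult r (\<Lambda> u)"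
      unfolding \<Lambda>_def linear_add[OF l] linear_scale[OF l] CV.PV_linear by simp_all
  qed
  have deg: "degree (\<Lambda> u) < degree ?p" for u unfolding \<Lambda>_def degree_mom(1) by (rule CV.degree_PV)
  define B where "B u = ?H *v u + (- \<mu>) *\<^sub>R u" for u
  have shift: "\<exists>c. \<Lambda> (B u) = [:- \<mu>, 1:] * \<Lambda> u + smult c ?p" for u
  proof -
    have "fa \<kappa> y *v (fE \<kappa> y *v u) = u" by (simp add: matrix_vector_mul_assoc L.aE[OF y])
    then have "\<Lambda> (?H *v u) = pCons 0 (\<Lambda> u) - smult (- 2 * (?T \<bullet> u)) ?p"
      using PV_\<Psi>_shift[OF k y, of "fE \<kappa> y *v u"] by (simp add: \<Lambda>_def)
    then have "\<Lambda> (B u) = [:- \<mu>, 1:] * \<Lambda> u + smult (2 * (?T \<bullet> u)) ?p" 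
      unfolding B_def lin by simp
    then show ?thesis by blast
  qed
  have p: "?p = ss * ([:- \<mu>, 1:] * ([:- \<mu>, 1:] * q2))" using qq(1)[OF X] q by simp
  have q2: "q2 \<noteq> 0" using p mom_nz[OF X] by auto
  have dl: "degree ([:- \<mu>, 1:] * r) = degree r + 1" if "r \<noteq> 0" for r :: "real poly"
    using degree_mult_eq[of "[:- \<mu>, 1:]" r] that by simp
  have nz: "[:- \<mu>, 1:] * q2 \<noteq> 0" using q2 by (simp del: mult_pCons_left)
  have d1: "degree (ss * ([:- \<mu>, 1:] * q2)) < degree ?p"
    unfolding p using dl[OF nz] degree_ss_mult[OF nz] degree_ss_mult[of "[:- \<mu>, 1:] * ([:- \<mu>, 1:] * q2)"] nz
    by (simp del: mult_pCons_left)
  have d2: "degree (ss * q2) < degree ?p"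
    using d1 dl[OF q2] degree_ss_mult[OF nz] degree_ss_mult[OF q2] by simp
  \<comment> \<open>A direction in which the derivative of p_h is p_h / (t - \<mu>)^2; applying H -
    \<mu> once multiplies it by t - \<mu>, and twice gives 0 modulo p_h.\<close>
  obtain v where v: "CV.PV (\<Psi> \<kappa> y v) = ss * q2" using ideal_element[OF k y reg] d2 unfolding degree_mom(1) by blast
  define u2 where "u2 = fa \<kappa> y *v v"
  have u2: "\<Lambda> u2 = ss * q2" by (simp add: \<Lambda>_def u2_def v matrix_vector_mul_assoc frame(2)[OF k y])
  define N where "N = {u. \<Lambda> u = 0}"
  have \<Lambda>0: "\<Lambda> 0 = 0" using lin(2)[of 0 0] by simp
  have subN: "subspace N" by (auto simp: N_def subspace_def lin \<Lambda>0)
  \<comment> \<open>Passing to the component orthogonal to the kernel \<open>N\<close> leaves the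
    value of \<Lambda> unchanged and makes vectors of the kernel orthogonal to w.\<close>
  obtain w0 w where w: "w0 \<in> span N" "\<And>z. z \<in> span N \<Longrightarrow> orthogonal w z" "u2 = w0 + w"
    using orthogonal_subspace_decomp_exists[of N u2] by metis
  have spanN: "span N = N" using subN by (simp add: span_eq_iff)
  have \<Lambda>w: "\<Lambda> w = ss * q2" 
  proof -
    have "w0 \<in> N" using w(1) unfolding spanN .
    then have "\<Lambda> w0 = 0" by (simp add: N_def)
    then show ?thesis using u2 unfolding w(3) lin by simp
  qed
  obtain c1 where c1: "\<Lambda> (B w) = [:- \<mu>, 1:] * \<Lambda> w + smult c1 ?p" using shift by blast
  have e1: "[:- \<mu>, 1:] * \<Lambda> w = ss * ([:- \<mu>, 1:] * q2)" unfolding \<Lambda>w by (rule mult.left_commute)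
  have "c1 = 0" by (rule smult_eq_0_if_small_degree[OF deg d1 c1[unfolded e1]])
  then have Bw: "\<Lambda> (B w) = ss * ([:- \<mu>, 1:] * q2)" using c1 e1 by simp
  obtain c2 where c2: "\<Lambda> (B (B w)) = [:- \<mu>, 1:] * \<Lambda> (B w) + smult c2 ?p" using shift by blast
  have "[:- \<mu>, 1:] * \<Lambda> (B w) = ?p" unfolding Bw p by (rule mult.left_commute)
  then have "\<Lambda> (B (B w)) = 0 + smult (1 + c2) ?p" using c2 by (simp add: smult_add_left)
  moreover have "1 + c2 = 0"
    by (rule smult_eq_0_if_small_degree[OF deg _ calculation]) (use degree_mom(1) in simp)
  ultimately have "B (B w) \<in> N" by (simp add: N_def)
  \<comment> \<open>By self-adjointness this inner product is |B w|^2, whereas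
    \<open>\<Lambda> (B w)\<close> is not 0.\<close>
  then have "w \<bullet> B (B w) = 0" using w(2) by (simp add: spanN orthogonal_def)
  moreover have "w \<bullet> B z = B w \<bullet> z" for z
  proof -
    have "w \<bullet> (?H *v z) = (?H *v w) \<bullet> z" by (simp add: inner_eq_Re_herm herm_matrix L.Hs[OF y])
    then show ?thesis unfolding B_def inner_add_left inner_add_right by simp
  qed
  ultimately have "B w = 0" by simp
  then have "ss * ([:- \<mu>, 1:] * q2) = 0" using Bw \<Lambda>0 by simp
  then show False using ss_nz nz by (simp del: mult_pCons_left)
qed

lemma rr_inj:
  assumes x: "x \<in> topspace X" "x \<notin> NN"
  shows "inj_on (rr x) {..<card K}"
proof (rule inj_onI, rule ccontr)
  fix i j assume ij: "i \<in> {..<card K}" "j \<in> {..<card K}" "rr x i = rr x j" "i \<noteq> j"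
  obtain \<kappa> where k: "\<kappa> \<in> A" "x \<in> fst \<kappa>" using chart_ex[OF x(1)] by blast
  have "qq x = [:- rr x i, 1:] * (\<Prod>l\<in>{..<card K} - {i}. [:- rr x l, 1:])"
    unfolding rr(1)[OF x(1)] using ij by (intro prod.remove) auto
  also have "(\<Prod>l\<in>{..<card K} - {i}. [:- rr x l, 1:]) = [:- rr x j, 1:] * (\<Prod>l\<in>{..<card K} - {i} - {j}. [:- rr x l, 1:])"
    using ij by (intro prod.remove) auto
  finally have "qq x = [:- rr x i, 1:] * ([:- rr x i, 1:] * (\<Prod>l\<in>{..<card K} - {i} - {j}. [:- rr x l, 1:]))"
    unfolding ij(3) .
  then show False using no_multiple_root[OF k(1) co_im[OF k(2)], of "rr x i"] k x(2) by (simp del: mult_pCons_left)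
qed

text \<open>Division by the fixed polynomial \<open>ss\<close> is linear in the dividend, so the
  coefficients of the quotient are affine functions of the h_k.\<close>

lemma coeff_qq: "coeff (qq x) l = coeff (monom 1 CARD('n) div ss) l +
    (\<Sum>i\<in>UNIV. ((-1) ^ dx i * coeff (monom 1 (CARD('n) - dx i) div ss) l) * hh (dx i) x)"
proof -
  have "monom ((-1) ^ dx i * hh (dx i) x) (CARD('n) - dx i) = smult ((-1) ^ dx i * hh (dx i) x) (monom 1 (CARD('n) - dx i))" for i
    by (simp add: smult_monom)
  then show ?thesis
    by (simp add: qq_def mom_PV CV.PV_def poly_div_add_left sum_div_poly div_smult_left coeff_sum mult_ac)
qed

lemma regular_chart_open: "\<kappa> \<in> A \<Longrightarrow> open (snd \<kappa> ` (fst \<kappa> \<inter> (topspace X - NN)))"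
  by (rule chart_open_image[OF _ open_regular])

lemma regular_chart_mem:
  assumes "\<kappa> \<in> A" "y \<in> snd \<kappa> ` (fst \<kappa> \<inter> (topspace X - NN))"
  shows "y \<in> im \<kappa>" "ic \<kappa> y \<in> topspace X" "ic \<kappa> y \<notin> NN"
  using assms by auto

lemma canal_rr:
  assumes k: "\<kappa> \<in> A" and y: "y \<in> snd \<kappa> ` (fst \<kappa> \<inter> (topspace X - NN))" and j: "j < card K"
  shows "canal (\<lambda>y. of_real (rr (ic \<kappa> y) j)) y"
proof (rule canal_simple_root[where r = "\<lambda>j y. rr (ic \<kappa> y) j", OF regular_chart_open[OF k] y _ _ _ j])
  note mem = regular_chart_mem[OF k]
  fix l
  have "canal (\<lambda>y. of_real (coeff (monom 1 CARD('n) div ss) l) +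
    (\<Sum>i\<in>(UNIV :: 'n set). of_real ((-1) ^ dx i * coeff (monom 1 (CARD('n) - dx i) div ss) l) * of_real (hh (dx i) (ic \<kappa> y)))) y"
    by (intro canal_add canal_const canal_sum canal_mult canal_h_fun[OF k mem(1)[OF y] dx_in])
  then show "canal (\<lambda>y. of_real (coeff (\<Prod>j<card K. [:- rr (ic \<kappa> y) j, 1:]) l)) y"
  proof (rule canal_cong[OF _ regular_chart_open[OF k] y])
    fix z assume z: "z \<in> snd \<kappa> ` (fst \<kappa> \<inter> (topspace X - NN))"
    show "of_real (coeff (monom 1 CARD('n) div ss) l) +
      (\<Sum>i\<in>(UNIV :: 'n set). of_real ((-1) ^ dx i * coeff (monom 1 (CARD('n) - dx i) div ss) l) * of_real (hh (dx i) (ic \<kappa> z)))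
      = complex_of_real (coeff (\<Prod>j<card K. [:- rr (ic \<kappa> z) j, 1:]) l)"
      unfolding rr(1)[OF mem(2)[OF z], symmetric] coeff_qq by simp
  qed
next
  note mem = regular_chart_mem[OF k]
  fix z i j assume z: "z \<in> snd \<kappa> ` (fst \<kappa> \<inter> (topspace X - NN))" and ij: "i \<le> j" "j < card K"
  show "rr (ic \<kappa> z) i \<le> rr (ic \<kappa> z) j" by (rule rr(2)[OF mem(2)[OF z] ij])
next
  note mem = regular_chart_mem[OF k]
  fix i j assume ij: "i < j" "j < card K"
  have "rr (ic \<kappa> y) i \<le> rr (ic \<kappa> y) j" using ij by (intro rr(2)[OF mem(2)[OF y]]) auto
  moreover have "rr (ic \<kappa> y) i \<noteq> rr (ic \<kappa> y) j"
    using inj_onD[OF rr_inj[OF mem(2)[OF y] mem(3)[OF y]], of i j] ij by auto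
  ultimately show "rr (ic \<kappa> y) i < rr (ic \<kappa> y) j" by simp
qed

lemma rr_analytic:
  assumes "j < card K" shows "analytic_fun_on A (topspace X - NN) (\<lambda>x. rr x j)"
  unfolding analytic_fun_on_def
proof (rule ballI)
  fix \<kappa> assume k: "\<kappa> \<in> A"
  have "real_analytic_on (snd \<kappa> ` (fst \<kappa> \<inter> (topspace X - NN))) (\<lambda>y. rr (ic \<kappa> y) j)"
    by (rule canal_imp_real_analytic_on[OF regular_chart_open[OF k] canal_rr[OF k _ assms]])
  then show "case \<kappa> of (U, h) \<Rightarrow> real_analytic_on (h ` (U \<inter> (topspace X - NN))) (\<lambda>y. rr (inv_into U h y) j)"
    by (simp add: ic_def case_prod_unfold)
qed

text \<open>Differentiating the factorisation expresses dp_h by the dr_j, each times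
  \<open>ss\<close> and the product of the other linear factors. By \<open>ideal_element\<close>
  some direction yields a single one of these products; evaluation at the distinct roots then shows
  that in this direction all dr_j but one vanish.\<close>

lemma rr_independent:
  assumes x: "x \<in> topspace X" "x \<notin> NN"
  shows "functionally_independent_at A x (card K) (\<lambda>j x. rr x j)"
proof -
  obtain \<kappa> where k: "\<kappa> \<in> A" "x \<in> fst \<kappa>" using chart_ex[OF x(1)] by blast
  define y where "y = snd \<kappa> x"
  have y: "y \<in> im \<kappa>" "ic \<kappa> y = x" using k by (auto simp: y_def)
  have yS: "y \<in> snd \<kappa> ` (fst \<kappa> \<inter> (topspace X - NN))" using k x by (auto simp: y_def)
  note mem = regular_chart_mem[OF k(1)]
  define \<rho> where "\<rho> j = frechet_derivative (\<lambda>y. rr (ic \<kappa> y) j) (at y)" for j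
  have \<rho>: "((\<lambda>y. rr (ic \<kappa> y) j) has_derivative \<rho> j) (at y)" if "j < card K" for j
    using canal_real_has_derivative[OF canal_rr[OF k(1) yS that]] frechet_derivative_at unfolding \<rho>_def by blast
  define r where "r = rr x"
  have deriv: "poly (CV.PV (\<Psi> \<kappa> y v)) t = - (poly ss t * (\<Sum>j<card K. \<rho> j v * (\<Prod>i\<in>{..<card K} - {j}. t - r i)))" for v t
  proof -
    have "((\<lambda>y. poly ss t * (\<Prod>j<card K. t - rr (ic \<kappa> y) j)) has_derivative
      (\<lambda>v. poly ss t * (\<Sum>j<card K. (0 - \<rho> j v) * (\<Prod>i\<in>{..<card K} - {j}. t - rr (ic \<kappa> y) i)))) (at y)"
      by (intro has_derivative_mult_right has_derivative_prod has_derivative_diff has_derivative_const \<rho>) auto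
    then have "((\<lambda>y. poly (mom (ic \<kappa> y)) t) has_derivative
      (\<lambda>v. poly ss t * (\<Sum>j<card K. (0 - \<rho> j v) * (\<Prod>i\<in>{..<card K} - {j}. t - rr (ic \<kappa> y) i)))) (at y)"
    proof (rule has_derivative_transform_within_open[OF _ regular_chart_open[OF k(1)] yS])
      fix z assume z: "z \<in> snd \<kappa> ` (fst \<kappa> \<inter> (topspace X - NN))"
      show "poly ss t * (\<Prod>j<card K. t - rr (ic \<kappa> z) j) = poly (mom (ic \<kappa> z)) t"
        unfolding qq(1)[OF mem(2)[OF z]] poly_mult rr(1)[OF mem(2)[OF z]] poly_prod by simp
    qed
    from fun_cong[OF has_derivative_unique[OF poly_mom_has_derivative_PV[OF k(1) y(1)] this], of v]
    show ?thesis by (simp add: y(2) r_def sum_negf)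
  qed
  have inj: "inj_on r {..<card K}" unfolding r_def by (rule rr_inj[OF x])
  have dual: "\<exists>v. \<forall>j<card K. \<rho> j v = (if j = j0 then - 1 else 0)" if j0: "j0 < card K" for j0
  proof -
    \<comment> \<open>The direction v is chosen with dp_h(v) = \<open>ss * q\<close>. As dp_h
      carries a minus sign from t - r_j, this gives dr_j(v) = -1 for j = j0.\<close>
    define q where "q = (\<Prod>i\<in>{..<card K} - {j0}. [:- r i, 1:])"
    have qnz: "q \<noteq> 0" by (auto simp: q_def)
    have "degree q = card ({..<card K} - {j0})"
      unfolding q_def by (subst degree_prod_eq_sum_degree) auto
    then have "degree q + 1 = card K" using j0 by simp
    then have "degree (ss * q) < CARD('n)" using degree_ss_mult[OF qnz] degree_ss(2) by simp
    then obtain v where v: "CV.PV (\<Psi> \<kappa> y v) = ss * q" using ideal_element[OF k(1) y(1)] y(2) x(2) by blast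
    define S where "S = (\<Sum>j<card K. smult (- \<rho> j v) (\<Prod>i\<in>{..<card K} - {j}. [:- r i, 1:]))"
    have "ss * q = ss * S"
    proof (rule poly_eqI_infinite[OF infinite_UNIV_char_0])
      fix t :: real
      show "poly (ss * q) t = poly (ss * S) t"
        unfolding v[symmetric] deriv S_def poly_mult poly_sum poly_smult poly_prod by (simp add: sum_negf)
    qed
    then have qS: "q = S" using ss_nz by simp
    have "\<rho> j v = (if j = j0 then - 1 else 0)" if j: "j < card K" for j
    proof -
      define P where "P j' = (\<Prod>i\<in>{..<card K} - {j'}. r j - r i)" for j'
      have P0: "P j' = 0" if "j' \<noteq> j" for j'
        unfolding P_def using j that by (subst prod_zero_iff) auto
      have Pj: "P j \<noteq> 0"
        unfolding P_def using inj j by (subst prod_zero_iff) (auto dest: inj_onD)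
      have "poly q (r j) = P j0" unfolding q_def poly_prod P_def by simp
      moreover have "poly S (r j) = (\<Sum>j'<card K. - \<rho> j' v * P j')"
        unfolding S_def poly_sum poly_smult poly_prod P_def by simp
      moreover have "(\<Sum>j'<card K. - \<rho> j' v * P j') = (\<Sum>j'<card K. if j' = j then - \<rho> j v * P j else 0)"
        using P0 by (intro sum.cong) auto
      ultimately have "P j0 = - \<rho> j v * P j" using qS j by simp
      then have "j = j0 \<Longrightarrow> (\<rho> j v + 1) * P j = 0" by (simp add: algebra_simps)
      moreover have "j \<noteq> j0 \<Longrightarrow> \<rho> j v * P j = 0" using P0[of j0] \<open>P j0 = - \<rho> j v * P j\<close> by simp
      ultimately show ?thesis using Pj by auto
    qed
    then show ?thesis by blast
  qed
  have diff: "has_differential_at A (\<lambda>x. rr x j) x (\<lambda>v. \<rho> j (v \<kappa>))" if "j < card K" for j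
    unfolding has_differential_at_def
  proof (intro allI impI)
    fix \<gamma> assume c: "curve_at A x \<gamma>"
    show "((\<lambda>x. rr x j) \<circ> \<gamma> has_vector_derivative \<rho> j (velocity A \<gamma> 0 \<kappa>)) (at 0)"
      by (rule curve_has_vector_derivative[OF k c]) (use \<rho>[OF that] in \<open>simp add: y_def\<close>)
  qed
  have "c j0 = 0" if c: "\<forall>v\<in>tangent_space A x. (\<Sum>j<card K. c j * \<rho> j (v \<kappa>)) = 0" and j0: "j0 < card K" for c j0
  proof -
    obtain v where v: "\<And>j. j < card K \<Longrightarrow> \<rho> j v = (if j = j0 then - 1 else 0)" using dual[OF j0] by blast
    have "(\<Sum>j<card K. c j * \<rho> j v) = 0"
      using c coord_vec_tangent[OF k, of v] coord_vec_comp[OF k, of v] by metis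
    moreover have "(\<Sum>j<card K. c j * \<rho> j v) = (\<Sum>j<card K. if j = j0 then - c j0 else 0)"
      by (intro sum.cong) (auto simp: v)
    ultimately show ?thesis using j0 by simp
  qed
  then have "\<forall>c. (\<forall>v\<in>tangent_space A x. (\<Sum>j<card K. c j * \<rho> j (v \<kappa>)) = 0) \<longrightarrow> (\<forall>j<card K. c j = 0)" by blast
  then show ?thesis
    unfolding functionally_independent_at_def using diff
    by - (rule exI[of _ "\<lambda>j v. \<rho> j (v \<kappa>)"], simp)
qed

end

theorem theorem5:
  fixes X :: "'a topology" and A :: "('a, complex ^ 'n) chart set" and g :: "('a, 'n) metric"
    and H :: "('a, 'n) coframe \<Rightarrow> complex ^ 'n ^ 'n"
    and T :: "('a, 'n) coframe \<Rightarrow> complex ^ 'n"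
    and V :: "('a, 'n) coframe \<Rightarrow> real"
    and m :: nat
  assumes "kaehler_manifold X A g"
    and "connected_space X" and "topspace X \<noteq> {}"
    and "bochner_kaehler A g H T V"
    and "cohomogeneity A g H = m"
  shows "\<exists>(c :: nat \<Rightarrow> real) (r :: nat \<Rightarrow> 'a \<Rightarrow> real) N.
    (\<forall>x\<in>topspace X. momentum_polynomial A g H x =
        (\<Prod>i<CARD('n) - m. [:- c i, 1:]) * (\<Prod>j<m. [:- r j x, 1:])) \<and>
    closed_analytic_subvariety X A N \<and> N \<subset> topspace X \<and>
    (\<forall>j<m. analytic_fun_on A (topspace X - N) (r j)) \<and>
    (\<forall>x\<in>topspace X - N. inj_on (\<lambda>j. r j x) {..<m} \<and>
        functionally_independent_at A x m r)"
proof -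
  obtain \<phi> where \<phi>: "unitary_connection A g \<phi>"
    "\<forall>p\<in>coframe_bundle A g. ctranspose (H p) = H p"
    "\<forall>p\<in>coframe_bundle A g. has_differential_at (coframe_atlas A g) H p (\<lambda>\<xi>.
          - (\<phi> p \<xi> ** H p) + H p ** \<phi> p \<xi> + outer (T p) (tautological_form A g p \<xi>) + outer (tautological_form A g p \<xi>) (T p))"
    "\<forall>p\<in>coframe_bundle A g. has_differential_at (coframe_atlas A g) T p (\<lambda>\<xi>.
          - (\<phi> p \<xi> *v T p)
          + (H p ** H p + mat (trace (H p)) ** H p + mat (complex_of_real (V p))) *v tautological_form A g p \<xi>)"
    "\<forall>p\<in>coframe_bundle A g. has_differential_at (coframe_atlas A g) (\<lambda>q. complex_of_real (V q)) p (\<lambda>\<xi>.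
          trace (H p) * (herm (T p) (tautological_form A g p \<xi>) + herm (tautological_form A g p \<xi>) (T p))
          + (herm (T p) (H p *v tautological_form A g p \<xi>) + herm (tautological_form A g p \<xi>) (H p *v T p)))"
    using assms(4) unfolding bochner_kaehler_def Let_def by (elim conjE exE) (rule that)
  interpret bk_mfd X A g H T V \<phi>
  proof
    show "complex_manifold X A" "hermitian_metric A g" using assms(1) by (simp_all add: kaehler_manifold_def)
    show "unitary_connection A g \<phi>" by (rule \<phi>(1))
    fix \<kappa> e e' assume "\<kappa> \<in> A"
    then show "real_analytic_on (snd \<kappa> ` fst \<kappa>) (metric_coeff A g \<kappa> e e')"
      using assms(4) by (cases \<kappa>) (fastforce simp: bochner_kaehler_def)
  qed (use \<phi> assms(2,3) in blast)+
  obtain K f x0 where K: "x0 \<in> topspace X" "indepR K (\<lambda>i. Zn i x0)"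
    "\<forall>k. k \<notin> K \<longrightarrow> (\<forall>x. Zn k x = (\<Sum>i\<in>K. f k i *\<^sub>R Zn i x))"
    using maximal_independent by (elim conjE exE) (rule that)
  interpret bk_max X A g H T V \<phi> K f x0
    by unfold_locales (use K in blast)+
  have m: "m = card K" using assms(5) cohomogeneity_eq by simp
  obtain c where c: "ss = (\<Prod>i<CARD('n) - card K. [:- c i, 1:])" using constant_roots by blast
  have "\<forall>x\<in>topspace X. mom x = (\<Prod>i<CARD('n) - m. [:- c i, 1:]) * (\<Prod>j<m. [:- rr x j, 1:])"
    unfolding m c[symmetric] using qq(1) rr(1) by simp
  moreover have "\<forall>j<m. analytic_fun_on A (topspace X - NN) (\<lambda>x. rr x j)" unfolding m using rr_analytic by blast
  moreover have "\<forall>x\<in>topspace X - NN. inj_on (\<lambda>j. rr x j) {..<m} \<and> functionally_independent_at A x m (\<lambda>j x. rr x j)"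
    unfolding m using rr_inj rr_independent by blast
  ultimately show ?thesis
    using NN_analytic NN_subset by - (rule exI[of _ c], rule exI[of _ "\<lambda>j x. rr x j"], rule exI[of _ NN], simp)
qed

end
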